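(* Let $\gamma>2$. Then for any initial data $(u_0,\mu_0)\in\mathcal{D}$ such that $\int_{\mathbb{R}}(1+|x|^\gamma)\,d\mu_0<\infty$, the Hunter--Saxton equation has a unique global weak conservative solution $(u,\mu)$ (with $(u(t),\mu(t))\in\mathcal{D}$) in the sense defined below, with initial data $(u_0,\mu_0)$, and it satisfies $\int_{\mathbb{R}}(1+|x|^\gamma)\,d\mu(t)<\infty$ for all $t$.
   Context: The Hunter--Saxton equation is $u_t+uu_x=\tfrac14\big(\int_{-\infty}^x d\mu(t,z)-\int_x^{\infty}d\mu(t,z)\big)$, $\mu_t+(u\mu)_x=0$. Fix $\psi^+,\psi^-\in C^\infty(\mathbb{R})$ with $\psi^++\psi^-\equiv1$, $0\le\psi^\pm\le1$, $\operatorname{supp}\psi^-\subset(-\infty,1)$, $\operatorname{supp}\psi^+\subset(-1,\infty)$. Let $E_1=\{\bar f+a\psi^+:\bar f\in H^1(\mathbb{R}),a\in\mathbb{R}\}$, $E_2=\{\bar f+a\psi^++b\psi^-:\bar f\in H^1(\mathbb{R}),a,b\in\mathbb{R}\}$, and let $E_1^0,E_2^0$ be defined in the same way with $\bar f\in L^2(\mathbb{R})$, normed by $(\|\bar f\|_{L^2}^2+a^2)^{1/2}$ resp. $(\|\bar f\|_{L^2}^2+a^2+b^2)^{1/2}$. $\mathcal{D}$ is the set of pairs $(u,\mu)$ with $u\in E_2$, $\mu$ a positive finite Radon measure on $\mathbb{R}$, $x\mapsto\mu((-\infty,x))$ in $E_1^0$, and $d\mu_{\rm ac}=u_x^2dx$.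 A weak conservative solution with initial data $(u(0,\cdot),\mu(0))\in\mathcal{D}$ is a pair $(u,\mu)$ such that: (i) $u(t,\cdot)\in E_2$ for each $t$; (ii) $\mu(t,(-\infty,\cdot))\in E_1^0$ and $d\mu_{\rm ac}(t)=u_x^2(t,\cdot)dx$; (iii) for all $\phi\in C_c^\infty([0,\infty)\times\mathbb{R})$: $\int_0^\infty\!\int_{\mathbb{R}}\big[u\phi_t+\tfrac12u^2\phi_x+\tfrac14\big(\int_{-\infty}^xd\mu(t)-\int_x^\infty d\mu(t)\big)\phi\big]dxdt=-\int_{\mathbb{R}}u\phi|_{t=0}dx$ and $\int_0^\infty\!\int_{\mathbb{R}}(\phi_t+u\phi_x)d\mu(t)dt=-\int_{\mathbb{R}}\phi|_{t=0}d\mu(0)$; (iv) for every $T>0$, $u$ is Hölder continuous on $[0,T]\times\mathbb{R}$ and $t\mapsto u(t,\cdot)$ is Lipschitz from $[0,T]$ into $E_2^0$; (v) for $t$ outside a Lebesgue null set, $\mu(t)$ is absolutely continuous with density $u_x^2(t,\cdot)$; (vi) $t\mapsto\mu(t)$ is continuous for weak convergence of measures. *)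

theory Defs
  imports "HOL-Analysis.Analysis"
begin

definition smooth1 :: "(real \<Rightarrow> real) \<Rightarrow> bool" where
  "smooth1 f \<longleftrightarrow> (\<forall>n x. ((deriv ^^ n) f) differentiable (at x))"

definition pdt :: "(real \<times> real \<Rightarrow> real) \<Rightarrow> real \<times> real \<Rightarrow> real" where
  "pdt f p = deriv (\<lambda>s. f (s, snd p)) (fst p)"

definition pdx :: "(real \<times> real \<Rightarrow> real) \<Rightarrow> real \<times> real \<Rightarrow> real" where
  "pdx f p = deriv (\<lambda>y. f (fst p, y)) (snd p)"

fun iterpd :: "bool list \<Rightarrow> (real \<times> real \<Rightarrow> real) \<Rightarrow> real \<times> real \<Rightarrow> real" where
  "iterpd [] f = f"
| "iterpd (d # ds) f = (if d then pdt else pdx) (iterpd ds f)"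

definition smooth2 :: "(real \<times> real \<Rightarrow> real) \<Rightarrow> bool" where
  "smooth2 f \<longleftrightarrow> (\<forall>ds. continuous_on UNIV (iterpd ds f) \<and>
      (\<forall>t x. (\<lambda>s. iterpd ds f (s, x)) differentiable (at t) \<and>
             (\<lambda>y. iterpd ds f (t, y)) differentiable (at x)))"

text \<open>Test functions: smooth with compact support (their restrictions to [0,\<infinity>)\<times>\<real>
  are exactly the class C_c^\<infinity>([0,\<infinity>)\<times>\<real>)).\<close>
definition test_fun :: "(real \<times> real \<Rightarrow> real) \<Rightarrow> bool" where
  "test_fun \<phi> \<longleftrightarrow> smooth2 \<phi> \<and> compact (closure {p. \<phi> p \<noteq> 0})"

definition L2 :: "(real \<Rightarrow> real) \<Rightarrow> bool" where
  "L2 f \<longleftrightarrow> f \<in> borel_measurable lborel \<and> integrable lborel (\<lambda>x. (f x)\<^sup>2)"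

text \<open>g is the (weak) derivative of f, f being the absolutely continuous representative.\<close>
definition wderiv :: "(real \<Rightarrow> real) \<Rightarrow> (real \<Rightarrow> real) \<Rightarrow> bool" where
  "wderiv f g \<longleftrightarrow> g \<in> borel_measurable lborel \<and>
     (\<forall>x y. x \<le> y \<longrightarrow> set_integrable lborel {x..y} g \<and> f y - f x = (LBINT s:{x..y}. g s))"

definition H1 :: "(real \<Rightarrow> real) \<Rightarrow> bool" where
  "H1 f \<longleftrightarrow> L2 f \<and> (\<exists>g. wderiv f g \<and> L2 g)"

definition E1 :: "(real \<Rightarrow> real) \<Rightarrow> (real \<Rightarrow> real) \<Rightarrow> bool" where
  "E1 \<psi>p f \<longleftrightarrow> (\<exists>fb a. H1 fb \<and> (\<forall>x. f x = fb x + a * \<psi>p x))"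

definition E2 :: "(real \<Rightarrow> real) \<Rightarrow> (real \<Rightarrow> real) \<Rightarrow> (real \<Rightarrow> real) \<Rightarrow> bool" where
  "E2 \<psi>p \<psi>m f \<longleftrightarrow> (\<exists>fb a b. H1 fb \<and> (\<forall>x. f x = fb x + a * \<psi>p x + b * \<psi>m x))"

definition E1_0 :: "(real \<Rightarrow> real) \<Rightarrow> (real \<Rightarrow> real) \<Rightarrow> bool" where
  "E1_0 \<psi>p f \<longleftrightarrow> (\<exists>fb a. L2 fb \<and> (\<forall>x. f x = fb x + a * \<psi>p x))"

definition E2_0 :: "(real \<Rightarrow> real) \<Rightarrow> (real \<Rightarrow> real) \<Rightarrow> (real \<Rightarrow> real) \<Rightarrow> bool" where
  "E2_0 \<psi>p \<psi>m f \<longleftrightarrow> (\<exists>fb a b. L2 fb \<and> (\<forall>x. f x = fb x + a * \<psi>p x + b * \<psi>m x))"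

text \<open>The E_2^0 norm of f is at most r (the decomposition is unique, so this is the norm bound).\<close>
definition E2_0_norm_le :: "(real \<Rightarrow> real) \<Rightarrow> (real \<Rightarrow> real) \<Rightarrow> (real \<Rightarrow> real) \<Rightarrow> real \<Rightarrow> bool" where
  "E2_0_norm_le \<psi>p \<psi>m f r \<longleftrightarrow> (\<exists>fb a b. L2 fb \<and> (\<forall>x. f x = fb x + a * \<psi>p x + b * \<psi>m x)
      \<and> sqrt ((LINT x|lborel. (fb x)\<^sup>2) + a\<^sup>2 + b\<^sup>2) \<le> r)"

definition fin_borel :: "real measure \<Rightarrow> bool" where
  "fin_borel \<mu> \<longleftrightarrow> sets \<mu> = sets borel \<and> emeasure \<mu> UNIV < \<infinity>"

definition ac_part :: "real measure \<Rightarrow> (real \<Rightarrow> real) \<Rightarrow> bool" where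
  "ac_part \<mu> h \<longleftrightarrow> (\<exists>N\<in>sets borel. emeasure lborel N = 0 \<and>
      (\<forall>A\<in>sets borel. emeasure \<mu> A = (\<integral>\<^sup>+x\<in>A. ennreal (h x) \<partial>lborel) + emeasure \<mu> (A \<inter> N)))"

definition has_density :: "real measure \<Rightarrow> (real \<Rightarrow> real) \<Rightarrow> bool" where
  "has_density \<mu> h \<longleftrightarrow> (\<forall>A\<in>sets borel. emeasure \<mu> A = (\<integral>\<^sup>+x\<in>A. ennreal (h x) \<partial>lborel))"

definition inD :: "(real \<Rightarrow> real) \<Rightarrow> (real \<Rightarrow> real) \<Rightarrow> (real \<Rightarrow> real) \<Rightarrow> real measure \<Rightarrow> bool" where
  "inD \<psi>p \<psi>m u \<mu> \<longleftrightarrow> E2 \<psi>p \<psi>m u \<and> fin_borel \<mu> \<and> E1_0 \<psi>p (\<lambda>x. measure \<mu> {..<x})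
      \<and> (\<exists>g. wderiv u g \<and> ac_part \<mu> (\<lambda>x. (g x)\<^sup>2))"

definition weak_cons_sol ::
  "(real \<Rightarrow> real) \<Rightarrow> (real \<Rightarrow> real) \<Rightarrow> (real \<Rightarrow> real \<Rightarrow> real) \<Rightarrow> (real \<Rightarrow> real measure) \<Rightarrow> bool" where
  "weak_cons_sol \<psi>p \<psi>m u \<mu> \<longleftrightarrow>
     \<comment> \<open>(i)\<close>
     (\<forall>t\<ge>0. E2 \<psi>p \<psi>m (u t))
     \<comment> \<open>(ii)\<close>
   \<and> (\<forall>t\<ge>0. fin_borel (\<mu> t) \<and> E1_0 \<psi>p (\<lambda>x. measure (\<mu> t) {..<x})
            \<and> (\<exists>g. wderiv (u t) g \<and> ac_part (\<mu> t) (\<lambda>x. (g x)\<^sup>2)))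
     \<comment> \<open>(iii)\<close>
   \<and> (\<forall>\<phi>. test_fun \<phi> \<longrightarrow>
        (LINT t:{0..}|lborel. LINT x|lborel.
            u t x * pdt \<phi> (t, x) + (u t x)\<^sup>2 / 2 * pdx \<phi> (t, x)
          + 1/4 * (measure (\<mu> t) {..<x} - measure (\<mu> t) {x<..}) * \<phi> (t, x))
        = - (LINT x|lborel. u 0 x * \<phi> (0, x)))
   \<and> (\<forall>\<phi>. test_fun \<phi> \<longrightarrow>
        (LINT t:{0..}|lborel. \<integral>x. pdt \<phi> (t, x) + u t x * pdx \<phi> (t, x) \<partial>(\<mu> t))
        = - (\<integral>x. \<phi> (0, x) \<partial>(\<mu> 0)))
     \<comment> \<open>(iv)\<close>
   \<and> (\<forall>T>0. (\<exists>\<alpha> C. 0 < \<alpha> \<and> \<alpha> \<le> 1 \<and>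
              (\<forall>t s x y. t \<in> {0..T} \<longrightarrow> s \<in> {0..T} \<longrightarrow>
                 \<bar>u t x - u s y\<bar> \<le> C * dist (t, x) (s, y) powr \<alpha>))
          \<and> (\<exists>L. \<forall>t s. t \<in> {0..T} \<longrightarrow> s \<in> {0..T} \<longrightarrow>
                 E2_0_norm_le \<psi>p \<psi>m (\<lambda>x. u t x - u s x) (L * \<bar>t - s\<bar>)))
     \<comment> \<open>(v)\<close>
   \<and> (\<exists>N. N \<in> null_sets lborel \<and>
        (\<forall>t\<ge>0. t \<notin> N \<longrightarrow> (\<exists>g. wderiv (u t) g \<and> has_density (\<mu> t) (\<lambda>x. (g x)\<^sup>2))))
     \<comment> \<open>(vi)\<close>
   \<and> (\<forall>f::real \<Rightarrow> real. continuous_on UNIV f \<and> bounded (range f) \<longrightarrow>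
        continuous_on {0..} (\<lambda>t. \<integral>x. f x \<partial>(\<mu> t)))"

end

theory Submission
  imports Defs "HOL-Probability.Sinc_Integral" "HOL-Probability.Distribution_Functions"
begin

text \<open>In the Lagrangian coordinate \<xi> = x + \<mu>0(-\<infinity>, x] the equation is solved explicitly: with H the
  cumulative energy and C the total energy, X(t) = y + t U0 + t^2/8 (2H - C), U = X_t, and the
  densities P = X_\<xi>, Q = U_\<xi>, h = H_\<xi> keep the relation Q^2 = P h, so P stays nonnegative. Pushing
  U and h d\<xi> forward along X(t) gives the solution; second moments of \<mu>0 give the decay of tails
  that puts the distribution function of the energy into E_1^0.

  For uniqueness, let F(t, x) = \<nu>(t)((-\<infinity>, x]). Testing the energy equation with moving steps
  shows that the quantile curves of \<nu>(t) are characteristics: X_t = v(t, X). Along any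
  characteristic x(t), testing the momentum equation with a moving bump \<beta> of width \<delta> supported to
  the right of x(t) gives (d/dt) v(t, x(t)) = (2F - C)/4 up to the defect
  1/2 \<integral> (v - x')^2 \<beta>', which is bounded by a multiple of the energy in (x, x + 2\<delta>) and so
  vanishes as \<delta> \<rightarrow> 0. On quantile curves F equals the quantile level for almost all t, so these
  curves and the velocities on them are explicit functions of the initial data.\<close>

section \<open>Smooth functions and weak derivatives\<close>

text \<open>Solutions are only 1/2-Hoelder in space, so the velocity field need not determine its
  characteristics, and two solutions cannot be compared by a Gronwall estimate along them. The
  energy level replaces the missing uniqueness: a quantile curve is singled out by the amount of
  energy to its left. An atom may sit on such a curve, and F jumps there. Hence the bump is
  one-sided, so that right continuity of F makes the errors vanish, and hence the weight of
  requirement (v): it removes the jump at almost every time. Since Q^2 = P h, the product p P(t) is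
  a perfect square; for each label P has at most one zero in time, so energy concentrates only for
  an instant and is then released. Compact support of test functions is bought twice: a step in
  space is cut by a second step sent to infinity, and a cut-off in time is shrunk to one instant.
  The bump itself is made from \<psi>p * \<psi>m. Pointwise estimates give increments of u only of
  order |t - s|^(1/2); the Lipschitz bound in E_2^0 comes from integrating the energy of a small
  window over the position of its centre.\<close>

lemma smooth1_deriv: "smooth1 f \<Longrightarrow> smooth1 (deriv f)"
  unfolding smooth1_def
proof (intro allI)
  fix n x assume "\<forall>n x. ((deriv ^^ n) f) differentiable (at x)"
  then have "((deriv ^^ Suc n) f) differentiable (at x)" by blast
  then show "((deriv ^^ n) (deriv f)) differentiable (at x)" by (simp add: funpow_swap1)
qed

lemma smooth1_DERIV: "smooth1 f \<Longrightarrow> (f has_real_derivative deriv f x) (at x)"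
  unfolding smooth1_def
  by (metis funpow_0 DERIV_deriv_iff_real_differentiable)

lemma smooth1_continuous: "smooth1 f \<Longrightarrow> continuous_on A f"
  by (meson smooth1_DERIV DERIV_continuous continuous_at_imp_continuous_on)

text \<open>Smoothness is the largest predicate closed under differentiation, so a closed class
  containing f suffices and no n-th derivative has to be computed. The closure properties that
  follow only exhibit such a class.\<close>

lemma smooth1_coinduct:
  assumes "P f" and step: "\<And>f. P f \<Longrightarrow> \<exists>f'. P f' \<and> (\<forall>x. (f has_real_derivative f' x) (at x))"
  shows "smooth1 f"
proof -
  have *: "P ((deriv ^^ n) f)" for n
  proof (induction n)
    case (Suc n)
    then obtain f' where f': "P f'" "\<forall>x. (((deriv ^^ n) f) has_real_derivative f' x) (at x)"
      using step by blast
    then have "deriv ((deriv ^^ n) f) = f'" by (intro ext DERIV_imp_deriv) auto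
    with f' show ?case by simp
  qed (simp add: assms(1))
  show ?thesis unfolding smooth1_def
    using step[OF *] real_differentiable_def by blast
qed

lemma smooth1_antideriv:
  assumes "smooth1 f'" "\<And>x. (f has_real_derivative f' x) (at x)"
  shows "smooth1 f"
proof (rule smooth1_coinduct[where P = "\<lambda>h. h = f \<or> smooth1 h"])
  fix h assume "h = f \<or> smooth1 h"
  then show "\<exists>f'. (f' = f \<or> smooth1 f') \<and> (\<forall>x. (h has_real_derivative f' x) (at x))"
    using assms smooth1_deriv smooth1_DERIV by blast
qed simp

lemma smooth1_cmult: assumes "smooth1 f" shows "smooth1 (\<lambda>x. c * f x)"
proof (rule smooth1_coinduct[where P = "\<lambda>h. \<exists>f. smooth1 f \<and> h = (\<lambda>x. c * f x)"])
  fix h assume "\<exists>f. smooth1 f \<and> h = (\<lambda>x. c * f x)"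
  then obtain f where f: "smooth1 f" "h = (\<lambda>x. c * f x)" by blast
  then have "\<forall>x. (h has_real_derivative c * deriv f x) (at x)"
    by (auto intro!: derivative_eq_intros smooth1_DERIV)
  then show "\<exists>f'. (\<exists>f. smooth1 f \<and> f' = (\<lambda>x. c * f x)) \<and> (\<forall>x. (h has_real_derivative f' x) (at x))"
    using smooth1_deriv[OF f(1)] by blast
qed (use assms in blast)

lemma smooth1_affine: assumes "smooth1 f" shows "smooth1 (\<lambda>x. f (a * x + b))"
proof (rule smooth1_coinduct[where P = "\<lambda>h. \<exists>f. smooth1 f \<and> h = (\<lambda>x. f (a * x + b))"])
  fix h assume "\<exists>f. smooth1 f \<and> h = (\<lambda>x. f (a * x + b))"
  then obtain f where f: "smooth1 f" "h = (\<lambda>x. f (a * x + b))" by blast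
  have "(h has_real_derivative a * deriv f (a * x + b)) (at x)" for x
  proof -
    have "((\<lambda>x. a * x + b) has_real_derivative a) (at x)" by (auto intro!: derivative_eq_intros)
    from DERIV_chain2[OF smooth1_DERIV[OF f(1)] this] show ?thesis by (simp add: f(2) mult.commute)
  qed
  moreover have "smooth1 (\<lambda>x. a * deriv f x)" by (intro smooth1_cmult smooth1_deriv f)
  ultimately show "\<exists>f'. (\<exists>f. smooth1 f \<and> f' = (\<lambda>x. f (a * x + b))) \<and> (\<forall>x. (h has_real_derivative f' x) (at x))"
    by blast
qed (use assms in blast)

lemma smooth1_diff: assumes "smooth1 f" "smooth1 g" shows "smooth1 (\<lambda>x. f x - g x)"
proof (rule smooth1_coinduct[where P = "\<lambda>h. \<exists>f g. smooth1 f \<and> smooth1 g \<and> h = (\<lambda>x. f x - g x)"])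
  fix h assume "\<exists>f g. smooth1 f \<and> smooth1 g \<and> h = (\<lambda>x. f x - g x)"
  then obtain f g where f: "smooth1 f" "smooth1 g" "h = (\<lambda>x. f x - g x)" by blast
  then have "\<forall>x. (h has_real_derivative deriv f x - deriv g x) (at x)"
    by (auto intro!: derivative_intros smooth1_DERIV)
  then show "\<exists>f'. (\<exists>f g. smooth1 f \<and> smooth1 g \<and> f' = (\<lambda>x. f x - g x)) \<and> (\<forall>x. (h has_real_derivative f' x) (at x))"
    using smooth1_deriv f by blast
qed (use assms in blast)

text \<open>Products alone are not closed under differentiation, as the product rule yields a sum of
  two products. Sums of products are closed, which makes this class the invariant for
  coinduction.\<close>

inductive smooth_combination :: "(real \<Rightarrow> real) \<Rightarrow> bool" where
  mult: "smooth1 f \<Longrightarrow> smooth1 g \<Longrightarrow> smooth_combination (\<lambda>x. f x * g x)"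
| add: "smooth_combination f \<Longrightarrow> smooth_combination g \<Longrightarrow> smooth_combination (\<lambda>x. f x + g x)"

lemma smooth1_mult: assumes "smooth1 f" "smooth1 g" shows "smooth1 (\<lambda>x. f x * g x)"
proof (rule smooth1_coinduct[where P = smooth_combination])
  show "smooth_combination h \<Longrightarrow>
    \<exists>f'. smooth_combination f' \<and> (\<forall>x. (h has_real_derivative f' x) (at x))" for h
  proof (induction rule: smooth_combination.induct)
    case (mult f g)
    have "\<forall>x. ((\<lambda>x. f x * g x) has_real_derivative (deriv f x * g x + f x * deriv g x)) (at x)"
      by (auto intro!: derivative_eq_intros smooth1_DERIV mult)
    moreover have "smooth_combination (\<lambda>x. deriv f x * g x + f x * deriv g x)"
      by (intro smooth_combination.intros smooth1_deriv mult)
    ultimately show ?case by blast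
  next
    case (add f g)
    then obtain f' g' where "smooth_combination f'" "smooth_combination g'"
      "\<forall>x. (f has_real_derivative f' x) (at x)" "\<forall>x. (g has_real_derivative g' x) (at x)" by blast
    then show ?case by (intro exI[of _ "\<lambda>x. f' x + g' x"])
       (auto intro!: derivative_intros smooth_combination.intros)
  qed
qed (use assms smooth_combination.mult in blast)

text \<open>A partial derivative falls on one factor only, so every iterated partial derivative is
  again a product of a smooth function of t and one of x.\<close>

lemma smooth2_tensor:
  assumes "smooth1 \<theta>" "smooth1 \<psi>"
  shows "smooth2 (\<lambda>p. \<theta> (fst p) * \<psi> (snd p))"
proof -
  have *: "\<exists>a b. smooth1 a \<and> smooth1 b \<and> iterpd ds (\<lambda>p. \<theta> (fst p) * \<psi> (snd p)) = (\<lambda>p. a (fst p) * b (snd p))" for ds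
  proof (induction ds)
    case Nil then show ?case using assms by auto
  next
    case (Cons d ds)
    then obtain a b where ab: "smooth1 a" "smooth1 b"
      "iterpd ds (\<lambda>p. \<theta> (fst p) * \<psi> (snd p)) = (\<lambda>p. a (fst p) * b (snd p))" by blast
    have "pdt (\<lambda>p. a (fst p) * b (snd p)) = (\<lambda>p. deriv a (fst p) * b (snd p))"
      unfolding pdt_def by (auto intro!: ext DERIV_imp_deriv derivative_eq_intros smooth1_DERIV ab)
    moreover have "pdx (\<lambda>p. a (fst p) * b (snd p)) = (\<lambda>p. a (fst p) * deriv b (snd p))"
      unfolding pdx_def by (auto intro!: ext DERIV_imp_deriv derivative_eq_intros smooth1_DERIV ab)
    ultimately show ?case using ab smooth1_deriv by (cases d) auto
  qed
  show ?thesis unfolding smooth2_def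
  proof (intro allI conjI)
    fix ds
    obtain a b where ab: "smooth1 a" "smooth1 b"
      "iterpd ds (\<lambda>p. \<theta> (fst p) * \<psi> (snd p)) = (\<lambda>p. a (fst p) * b (snd p))" using * by blast
    show "continuous_on UNIV (iterpd ds (\<lambda>p. \<theta> (fst p) * \<psi> (snd p)))"
      unfolding ab(3) using smooth1_continuous[OF ab(1), of UNIV] smooth1_continuous[OF ab(2), of UNIV]
      by (auto intro!: continuous_intros continuous_on_compose2[of UNIV a _ fst] continuous_on_compose2[of UNIV b _ snd])
    fix t x
    have d: "a differentiable (at t)" "b differentiable (at x)"
      using smooth1_DERIV ab real_differentiable_def by blast+
    show "(\<lambda>s. iterpd ds (\<lambda>p. \<theta> (fst p) * \<psi> (snd p)) (s, x)) differentiable (at t)"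
         "(\<lambda>y. iterpd ds (\<lambda>p. \<theta> (fst p) * \<psi> (snd p)) (t, y)) differentiable (at x)"
      unfolding ab(3) using d by auto
  qed
qed

lemma pd_tensor:
  assumes "smooth1 \<theta>" "smooth1 \<psi>"
  shows "pdt (\<lambda>p. \<theta> (fst p) * \<psi> (snd p)) = (\<lambda>p. deriv \<theta> (fst p) * \<psi> (snd p))"
    "pdx (\<lambda>p. \<theta> (fst p) * \<psi> (snd p)) = (\<lambda>p. \<theta> (fst p) * deriv \<psi> (snd p))"
  unfolding pdt_def pdx_def
  by (auto intro!: ext DERIV_imp_deriv derivative_eq_intros smooth1_DERIV assms)

lemma test_fun_tensor:
  assumes "smooth1 \<theta>" "smooth1 \<psi>" "\<And>t. \<bar>t\<bar> > B \<Longrightarrow> \<theta> t = 0" "\<And>t. \<bar>t\<bar> > B \<Longrightarrow> \<psi> t = 0"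
  shows "test_fun (\<lambda>p. \<theta> (fst p) * \<psi> (snd p))"
proof -
  have "{p. \<theta> (fst p) * \<psi> (snd p) \<noteq> 0} \<subseteq> {-B..B} \<times> {-B..B}"
    using assms(3,4) by (force simp: abs_le_iff not_less[symmetric])
  moreover have "compact ({-B..B} \<times> {-B..B})" by (intro compact_Times compact_Icc)
  ultimately have "compact (closure {p. \<theta> (fst p) * \<psi> (snd p) \<noteq> 0})"
    by (meson bounded_subset compact_closure compact_imp_bounded)
  then show ?thesis using smooth2_tensor assms unfolding test_fun_def by blast
qed

lemma smooth2_continuous:
  assumes "smooth2 \<phi>" 
  shows "continuous_on UNIV \<phi>" "continuous_on UNIV (pdt \<phi>)" "continuous_on UNIV (pdx \<phi>)"
  using assms[unfolded smooth2_def, rule_format, of "[]"] assms[unfolded smooth2_def, rule_format, of "[True]"]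
    assms[unfolded smooth2_def, rule_format, of "[False]"] by auto

lemma smooth2_DERIV:
  assumes "smooth2 \<phi>" 
  shows "((\<lambda>s. \<phi> (s, x)) has_real_derivative pdt \<phi> (t, x)) (at t)"
    "((\<lambda>y. \<phi> (t, y)) has_real_derivative pdx \<phi> (t, x)) (at x)"
proof -
  from assms have "(\<lambda>s. iterpd [] \<phi> (s, x)) differentiable (at t) \<and> (\<lambda>y. iterpd [] \<phi> (t, y)) differentiable (at x)"
    unfolding smooth2_def by blast
  then show "((\<lambda>s. \<phi> (s, x)) has_real_derivative pdt \<phi> (t, x)) (at t)"
    "((\<lambda>y. \<phi> (t, y)) has_real_derivative pdx \<phi> (t, x)) (at x)"
    by (auto simp: pdt_def pdx_def DERIV_deriv_iff_real_differentiable)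
qed

text \<open>One constant serves as radius of the support and as bound for \<phi> and both first
  partial derivatives, which keeps later estimates to a single parameter.\<close>

lemma test_fun_bounds:
  assumes "test_fun \<phi>"
  obtains B where "B > 0" "\<And>t x. \<bar>t\<bar> > B \<or> \<bar>x\<bar> > B \<Longrightarrow> \<phi> (t,x) = 0 \<and> pdt \<phi> (t,x) = 0 \<and> pdx \<phi> (t,x) = 0"
    "\<And>p. \<bar>\<phi> p\<bar> \<le> B" "\<And>p. \<bar>pdt \<phi> p\<bar> \<le> B" "\<And>p. \<bar>pdx \<phi> p\<bar> \<le> B"
proof -
  have sm: "smooth2 \<phi>" and K: "compact (closure {p. \<phi> p \<noteq> 0})" (is "compact ?K")
    using assms by (auto simp: test_fun_def)
  from compact_imp_bounded[OF K] obtain B where B: "\<And>p. p \<in> ?K \<Longrightarrow> norm p \<le> B"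
    by (auto simp: bounded_iff)
  \<comment> \<open>Off the closed support \<phi> vanishes in a whole neighbourhood, hence so do its
    partial derivatives; at a mere zero of \<phi> this could fail.\<close>
  have out: "\<phi> p = 0 \<and> pdt \<phi> p = 0 \<and> pdx \<phi> p = 0" if "p \<notin> ?K" for p
  proof -
    obtain t x where p: "p = (t,x)" by (cases p)
    have o: "open (- ?K)" by auto
    have z: "\<phi> q = 0" if "q \<in> - ?K" for q using that closure_subset[of "{p. \<phi> p \<noteq> 0}"] by (metis (mono_tags) ComplD mem_Collect_eq subset_iff)
    have 1: "\<forall>\<^sub>F s in nhds t. \<phi> (s, x) = 0"
    proof -
      have "open ((\<lambda>s. (s,x)) -` (- ?K))" by (intro open_vimage o continuous_intros)
      from eventually_nhds_in_open[OF this, of t] that show ?thesis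
        unfolding p by (auto elim!: eventually_mono intro!: z)
    qed
    have 2: "\<forall>\<^sub>F s in nhds x. \<phi> (t, s) = 0"
    proof -
      have "open ((\<lambda>s. (t,s)) -` (- ?K))" by (intro open_vimage o continuous_intros)
      from eventually_nhds_in_open[OF this, of x] that show ?thesis
        unfolding p by (auto elim!: eventually_mono intro!: z)
    qed
    have "pdt \<phi> p = deriv (\<lambda>_. 0) t" unfolding pdt_def p fst_conv snd_conv 
      by (rule deriv_cong_ev) (use 1 in auto)
    moreover have "pdx \<phi> p = deriv (\<lambda>_. 0) x" unfolding pdx_def p fst_conv snd_conv 
      by (rule deriv_cong_ev) (use 2 in auto)
    ultimately show ?thesis using z[of p] that by simp
  qed
  have bd: "\<exists>C. \<forall>p. \<bar>f p\<bar> \<le> C" if "continuous_on UNIV f" "\<And>p. p \<notin> ?K \<Longrightarrow> f p = 0" for f :: "real \<times> real \<Rightarrow> real"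
  proof -
    have "bounded (f ` ?K)" using that(1) K
      by (meson compact_continuous_image compact_imp_bounded continuous_on_subset subset_UNIV)
    then obtain C where "\<And>p. p \<in> ?K \<Longrightarrow> \<bar>f p\<bar> \<le> C" by (auto simp: bounded_iff)
    then have "\<bar>f p\<bar> \<le> max C 0" for p using that(2)[of p] by (cases "p \<in> ?K") (auto simp: le_max_iff_disj)
    then show ?thesis by blast
  qed
  obtain C1 where C1: "\<And>p. \<bar>\<phi> p\<bar> \<le> C1" using bd[of \<phi>] smooth2_continuous[OF sm] out by blast
  obtain C2 where C2: "\<And>p. \<bar>pdt \<phi> p\<bar> \<le> C2" using bd[of "pdt \<phi>"] smooth2_continuous[OF sm] out by blast
  obtain C3 where C3: "\<And>p. \<bar>pdx \<phi> p\<bar> \<le> C3" using bd[of "pdx \<phi>"] smooth2_continuous[OF sm] out by blast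
  define M where "M = \<bar>B\<bar> + \<bar>C1\<bar> + \<bar>C2\<bar> + \<bar>C3\<bar> + 1"
  have M: "\<bar>B\<bar> < M" "C1 \<le> M" "C2 \<le> M" "C3 \<le> M" "M > 0"
    by (auto simp: M_def)
  show ?thesis
  proof (rule that[OF \<open>M > 0\<close>])
    fix t x assume "\<bar>t\<bar> > M \<or> \<bar>x\<bar> > M"
    then have "norm (t,x) > B"
      using M(1) norm_fst_le[of t x] norm_snd_le[of x t] by (auto simp: real_norm_def)
    then have "(t,x) \<notin> ?K" using B by force
    then show "\<phi> (t,x) = 0 \<and> pdt \<phi> (t,x) = 0 \<and> pdx \<phi> (t,x) = 0" using out by blast
  qed (use C1 C2 C3 M order_trans in blast)+
qed

text \<open>A chain rule with unequal demands: differentiability in time is asked only at the base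
  point, because joint continuity of the space derivative controls the rest. The set S admits
  one-sided derivatives at the ends of a time interval.\<close>

lemma DERIV_along_curve:
  fixes K k2 :: "real \<Rightarrow> real \<Rightarrow> real"
  assumes t: "t \<in> S"
    and K1: "((\<lambda>s. K s (x t)) has_real_derivative k1) (at t within S)"
    and K2: "\<And>s z. s \<in> S \<Longrightarrow> (K s has_real_derivative k2 s z) (at z)"
    and cont: "continuous_on (S \<times> UNIV) (\<lambda>(s,z). k2 s z)"
    and x: "(x has_real_derivative x') (at t within S)"
  shows "((\<lambda>s. K s (x s)) has_real_derivative k1 + k2 t (x t) * x') (at t within S)"
proof -
  have "((\<lambda>(s,z). K s z) has_derivative (\<lambda>(ts,tz). k1 * ts + blinfun_mult_right (k2 t (x t)) tz))
     (at (t, x t) within S \<times> UNIV)"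
  proof (rule has_derivative_partialsI)
    show "((\<lambda>s. K s (x t)) has_derivative (*) k1) (at t within S)"
      using K1 by (simp add: has_field_derivative_def)
    show "(K s has_derivative blinfun_apply (blinfun_mult_right (k2 s z))) (at z within UNIV)" if "s \<in> S" for s z
      using K2[OF that, of z] by (simp add: has_field_derivative_def)
    have "continuous_on (S \<times> UNIV) (\<lambda>p. blinfun_mult_right ((\<lambda>(s,z). k2 s z) p))"
      by (intro bounded_linear.continuous_on[OF bounded_linear_blinfun_mult_right] cont)
    then show "continuous (at (t, x t) within S \<times> UNIV) (\<lambda>(s, z). blinfun_mult_right (k2 s z))"
      using t unfolding continuous_on_eq_continuous_within by (auto simp: case_prod_unfold)
  qed auto
  moreover have "((\<lambda>s. (s, x s)) has_derivative (\<lambda>h. (h, x' * h))) (at t within S)"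
    using x by (auto intro!: derivative_intros simp: has_field_derivative_def)
  moreover have "(\<lambda>s. (s, x s)) ` S \<subseteq> S \<times> UNIV" by auto
  ultimately have "((\<lambda>s. (\<lambda>(s,z). K s z) (s, x s)) has_derivative
     (\<lambda>h. (\<lambda>(ts,tz). k1 * ts + blinfun_mult_right (k2 t (x t)) tz) (h, x' * h))) (at t within S)"
    using has_derivative_in_compose[of "\<lambda>s. (s, x s)" "\<lambda>h. (h, x' * h)" t S "\<lambda>(s,z). K s z"] 
      has_derivative_subset by blast
  moreover have "(\<lambda>h. (\<lambda>(ts,tz). k1 * ts + blinfun_mult_right (k2 t (x t)) tz) (h, x' * h)) = (*) (k1 + k2 t (x t) * x')"
    by (auto simp: algebra_simps)
  ultimately show ?thesis by (simp add: has_field_derivative_def)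
qed

section \<open>Calculus of absolutely continuous functions\<close>

lemma wderiv_integrable: "wderiv f g \<Longrightarrow> set_integrable lborel {a..b} g"
  by (cases "a \<le> b") (auto simp: wderiv_def set_integrable_def)

lemma wderiv_measurable: "wderiv f g \<Longrightarrow> g \<in> borel_measurable borel"
  by (auto simp: wderiv_def)

lemma wderiv_continuous:
  assumes "wderiv f g" shows "continuous_on UNIV f"
proof -
  have "isCont f x" for x
  proof -
    have i: "g integrable_on {x-1..x+1}"
      using set_borel_integral_eq_integral(1)[OF wderiv_integrable[OF assms]] .
    have "continuous_on {x-1..x+1} (\<lambda>y. f (x-1) + integral {x-1..y} g)"
      by (intro continuous_intros indefinite_integral_continuous_1 i)
    moreover have "f (x-1) + integral {x-1..y} g = f y" if "y \<in> {x-1..x+1}" for y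
    proof -
      have "f y - f (x-1) = (LBINT s:{x-1..y}. g s)" using assms that by (simp add: wderiv_def)
      then show ?thesis
        using set_borel_integral_eq_integral(2)[OF wderiv_integrable[OF assms], of "x-1" y] by simp
    qed
    ultimately have "continuous_on {x-1..x+1} f" by (metis (no_types, lifting) continuous_on_cong)
    then show ?thesis
      by (rule continuous_on_interior) simp
  qed
  then show ?thesis by (simp add: continuous_on_eq_continuous_at)
qed

lemma C1_wderiv:
  assumes "\<And>x. (f has_real_derivative f' x) (at x)" "continuous_on UNIV f'"
  shows "wderiv f f'"
  unfolding wderiv_def
proof (intro conjI allI impI)
  show "f' \<in> borel_measurable lborel" using borel_measurable_continuous_onI[OF assms(2)] by simp
  fix x y :: real assume xy: "x \<le> y"
  show i: "set_integrable lborel {x..y} f'"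
    by (rule borel_integrable_atLeastAtMost') (meson assms(2) continuous_on_subset subset_UNIV)
  have "(f' has_integral (f y - f x)) {x..y}"
    by (rule fundamental_theorem_of_calculus[OF xy])
       (meson assms(1) has_real_derivative_iff_has_vector_derivative has_vector_derivative_at_within)
  then show "f y - f x = (LBINT s:{x..y}. f' s)"
    using set_borel_integral_eq_integral(2)[OF i] by (simp add: integral_unique)
qed

lemma ioc_indicator_AE:
  fixes a b :: real
  shows "AE s in lborel. indicator {a..b} s = (indicator {a<..<b} s :: real)"
    "AE s in lborel. indicator {a..b} s = (indicator {a<..b} s :: real)"
proof -
  have "AE s in lborel. s \<noteq> a \<and> s \<noteq> b"
    using AE_lborel_singleton[of a] AE_lborel_singleton[of b] by eventually_elim simp
  then show "AE s in lborel. indicator {a..b} s = (indicator {a<..<b} s :: real)"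
    "AE s in lborel. indicator {a..b} s = (indicator {a<..b} s :: real)"
    by (eventually_elim, auto simp: indicator_def)+
qed

text \<open>Cauchy-Schwarz by completing the square: the integral of (g - c)^2 is nonnegative, and
  with c the mean slope it equals the integral of g^2 minus (f y - f x)^2 / (y - x).\<close>

lemma wderiv_sq_le:
  assumes fg: "wderiv f g" and xy: "x \<le> y" and g2: "set_integrable lborel {x..y} (\<lambda>s. (g s)\<^sup>2)"
  shows "(f y - f x)\<^sup>2 \<le> (y - x) * (LBINT s:{x..y}. (g s)\<^sup>2)"
proof (cases "x = y")
  case False
  with xy have xy: "x < y" by simp
  define c where "c = (f y - f x) / (y - x)"
  have g: "set_integrable lborel {x..y} g" using wderiv_integrable[OF fg] .
  have one: "set_integrable lborel {x..y} (\<lambda>_. c\<^sup>2)" by (intro borel_integrable_atLeastAtMost') auto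
  have I: "(LBINT s:{x..y}. g s) = f y - f x" using fg xy by (auto simp: wderiv_def)
  have "0 \<le> (LBINT s:{x..y}. (g s - c)\<^sup>2)"
    unfolding set_lebesgue_integral_def by (intro Bochner_Integration.integral_nonneg) auto
  also have "\<dots> = (LBINT s:{x..y}. (g s)\<^sup>2 - 2 * c * g s + c\<^sup>2)"
    by (intro set_lebesgue_integral_cong) (auto simp: power2_diff)
  also have "\<dots> = (LBINT s:{x..y}. (g s)\<^sup>2 - 2 * c * g s) + (LBINT s:{x..y}. c\<^sup>2)"
    by (intro set_integral_add set_integral_diff g2 one set_integrable_mult_right g)
  also have "(LBINT s:{x..y}. (g s)\<^sup>2 - 2 * c * g s) = (LBINT s:{x..y}. (g s)\<^sup>2) - (LBINT s:{x..y}. 2 * c * g s)"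
    by (intro set_integral_diff g2 set_integrable_mult_right g)
  also have "(LBINT s:{x..y}. c\<^sup>2) = (y - x) * c\<^sup>2" using xy by (simp add: set_lebesgue_integral_def)
  also have "(LBINT s:{x..y}. 2 * c * g s) = 2 * c * (f y - f x)" by (simp add: I)
  also have "(LBINT s:{x..y}. (g s)\<^sup>2) - 2 * c * (f y - f x) + (y - x) * c\<^sup>2
      = (LBINT s:{x..y}. (g s)\<^sup>2) - (f y - f x)\<^sup>2 / (y - x)"
    using xy by (simp add: c_def power2_eq_square divide_simps)
  finally have "(f y - f x)\<^sup>2 / (y - x) \<le> (LBINT s:{x..y}. (g s)\<^sup>2)" by simp
  then show ?thesis using xy by (simp add: pos_divide_le_eq mult.commute)
qed simp

lemma fin_borel_finite_measure: "fin_borel \<mu> \<Longrightarrow> finite_measure \<mu>"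
  using sets_eq_imp_space_eq[of \<mu> borel] by (auto simp: fin_borel_def intro!: finite_measureI)

lemma ac_part_nn_integral_le:
  assumes "ac_part \<mu> h" "A \<in> sets borel"
  shows "(\<integral>\<^sup>+x\<in>A. ennreal (h x) \<partial>lborel) \<le> emeasure \<mu> A"
  using assms unfolding ac_part_def by auto

text \<open>The open interval on the right matters: endpoints are Lebesgue null, so atoms of \<mu>
  at x or y do not contribute. All estimates beside a curve that may carry an atom rest on
  this.\<close>

lemma ac_part_energy_le:
  assumes wd: "wderiv f g" and mu: "fin_borel \<mu>" and ac: "ac_part \<mu> (\<lambda>x. (g x)\<^sup>2)" and xy: "x \<le> y"
  shows "(f y - f x)\<^sup>2 \<le> (y - x) * measure \<mu> {x<..<y}"
proof -
  interpret finite_measure \<mu> by (rule fin_borel_finite_measure[OF mu])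
  have [measurable]: "g \<in> borel_measurable borel" by (rule wderiv_measurable[OF wd])
  have le: "(\<integral>\<^sup>+s\<in>{x<..<y}. ennreal ((g s)\<^sup>2) \<partial>lborel) \<le> ennreal (measure \<mu> {x<..<y})"
    using ac_part_nn_integral_le[OF ac, of "{x<..<y}"] by (simp add: emeasure_eq_measure)
  have eq: "(\<integral>\<^sup>+s. ennreal (indicator {x..y} s *\<^sub>R (g s)\<^sup>2) \<partial>lborel)
      = (\<integral>\<^sup>+s\<in>{x<..<y}. ennreal ((g s)\<^sup>2) \<partial>lborel)"
    by (intro nn_integral_cong_AE) (use ioc_indicator_AE(1)[of x y] in \<open>auto elim!: eventually_mono simp: indicator_def\<close>)
  have i: "set_integrable lborel {x..y} (\<lambda>s. (g s)\<^sup>2)"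
    unfolding set_integrable_def
    by (rule integrableI_nonneg) (use eq le in \<open>auto simp: order_le_less_trans[OF _ ennreal_less_top]\<close>)
  have "ennreal (LBINT s:{x..y}. (g s)\<^sup>2) = (\<integral>\<^sup>+s. ennreal (indicator {x..y} s *\<^sub>R (g s)\<^sup>2) \<partial>lborel)"
    unfolding set_lebesgue_integral_def using i
    by (subst nn_integral_eq_integral) (auto simp: set_integrable_def)
  with eq le have "ennreal (LBINT s:{x..y}. (g s)\<^sup>2) \<le> ennreal (measure \<mu> {x<..<y})" by metis
  then have "(LBINT s:{x..y}. (g s)\<^sup>2) \<le> measure \<mu> {x<..<y}" by simp
  with wderiv_sq_le[OF wd xy i] show ?thesis
    using xy by (smt (verit) mult_left_mono)
qed

text \<open>Integration by parts through Fubini: G1 r * G2 s on the square is split along the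
  diagonal. The part r \<le> s gives the integral of (f1 - f1 a) g2, the part r > s that of g1 (f2 -
  f2 a).\<close>

lemma wderiv_mult:
  assumes "wderiv f1 g1" "wderiv f2 g2"
  shows "wderiv (\<lambda>x. f1 x * f2 x) (\<lambda>x. f1 x * g2 x + g1 x * f2 x)"
proof -
  have [measurable]: "g1 \<in> borel_measurable borel" "g2 \<in> borel_measurable borel"
    using assms wderiv_measurable by auto
  have c: "continuous_on UNIV f1" "continuous_on UNIV f2" using assms wderiv_continuous by auto
  have [measurable]: "f1 \<in> borel_measurable borel" "f2 \<in> borel_measurable borel"
    using c borel_measurable_continuous_onI by auto
  have prod_int: "set_integrable lborel {a..b} (\<lambda>x. f x * g x)"
    if f: "continuous_on UNIV f" and g: "set_integrable lborel {a..b} g" and [measurable]: "g \<in> borel_measurable borel" "f \<in> borel_measurable borel"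
    for f g :: "real \<Rightarrow> real" and a b
  proof -
    have "bounded (f ` {a..b})"
      by (meson compact_Icc compact_continuous_image compact_imp_bounded continuous_on_subset f subset_UNIV)
    then obtain B where B: "\<And>x. x \<in> {a..b} \<Longrightarrow> \<bar>f x\<bar> \<le> B" unfolding bounded_iff by force
    show ?thesis unfolding set_integrable_def
    proof (rule Bochner_Integration.integrable_bound)
      show "integrable lborel (\<lambda>x. B * (indicator {a..b} x *\<^sub>R g x))"
        using g by (auto simp: set_integrable_def)
      show "AE x in lborel. norm (indicator {a..b} x *\<^sub>R (f x * g x)) \<le> norm (B * (indicator {a..b} x *\<^sub>R g x))"
        using B by (intro AE_I2) (force simp: indicator_def abs_mult intro: mult_right_mono order_trans[OF _ abs_ge_self])
    qed measurable
  qed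
  have i1: "set_integrable lborel {a..b} (\<lambda>x. f1 x * g2 x)" for a b
    by (intro prod_int c wderiv_integrable[OF assms(2)]) auto
  have i2: "set_integrable lborel {a..b} (\<lambda>x. g1 x * f2 x)" for a b
    using prod_int[OF c(2) wderiv_integrable[OF assms(1)], of a b] by (simp add: mult.commute)
  show ?thesis unfolding wderiv_def
  proof (intro conjI allI impI)
    show "(\<lambda>x. f1 x * g2 x + g1 x * f2 x) \<in> borel_measurable lborel" by simp
    fix a b :: real assume ab: "a \<le> b"
    show "set_integrable lborel {a..b} (\<lambda>x. f1 x * g2 x + g1 x * f2 x)" using i1 i2 by auto
    define G1 where "G1 s = indicator {a..b} s * g1 s" for s
    define G2 where "G2 s = indicator {a..b} s * g2 s" for s
    have G[measurable]: "G1 \<in> borel_measurable borel" "G2 \<in> borel_measurable borel" by (auto simp: G1_def[abs_def] G2_def[abs_def])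
    have Gi: "integrable lborel G1" "integrable lborel G2"
      using wderiv_integrable[OF assms(1), of a b] wderiv_integrable[OF assms(2), of a b]
      by (simp_all add: set_integrable_def G1_def[abs_def] G2_def[abs_def])
    have IG: "(\<integral>s. G1 s \<partial>lborel) = f1 b - f1 a" "(\<integral>s. G2 s \<partial>lborel) = f2 b - f2 a"
      using assms ab by (auto simp: wderiv_def set_lebesgue_integral_def G1_def G2_def)
    have f1: "f1 s = f1 a + (\<integral>r. indicator {..s} r * G1 r \<partial>lborel)" if "s \<in> {a..b}" for s
    proof -
      have "f1 s - f1 a = (\<integral>r. indicator {a..s} r *\<^sub>R g1 r \<partial>lborel)"
        using assms(1) that by (auto simp: wderiv_def set_lebesgue_integral_def)
      also have "\<dots> = (\<integral>r. indicator {..s} r * G1 r \<partial>lborel)"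
        using that by (intro Bochner_Integration.integral_cong) (auto simp: G1_def indicator_def)
      finally show ?thesis by simp
    qed
    \<comment> \<open>The open half line here, against the closed one for \<open>f1\<close>, makes
      the two triangles disjoint and exhaustive; the missing point is null.\<close>
    have f2: "f2 s = f2 a + (\<integral>r. indicator {..<s} r * G2 r \<partial>lborel)" if "s \<in> {a..b}" for s
    proof -
      have "f2 s - f2 a = (\<integral>r. indicator {a..s} r *\<^sub>R g2 r \<partial>lborel)"
        using assms(2) that by (auto simp: wderiv_def set_lebesgue_integral_def)
      also have "\<dots> = (\<integral>r. indicator {..<s} r * G2 r \<partial>lborel)"
        by (intro integral_cong_AE) (use AE_lborel_singleton[of s] that in
            \<open>auto elim!: eventually_mono simp: G2_def indicator_def\<close>)
      finally show ?thesis by simp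
    qed
    define k1 where "k1 s r = indicator {..s} r * (G1 r * G2 s)" for s r :: real
    define k2 where "k2 s r = (if r \<le> s then 0 else G1 r * G2 s)" for s r :: real
    have k1': "k1 s r = (if r \<le> s then G1 r * G2 s else 0)" for s r by (simp add: k1_def)
    have m: "(\<lambda>p. k1 (fst p) (snd p)) \<in> borel_measurable (lborel \<Otimes>\<^sub>M lborel)"
       "(\<lambda>p. k2 (fst p) (snd p)) \<in> borel_measurable (lborel \<Otimes>\<^sub>M lborel)"
      unfolding k1' k2_def by measurable
    have base: "integrable (lborel \<Otimes>\<^sub>M lborel) (\<lambda>p. G1 (snd p) * G2 (fst p))"
    proof (rule lborel_pair.Fubini_integrable)
      have "integrable lborel (\<lambda>x. (\<integral>y. \<bar>G1 y\<bar> \<partial>lborel) * \<bar>G2 x\<bar>)" using Gi by simp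
      then show "integrable lborel (\<lambda>x. LINT y|lborel. norm (G1 (snd (x, y)) * G2 (fst (x, y))))"
        by (simp add: abs_mult)
    qed (use Gi in auto)
    have ki: "integrable (lborel \<Otimes>\<^sub>M lborel) (\<lambda>p. k1 (fst p) (snd p))" "integrable (lborel \<Otimes>\<^sub>M lborel) (\<lambda>p. k2 (fst p) (snd p))"
      by (auto intro!: Bochner_Integration.integrable_bound[OF base] m simp: k1' k2_def)
    have A: "(LBINT x:{a..b}. f1 x * g2 x) = f1 a * (f2 b - f2 a) + (\<integral>s. (\<integral>r. k1 s r \<partial>lborel) \<partial>lborel)"
    proof -
      have "(LBINT x:{a..b}. f1 x * g2 x) = (\<integral>s. f1 a * G2 s + (\<integral>r. k1 s r \<partial>lborel) \<partial>lborel)"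
        unfolding set_lebesgue_integral_def
      proof (intro Bochner_Integration.integral_cong refl)
        fix s
        have "(\<integral>r. k1 s r \<partial>lborel) = (\<integral>r. (indicator {..s} r * G1 r) * G2 s \<partial>lborel)"
          by (simp add: k1_def mult.assoc)
        also have "\<dots> = (\<integral>r. (indicator {..s} r * G1 r) \<partial>lborel) * G2 s" by (rule integral_mult_left_zero)
        finally have e: "(\<integral>r. k1 s r \<partial>lborel) = (\<integral>r. indicator {..s} r * G1 r \<partial>lborel) * G2 s" .
        show "indicator {a..b} s *\<^sub>R (f1 s * g2 s) = f1 a * G2 s + (\<integral>r. k1 s r \<partial>lborel)"
          unfolding e using f1[of s] by (cases "s \<in> {a..b}") (auto simp: G2_def algebra_simps)
      qed
      also have "\<dots> = f1 a * (f2 b - f2 a) + (\<integral>s. (\<integral>r. k1 s r \<partial>lborel) \<partial>lborel)"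
        using Gi IG lborel_pair.integrable_fst'[OF ki(1)] by (subst Bochner_Integration.integral_add) auto
      finally show ?thesis .
    qed
    have B: "(LBINT x:{a..b}. g1 x * f2 x) = f2 a * (f1 b - f1 a) + (\<integral>s. (\<integral>r. k2 s r \<partial>lborel) \<partial>lborel)"
    proof -
      have sw: "(\<integral>r. (\<integral>s. k2 s r \<partial>lborel) \<partial>lborel) = (\<integral>s. (\<integral>r. k2 s r \<partial>lborel) \<partial>lborel)"
        using lborel_pair.Fubini_integral[of k2] ki(2) by (simp add: case_prod_unfold)
      have k2i: "integrable lborel (\<lambda>r. (\<integral>s. k2 s r \<partial>lborel))"
        using lborel_pair.integrable_snd[of k2] ki(2) by (simp add: case_prod_unfold)
      have "(LBINT x:{a..b}. g1 x * f2 x) = (\<integral>r. f2 a * G1 r + (\<integral>s. k2 s r \<partial>lborel) \<partial>lborel)"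
        unfolding set_lebesgue_integral_def
      proof (intro Bochner_Integration.integral_cong refl)
        fix r
        have "(\<integral>s. k2 s r \<partial>lborel) = (\<integral>s. (indicator {..<r} s * G2 s) * G1 r \<partial>lborel)"
          by (intro Bochner_Integration.integral_cong) (auto simp: k2_def)
        also have "\<dots> = (\<integral>s. (indicator {..<r} s * G2 s) \<partial>lborel) * G1 r" by (rule integral_mult_left_zero)
        finally have e: "(\<integral>s. k2 s r \<partial>lborel) = (\<integral>s. indicator {..<r} s * G2 s \<partial>lborel) * G1 r" .
        show "indicator {a..b} r *\<^sub>R (g1 r * f2 r) = f2 a * G1 r + (\<integral>s. k2 s r \<partial>lborel)"
          unfolding e using f2[of r] by (cases "r \<in> {a..b}") (auto simp: G1_def algebra_simps)
      qed
      also have "\<dots> = f2 a * (f1 b - f1 a) + (\<integral>s. (\<integral>r. k2 s r \<partial>lborel) \<partial>lborel)"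
        using Gi IG k2i sw by (subst Bochner_Integration.integral_add) auto
      finally show ?thesis .
    qed
    have "(\<integral>s. (\<integral>r. k1 s r \<partial>lborel) \<partial>lborel) + (\<integral>s. (\<integral>r. k2 s r \<partial>lborel) \<partial>lborel)
        = (\<integral>p. k1 (fst p) (snd p) \<partial>(lborel \<Otimes>\<^sub>M lborel)) + (\<integral>p. k2 (fst p) (snd p) \<partial>(lborel \<Otimes>\<^sub>M lborel))"
      using lborel_pair.integral_fst'[OF ki(1)] lborel_pair.integral_fst'[OF ki(2)] by simp
    also have "\<dots> = (\<integral>p. G1 (snd p) * G2 (fst p) \<partial>(lborel \<Otimes>\<^sub>M lborel))"
      by (subst Bochner_Integration.integral_add[symmetric], rule ki, rule ki)
         (auto intro!: Bochner_Integration.integral_cong simp: k1' k2_def)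
    also have "\<dots> = (f1 b - f1 a) * (f2 b - f2 a)"
      using lborel_pair.integral_fst'[OF base] IG by simp
    finally have "(LBINT x:{a..b}. f1 x * g2 x) + (LBINT x:{a..b}. g1 x * f2 x)
       = f1 a * (f2 b - f2 a) + f2 a * (f1 b - f1 a) + (f1 b - f1 a) * (f2 b - f2 a)" using A B by linarith
    then show "f1 b * f2 b - f1 a * f2 a = (LBINT x:{a..b}. f1 x * g2 x + g1 x * f2 x)"
      using set_integral_add(2)[OF i1 i2, of a b] by (simp add: algebra_simps)
  qed
qed

text \<open>A Sobolev bound by averaging: for y in [x, x + 1] the values f x and f y differ by at
  most the root of the integral of g^2, and integrating over y replaces f y by the L2 norm.\<close>

lemma H1_bounded:
  assumes "H1 f" obtains B where "\<And>x. \<bar>f x\<bar> \<le> B"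
proof -
  from assms obtain g where fg: "wderiv f g" "L2 g" "L2 f" by (auto simp: H1_def)
  define D where "D = (\<integral>x. (g x)\<^sup>2 \<partial>lborel)"
  define E where "E = (\<integral>x. (f x)\<^sup>2 \<partial>lborel)"
  have i: "integrable lborel (\<lambda>x. (g x)\<^sup>2)" "integrable lborel (\<lambda>x. (f x)\<^sup>2)" using fg by (auto simp: L2_def)
  have "(f x)\<^sup>2 \<le> 2 * E + 2 * D" for x
  proof -
    have gi: "set_integrable lborel {x..y} (\<lambda>s. (g s)\<^sup>2)" for y
      using i(1) integrable_mult_indicator[of "{x..y}" lborel "\<lambda>s. (g s)\<^sup>2"] by (simp add: set_integrable_def)
    have one: "integrable lborel (indicator {x..x+1} :: real \<Rightarrow> real)" by simp
    have fi: "integrable lborel (\<lambda>s. indicator {x..x+1} s *\<^sub>R (f s)\<^sup>2)"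
      using i(2) integrable_mult_indicator[of "{x..x+1}" lborel "\<lambda>s. (f s)\<^sup>2"] by simp
    have le: "(f x)\<^sup>2 \<le> 2 * (f y)\<^sup>2 + 2 * D" if y: "y \<in> {x..x+1}" for y
    proof -
      have 1: "(LBINT s:{x..y}. (g s)\<^sup>2) \<le> D" unfolding D_def set_lebesgue_integral_def
        by (intro integral_mono gi[unfolded set_integrable_def] i) (auto simp: indicator_def)
      have 2: "0 \<le> (LBINT s:{x..y}. (g s)\<^sup>2)"
        unfolding set_lebesgue_integral_def by (intro Bochner_Integration.integral_nonneg) auto
      have "(f y - f x)\<^sup>2 \<le> (y - x) * (LBINT s:{x..y}. (g s)\<^sup>2)" using wderiv_sq_le[OF fg(1) _ gi] y by auto
      also have "\<dots> \<le> 1 * D" using 1 2 y by (intro mult_mono) auto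
      finally have "(f y - f x)\<^sup>2 \<le> D" by simp
      moreover have "(f x)\<^sup>2 \<le> 2 * (f y)\<^sup>2 + 2 * (f y - f x)\<^sup>2"
        using zero_le_power2[of "2 * f y - f x"] by (simp add: power2_eq_square algebra_simps)
      ultimately show ?thesis by simp
    qed
    have "(\<integral>s. indicator {x..x+1} s * (f x)\<^sup>2 \<partial>lborel) \<le> (\<integral>s. 2 * (indicator {x..x+1} s *\<^sub>R (f s)\<^sup>2) + indicator {x..x+1} s * (2 * D) \<partial>lborel)"
      by (intro integral_mono Bochner_Integration.integrable_add integrable_mult_right integrable_mult_left fi one)
         (auto simp: indicator_def le)
    also have "\<dots> = 2 * (\<integral>s. indicator {x..x+1} s *\<^sub>R (f s)\<^sup>2 \<partial>lborel) + 2 * D"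
      by (subst Bochner_Integration.integral_add) (use fi one in auto)
    also have "(\<integral>s. indicator {x..x+1} s *\<^sub>R (f s)\<^sup>2 \<partial>lborel) \<le> E"
      unfolding E_def by (intro integral_mono fi i) (auto simp: indicator_def)
    finally show ?thesis by simp
  qed
  then have "\<bar>f x\<bar> \<le> sqrt (2 * E + 2 * D)" for x using real_le_rsqrt[of "\<bar>f x\<bar>"] by simp
  then show ?thesis using that by blast
qed

lemma E2_bounded:
  assumes "E2 \<psi>p \<psi>m f" "\<And>x. 0 \<le> \<psi>p x \<and> \<psi>p x \<le> 1" "\<And>x. 0 \<le> \<psi>m x \<and> \<psi>m x \<le> 1"
  obtains B where "B > 0" "\<And>x. \<bar>f x\<bar> \<le> B"
proof -
  from assms(1) obtain fb a b where f: "H1 fb" "\<And>x. f x = fb x + a * \<psi>p x + b * \<psi>m x" by (auto simp: E2_def)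
  obtain B where B: "\<And>x. \<bar>fb x\<bar> \<le> B" using H1_bounded[OF f(1)] by blast
  show ?thesis
  proof (rule that[of "\<bar>B\<bar> + \<bar>a\<bar> + \<bar>b\<bar> + 1"])
    fix x
    have "\<bar>a * \<psi>p x\<bar> \<le> \<bar>a\<bar>" "\<bar>b * \<psi>m x\<bar> \<le> \<bar>b\<bar>" using assms(2,3)[of x] by (simp_all add: abs_mult mult_left_le)
    then show "\<bar>f x\<bar> \<le> \<bar>B\<bar> + \<bar>a\<bar> + \<bar>b\<bar> + 1" unfolding f using B[of x] by linarith
  qed simp
qed

section \<open>Passage from Lagrangian to Eulerian variables\<close>

text \<open>Half-open intervals are the convenient generator: under the monotone maps used here
  their preimages are again half-open intervals, by the Galois connections of the generalized
  inverses.\<close>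

lemma measure_eqI_Ioc:
  fixes M N :: "real measure"
  assumes sets: "sets M = sets borel" "sets N = sets borel"
    and eq: "\<And>a b. a \<le> b \<Longrightarrow> emeasure M {a<..b} = emeasure N {a<..b}"
    and fin: "\<And>a b. emeasure M {a<..b} \<noteq> \<infinity>"
  shows "M = N"
proof (rule measure_eqI_generator_eq[where \<Omega> = UNIV and E = "range (\<lambda>(a, b). {a<..b::real})"])
  show "Int_stable (range (\<lambda>(a, b). {a<..b::real}))"
  proof (rule Int_stableI)
    fix A B assume "A \<in> range (\<lambda>(a, b). {a<..b::real})" "B \<in> range (\<lambda>(a, b). {a<..b::real})"
    then obtain a b c d where "A = {a<..b}" "B = {c<..d}" by auto
    then have "A \<inter> B = {max a c<..min b d}" by auto
    then show "A \<inter> B \<in> range (\<lambda>(a, b). {a<..b::real})" by auto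
  qed
  show "emeasure M Y = emeasure N Y" if Y: "Y \<in> range (\<lambda>(a, b). {a<..b::real})" for Y
  proof -
    obtain a b where "Y = {a<..b}" using Y by auto
    then show ?thesis using eq[of a b] by (cases "a \<le> b") auto
  qed
  show "sets M = sigma_sets UNIV (range (\<lambda>(a, b). {a<..b::real}))"
    "sets N = sigma_sets UNIV (range (\<lambda>(a, b). {a<..b::real}))"
    unfolding sets borel_sigma_sets_Ioc by (auto intro!: sets_measure_of)
  show "range (\<lambda>n. {-real n<..real n}) \<subseteq> range (\<lambda>(a, b). {a<..b::real})" by auto
  show "(\<Union>n. {-real n<..real n}) = UNIV"
  proof (intro set_eqI iffI UNIV_I)
    fix x :: real obtain n where "\<bar>x\<bar> < real n" using reals_Archimedean2 by blast
    then show "x \<in> (\<Union>n. {-real n<..real n})" by (intro UN_I[of n]) auto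
  qed
  show "emeasure M {- real i<..real i} \<noteq> \<infinity>" for i by (rule fin)
qed auto

lemma fin_borel_eqI_cdf:
  assumes M: "fin_borel M" and N: "fin_borel N"
    and eq: "\<And>x. measure M {..x} = measure N {..x}"
  shows "M = N"
proof (rule measure_eqI_Ioc)
  interpret M: finite_measure M by (rule fin_borel_finite_measure[OF M])
  interpret N: finite_measure N by (rule fin_borel_finite_measure[OF N])
  show s: "sets M = sets borel" "sets N = sets borel" using M N by (auto simp: fin_borel_def)
  show "emeasure M {a<..b} \<noteq> \<infinity>" for a b by simp
  fix a b :: real assume ab: "a \<le> b"
  have "{a<..b} = {..b} - {..a}" using ab by auto
  then have "measure M {a<..b} = measure N {a<..b}"
    using ab eq M.finite_measure_Diff[of "{..b}" "{..a}"] N.finite_measure_Diff[of "{..b}" "{..a}"] by (simp add: s)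
  then show "emeasure M {a<..b} = emeasure N {a<..b}"
    by (simp add: M.emeasure_eq_measure N.emeasure_eq_measure)
qed

lemma emeasure_density_Ioc:
  assumes w: "wderiv F f" and pos: "\<And>x. 0 \<le> f x" and ab: "a \<le> b"
  shows "emeasure (density lborel (\<lambda>x. ennreal (f x))) {a<..b} = ennreal (F b - F a)"
proof -
  have [measurable]: "f \<in> borel_measurable borel" using wderiv_measurable[OF w] .
  have "emeasure (density lborel (\<lambda>x. ennreal (f x))) {a<..b} = (\<integral>\<^sup>+x. ennreal (f x) * indicator {a<..b} x \<partial>lborel)"
    by (subst emeasure_density) auto
  also have "\<dots> = (\<integral>\<^sup>+x. ennreal (indicator {a..b} x *\<^sub>R f x) \<partial>lborel)"
    by (rule nn_integral_cong_AE) (use ioc_indicator_AE(2)[of a b] in \<open>eventually_elim, auto simp: indicator_def\<close>)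
  also have "\<dots> = ennreal (LBINT x:{a..b}. f x)"
    unfolding set_lebesgue_integral_def using wderiv_integrable[OF w, of a b] pos
    by (intro nn_integral_eq_integral) (auto simp: set_integrable_def)
  also have "(LBINT x:{a..b}. f x) = F b - F a" using w ab by (auto simp: wderiv_def)
  finally show ?thesis .
qed

lemma wderiv_nonneg_mono:
  assumes w: "wderiv F f" and pos: "\<And>x. 0 \<le> f x" shows "mono F"
proof (rule monoI)
  fix x y :: real assume xy: "x \<le> y"
  have "F y - F x = (LBINT x:{x..y}. f x)" using w xy by (auto simp: wderiv_def)
  also have "\<dots> \<ge> 0" unfolding set_lebesgue_integral_def by (intro Bochner_Integration.integral_nonneg) (auto simp: pos)
  finally show "F x \<le> F y" by simp
qed

text \<open>H is the cumulative energy, so energy may sit where P = 0: there h d\<xi> is mapped to the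
  singular part of the Eulerian measure.\<close>
locale lagrangian_snapshot =
  fixes X U H P Q h :: "real \<Rightarrow> real" and C K :: real
  assumes wX: "wderiv X P" and wU: "wderiv U Q" and wH: "wderiv H h"
    and P0: "\<And>\<xi>. 0 \<le> P \<xi>" and h0: "\<And>\<xi>. 0 \<le> h \<xi>" and Q2: "\<And>\<xi>. (Q \<xi>)\<^sup>2 = P \<xi> * h \<xi>"
    and X_near: "\<And>\<xi>. \<bar>X \<xi> - \<xi>\<bar> \<le> K"
    and H_bot: "(H \<longlongrightarrow> 0) at_bot" and H_top: "(H \<longlongrightarrow> C) at_top"
begin

text \<open>The right-continuous generalized inverse of X. With the supremum, X \<xi> \<le> x is
  equivalent to \<xi> \<le> R x, and a flat piece of X is represented by its right end.\<close>

definition R :: "real \<Rightarrow> real" where "R x = Sup {\<xi>. X \<xi> \<le> x}"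

definition eul_u :: "real \<Rightarrow> real" where "eul_u x = U (R x)"

text \<open>The chain rule, u_x at X times P equals Q, solved for u_x. Division by zero gives 0
  where P vanishes; the Eulerian points concerned form a null set.\<close>

definition eul_g :: "real \<Rightarrow> real" where "eul_g x = Q (R x) / P (R x)"

definition eul_mu :: "real measure" where
  "eul_mu = distr (density lborel (\<lambda>\<xi>. ennreal (h \<xi>))) borel X"

lemma meas[measurable]:
  "P \<in> borel_measurable borel" "Q \<in> borel_measurable borel" "h \<in> borel_measurable borel"
  "X \<in> borel_measurable borel" "U \<in> borel_measurable borel" "H \<in> borel_measurable borel"
  using wX wU wH wderiv_measurable wderiv_continuous borel_measurable_continuous_onI by blast+

lemma mono_X: "a \<le> b \<Longrightarrow> X a \<le> X b"
  using wderiv_nonneg_mono[OF wX P0] by (rule monoD)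

lemma mono_H: "a \<le> b \<Longrightarrow> H a \<le> H b"
  using wderiv_nonneg_mono[OF wH h0] by (rule monoD)

text \<open>The supremum exists because X stays within K of the identity, and it is attained because
  X is continuous. Later facts about R mostly go through this equivalence.\<close>

lemma galois: "X \<xi> \<le> x \<longleftrightarrow> \<xi> \<le> R x"
proof -
  let ?S = "{\<xi>. X \<xi> \<le> x}"
  have ne: "?S \<noteq> {}" using X_near[of "x - K"] by (auto intro!: exI[of _ "x - K"])
  have bd: "bdd_above ?S"
  proof (rule bdd_aboveI[of _ "x + K"])
    fix \<zeta> assume "\<zeta> \<in> ?S" then show "\<zeta> \<le> x + K" using X_near[of \<zeta>] by simp
  qed
  have cl: "closed ?S" using wderiv_continuous[OF wX]
    by (intro closed_Collect_le continuous_intros) auto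
  have "R x \<in> ?S" unfolding R_def by (rule closed_contains_Sup[OF ne bd cl])
  then show ?thesis using cSup_upper[OF _ bd, of \<xi>] mono_X[of \<xi> "R x"] by (auto simp: R_def)
qed

lemma mono_R: "x \<le> y \<Longrightarrow> R x \<le> R y"
  using galois[of "R x" x] galois[of "R x" y] by simp

lemma meas_R[measurable]: "R \<in> borel_measurable borel"
  by (rule borel_measurable_mono) (simp add: monoI mono_R)

lemma meas_g[measurable]: "eul_g \<in> borel_measurable borel"
  unfolding eul_g_def[abs_def] by measurable

lemma X_R: "X (R x) = x"
proof (rule antisym)
  show "X (R x) \<le> x" using galois by blast
  show "x \<le> X (R x)"
  proof (rule ccontr)
    assume "\<not> x \<le> X (R x)"
    then have lt: "X (R x) < x" by simp
    have "x \<le> X (x + K)" using X_near[of "x + K"] by linarith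
    moreover have "R x \<le> x + K" using lt \<open>x \<le> X (x + K)\<close> mono_X by (smt (verit))
    ultimately obtain \<xi> where "R x \<le> \<xi>" "X \<xi> = x"
      using IVT'[of X "R x" x "x + K"] lt wderiv_continuous[OF wX] continuous_on_subset by (metis less_imp_le subset_UNIV)
    then show False using galois[of \<xi> x] lt by auto
  qed
qed

text \<open>The preimage of (a, b] is (R a, R b], where P has mass X (R b) - X (R a) = b - a. This
  is the change of variables for a map X that need not be injective: flat pieces carry no
  P-mass.\<close>

lemma distr_P: "distr (density lborel (\<lambda>\<xi>. ennreal (P \<xi>))) borel X = lborel"
proof (rule measure_eqI_Ioc)
  have *: "X -` {a<..b} = {R a<..R b}" for a b using galois by (auto simp: not_le[symmetric])
  have **: "emeasure (distr (density lborel (\<lambda>\<xi>. ennreal (P \<xi>))) borel X) {a<..b} = ennreal (b - a)" if "a \<le> b" for a b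
    using emeasure_density_Ioc[OF wX P0 mono_R[OF that]] by (simp add: emeasure_distr * X_R)
  then show "a \<le> b \<Longrightarrow> emeasure (distr (density lborel (\<lambda>\<xi>. ennreal (P \<xi>))) borel X) {a<..b} = emeasure lborel {a<..b}" for a b by simp
  show "emeasure (distr (density lborel (\<lambda>\<xi>. ennreal (P \<xi>))) borel X) {a<..b} \<noteq> \<infinity>" for a b
    using **[of a b] by (cases "a \<le> b") auto
qed auto

lemma nn_integral_X:
  assumes [measurable]: "f \<in> borel_measurable borel"
  shows "(\<integral>\<^sup>+x. f x \<partial>lborel) = (\<integral>\<^sup>+\<xi>. ennreal (P \<xi>) * f (X \<xi>) \<partial>lborel)"
  by (subst distr_P[symmetric]) (simp add: nn_integral_distr nn_integral_density)

lemma integrable_X: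
  fixes f :: "real \<Rightarrow> real" assumes [measurable]: "f \<in> borel_measurable borel"
  shows "integrable lborel f \<longleftrightarrow> integrable lborel (\<lambda>\<xi>. P \<xi> * f (X \<xi>))"
  by (subst distr_P[symmetric]) (simp add: integrable_distr_eq integrable_density P0)

lemma integral_X:
  fixes f :: "real \<Rightarrow> real" assumes [measurable]: "f \<in> borel_measurable borel"
  shows "(\<integral>x. f x \<partial>lborel) = (\<integral>\<xi>. P \<xi> * f (X \<xi>) \<partial>lborel)"
  by (subst distr_P[symmetric]) (simp add: integral_distr integral_density P0)

lemma AE_X: assumes "AE x in lborel. A x" and [measurable]: "Measurable.pred borel A"
  shows "AE \<xi> in lborel. P \<xi> > 0 \<longrightarrow> A (X \<xi>)"
proof -
  have "AE x in distr (density lborel (\<lambda>\<xi>. ennreal (P \<xi>))) borel X. A x" using assms(1) by (simp only: distr_P)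
  then show ?thesis by (subst (asm) AE_distr_iff) (auto simp: AE_density)
qed

text \<open>A label that is not the right end of its flat piece shares the piece with a rational, so
  X \<xi> lies in the countable image of the rationals. That image is Lebesgue null, and by the
  push-forward of P d\<xi> its preimage meets {P > 0} in a null set.\<close>

lemma AE_R_X: "AE \<xi> in lborel. P \<xi> > 0 \<longrightarrow> X \<xi> \<notin> X ` \<rat> \<and> R (X \<xi>) = \<xi>"
proof -
  have "AE \<xi> in lborel. \<forall>r\<in>\<rat>. P \<xi> > 0 \<longrightarrow> X \<xi> \<noteq> X r"
    by (subst AE_ball_countable) (auto intro!: AE_X AE_lborel_singleton countable_rat)
  then show ?thesis
  proof (eventually_elim, intro impI conjI)
    fix \<xi> assume *: "\<forall>r\<in>\<rat>. P \<xi> > 0 \<longrightarrow> X \<xi> \<noteq> X r" and p: "P \<xi> > 0"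
    then show "X \<xi> \<notin> X ` \<rat>" by blast
    have "\<xi> \<le> R (X \<xi>)" using galois by blast
    moreover have False if lt: "\<xi> < R (X \<xi>)"
    proof -
      obtain r where r: "r \<in> \<rat>" "\<xi> < r" "r < R (X \<xi>)" using Rats_dense_in_real[OF lt] by blast
      then have "X r = X \<xi>" using galois[of r "X \<xi>"] mono_X[of \<xi> r] by simp
      then show False using * p r by auto
    qed
    ultimately show "R (X \<xi>) = \<xi>" by force
  qed
qed

lemma Q_zero: "P \<xi> = 0 \<Longrightarrow> Q \<xi> = 0"
  using Q2[of \<xi>] by simp

lemma g_X: "AE \<xi> in lborel. P \<xi> * eul_g (X \<xi>) = Q \<xi>"
  using AE_R_X
proof eventually_elim
  fix \<xi> assume *: "P \<xi> > 0 \<longrightarrow> X \<xi> \<notin> X ` \<rat> \<and> R (X \<xi>) = \<xi>"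
  show "P \<xi> * eul_g (X \<xi>) = Q \<xi>"
    using * P0[of \<xi>] Q_zero[of \<xi>] by (cases "P \<xi> = 0") (auto simp: eul_g_def)
qed

lemma g2_X: "AE \<xi> in lborel. P \<xi> * (eul_g (X \<xi>))\<^sup>2 = (if P \<xi> = 0 then 0 else h \<xi>)"
  using AE_R_X
proof eventually_elim
  fix \<xi> assume *: "P \<xi> > 0 \<longrightarrow> X \<xi> \<notin> X ` \<rat> \<and> R (X \<xi>) = \<xi>"
  show "P \<xi> * (eul_g (X \<xi>))\<^sup>2 = (if P \<xi> = 0 then 0 else h \<xi>)"
    using * P0[of \<xi>] Q2[of \<xi>] by (cases "P \<xi> = 0") (auto simp: eul_g_def power_divide, simp add: power2_eq_square)
qed

text \<open>This makes u well defined: on a flat piece of X the density P vanishes almost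
  everywhere, and Q^2 = P h forces Q to vanish with it.\<close>

lemma U_diff_eq_0: assumes ab: "a \<le> b" and eq: "X a = X b" shows "U a = U b"
proof -
  have "AE \<xi> in density lborel (\<lambda>\<xi>. ennreal (P \<xi>)). \<not> (\<xi> \<in> {a<..b})"
    by (rule AE_I[where N = "{a<..b}"]) (use emeasure_density_Ioc[OF wX P0 ab] eq in auto)
  then have "AE \<xi> in lborel. 0 < P \<xi> \<longrightarrow> \<xi> \<notin> {a<..b}" by (simp add: AE_density)
  then have 1: "AE \<xi> in lborel. \<xi> \<in> {a<..b} \<longrightarrow> P \<xi> = 0"
    by eventually_elim (use P0 less_le in metis)
  have "U b - U a = (LBINT x:{a..b}. Q x)" using wU ab by (auto simp: wderiv_def)
  also have "\<dots> = (LBINT (x::real). 0)" unfolding set_lebesgue_integral_def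
    by (rule integral_cong_AE) (use 1 ioc_indicator_AE(2)[of a b] in \<open>auto elim!: eventually_elim2 simp: Q_zero indicator_def split: if_splits\<close>)
  finally show ?thesis by simp
qed

lemma u_X: "eul_u (X \<xi>) = U \<xi>"
  unfolding eul_u_def using U_diff_eq_0[of \<xi> "R (X \<xi>)"] galois[of \<xi> "X \<xi>"] X_R by simp

lemma wderiv_u: "wderiv eul_u eul_g"
  unfolding wderiv_def
proof (intro conjI allI impI)
  fix a b :: real assume ab: "a \<le> b"
  have Rab: "R a \<le> R b" by (rule mono_R[OF ab])
  \<comment> \<open>The half-open indicator pulls back exactly to (R a, R b]; passing to closed
    intervals costs only null sets on either side.\<close>
  let ?f = "\<lambda>x. indicator {a<..b} x * eul_g x"
  have ind: "indicator {a<..b} (X \<xi>) = (indicator {R a<..R b} \<xi> :: real)" for \<xi>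
    using galois by (auto simp: indicator_def not_le[symmetric])
  have e: "AE \<xi> in lborel. P \<xi> * ?f (X \<xi>) = indicator {R a..R b} \<xi> *\<^sub>R Q \<xi>"
    using g_X ioc_indicator_AE(2)[of "R a" "R b"] by eventually_elim (simp add: ind)
  have i: "integrable lborel (\<lambda>\<xi>. P \<xi> * ?f (X \<xi>))"
    by (subst integrable_cong_AE[OF _ _ e])
       (use wderiv_integrable[OF wU] in \<open>auto simp: set_integrable_def\<close>)
  have e2: "AE x in lborel. indicator {a..b} x *\<^sub>R eul_g x = ?f x"
    using ioc_indicator_AE(2)[of a b] by eventually_elim simp
  show "set_integrable lborel {a..b} eul_g" unfolding set_integrable_def
    by (subst integrable_cong_AE[OF _ _ e2]) (use i integrable_X[of ?f] in auto)
  have "(LBINT s:{a..b}. eul_g s) = (\<integral>x. ?f x \<partial>lborel)" unfolding set_lebesgue_integral_def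
    by (rule integral_cong_AE[OF _ _ e2]) auto
  also have "\<dots> = (\<integral>\<xi>. P \<xi> * ?f (X \<xi>) \<partial>lborel)" by (rule integral_X) simp
  also have "\<dots> = (LBINT \<xi>:{R a..R b}. Q \<xi>)" unfolding set_lebesgue_integral_def
    by (rule integral_cong_AE[OF _ _ e]) auto
  also have "\<dots> = U (R b) - U (R a)" using wU Rab by (auto simp: wderiv_def)
  finally show "eul_u b - eul_u a = (LBINT s:{a..b}. eul_g s)" by (simp add: eul_u_def)
qed simp

section \<open>The energy measure in Eulerian variables\<close>

lemma emeasure_h_Iic: "emeasure (density lborel (\<lambda>\<xi>. ennreal (h \<xi>))) {..b} = ennreal (H b)"
proof -
  let ?M = "density lborel (\<lambda>\<xi>. ennreal (h \<xi>))"
  have "(\<lambda>n. emeasure ?M {-real n<..b}) \<longlonglongrightarrow> emeasure ?M (\<Union>n. {-real n<..b})"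
    by (rule Lim_emeasure_incseq) (auto simp: incseq_def)
  also have "(\<Union>n. {-real n<..b}) = {..b}"
  proof (intro set_eqI iffI)
    fix x assume "x \<in> {..b}"
    moreover obtain n where "- x < real n" using reals_Archimedean2 by blast
    ultimately show "x \<in> (\<Union>n. {-real n<..b})" by (intro UN_I[of n]) auto
  qed auto
  finally have 1: "(\<lambda>n. emeasure ?M {-real n<..b}) \<longlonglongrightarrow> emeasure ?M {..b}" .
  have "filterlim (\<lambda>n. - real n) at_bot sequentially"
    by (simp add: filterlim_real_sequentially filterlim_uminus_at_bot)
  then have "(\<lambda>n. ennreal (H b - H (- real n))) \<longlonglongrightarrow> ennreal (H b - 0)"
    by (intro tendsto_ennrealI tendsto_intros filterlim_compose[OF H_bot])
  moreover have "\<forall>\<^sub>F n in sequentially. ennreal (H b - H (- real n)) = emeasure ?M {-real n<..b}"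
  proof -
    obtain n where n: "- b < real n" using reals_Archimedean2 by blast
    show ?thesis using eventually_ge_at_top[of n]
      by eventually_elim (use n emeasure_density_Ioc[OF wH h0] in force)
  qed
  ultimately have "(\<lambda>n. emeasure ?M {-real n<..b}) \<longlonglongrightarrow> ennreal (H b)"
    by (simp add: tendsto_cong)
  with 1 show ?thesis using LIMSEQ_unique by blast
qed

lemma H_nonneg: "0 \<le> H \<xi>"
  by (rule tendsto_upperbound[OF H_bot]) (auto intro!: exI[of _ \<xi>] mono_H simp: eventually_at_bot_linorder)

lemma H_le: "H \<xi> \<le> C"
  by (rule tendsto_lowerbound[OF H_top]) (auto intro!: exI[of _ \<xi>] mono_H simp: eventually_at_top_linorder)

lemma emeasure_h_UNIV: "emeasure (density lborel (\<lambda>\<xi>. ennreal (h \<xi>))) UNIV = ennreal C"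
proof -
  let ?M = "density lborel (\<lambda>\<xi>. ennreal (h \<xi>))"
  have "(\<lambda>n. emeasure ?M {..real n}) \<longlonglongrightarrow> emeasure ?M (\<Union>n. {..real n})"
    by (rule Lim_emeasure_incseq) (auto simp: incseq_def)
  also have "(\<Union>n. {..real n}) = UNIV" using real_arch_simple by auto
  finally have "(\<lambda>n. emeasure ?M {..real n}) \<longlonglongrightarrow> emeasure ?M UNIV" .
  moreover have "(\<lambda>n. emeasure ?M {..real n}) \<longlonglongrightarrow> ennreal C"
    unfolding emeasure_h_Iic
    by (intro tendsto_ennrealI filterlim_compose[OF H_top] filterlim_real_sequentially)
  ultimately show ?thesis using LIMSEQ_unique by blast
qed

lemma integrable_h: "integrable lborel h"
proof (rule integrableI_nonneg)
  have "(\<integral>\<^sup>+ x. ennreal (h x) \<partial>lborel) = ennreal C"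
    using emeasure_h_UNIV by (simp add: emeasure_density)
  then show "(\<integral>\<^sup>+ x. ennreal (h x) \<partial>lborel) < \<infinity>" by simp
qed (auto simp: h0)

lemma C_nonneg: "0 \<le> C" using H_nonneg H_le order_trans by blast

lemma integral_h: "(\<integral>\<xi>. h \<xi> \<partial>lborel) = C"
proof -
  have "ennreal (\<integral>\<xi>. h \<xi> \<partial>lborel) = (\<integral>\<^sup>+ x. ennreal (h x) \<partial>lborel)"
    by (rule nn_integral_eq_integral[symmetric]) (auto simp: integrable_h h0)
  also have "\<dots> = ennreal C" using emeasure_h_UNIV by (simp add: emeasure_density)
  finally show ?thesis using C_nonneg by (simp add: Bochner_Integration.integral_nonneg h0)
qed

lemma sets_mu[simp]: "sets eul_mu = sets borel" "space eul_mu = UNIV" by (auto simp: eul_mu_def)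

lemma emeasure_mu: "A \<in> sets borel \<Longrightarrow> emeasure eul_mu A = emeasure (density lborel (\<lambda>\<xi>. ennreal (h \<xi>))) (X -` A)"
  by (simp add: eul_mu_def emeasure_distr)

lemma fin_borel_mu: "fin_borel eul_mu"
  using emeasure_mu[of UNIV] emeasure_h_UNIV by (auto simp: fin_borel_def)

sublocale mu: finite_measure eul_mu by (rule fin_borel_finite_measure[OF fin_borel_mu])

lemma mu_UNIV: "measure eul_mu UNIV = C"
proof -
  have "emeasure eul_mu UNIV = ennreal C" by (simp add: emeasure_mu emeasure_h_UNIV)
  then show ?thesis by (rule measure_eq_emeasure_eq_ennreal[OF C_nonneg])
qed

lemma mu_Iic: "measure eul_mu {..x} = H (R x)"
proof -
  have "X -` {..x} = {..R x}" using galois by auto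
  then have "emeasure eul_mu {..x} = ennreal (H (R x))" by (simp only: emeasure_mu emeasure_h_Iic atMost_borel)
  then show ?thesis by (rule measure_eq_emeasure_eq_ennreal[OF H_nonneg])
qed

lemma nn_integral_mu:
  assumes [measurable]: "f \<in> borel_measurable borel"
  shows "(\<integral>\<^sup>+x. f x \<partial>eul_mu) = (\<integral>\<^sup>+\<xi>. ennreal (h \<xi>) * f (X \<xi>) \<partial>lborel)"
  by (simp add: eul_mu_def nn_integral_distr nn_integral_density)

lemma integral_mu:
  fixes f :: "real \<Rightarrow> real" assumes [measurable]: "f \<in> borel_measurable borel"
  shows "(\<integral>x. f x \<partial>eul_mu) = (\<integral>\<xi>. h \<xi> * f (X \<xi>) \<partial>lborel)"
  by (simp add: eul_mu_def integral_distr integral_density h0)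

lemma nn_integral_g2:
  assumes A[measurable]: "A \<in> sets borel"
  shows "(\<integral>\<^sup>+x\<in>A. ennreal ((eul_g x)\<^sup>2) \<partial>lborel) = (\<integral>\<^sup>+\<xi>. ennreal (if P \<xi> = 0 then 0 else h \<xi>) * indicator A (X \<xi>) \<partial>lborel)"
proof -
  have "(\<integral>\<^sup>+x\<in>A. ennreal ((eul_g x)\<^sup>2) \<partial>lborel) = (\<integral>\<^sup>+\<xi>. ennreal (P \<xi>) * (ennreal ((eul_g (X \<xi>))\<^sup>2) * indicator A (X \<xi>)) \<partial>lborel)"
    by (rule nn_integral_X) simp
  also have "\<dots> = (\<integral>\<^sup>+\<xi>. ennreal (if P \<xi> = 0 then 0 else h \<xi>) * indicator A (X \<xi>) \<partial>lborel)"
    by (rule nn_integral_cong_AE) (use g2_X in \<open>eventually_elim, simp add: ennreal_mult'[symmetric] mult.assoc[symmetric] P0\<close>)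
  finally show ?thesis .
qed

text \<open>Energy at labels with P > 0 forms the absolutely continuous part, energy at labels with
  P = 0 the singular one. The image of the rationals belongs to the null set because a label with P
  = 0 inside a flat piece is represented by its right end, where P may be positive.\<close>

lemma ac_part_mu: "ac_part eul_mu (\<lambda>x. (eul_g x)\<^sup>2)"
proof -
  define N where "N = {x. P (R x) = 0} \<union> X ` \<rat>"
  have [measurable]: "X ` \<rat> \<in> sets borel"
    by (intro borel_closed sets.countable) (auto simp: countable_rat)
  have N[measurable]: "N \<in> sets borel" unfolding N_def by measurable
  have notN: "AE \<xi> in lborel. P \<xi> > 0 \<longrightarrow> X \<xi> \<notin> N"
    using AE_R_X by eventually_elim (auto simp: N_def)
  have N0: "emeasure lborel N = 0"
  proof -
    have "emeasure lborel N = (\<integral>\<^sup>+x. indicator N x \<partial>lborel)" by simp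
    also have "\<dots> = (\<integral>\<^sup>+\<xi>. ennreal (P \<xi>) * indicator N (X \<xi>) \<partial>lborel)" by (rule nn_integral_X) simp
    also have "\<dots> = (\<integral>\<^sup>+(\<xi>::real). 0 \<partial>lborel)"
      by (rule nn_integral_cong_AE) (use notN in \<open>eventually_elim, auto simp: indicator_def not_less ennreal_neg\<close>)
    finally show ?thesis by simp
  qed
  have inN: "X \<xi> \<in> N" if "P \<xi> = 0" for \<xi>
  proof (cases "R (X \<xi>) = \<xi>")
    case False
    moreover have "\<xi> \<le> R (X \<xi>)" using galois by blast
    ultimately have "\<xi> < R (X \<xi>)" by simp
    then obtain r where r: "r \<in> \<rat>" "\<xi> < r" "r < R (X \<xi>)" using Rats_dense_in_real by blast
    then have "X r = X \<xi>" using galois[of r "X \<xi>"] mono_X[of \<xi> r] by simp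
    then show ?thesis using r(1) unfolding N_def by (metis UnI2 imageI)
  qed (use that in \<open>auto simp: N_def\<close>)
  show ?thesis unfolding ac_part_def
  proof (intro bexI[of _ N] conjI ballI N N0)
    fix A :: "real set" assume A[measurable]: "A \<in> sets borel"
    have m: "emeasure eul_mu B = (\<integral>\<^sup>+\<xi>. ennreal (h \<xi>) * indicator B (X \<xi>) \<partial>lborel)" if "B \<in> sets borel" for B
      using that nn_integral_mu[of "indicator B"] by simp
    have "emeasure eul_mu A = (\<integral>\<^sup>+\<xi>. ennreal (h \<xi>) * indicator A (X \<xi>) \<partial>lborel)" by (rule m[OF A])
    also have "\<dots> = (\<integral>\<^sup>+\<xi>. ennreal (if P \<xi> = 0 then 0 else h \<xi>) * indicator A (X \<xi>) + ennreal (h \<xi>) * indicator (A \<inter> N) (X \<xi>) \<partial>lborel)"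
    proof (rule nn_integral_cong_AE, use notN in eventually_elim)
      fix \<xi> assume "0 < P \<xi> \<longrightarrow> X \<xi> \<notin> N"
      then show "ennreal (h \<xi>) * indicator A (X \<xi>) = ennreal (if P \<xi> = 0 then 0 else h \<xi>) * indicator A (X \<xi>) + ennreal (h \<xi>) * indicator (A \<inter> N) (X \<xi>)"
        using P0[of \<xi>] inN[of \<xi>] by (cases "P \<xi> = 0") (auto simp: indicator_def)
    qed
    also have "\<dots> = (\<integral>\<^sup>+\<xi>. ennreal (if P \<xi> = 0 then 0 else h \<xi>) * indicator A (X \<xi>) \<partial>lborel) + (\<integral>\<^sup>+\<xi>. ennreal (h \<xi>) * indicator (A \<inter> N) (X \<xi>) \<partial>lborel)"
      by (rule nn_integral_add) auto
    also have "\<dots> = (\<integral>\<^sup>+x\<in>A. ennreal ((eul_g x)\<^sup>2) \<partial>lborel) + emeasure eul_mu (A \<inter> N)"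
      by (simp add: nn_integral_g2 m)
    finally show "emeasure eul_mu A = (\<integral>\<^sup>+x\<in>A. ennreal ((eul_g x)\<^sup>2) \<partial>lborel) + emeasure eul_mu (A \<inter> N)" .
  qed
qed

lemma has_density_mu:
  assumes "AE \<xi> in lborel. P \<xi> \<noteq> 0"
  shows "has_density eul_mu (\<lambda>x. (eul_g x)\<^sup>2)"
  unfolding has_density_def
proof
  fix A :: "real set" assume A[measurable]: "A \<in> sets borel"
  have "emeasure eul_mu A = (\<integral>\<^sup>+\<xi>. ennreal (h \<xi>) * indicator A (X \<xi>) \<partial>lborel)"
    using nn_integral_mu[of "indicator A"] by simp
  also have "\<dots> = (\<integral>\<^sup>+x\<in>A. ennreal ((eul_g x)\<^sup>2) \<partial>lborel)" unfolding nn_integral_g2[OF A]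
    by (rule nn_integral_cong_AE) (use assms in \<open>eventually_elim, simp\<close>)
  finally show "emeasure eul_mu A = (\<integral>\<^sup>+x\<in>A. ennreal ((eul_g x)\<^sup>2) \<partial>lborel)" .
qed

end

section \<open>Lagrangian variables for the initial data\<close>

lemma wderiv_lincomb:
  assumes "wderiv f f'" "wderiv k k'"
  shows "wderiv (\<lambda>x. a * f x + b * k x) (\<lambda>x. a * f' x + b * k' x)"
  unfolding wderiv_def
proof (intro conjI allI impI)
  show "(\<lambda>x. a * f' x + b * k' x) \<in> borel_measurable lborel" using assms by (auto simp: wderiv_def)
  fix x y :: real assume xy: "x \<le> y"
  have i: "set_integrable lborel {x..y} (\<lambda>x. a * f' x)" "set_integrable lborel {x..y} (\<lambda>x. b * k' x)"
    using assms by (auto intro: wderiv_integrable)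
  show "set_integrable lborel {x..y} (\<lambda>x. a * f' x + b * k' x)" using i by auto
  have "f y - f x = (LBINT s:{x..y}. f' s)" "k y - k x = (LBINT s:{x..y}. k' s)"
    using assms xy by (auto simp: wderiv_def)
  then show "a * f y + b * k y - (a * f x + b * k x) = (LBINT s:{x..y}. a * f' s + b * k' s)"
    using set_integral_add(2)[OF i] by (simp add: algebra_simps)
qed

lemma wderiv_add: "wderiv f f' \<Longrightarrow> wderiv k k' \<Longrightarrow> wderiv (\<lambda>x. f x + k x) (\<lambda>x. f' x + k' x)"
  using wderiv_lincomb[of f f' k k' 1 1] by simp

lemma wderiv_diff: "wderiv f f' \<Longrightarrow> wderiv k k' \<Longrightarrow> wderiv (\<lambda>x. f x - k x) (\<lambda>x. f' x - k' x)"
  using wderiv_lincomb[of f f' k k' 1 "-1"] by simp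

lemma wderiv_cmult: "wderiv f f' \<Longrightarrow> wderiv (\<lambda>x. a * f x) (\<lambda>x. a * f' x)"
  using wderiv_lincomb[of f f' f f' a 0] by simp

lemma wderiv_const: "wderiv (\<lambda>x. a) (\<lambda>x. 0)"
  by (rule C1_wderiv) auto

lemma wderiv_ident: "wderiv (\<lambda>x. x) (\<lambda>x. 1)"
  by (rule C1_wderiv) auto

text \<open>Additivity in the measure, by induction from indicators. It is applied to Lebesgue
  measure plus \<mu>, which the coordinate \<xi> parametrizes.\<close>

lemma nn_integral_sum_measure:
  fixes \<sigma> M N :: "real measure"
  assumes sets: "sets \<sigma> = sets borel" "sets M = sets borel" "sets N = sets borel"
    and eq: "\<And>A. A \<in> sets borel \<Longrightarrow> emeasure \<sigma> A = emeasure M A + emeasure N A"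
    and f: "f \<in> borel_measurable borel"
  shows "(\<integral>\<^sup>+x. f x \<partial>\<sigma>) = (\<integral>\<^sup>+x. f x \<partial>M) + (\<integral>\<^sup>+x. f x \<partial>N)"
  using f
proof (induction rule: borel_measurable_induct)
  have sp: "space \<sigma> = UNIV" "space M = UNIV" "space N = UNIV"
    using sets[THEN sets_eq_imp_space_eq] by auto
  have bm: "borel_measurable \<sigma> = (borel_measurable borel :: (real \<Rightarrow> ennreal) set)"
    "borel_measurable M = (borel_measurable borel :: (real \<Rightarrow> ennreal) set)"
    "borel_measurable N = (borel_measurable borel :: (real \<Rightarrow> ennreal) set)"
    using sets by (auto intro!: measurable_cong_sets)
  {
    case (cong f g) then show ?case by (simp add: space_borel cong: nn_integral_cong_simp)
  next
    case (set A) then show ?case using sets eq by simp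
  next
    case (mult u c) then show ?case by (simp add: nn_integral_cmult bm distrib_left)
  next
    case (add u v) then show ?case by (simp add: nn_integral_add bm ac_simps)
  next
    case (seq U)
    have inc: "incseq (\<lambda>i. (\<integral>\<^sup>+x. U i x \<partial>K))" for K :: "real measure"
      using \<open>incseq U\<close> by (auto simp: incseq_def le_fun_def intro!: nn_integral_mono)
    have "(\<integral>\<^sup>+x. (SUP i. U i x) \<partial>\<sigma>) = (SUP i. (\<integral>\<^sup>+x. U i x \<partial>M) + (\<integral>\<^sup>+x. U i x \<partial>N))"
      using seq by (simp add: nn_integral_monotone_convergence_SUP bm)
    also have "\<dots> = (SUP i. (\<integral>\<^sup>+x. U i x \<partial>M)) + (SUP i. (\<integral>\<^sup>+x. U i x \<partial>N))"
      by (rule ennreal_SUP_add[OF inc inc])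
    also have "\<dots> = (\<integral>\<^sup>+x. (SUP i. U i x) \<partial>M) + (\<integral>\<^sup>+x. (SUP i. U i x) \<partial>N)"
      using seq by (simp add: nn_integral_monotone_convergence_SUP bm)
    finally show ?case by (simp add: SUP_apply image_comp)
  }
qed

lemma cdf_right_limit:
  assumes M: "fin_borel M" and x: "\<And>n. x < s n" "s \<longlonglongrightarrow> x" 
  shows "(\<lambda>n. measure M {..s n}) \<longlonglongrightarrow> measure M {..x}"
proof -
  interpret finite_borel_measure M
    using M fin_borel_finite_measure[OF M] sets_eq_imp_space_eq[of M borel]
    by (auto simp: finite_borel_measure_def finite_borel_measure_axioms_def fin_borel_def)
  have "((cdf M) \<longlongrightarrow> cdf M x) (at_right x)" using cdf_is_right_cont[of x] by (simp add: continuous_within)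
  moreover have "filterlim s (at_right x) sequentially"
    using x by (auto simp: filterlim_at intro!: always_eventually)
  ultimately show ?thesis unfolding cdf_def by (rule filterlim_compose)
qed

lemma cdf_limits:
  assumes M: "fin_borel M"
  shows "((\<lambda>x. measure M {..x}) \<longlongrightarrow> 0) at_bot" "((\<lambda>x. measure M {..x}) \<longlongrightarrow> measure M UNIV) at_top"
proof -
  interpret finite_borel_measure M
    using M fin_borel_finite_measure[OF M] sets_eq_imp_space_eq[of M borel]
    by (auto simp: finite_borel_measure_def finite_borel_measure_axioms_def fin_borel_def)
  show "((\<lambda>x. measure M {..x}) \<longlongrightarrow> 0) at_bot" using cdf_lim_at_bot by (simp add: cdf_def)
  show "((\<lambda>x. measure M {..x}) \<longlongrightarrow> measure M UNIV) at_top"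
    using cdf_lim_at_top by (simp add: cdf_def sets_eq_imp_space_eq[OF M_is_borel])
qed

locale eulerian_data =
  fixes u0 g :: "real \<Rightarrow> real" and \<mu> :: "real measure"
  assumes fin: "fin_borel \<mu>" and wd: "wderiv u0 g" and ac: "ac_part \<mu> (\<lambda>x. (g x)\<^sup>2)"
begin

sublocale finite_measure \<mu> by (rule fin_borel_finite_measure[OF fin])

lemma sets_mu[simp, measurable_cong]: "sets \<mu> = sets borel" using fin by (simp add: fin_borel_def)

definition C :: real where "C = measure \<mu> UNIV"
definition G :: "real \<Rightarrow> real" where "G x = x + measure \<mu> {..x}"
definition y :: "real \<Rightarrow> real" where "y \<xi> = Inf {x. \<xi> \<le> G x}"
text \<open>One Lebesgue null set carrying the singular part of \<mu> is fixed once and for all,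
  since the density \<open>w\<close> refers to it.\<close>

definition N :: "real set" where "N = (SOME N. N \<in> sets borel \<and> emeasure lborel N = 0 \<and>
      (\<forall>A\<in>sets borel. emeasure \<mu> A = (\<integral>\<^sup>+x\<in>A. ennreal ((g x)\<^sup>2) \<partial>lborel) + emeasure \<mu> (A \<inter> N)))"
text \<open>The Radon-Nikodym density of dx with respect to dx + d\<mu>: off N the sum is (1 + g^2)
  dx, and on N Lebesgue measure contributes nothing.\<close>

definition w :: "real \<Rightarrow> real" where "w x = (if x \<in> N then 0 else 1 / (1 + (g x)\<^sup>2))"
definition p :: "real \<Rightarrow> real" where "p \<xi> = w (y \<xi>)"
definition q :: "real \<Rightarrow> real" where "q \<xi> = g (y \<xi>) * p \<xi>"
definition h :: "real \<Rightarrow> real" where "h \<xi> = 1 - p \<xi>"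

lemma N: "N \<in> sets borel" "emeasure lborel N = 0"
    "\<And>A. A \<in> sets borel \<Longrightarrow> emeasure \<mu> A = (\<integral>\<^sup>+x\<in>A. ennreal ((g x)\<^sup>2) \<partial>lborel) + emeasure \<mu> (A \<inter> N)"
proof -
  have "\<exists>N. N \<in> sets borel \<and> emeasure lborel N = 0 \<and>
      (\<forall>A\<in>sets borel. emeasure \<mu> A = (\<integral>\<^sup>+x\<in>A. ennreal ((g x)\<^sup>2) \<partial>lborel) + emeasure \<mu> (A \<inter> N))"
    using ac unfolding ac_part_def by blast
  from someI_ex[OF this] show "N \<in> sets borel" "emeasure lborel N = 0"
    "\<And>A. A \<in> sets borel \<Longrightarrow> emeasure \<mu> A = (\<integral>\<^sup>+x\<in>A. ennreal ((g x)\<^sup>2) \<partial>lborel) + emeasure \<mu> (A \<inter> N)"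
    unfolding N_def by blast+
qed

declare N(1)[measurable]

lemma meas_g[measurable]: "g \<in> borel_measurable borel" using wderiv_measurable[OF wd] .

lemma meas_w[measurable]: "w \<in> borel_measurable borel"
  unfolding w_def[abs_def] by measurable

lemma mu_le_C: "measure \<mu> A \<le> C"
  unfolding C_def by (rule finite_measure_mono) auto

lemma mono_G: "a \<le> b \<Longrightarrow> G a \<le> G b"
  unfolding G_def by (intro add_mono finite_measure_mono) auto

text \<open>The infimum is attained because distribution functions are right continuous. Jumps of G
  become flat pieces of y, so atoms of \<mu> are spread over intervals of labels.\<close>

lemma galois_y: "y \<xi> \<le> x \<longleftrightarrow> \<xi> \<le> G x"
proof -
  let ?S = "{x. \<xi> \<le> G x}"
  have ne: "?S \<noteq> {}" using measure_nonneg[of \<mu> "{..\<xi>}"] by (auto simp: G_def intro!: exI[of _ \<xi>])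
  have bd: "bdd_below ?S"
  proof (rule bdd_belowI[of _ "\<xi> - C"])
    fix x assume "x \<in> ?S" then show "\<xi> - C \<le> x" using mu_le_C[of "{..x}"] by (simp add: G_def)
  qed
  have "y \<xi> \<in> ?S"
  proof -
    define s where "s n = y \<xi> + 1 / real (Suc n)" for n
    have s: "y \<xi> < s n" for n by (simp add: s_def)
    have lim: "s \<longlonglongrightarrow> y \<xi>"
      using tendsto_add[OF tendsto_const[of "y \<xi>"] LIMSEQ_inverse_real_of_nat] by (simp add: s_def[abs_def] inverse_eq_divide)
    have "(\<lambda>n. G (s n)) \<longlonglongrightarrow> G (y \<xi>)" unfolding G_def
      by (intro tendsto_add lim cdf_right_limit[OF fin s lim])
    moreover have "\<xi> \<le> G (s n)" for n
    proof -
      obtain x where "x \<in> ?S" "x < s n" using cInf_lessD[OF ne] s[of n] unfolding y_def by blast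
      then show ?thesis using mono_G[of x "s n"] by auto
    qed
    ultimately show ?thesis using LIMSEQ_le_const by blast
  qed
  then show ?thesis using cInf_lower[OF _ bd, of x] mono_G[of "y \<xi>" x] by (auto simp: y_def)
qed

lemma mono_y: "a \<le> b \<Longrightarrow> y a \<le> y b"
  using galois_y[of b "y b"] galois_y[of a "y b"] by simp

lemma meas_y[measurable]: "y \<in> borel_measurable borel"
  by (rule borel_measurable_mono) (simp add: monoI mono_y)

lemma y_le: "y \<xi> \<le> \<xi>"
  using measure_nonneg[of \<mu> "{..\<xi>}"] by (simp add: galois_y G_def)

lemma le_y: "\<xi> - y \<xi> \<le> measure \<mu> {..y \<xi>}"
  using galois_y[of \<xi> "y \<xi>"] by (simp add: G_def)

text \<open>y maps Lebesgue measure to dx + d\<mu>, which is why \<xi> can be used as a common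
  coordinate for length and energy.\<close>
definition sum_measure :: "real measure" where
  "sum_measure = measure_of UNIV (sets borel) (\<lambda>A. emeasure lborel A + emeasure \<mu> A)"

lemma sets_sum_measure: "sets sum_measure = sets borel"
  unfolding sum_measure_def by (metis sets.sigma_sets_eq sets_measure_of space_borel subset_UNIV Pow_UNIV)

lemma emeasure_sum_measure: "A \<in> sets borel \<Longrightarrow> emeasure sum_measure A = emeasure lborel A + emeasure \<mu> A"
proof (rule emeasure_measure_of[OF sum_measure_def])
  show "positive (sets sum_measure) (\<lambda>A. emeasure lborel A + emeasure \<mu> A)" by (auto simp: positive_def)
  show "countably_additive (sets sum_measure) (\<lambda>A. emeasure lborel A + emeasure \<mu> A)"
    unfolding sets_sum_measure
  proof (rule countably_additiveI)
    fix A :: "nat \<Rightarrow> real set" assume A: "range A \<subseteq> sets borel" "disjoint_family A"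
    show "(\<Sum>i. emeasure lborel (A i) + emeasure \<mu> (A i)) = emeasure lborel (\<Union> (range A)) + emeasure \<mu> (\<Union> (range A))"
      using A by (subst suminf_add[symmetric]) (auto simp: suminf_emeasure)
  qed
qed (auto simp: sets_sum_measure)

text \<open>The preimage of (a, b] is (G a, G b], whose length is b - a plus the \<mu>-mass of (a,
  b].\<close>

lemma distr_y: "distr lborel borel y = sum_measure"
proof (rule measure_eqI_Ioc)
  have *: "emeasure (distr lborel borel y) {a<..b} = ennreal (G b - G a)" if "a \<le> b" for a b
  proof -
    have "y -` {a<..b} = {G a<..G b}" using galois_y by (auto simp: not_le[symmetric])
    then show ?thesis using mono_G[OF that] by (simp add: emeasure_distr)
  qed
  have **: "emeasure sum_measure {a<..b} = ennreal (G b - G a)" if "a \<le> b" for a b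
  proof -
    have "{a<..b} = {..b} - {..a}" using that by auto
    then have "measure \<mu> {a<..b} = measure \<mu> {..b} - measure \<mu> {..a}"
      using that finite_measure_Diff[of "{..b}" "{..a}"] by simp
    moreover have "measure \<mu> {..a} \<le> measure \<mu> {..b}" using that by (intro finite_measure_mono) auto
    ultimately show ?thesis using that
      by (simp add: emeasure_sum_measure emeasure_eq_measure G_def ennreal_plus[symmetric] del: ennreal_plus)
  qed
  show "a \<le> b \<Longrightarrow> emeasure (distr lborel borel y) {a<..b} = emeasure sum_measure {a<..b}" for a b
    using * ** by simp
  show "emeasure (distr lborel borel y) {a<..b} \<noteq> \<infinity>" for a b using * by (cases "a \<le> b") auto
qed (auto simp: sets_sum_measure)

lemma nn_integral_y:
  assumes [measurable]: "f \<in> borel_measurable borel"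
  shows "(\<integral>\<^sup>+\<xi>. f (y \<xi>) \<partial>lborel) = (\<integral>\<^sup>+x. f x \<partial>lborel) + (\<integral>\<^sup>+x. f x \<partial>\<mu>)"
proof -
  have "(\<integral>\<^sup>+\<xi>. f (y \<xi>) \<partial>lborel) = (\<integral>\<^sup>+x. f x \<partial>sum_measure)"
    by (simp add: distr_y[symmetric] nn_integral_distr)
  also have "\<dots> = (\<integral>\<^sup>+x. f x \<partial>lborel) + (\<integral>\<^sup>+x. f x \<partial>\<mu>)"
    by (rule nn_integral_sum_measure) (auto simp: sets_sum_measure emeasure_sum_measure)
  finally show ?thesis .
qed

text \<open>Off N only the first term of the decomposition of \<mu> survives; this is an equality of
  two measures with densities, hence valid for all integrands.\<close>

lemma nn_integral_mu_off_N:
  assumes [measurable]: "f \<in> borel_measurable borel"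
  shows "(\<integral>\<^sup>+x. f x * indicator (-N) x \<partial>\<mu>) = (\<integral>\<^sup>+x. f x * ennreal ((g x)\<^sup>2) \<partial>lborel)"
proof -
  have AEN: "AE x in lborel. x \<notin> N" using N by (intro AE_I[of _ _ N]) auto
  have "density \<mu> (indicator (-N)) = density lborel (\<lambda>x. ennreal ((g x)\<^sup>2))"
  proof (rule measure_eqI)
    fix A assume "A \<in> sets (density \<mu> (indicator (-N)))"
    then have A[measurable]: "A \<in> sets borel" by simp
    have "emeasure (density \<mu> (indicator (-N))) A = emeasure \<mu> (A - N)"
      by (simp add: emeasure_density indicator_inter_arith[symmetric] Diff_eq Int_commute)
    also have "\<dots> = (\<integral>\<^sup>+x\<in>A - N. ennreal ((g x)\<^sup>2) \<partial>lborel)"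
      using N(3)[of "A - N"] by (simp add: Diff_eq Int_assoc)
    also have "\<dots> = (\<integral>\<^sup>+x\<in>A. ennreal ((g x)\<^sup>2) \<partial>lborel)"
      by (rule nn_integral_cong_AE) (use AEN in \<open>eventually_elim, auto simp: indicator_def\<close>)
    also have "\<dots> = emeasure (density lborel (\<lambda>x. ennreal ((g x)\<^sup>2))) A" by (simp add: emeasure_density)
    finally show "emeasure (density \<mu> (indicator (-N))) A = emeasure (density lborel (\<lambda>x. ennreal ((g x)\<^sup>2))) A" .
  qed simp
  then have "(\<integral>\<^sup>+x. f x \<partial>density \<mu> (indicator (-N))) = (\<integral>\<^sup>+x. f x \<partial>density lborel (\<lambda>x. ennreal ((g x)\<^sup>2)))" by simp
  then show ?thesis by (simp add: nn_integral_density mult.commute)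
qed

lemma w_range: "0 \<le> w x" "w x \<le> 1"
proof -
  have pos: "0 < 1 + (g x)\<^sup>2" by (simp add: add_pos_nonneg)
  then have a: "1 / (1 + (g x)\<^sup>2) \<le> 1 / 1" by (intro divide_left_mono) (simp_all add: add_pos_nonneg)
  show "w x \<le> 1" by (cases "x \<in> N") (use a in \<open>simp_all only: w_def if_True if_False div_by_1 zero_le_one\<close>)
  show "0 \<le> w x" using pos by (simp add: w_def)
qed

lemma AE_w: "AE x in lborel. w x * (1 + (g x)\<^sup>2) = 1"
proof -
  have "AE x in lborel. x \<notin> N" using N by (intro AE_I[of _ _ N]) auto
  then show ?thesis
  proof eventually_elim
    fix x assume "x \<notin> N"
    moreover have "1 + (g x)\<^sup>2 \<noteq> 0" using zero_le_power2[of "g x"] by linarith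
    ultimately show "w x * (1 + (g x)\<^sup>2) = 1" by (simp add: w_def)
  qed
qed

lemma nn_integral_w_mu:
  assumes [measurable]: "f \<in> borel_measurable borel"
  shows "(\<integral>\<^sup>+x. f x * ennreal (w x) \<partial>\<mu>) = (\<integral>\<^sup>+x. f x * ennreal (w x * (g x)\<^sup>2) \<partial>lborel)"
proof -
  have "(\<integral>\<^sup>+x. f x * ennreal (w x) \<partial>\<mu>) = (\<integral>\<^sup>+x. (f x * ennreal (w x)) * indicator (-N) x \<partial>\<mu>)"
    by (intro nn_integral_cong) (auto simp: w_def indicator_def)
  also have "\<dots> = (\<integral>\<^sup>+x. (f x * ennreal (w x)) * ennreal ((g x)\<^sup>2) \<partial>lborel)" by (rule nn_integral_mu_off_N) simp
  finally show ?thesis by (simp add: ennreal_mult' mult.assoc w_range)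
qed

text \<open>The weight turns dx + d\<mu> into w (1 + g^2) dx = dx, because w vanishes on N and so
  sees only the absolutely continuous part of \<mu>.\<close>

lemma distr_p: "distr (density lborel (\<lambda>\<xi>. ennreal (p \<xi>))) borel y = lborel"
proof (rule measure_eqI)
  have [measurable]: "p \<in> borel_measurable borel" unfolding p_def[abs_def] by measurable
  fix A assume "A \<in> sets (distr (density lborel (\<lambda>\<xi>. ennreal (p \<xi>))) borel y)"
  then have A[measurable]: "A \<in> sets borel" by simp
  have [measurable]: "y -` A \<in> sets borel" using measurable_sets_borel[OF meas_y A] .
  have "emeasure (distr (density lborel (\<lambda>\<xi>. ennreal (p \<xi>))) borel y) A = (\<integral>\<^sup>+\<xi>. indicator A (y \<xi>) * ennreal (w (y \<xi>)) \<partial>lborel)"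
    by (simp add: emeasure_distr emeasure_density p_def mult.commute indicator_vimage[symmetric] comp_def)
  also have "\<dots> = (\<integral>\<^sup>+x. indicator A x * ennreal (w x) \<partial>lborel) + (\<integral>\<^sup>+x. indicator A x * ennreal (w x) \<partial>\<mu>)"
    by (rule nn_integral_y) simp
  also have "\<dots> = (\<integral>\<^sup>+x. indicator A x * ennreal (w x) + indicator A x * ennreal (w x * (g x)\<^sup>2) \<partial>lborel)"
    by (simp add: nn_integral_w_mu nn_integral_add)
  also have "\<dots> = (\<integral>\<^sup>+x. indicator A x \<partial>lborel)"
    by (rule nn_integral_cong_AE) (use AE_w in \<open>eventually_elim, auto simp: indicator_def distrib_left w_range ennreal_plus[symmetric] simp del: ennreal_plus\<close>)
  finally show "emeasure (distr (density lborel (\<lambda>\<xi>. ennreal (p \<xi>))) borel y) A = emeasure lborel A" by simp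
qed simp

text \<open>(1 - w) (dx + d\<mu>) = d\<mu>, because the Lebesgue part (1 - w) dx = w g^2 dx equals w
  d\<mu> and completes (1 - w) d\<mu>.\<close>

lemma distr_h: "distr (density lborel (\<lambda>\<xi>. ennreal (h \<xi>))) borel y = \<mu>"
proof (rule measure_eqI)
  have [measurable]: "h \<in> borel_measurable borel" unfolding h_def[abs_def] p_def by measurable
  fix A assume "A \<in> sets (distr (density lborel (\<lambda>\<xi>. ennreal (h \<xi>))) borel y)"
  then have A[measurable]: "A \<in> sets borel" by simp
  have [measurable]: "y -` A \<in> sets borel" using measurable_sets_borel[OF meas_y A] .
  have "emeasure (distr (density lborel (\<lambda>\<xi>. ennreal (h \<xi>))) borel y) A = (\<integral>\<^sup>+\<xi>. indicator A (y \<xi>) * ennreal (1 - w (y \<xi>)) \<partial>lborel)"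
    by (simp add: emeasure_distr emeasure_density p_def h_def mult.commute indicator_vimage[symmetric] comp_def)
  also have "\<dots> = (\<integral>\<^sup>+x. indicator A x * ennreal (1 - w x) \<partial>lborel) + (\<integral>\<^sup>+x. indicator A x * ennreal (1 - w x) \<partial>\<mu>)"
    by (rule nn_integral_y) simp
  also have "(\<integral>\<^sup>+x. indicator A x * ennreal (1 - w x) \<partial>lborel) = (\<integral>\<^sup>+x. indicator A x * ennreal (w x * (g x)\<^sup>2) \<partial>lborel)"
  proof (rule nn_integral_cong_AE, use AE_w in eventually_elim)
    fix x assume "w x * (1 + (g x)\<^sup>2) = 1"
    then have "1 - w x = w x * (g x)\<^sup>2" by (simp add: algebra_simps)
    then show "indicator A x * ennreal (1 - w x) = indicator A x * ennreal (w x * (g x)\<^sup>2)" by simp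
  qed
  also have "\<dots> = (\<integral>\<^sup>+x. indicator A x * ennreal (w x) \<partial>\<mu>)" by (simp add: nn_integral_w_mu)
  also have "(\<integral>\<^sup>+x. indicator A x * ennreal (w x) \<partial>\<mu>) + (\<integral>\<^sup>+x. indicator A x * ennreal (1 - w x) \<partial>\<mu>)
      = (\<integral>\<^sup>+x. indicator A x * ennreal (w x) + indicator A x * ennreal (1 - w x) \<partial>\<mu>)"
    by (simp add: nn_integral_add)
  also have "\<dots> = (\<integral>\<^sup>+x. indicator A x \<partial>\<mu>)"
    by (intro nn_integral_cong) (auto simp: indicator_def w_range ennreal_plus[symmetric] simp del: ennreal_plus)
  finally show "emeasure (distr (density lborel (\<lambda>\<xi>. ennreal (h \<xi>))) borel y) A = emeasure \<mu> A" by simp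
qed simp

lemma meas_pqh[measurable]: "p \<in> borel_measurable borel" "q \<in> borel_measurable borel" "h \<in> borel_measurable borel"
  unfolding p_def[abs_def] q_def[abs_def] h_def[abs_def] by measurable

lemma p0: "0 \<le> p \<xi>" by (simp add: p_def w_range)

text \<open>The chain rule by change of variables, as f' is merely locally integrable: y maps p
  d\<xi> to Lebesgue measure.\<close>

lemma wderiv_comp_y:
  assumes f: "wderiv f f'" shows "wderiv (\<lambda>\<xi>. f (y \<xi>)) (\<lambda>\<xi>. f' (y \<xi>) * p \<xi>)"
  unfolding wderiv_def
proof (intro conjI allI impI)
  have [measurable]: "f' \<in> borel_measurable borel" using wderiv_measurable[OF f] .
  show "(\<lambda>\<xi>. f' (y \<xi>) * p \<xi>) \<in> borel_measurable lborel" by simp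
  fix a b :: real assume ab: "a \<le> b"
  let ?k = "\<lambda>x. indicator {y a..y b} x * f' x"
  \<comment> \<open>A single point has no p-mass. Hence [a, b] is, up to p-null sets, the preimage
    of [y a, y b], even if y is flat at the ends.\<close>
  have ne: "AE \<xi> in lborel. p \<xi> > 0 \<longrightarrow> y \<xi> \<noteq> c" for c
  proof -
    have "AE x in distr (density lborel (\<lambda>\<xi>. ennreal (p \<xi>))) borel y. x \<noteq> c"
      unfolding distr_p by (rule AE_lborel_singleton)
    then show ?thesis by (subst (asm) AE_distr_iff) (auto simp: AE_density)
  qed
  have e: "AE \<xi> in lborel. indicator {a..b} \<xi> *\<^sub>R (f' (y \<xi>) * p \<xi>) = p \<xi> * ?k (y \<xi>)"
    using ne[of "y a"] ne[of "y b"]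
  proof eventually_elim
    fix \<xi> assume *: "p \<xi> > 0 \<longrightarrow> y \<xi> \<noteq> y a" "p \<xi> > 0 \<longrightarrow> y \<xi> \<noteq> y b"
    show "indicator {a..b} \<xi> *\<^sub>R (f' (y \<xi>) * p \<xi>) = p \<xi> * ?k (y \<xi>)"
    proof (cases "p \<xi> > 0")
      case True
      with * have "y \<xi> \<noteq> y a" "y \<xi> \<noteq> y b" by auto
      then have "\<xi> \<in> {a..b} \<longleftrightarrow> y \<xi> \<in> {y a..y b}"
        using mono_y[of a \<xi>] mono_y[of \<xi> b] mono_y[of \<xi> a] mono_y[of b \<xi>] by (auto simp: not_le)
          (use linorder_le_cases in blast)+
      then show ?thesis by (auto simp: indicator_def)
    qed (use p0[of \<xi>] in auto)
  qed
  have i: "integrable lborel ?k" using wderiv_integrable[OF f, of "y a" "y b"] by (simp add: set_integrable_def)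
  have "integrable lborel (\<lambda>\<xi>. p \<xi> * ?k (y \<xi>))"
    using i by (subst (asm) distr_p[symmetric]) (simp add: integrable_distr_eq integrable_density p0)
  then show "set_integrable lborel {a..b} (\<lambda>\<xi>. f' (y \<xi>) * p \<xi>)" unfolding set_integrable_def
    by (subst integrable_cong_AE[OF _ _ e]) auto
  have "(LBINT s:{a..b}. f' (y s) * p s) = (\<integral>\<xi>. p \<xi> * ?k (y \<xi>) \<partial>lborel)" unfolding set_lebesgue_integral_def
    by (rule integral_cong_AE[OF _ _ e]) auto
  also have "\<dots> = (\<integral>x. ?k x \<partial>lborel)"
    by (subst (2) distr_p[symmetric]) (simp add: integral_distr integral_density p0)
  also have "\<dots> = f (y b) - f (y a)" using f mono_y[OF ab] by (simp add: wderiv_def set_lebesgue_integral_def)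
  finally show "f (y b) - f (y a) = (LBINT s:{a..b}. f' (y s) * p s)" by simp
qed

lemma h0: "0 \<le> h \<xi>" by (simp add: h_def p_def w_range)

text \<open>On N both sides vanish by the choice of w; elsewhere p (1 + g^2) = 1 gives h = p
  g^2.\<close>

lemma q2: "(q \<xi>)\<^sup>2 = p \<xi> * h \<xi>"
proof (cases "y \<xi> \<in> N")
  case False
  have "1 + (g (y \<xi>))\<^sup>2 \<noteq> 0" using zero_le_power2[of "g (y \<xi>)"] by linarith
  then have "p \<xi> * (1 + (g (y \<xi>))\<^sup>2) = 1" using False by (simp add: p_def w_def)
  then have "h \<xi> = p \<xi> * (g (y \<xi>))\<^sup>2" by (simp add: h_def algebra_simps)
  then show ?thesis by (simp add: q_def power_mult_distrib power2_eq_square)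
qed (simp add: q_def p_def w_def)

text \<open>The coordinate adds length and energy, so at time zero the cumulative energy is \<xi> -
  y \<xi>. The same quantity is the distance from y to the identity, which is why C appears both as
  total energy and as bound K.\<close>

lemma snapshot0: "lagrangian_snapshot y (\<lambda>\<xi>. u0 (y \<xi>)) (\<lambda>\<xi>. \<xi> - y \<xi>) p q h C C"
proof
  show wy: "wderiv y p" using wderiv_comp_y[OF wderiv_ident] by simp
  show "wderiv (\<lambda>\<xi>. u0 (y \<xi>)) q" using wderiv_comp_y[OF wd] by (simp add: q_def[abs_def])
  show wH: "wderiv (\<lambda>\<xi>. \<xi> - y \<xi>) h" using wderiv_diff[OF wderiv_ident wy] by (simp add: h_def[abs_def])
  have HC: "\<xi> - y \<xi> \<le> C" for \<xi> using le_y[of \<xi>] mu_le_C order_trans by blast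
  show "\<bar>y \<xi> - \<xi>\<bar> \<le> C" for \<xi> using y_le[of \<xi>] HC[of \<xi>] by simp
  show "((\<lambda>\<xi>. \<xi> - y \<xi>) \<longlongrightarrow> 0) at_bot"
  proof (rule tendsto_sandwich[OF _ _ tendsto_const cdf_limits(1)[OF fin]])
    show "\<forall>\<^sub>F \<xi> in at_bot. \<xi> - y \<xi> \<le> measure \<mu> {..\<xi>}"
    proof (intro always_eventually allI)
      fix \<xi> have "measure \<mu> {..y \<xi>} \<le> measure \<mu> {..\<xi>}" using y_le[of \<xi>] by (intro finite_measure_mono) auto
      then show "\<xi> - y \<xi> \<le> measure \<mu> {..\<xi>}" using le_y[of \<xi>] by simp
    qed
  qed (use y_le in \<open>auto intro!: always_eventually\<close>)
  show "((\<lambda>\<xi>. \<xi> - y \<xi>) \<longlongrightarrow> C) at_top"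
  proof (rule tendsto_sandwich[OF _ _ _ tendsto_const])
    have mono: "a - y a \<le> b - y b" if "a \<le> b" for a b
      using monoD[OF wderiv_nonneg_mono[OF wH h0] that] .
    show "\<forall>\<^sub>F \<xi> in at_top. measure \<mu> {..\<xi> - C} \<le> \<xi> - y \<xi>"
    proof (intro always_eventually allI)
      fix \<xi>
      \<comment> \<open>The lower bound evaluates the nondecreasing function \<xi> - y \<xi> at G
        (\<xi> - C), where y (G x) \<le> x turns it into a value of the distribution
        function.\<close>
      have "G (\<xi> - C) \<le> \<xi>" using mu_le_C[of "{..\<xi> - C}"] by (simp add: G_def)
      from mono[OF this] have "G (\<xi> - C) - y (G (\<xi> - C)) \<le> \<xi> - y \<xi>" .
      moreover have "y (G (\<xi> - C)) \<le> \<xi> - C" by (simp add: galois_y)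
      ultimately show "measure \<mu> {..\<xi> - C} \<le> \<xi> - y \<xi>" by (simp add: G_def)
    qed
    have "filterlim (\<lambda>\<xi>. \<xi> - C) at_top at_top"
      using filterlim_tendsto_add_at_top[OF tendsto_const[of "-C"] filterlim_ident] by simp
    from filterlim_compose[OF cdf_limits(2)[OF fin] this]
    show "((\<lambda>\<xi>. measure \<mu> {..\<xi> - C}) \<longlongrightarrow> C) at_top" by (simp add: C_def)
  qed (use HC in \<open>auto intro!: always_eventually\<close>)
qed (use p0 h0 q2 in auto)

end

section \<open>The explicit flow\<close>

lemma L2_lincomb:
  assumes "L2 f" "L2 k" shows "L2 (\<lambda>x. a * f x + b * k x)"
  unfolding L2_def
proof (intro conjI)
  show m: "(\<lambda>x. a * f x + b * k x) \<in> borel_measurable lborel" using assms by (auto simp: L2_def)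
  have i: "integrable lborel (\<lambda>x. (2 * a\<^sup>2) * (f x)\<^sup>2 + (2 * b\<^sup>2) * (k x)\<^sup>2)"
    using assms by (auto simp: L2_def intro!: Bochner_Integration.integrable_add integrable_mult_right)
  show "integrable lborel (\<lambda>x. (a * f x + b * k x)\<^sup>2)"
  proof (rule Bochner_Integration.integrable_bound[OF i])
    show "(\<lambda>x. (a * f x + b * k x)\<^sup>2) \<in> borel_measurable lborel" using m by simp
    have "(a * f x + b * k x)\<^sup>2 \<le> (2 * a\<^sup>2) * (f x)\<^sup>2 + (2 * b\<^sup>2) * (k x)\<^sup>2" for x
      using zero_le_power2[of "a * f x - b * k x"] by (simp add: power2_eq_square algebra_simps)
    then show "AE x in lborel. norm ((a * f x + b * k x)\<^sup>2) \<le> norm ((2 * a\<^sup>2) * (f x)\<^sup>2 + (2 * b\<^sup>2) * (k x)\<^sup>2)"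
      by (intro AE_I2) (simp add: order_trans[OF _ abs_ge_self])
  qed
qed

lemma L2_bounded_support:
  assumes m: "f \<in> borel_measurable borel" and b: "\<And>x. \<bar>x\<bar> \<le> r \<Longrightarrow> \<bar>f x\<bar> \<le> B" and s: "\<And>x. \<bar>x\<bar> > r \<Longrightarrow> f x = 0"
  shows "L2 f"
  unfolding L2_def
proof
  show "integrable lborel (\<lambda>x. (f x)\<^sup>2)"
  proof (rule integrableI_bounded_set[where A = "{-r..r}" and B = "B\<^sup>2"])
    have "\<bar>f x\<bar>\<^sup>2 \<le> B\<^sup>2" if "\<bar>x\<bar> \<le> r" for x using b[OF that] by (intro power_mono) auto
    then show "AE x in lborel. x \<in> {-r..r} \<longrightarrow> norm ((f x)\<^sup>2) \<le> B\<^sup>2" by (intro AE_I2) (auto simp: abs_le_iff)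
    show "AE x in lborel. x \<notin> {-r..r} \<longrightarrow> (f x)\<^sup>2 = 0"
    proof (intro AE_I2 impI)
      fix x assume "x \<notin> {-r..r}" then have "\<bar>x\<bar> > r" by auto
      then show "(f x)\<^sup>2 = 0" using s by simp
    qed
  qed (use m in \<open>auto simp: emeasure_lborel_Icc_eq\<close>)
qed (use m in simp)

lemma integrable_inverse_1_plus_sq: "integrable lborel (\<lambda>x::real. 1 / (1 + x\<^sup>2))"
  using integrable_inverse_1_plus_square by (simp add: set_integrable_def inverse_eq_divide)

text \<open>The first C is the total energy, the second the bound for the distance from y to the
  identity. The relation p + h = 1 says that \<xi> measures length plus energy at time zero.\<close>

locale hs_flow = I: lagrangian_snapshot y U0 "\<lambda>\<xi>. \<xi> - y \<xi>" p q h C C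
  for y U0 p q h C +
  fixes Bd :: real
  assumes ph: "\<And>\<xi>. p \<xi> + h \<xi> = 1" and U0_bd: "\<And>\<xi>. \<bar>U0 \<xi>\<bar> \<le> Bd"
    and mom2: "integrable lborel (\<lambda>\<xi>. h \<xi> * (y \<xi>)\<^sup>2)"
begin

definition H where "H \<xi> = \<xi> - y \<xi>"
definition X where "X t \<xi> = y \<xi> + t * U0 \<xi> + t\<^sup>2 / 8 * (2 * H \<xi> - C)"
definition U where "U t \<xi> = U0 \<xi> + t / 4 * (2 * H \<xi> - C)"
definition P where "P t \<xi> = p \<xi> + t * q \<xi> + t\<^sup>2 / 4 * h \<xi>"
definition Q where "Q t \<xi> = q \<xi> + t / 2 * h \<xi>"

lemma H_range: "0 \<le> H \<xi>" "H \<xi> \<le> C" "\<bar>2 * H \<xi> - C\<bar> \<le> C"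
  using I.H_nonneg[of \<xi>] I.H_le[of \<xi>] by (auto simp: H_def abs_le_iff)

lemma C0: "0 \<le> C" using I.C_nonneg .
lemma Bd0: "0 \<le> Bd" using U0_bd[of 0] by linarith

text \<open>As a quadratic in t, P has discriminant q^2 - p h = 0, so p times P is the square of p +
  t q / 2.\<close>

lemma P_nonneg: "0 \<le> P t \<xi>"
proof (cases "p \<xi> = 0")
  case True
  then have "q \<xi> = 0" using I.Q2[of \<xi>] by simp
  then show ?thesis using True I.h0[of \<xi>] by (simp add: P_def)
next
  case False
  then have pos: "p \<xi> > 0" using I.P0[of \<xi>] by simp
  have "p \<xi> * P t \<xi> = (p \<xi>)\<^sup>2 + t * p \<xi> * q \<xi> + t\<^sup>2 / 4 * (p \<xi> * h \<xi>)"
    by (simp add: P_def power2_eq_square algebra_simps)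
  also have "\<dots> = (p \<xi> + t / 2 * q \<xi>)\<^sup>2"
    unfolding I.Q2[symmetric] by (simp add: power2_eq_square field_simps)
  finally have "0 \<le> p \<xi> * P t \<xi>" by simp
  then show ?thesis using pos by (simp add: zero_le_mult_iff)
qed

lemma X_deriv: "((\<lambda>t. X t \<xi>) has_real_derivative U t \<xi>) (at t)"
  unfolding X_def U_def by (auto intro!: derivative_eq_intros)

text \<open>Each time slice has the structure of the initial one, with the same H and h. The
  distance bound collects the initial offset, the initial velocity and the acceleration, where |2 H
  - C| \<le> C.\<close>

sublocale S: lagrangian_snapshot "X t" "U t" H "P t" "Q t" h C "C + \<bar>t\<bar> * Bd + t\<^sup>2 / 8 * C" for t
proof
  have wH: "wderiv (\<lambda>\<xi>. 2 * H \<xi> - C) (\<lambda>\<xi>. 2 * h \<xi>)"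
    using wderiv_diff[OF wderiv_cmult[OF I.wH, of 2] wderiv_const[of C]] by (simp only: H_def diff_0_right)
  show "wderiv (X t) (P t)"
    using wderiv_add[OF wderiv_add[OF I.wX wderiv_cmult[OF I.wU]] wderiv_cmult[OF wH], of t "t\<^sup>2 / 8"]
    unfolding X_def[abs_def] P_def[abs_def] by (simp add: mult_ac)
  show "wderiv (U t) (Q t)"
    using wderiv_add[OF I.wU wderiv_cmult[OF wH], of "t / 4"]
    unfolding U_def[abs_def] Q_def[abs_def] by (simp add: mult_ac)
  show "wderiv H h" using I.wH unfolding H_def[abs_def] .
  show "0 \<le> P t \<xi>" for \<xi> by (rule P_nonneg)
  show "0 \<le> h \<xi>" for \<xi> by (rule I.h0)
  have "P t \<xi> * h \<xi> = p \<xi> * h \<xi> + t * q \<xi> * h \<xi> + t\<^sup>2 / 4 * (h \<xi>)\<^sup>2" for \<xi>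
    by (simp add: P_def power2_eq_square algebra_simps)
  then show "(Q t \<xi>)\<^sup>2 = P t \<xi> * h \<xi>" for \<xi>
    unfolding I.Q2[symmetric] by (simp add: Q_def power2_eq_square field_simps)
  show "\<bar>X t \<xi> - \<xi>\<bar> \<le> C + \<bar>t\<bar> * Bd + t\<^sup>2 / 8 * C" for \<xi>
  proof -
    have "\<bar>t * U0 \<xi>\<bar> \<le> \<bar>t\<bar> * Bd" using U0_bd[of \<xi>] by (simp add: abs_mult mult_left_mono)
    moreover have "\<bar>t\<^sup>2 / 8 * (2 * H \<xi> - C)\<bar> \<le> t\<^sup>2 / 8 * C"
      unfolding abs_mult using H_range(3)[of \<xi>] by (intro mult_mono) auto
    moreover have "\<bar>y \<xi> - \<xi>\<bar> \<le> C" by (rule I.X_near)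
    ultimately show ?thesis unfolding X_def by linarith
  qed
  show "(H \<longlongrightarrow> 0) at_bot" using I.H_bot unfolding H_def[abs_def] .
  show "(H \<longlongrightarrow> C) at_top" using I.H_top unfolding H_def[abs_def] .
qed

abbreviation "u \<equiv> \<lambda>t. S.eul_u t"
abbreviation "mu \<equiv> \<lambda>t. S.eul_mu t"

text \<open>A speed limit on [-T, T]: velocities start below Bd and the acceleration is at most C /
  4.\<close>

definition V where "V T = Bd + T * C / 4"

lemma V0: "0 \<le> T \<Longrightarrow> 0 \<le> V T" using Bd0 C0 by (simp add: V_def)

lemma U_bd: assumes "\<bar>t\<bar> \<le> T" shows "\<bar>U t \<xi>\<bar> \<le> V T"
proof -
  have "\<bar>t / 4 * (2 * H \<xi> - C)\<bar> \<le> T / 4 * C"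
    unfolding abs_mult using H_range(3)[of \<xi>] assms by (intro mult_mono) auto
  then show ?thesis using U0_bd[of \<xi>] unfolding U_def V_def by linarith
qed

lemma X_lipschitz: assumes "\<bar>t\<bar> \<le> T" "\<bar>s\<bar> \<le> T" shows "\<bar>X t \<xi> - X s \<xi>\<bar> \<le> V T * \<bar>t - s\<bar>"
proof -
  have "norm (X t \<xi> - X s \<xi>) \<le> V T * norm (t - s)"
  proof (rule field_differentiable_bound[of "{-T..T}" "\<lambda>t. X t \<xi>" "\<lambda>t. U t \<xi>"])
    show "((\<lambda>t. X t \<xi>) has_field_derivative U z \<xi>) (at z within {-T..T})" for z
      using X_deriv by (rule has_field_derivative_at_within)
    show "norm (U z \<xi>) \<le> V T" if "z \<in> {-T..T}" for z using U_bd[of z T \<xi>] that by auto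
  qed (use assms in auto)
  then show ?thesis by simp
qed

lemma u_X_diff: "u t (X t \<xi>) - u s (X s \<xi>) = (t - s) / 4 * (2 * H \<xi> - C)"
  unfolding S.u_X by (simp add: U_def field_simps)

lemma mu_UNIV_le: "measure (mu t) A \<le> C"
  using S.mu.finite_measure_mono[of A UNIV t] S.mu_UNIV[of t] by (cases "A \<in> sets borel") (auto simp: measure_notin_sets C0)

lemma u_energy: "(u t a - u t b)\<^sup>2 \<le> \<bar>a - b\<bar> * measure (mu t) {min a b..max a b}"
proof -
  have *: "(u t b - u t a)\<^sup>2 \<le> (b - a) * measure (mu t) {a..b}" if "a \<le> b" for a b
  proof -
    have "measure (mu t) {a<..<b} \<le> measure (mu t) {a..b}" by (rule S.mu.finite_measure_mono) auto
    then have "(b - a) * measure (mu t) {a<..<b} \<le> (b - a) * measure (mu t) {a..b}" using that by (intro mult_left_mono) auto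
    with ac_part_energy_le[OF S.wderiv_u S.fin_borel_mu S.ac_part_mu that, of t] show ?thesis by linarith
  qed
  show ?thesis using *[of a b] *[of b a] by (cases "a \<le> b") (auto simp: power2_commute min_def max_def)
qed

lemma u_cont: "continuous_on UNIV (u t)" by (rule wderiv_continuous[OF S.wderiv_u])

lemma u_meas[measurable]: "u t \<in> borel_measurable borel"
  by (rule borel_measurable_continuous_onI[OF u_cont])

lemma u_space: "\<bar>u t a - u t b\<bar> \<le> sqrt C * sqrt \<bar>a - b\<bar>"
proof -
  have "(u t a - u t b)\<^sup>2 \<le> \<bar>a - b\<bar> * measure (mu t) {min a b..max a b}" by (rule u_energy)
  also have "\<dots> \<le> \<bar>a - b\<bar> * C" by (intro mult_left_mono mu_UNIV_le) auto
  finally have "\<bar>u t a - u t b\<bar> \<le> sqrt (\<bar>a - b\<bar> * C)" using real_le_rsqrt by (simp add: real_le_rsqrt)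
  then show ?thesis by (simp add: real_sqrt_mult mult.commute)
qed

text \<open>From (s, z) follow the characteristic to time t, along which the velocity changes by at
  most C / 4 * |t - s|, then move in space at the fixed time t, where the energy yields a square
  root of the distance. The Lipschitz term in time is weakened to a square root at the price of sqrt
  T.\<close>

lemma u_holder:
  assumes T: "T > 0"
  shows "\<exists>\<alpha> C'. 0 < \<alpha> \<and> \<alpha> \<le> 1 \<and> (\<forall>t s x z. t \<in> {0..T} \<longrightarrow> s \<in> {0..T} \<longrightarrow>
           \<bar>u t x - u s z\<bar> \<le> C' * dist (t, x) (s, z) powr \<alpha>)"
proof (rule exI[of _ "1/2"], rule exI[of _ "sqrt C + sqrt C * sqrt (V T) + sqrt T * C / 4"], intro conjI allI impI)
  fix t s x z :: real assume ts: "t \<in> {0..T}" "s \<in> {0..T}"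
  define D where "D = dist (t, x) (s, z)"
  define \<xi> where "\<xi> = S.R s z"
  have z: "X s \<xi> = z" unfolding \<xi>_def by (rule S.X_R)
  have D: "\<bar>x - z\<bar> \<le> D" "\<bar>t - s\<bar> \<le> D"
    using dist_fst_le[of "(t,x)" "(s,z)"] dist_snd_le[of "(t,x)" "(s,z)"] by (auto simp: D_def dist_real_def)
  have 1: "\<bar>u t x - u t z\<bar> \<le> sqrt C * sqrt D"
    by (rule order_trans[OF u_space]) (use D C0 in \<open>intro mult_left_mono, auto\<close>)
  have "\<bar>z - X t \<xi>\<bar> \<le> V T * \<bar>t - s\<bar>" using X_lipschitz[of t T s \<xi>] ts by (auto simp: z abs_minus_commute)
  also have "\<dots> \<le> V T * D" using D V0 T by (intro mult_left_mono) auto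
  finally have "sqrt \<bar>z - X t \<xi>\<bar> \<le> sqrt (V T) * sqrt D" by (simp add: real_sqrt_mult[symmetric])
  then have 2: "\<bar>u t z - u t (X t \<xi>)\<bar> \<le> sqrt C * (sqrt (V T) * sqrt D)"
    by (intro order_trans[OF u_space] mult_left_mono) (auto simp: C0)
  have 3: "\<bar>u t (X t \<xi>) - u s z\<bar> \<le> sqrt T * C / 4 * sqrt D"
  proof -
    have "\<bar>u t (X t \<xi>) - u s z\<bar> = \<bar>t - s\<bar> / 4 * \<bar>2 * H \<xi> - C\<bar>"
    proof -
      have "u t (X t \<xi>) - u s z = (t - s) / 4 * (2 * H \<xi> - C)" using u_X_diff[of t \<xi> s] by (simp only: z)
      then show ?thesis by (simp only: abs_mult abs_divide abs_numeral)
    qed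
    also have "\<dots> \<le> \<bar>t - s\<bar> / 4 * C" using H_range(3)[of \<xi>] by (intro mult_left_mono) auto
    also have "\<bar>t - s\<bar> = sqrt \<bar>t - s\<bar> * sqrt \<bar>t - s\<bar>" by simp
    also have "sqrt \<bar>t - s\<bar> * sqrt \<bar>t - s\<bar> / 4 * C \<le> sqrt T * sqrt D / 4 * C"
      using ts D C0 by (intro mult_right_mono divide_right_mono mult_mono) auto
    finally show ?thesis by (simp add: mult_ac)
  qed
  have "\<bar>u t x - u s z\<bar> \<le> (sqrt C + sqrt C * sqrt (V T) + sqrt T * C / 4) * sqrt D"
  proof -
    have "\<bar>u t x - u s z\<bar> \<le> sqrt C * sqrt D + sqrt C * (sqrt (V T) * sqrt D) + sqrt T * C / 4 * sqrt D"
      using 1 2 3 by linarith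
    also have "\<dots> = (sqrt C + sqrt C * sqrt (V T) + sqrt T * C / 4) * sqrt D" by (simp add: algebra_simps)
    finally show ?thesis .
  qed
  then show "\<bar>u t x - u s z\<bar> \<le> (sqrt C + sqrt C * sqrt (V T) + sqrt T * C / 4) * dist (t, x) (s, z) powr (1 / 2)"
    by (simp add: D_def powr_half_sqrt)
qed auto

lemma X_joint_meas[measurable]:
  "(\<lambda>z. X (fst z) (snd z)) \<in> borel_measurable (borel \<Otimes>\<^sub>M borel)"
  "(\<lambda>z. U (fst z) (snd z)) \<in> borel_measurable (borel \<Otimes>\<^sub>M borel)"
  "(\<lambda>z. P (fst z) (snd z)) \<in> borel_measurable (borel \<Otimes>\<^sub>M borel)"
  "(\<lambda>z. Q (fst z) (snd z)) \<in> borel_measurable (borel \<Otimes>\<^sub>M borel)"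
proof -
  have [measurable]: "H \<in> borel_measurable borel" using S.meas by blast
  show "(\<lambda>z. X (fst z) (snd z)) \<in> borel_measurable (borel \<Otimes>\<^sub>M borel)"
  "(\<lambda>z. U (fst z) (snd z)) \<in> borel_measurable (borel \<Otimes>\<^sub>M borel)"
  "(\<lambda>z. P (fst z) (snd z)) \<in> borel_measurable (borel \<Otimes>\<^sub>M borel)"
  "(\<lambda>z. Q (fst z) (snd z)) \<in> borel_measurable (borel \<Otimes>\<^sub>M borel)"
    unfolding X_def U_def P_def Q_def by measurable
qed

text \<open>For a fixed label P vanishes at no more than one time: at t = -2 p / q if p > 0, at t =
  0 if p = 0. Fubini then exchanges the order of the two quantifiers.\<close>

lemma AE_P_nonzero: "AE t in lborel. AE \<xi> in lborel. P t \<xi> \<noteq> 0"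
proof (subst lborel_pair.AE_commute)
  show "{x \<in> space (lborel \<Otimes>\<^sub>M lborel). P (fst x) (snd x) \<noteq> 0} \<in> sets (lborel \<Otimes>\<^sub>M lborel)" by measurable
  have "AE t in lborel. P t \<xi> \<noteq> 0" for \<xi>
    \<comment> \<open>For q \<xi> = 0 the quotient is 0 by convention, an instant already
      excluded.\<close>
    using AE_lborel_singleton[of 0] AE_lborel_singleton[of "- 2 * p \<xi> / q \<xi>"]
  proof eventually_elim
    fix t :: real assume t: "t \<noteq> 0" "t \<noteq> - 2 * p \<xi> / q \<xi>"
    show "P t \<xi> \<noteq> 0"
    proof (cases "p \<xi> = 0")
      case True
      then have "q \<xi> = 0" "h \<xi> = 1" using I.Q2[of \<xi>] ph[of \<xi>] by auto
      then show ?thesis using t True by (simp add: P_def)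
    next
      case False
      have "p \<xi> * P t \<xi> = (p \<xi>)\<^sup>2 + t * p \<xi> * q \<xi> + t\<^sup>2 / 4 * (p \<xi> * h \<xi>)"
        by (simp add: P_def power2_eq_square algebra_simps)
      also have "\<dots> = (p \<xi> + t / 2 * q \<xi>)\<^sup>2"
        unfolding I.Q2[symmetric] by (simp add: power2_eq_square field_simps)
      finally have *: "p \<xi> * P t \<xi> = (p \<xi> + t / 2 * q \<xi>)\<^sup>2" .
      have "p \<xi> + t / 2 * q \<xi> \<noteq> 0" using t(2) False by (cases "q \<xi> = 0") (auto simp: field_simps)
      then show ?thesis using * by auto
    qed
  qed
  then show "AE \<xi> in lborel. AE t in lborel. P t \<xi> \<noteq> 0" by simp
qed

lemma AE_density:
  "\<exists>N. N \<in> null_sets lborel \<and> (\<forall>t\<ge>0. t \<notin> N \<longrightarrow> (\<exists>g. wderiv (u t) g \<and> has_density (mu t) (\<lambda>x. (g x)\<^sup>2)))"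
proof -
  obtain N where N: "N \<in> null_sets lborel" "{t \<in> space lborel. \<not> (AE \<xi> in lborel. P t \<xi> \<noteq> 0)} \<subseteq> N"
    using AE_P_nonzero unfolding eventually_ae_filter by blast
  show ?thesis
  proof (intro exI[of _ N] conjI allI impI N)
    fix t assume "t \<notin> N"
    then have "AE \<xi> in lborel. P t \<xi> \<noteq> 0" using N(2) by auto
    from S.has_density_mu[OF this] S.wderiv_u[of t]
    show "\<exists>g. wderiv (u t) g \<and> has_density (mu t) (\<lambda>x. (g x)\<^sup>2)" by blast
  qed
qed

text \<open>In Lagrangian variables the measure h d\<xi> is fixed and only the curves t -> X t \<xi>
  move, so dominated convergence with majorant B h applies.\<close>

lemma mu_weakly_continuous:
  fixes f :: "real \<Rightarrow> real"
  assumes f: "continuous_on UNIV f" "bounded (range f)"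
  shows "continuous_on A (\<lambda>t. \<integral>x. f x \<partial>(mu t))"
proof -
  have [measurable]: "f \<in> borel_measurable borel" using f(1) by (rule borel_measurable_continuous_onI)
  obtain B where B: "\<And>x. \<bar>f x\<bar> \<le> B" using f(2) by (auto simp: bounded_iff)
  have "continuous_on UNIV (\<lambda>t. \<integral>\<xi>. h \<xi> * f (X t \<xi>) \<partial>lborel)"
    unfolding continuous_on_sequentially comp_def
  proof (intro ballI allI impI)
    fix s :: "nat \<Rightarrow> real" and t assume s: "(\<forall>n. s n \<in> UNIV) \<and> s \<longlonglongrightarrow> t"
    show "(\<lambda>n. \<integral>\<xi>. h \<xi> * f (X (s n) \<xi>) \<partial>lborel) \<longlonglongrightarrow> (\<integral>\<xi>. h \<xi> * f (X t \<xi>) \<partial>lborel)"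
    proof (rule integral_dominated_convergence[where w = "\<lambda>\<xi>. h \<xi> * B"])
      show "integrable lborel (\<lambda>\<xi>. h \<xi> * B)" using S.integrable_h by simp
      have "(\<lambda>n. X (s n) \<xi>) \<longlonglongrightarrow> X t \<xi>" for \<xi>
        using s DERIV_isCont[OF X_deriv] isCont_tendsto_compose by blast
      then have "(\<lambda>n. f (X (s n) \<xi>)) \<longlonglongrightarrow> f (X t \<xi>)" for \<xi>
        using f(1) continuous_on_eq_continuous_at[of UNIV f] isCont_tendsto_compose by blast
      then show "AE \<xi> in lborel. (\<lambda>n. h \<xi> * f (X (s n) \<xi>)) \<longlonglongrightarrow> h \<xi> * f (X t \<xi>)"
        by (auto intro!: tendsto_intros)
      show "AE \<xi> in lborel. norm (h \<xi> * f (X (s n) \<xi>)) \<le> h \<xi> * B" for n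
        using B S.h0 by (auto simp: abs_mult intro!: mult_left_mono)
    qed auto
  qed
  from continuous_on_subset[OF this subset_UNIV] show ?thesis by (simp add: S.integral_mu)
qed

lemma moment:
  assumes g: "\<gamma> > 0" and m: "(\<integral>\<^sup>+\<xi>. ennreal (h \<xi>) * ennreal (\<bar>y \<xi>\<bar> powr \<gamma>) \<partial>lborel) < \<infinity>"
  shows "(\<integral>\<^sup>+x. ennreal (1 + \<bar>x\<bar> powr \<gamma>) \<partial>(mu t)) < \<infinity>"
proof -
  \<comment> \<open>The farthest that a point can travel up to time t; moments therefore grow only
    by a factor and a constant.\<close>
  define c where "c = V \<bar>t\<bar> * \<bar>t\<bar>"
  have c0: "0 \<le> c" using V0 by (simp add: c_def)
  have X: "\<bar>X t \<xi>\<bar> powr \<gamma> \<le> 2 powr \<gamma> * (\<bar>y \<xi>\<bar> powr \<gamma> + c powr \<gamma>)" for \<xi>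
  proof -
    have "X 0 \<xi> = y \<xi>" by (simp add: X_def)
    then have "\<bar>X t \<xi>\<bar> \<le> \<bar>y \<xi>\<bar> + c" using X_lipschitz[of t "\<bar>t\<bar>" 0 \<xi>] by (simp add: c_def)
    also have "\<dots> \<le> 2 * max \<bar>y \<xi>\<bar> c" by simp
    finally have "\<bar>X t \<xi>\<bar> powr \<gamma> \<le> (2 * max \<bar>y \<xi>\<bar> c) powr \<gamma>" using g by (intro powr_mono2) auto
    also have "\<dots> = 2 powr \<gamma> * (max \<bar>y \<xi>\<bar> c) powr \<gamma>" using c0 by (subst powr_mult) auto
    also have "\<dots> \<le> 2 powr \<gamma> * (\<bar>y \<xi>\<bar> powr \<gamma> + c powr \<gamma>)" by (intro mult_left_mono) (auto simp: max_def)
    finally show ?thesis .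
  qed
  have "(\<integral>\<^sup>+x. ennreal (1 + \<bar>x\<bar> powr \<gamma>) \<partial>(mu t)) = (\<integral>\<^sup>+\<xi>. ennreal (h \<xi>) * ennreal (1 + \<bar>X t \<xi>\<bar> powr \<gamma>) \<partial>lborel)"
    by (rule S.nn_integral_mu) simp
  also have "\<dots> \<le> (\<integral>\<^sup>+\<xi>. ennreal (1 + 2 powr \<gamma> * c powr \<gamma>) * ennreal (h \<xi>) + ennreal (2 powr \<gamma>) * (ennreal (h \<xi>) * ennreal (\<bar>y \<xi>\<bar> powr \<gamma>)) \<partial>lborel)"
  proof (rule nn_integral_mono)
    fix \<xi>
    have "h \<xi> * (1 + \<bar>X t \<xi>\<bar> powr \<gamma>) \<le> h \<xi> * (1 + 2 powr \<gamma> * (\<bar>y \<xi>\<bar> powr \<gamma> + c powr \<gamma>))"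
      using X S.h0 by (intro mult_left_mono) auto
    also have "\<dots> = (1 + 2 powr \<gamma> * c powr \<gamma>) * h \<xi> + 2 powr \<gamma> * (h \<xi> * \<bar>y \<xi>\<bar> powr \<gamma>)" by (simp add: algebra_simps)
    finally show "ennreal (h \<xi>) * ennreal (1 + \<bar>X t \<xi>\<bar> powr \<gamma>) \<le> ennreal (1 + 2 powr \<gamma> * c powr \<gamma>) * ennreal (h \<xi>) + ennreal (2 powr \<gamma>) * (ennreal (h \<xi>) * ennreal (\<bar>y \<xi>\<bar> powr \<gamma>))"
      using S.h0 by (simp add: ennreal_mult[symmetric] ennreal_plus[symmetric] del: ennreal_plus)
  qed
  also have "\<dots> = ennreal (1 + 2 powr \<gamma> * c powr \<gamma>) * (\<integral>\<^sup>+\<xi>. ennreal (h \<xi>) \<partial>lborel) + ennreal (2 powr \<gamma>) * (\<integral>\<^sup>+\<xi>. ennreal (h \<xi>) * ennreal (\<bar>y \<xi>\<bar> powr \<gamma>) \<partial>lborel)"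
    by (simp add: nn_integral_add nn_integral_cmult)
  also have "\<dots> < \<infinity>"
    using m S.integrable_h by (auto simp: ennreal_mult_less_top integrable_iff_bounded S.h0)
  finally show ?thesis .
qed

section \<open>Decay of the energy tails and the profile at infinity\<close>

definition M2 where "M2 T = (\<integral>\<xi>. h \<xi> * (1 + 2 * (V T * T)\<^sup>2) + 2 * (h \<xi> * (y \<xi>)\<^sup>2) \<partial>lborel)"

text \<open>Chebyshev's inequality: if X s \<xi> \<le> 0, all labels to the left sit still farther
  from 0, so (1 + (X s \<xi>)^2) H \<xi> is at most the integral of h (1 + X^2). That integral is at
  most \<open>M2 T\<close>, from X^2 \<le> 2 (X - y)^2 + 2 y^2 and a displacement of at most V T *
  T.\<close>

lemma tails:
  assumes T: "\<bar>s\<bar> \<le> T"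
  shows "X s \<xi> \<le> 0 \<Longrightarrow> H \<xi> \<le> M2 T / (1 + (X s \<xi>)\<^sup>2)"
    and "X s \<xi> \<ge> 0 \<Longrightarrow> C - H \<xi> \<le> M2 T / (1 + (X s \<xi>)\<^sup>2)"
    and "0 \<le> M2 T"
proof -
  have T0: "0 \<le> T" using T by linarith
  let ?F = "\<lambda>\<xi>. h \<xi> * (1 + 2 * (V T * T)\<^sup>2) + 2 * (h \<xi> * (y \<xi>)\<^sup>2)"
  have i: "integrable lborel ?F"
    using S.integrable_h mom2 by (intro Bochner_Integration.integrable_add integrable_mult_left integrable_mult_right) auto
  have F: "h \<zeta> * (1 + (X s \<zeta>)\<^sup>2) \<le> ?F \<zeta>" for \<zeta>
  proof -
    have "\<bar>X s \<zeta> - y \<zeta>\<bar> \<le> V T * \<bar>s\<bar>" using X_lipschitz[of s T 0 \<zeta>] T T0 by (simp add: X_def)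
    also have "\<dots> \<le> V T * T" using T V0[OF T0] by (intro mult_left_mono) auto
    finally have "(X s \<zeta> - y \<zeta>)\<^sup>2 \<le> (V T * T)\<^sup>2" by (metis abs_ge_zero power2_abs power_mono)
    moreover have "(X s \<zeta>)\<^sup>2 \<le> 2 * (X s \<zeta> - y \<zeta>)\<^sup>2 + 2 * (y \<zeta>)\<^sup>2"
      using zero_le_power2[of "X s \<zeta> - 2 * y \<zeta>"] by (simp add: power2_eq_square algebra_simps)
    ultimately have "1 + (X s \<zeta>)\<^sup>2 \<le> 1 + 2 * (V T * T)\<^sup>2 + 2 * (y \<zeta>)\<^sup>2" by linarith
    then have "h \<zeta> * (1 + (X s \<zeta>)\<^sup>2) \<le> h \<zeta> * (1 + 2 * (V T * T)\<^sup>2 + 2 * (y \<zeta>)\<^sup>2)" using S.h0 by (intro mult_left_mono)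
    also have "\<dots> = ?F \<zeta>" by (simp add: algebra_simps)
    finally show ?thesis .
  qed
  have F0: "0 \<le> ?F \<zeta>" for \<zeta> using S.h0 by simp
  then show M0: "0 \<le> M2 T" unfolding M2_def by (intro Bochner_Integration.integral_nonneg)
  have pos: "0 < 1 + (X s \<xi>)\<^sup>2" by (simp add: add_pos_nonneg)
  have key: "(1 + (X s \<xi>)\<^sup>2) * (\<integral>\<zeta>. indicator A \<zeta> * h \<zeta> \<partial>lborel) \<le> M2 T"
    if A: "A \<in> sets borel" and le: "\<And>\<zeta>. \<zeta> \<in> A \<Longrightarrow> (X s \<xi>)\<^sup>2 \<le> (X s \<zeta>)\<^sup>2" for A
  proof -
    have iA: "integrable lborel (\<lambda>\<zeta>. indicator A \<zeta> * h \<zeta>)"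
      using integrable_mult_indicator[of A lborel h] A S.integrable_h by simp
    have "(1 + (X s \<xi>)\<^sup>2) * (\<integral>\<zeta>. indicator A \<zeta> * h \<zeta> \<partial>lborel) = (\<integral>\<zeta>. (1 + (X s \<xi>)\<^sup>2) * (indicator A \<zeta> * h \<zeta>) \<partial>lborel)" by simp
    also have "\<dots> \<le> M2 T" unfolding M2_def
    proof (rule integral_mono[OF integrable_mult_right[OF iA] i])
      fix \<zeta>
      show "(1 + (X s \<xi>)\<^sup>2) * (indicator A \<zeta> * h \<zeta>) \<le> ?F \<zeta>"
      proof (cases "\<zeta> \<in> A")
        case True
        then have "(1 + (X s \<xi>)\<^sup>2) * h \<zeta> \<le> (1 + (X s \<zeta>)\<^sup>2) * h \<zeta>" using le S.h0 by (intro mult_right_mono) auto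
        then show ?thesis using True F[of \<zeta>] by (simp add: mult.commute)
      qed (use F0 in simp)
    qed
    finally show ?thesis .
  qed
  have H1: "(\<integral>\<zeta>. indicator {..\<xi>} \<zeta> * h \<zeta> \<partial>lborel) = H \<xi>"
  proof -
    have "ennreal (\<integral>\<zeta>. indicator {..\<xi>} \<zeta> * h \<zeta> \<partial>lborel) = (\<integral>\<^sup>+\<zeta>. ennreal (indicator {..\<xi>} \<zeta> * h \<zeta>) \<partial>lborel)"
      using integrable_mult_indicator[of "{..\<xi>}" lborel h] S.integrable_h S.h0
      by (intro nn_integral_eq_integral[symmetric]) auto
    also have "\<dots> = (\<integral>\<^sup>+\<zeta>. ennreal (h \<zeta>) * indicator {..\<xi>} \<zeta> \<partial>lborel)"
      by (intro nn_integral_cong) (auto simp: indicator_def)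
    also have "\<dots> = ennreal (H \<xi>)" using S.emeasure_h_Iic[of \<xi>] by (simp add: emeasure_density)
    finally show ?thesis using H_range S.h0 by (subst (asm) ennreal_inj) (auto intro!: Bochner_Integration.integral_nonneg)
  qed
  have H2: "(\<integral>\<zeta>. indicator {\<xi><..} \<zeta> * h \<zeta> \<partial>lborel) = C - H \<xi>"
  proof -
    have "(\<integral>\<zeta>. h \<zeta> \<partial>lborel) = (\<integral>\<zeta>. indicator {..\<xi>} \<zeta> * h \<zeta> + indicator {\<xi><..} \<zeta> * h \<zeta> \<partial>lborel)"
      by (intro Bochner_Integration.integral_cong) (auto simp: indicator_def)
    also have "\<dots> = H \<xi> + (\<integral>\<zeta>. indicator {\<xi><..} \<zeta> * h \<zeta> \<partial>lborel)"
      using integrable_mult_indicator[of "{..\<xi>}" lborel h] integrable_mult_indicator[of "{\<xi><..}" lborel h] S.integrable_h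
      by (subst Bochner_Integration.integral_add) (auto simp: H1)
    finally show ?thesis using S.integral_h by simp
  qed
  have sq: "a\<^sup>2 \<le> b\<^sup>2" if "\<bar>a\<bar> \<le> \<bar>b\<bar>" for a b :: real using that by (metis abs_ge_zero power2_abs power_mono)
  show "X s \<xi> \<le> 0 \<Longrightarrow> H \<xi> \<le> M2 T / (1 + (X s \<xi>)\<^sup>2)"
  proof -
    assume neg: "X s \<xi> \<le> 0"
    have "(1 + (X s \<xi>)\<^sup>2) * H \<xi> \<le> M2 T"
      unfolding H1[symmetric]
    proof (rule key)
      fix \<zeta> assume "\<zeta> \<in> {..\<xi>}"
      then have "X s \<zeta> \<le> X s \<xi>" using S.mono_X[of \<zeta> \<xi> s] by simp
      then show "(X s \<xi>)\<^sup>2 \<le> (X s \<zeta>)\<^sup>2" using neg by (intro sq) simp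
    qed simp
    then show ?thesis using pos by (simp add: pos_le_divide_eq mult.commute)
  qed
  show "X s \<xi> \<ge> 0 \<Longrightarrow> C - H \<xi> \<le> M2 T / (1 + (X s \<xi>)\<^sup>2)"
  proof -
    assume neg: "X s \<xi> \<ge> 0"
    have "(1 + (X s \<xi>)\<^sup>2) * (C - H \<xi>) \<le> M2 T"
      unfolding H2[symmetric]
    proof (rule key)
      fix \<zeta> assume "\<zeta> \<in> {\<xi><..}"
      then have "X s \<xi> \<le> X s \<zeta>" using S.mono_X[of \<xi> \<zeta> s] by simp
      then show "(X s \<xi>)\<^sup>2 \<le> (X s \<zeta>)\<^sup>2" using neg by (intro sq) simp
    qed simp
    then show ?thesis using pos by (simp add: pos_le_divide_eq mult.commute)
  qed
qed

end

lemma deriv_locally_constant: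
  assumes "\<forall>\<^sub>F z in nhds x. f z = (c::real)" shows "deriv f x = 0"
  using deriv_cong_ev[OF assms refl] by simp

locale hs_flow_psi = hs_flow +
  fixes \<psi>p \<psi>m :: "real \<Rightarrow> real"
  assumes psi_smooth: "smooth1 \<psi>p" "smooth1 \<psi>m"
    and psi_sum: "\<And>x. \<psi>p x + \<psi>m x = 1"
    and psi_range: "\<And>x. 0 \<le> \<psi>p x \<and> \<psi>p x \<le> 1"
    and psi_left: "\<And>x. x \<le> -1 \<Longrightarrow> \<psi>p x = 0" and psi_right: "\<And>x. x \<ge> 1 \<Longrightarrow> \<psi>m x = 0"
    and init_E2: "E2 \<psi>p \<psi>m (u 0)"
begin

lemma psi_meas[measurable]: "\<psi>p \<in> borel_measurable borel" "\<psi>m \<in> borel_measurable borel"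
  using psi_smooth smooth1_continuous borel_measurable_continuous_onI by blast+

lemma psi_C1: "wderiv \<psi>p (deriv \<psi>p)" "wderiv \<psi>m (deriv \<psi>m)"
  using psi_smooth by (auto intro!: C1_wderiv smooth1_DERIV smooth1_continuous smooth1_deriv)

lemma deriv_psi_support: assumes "\<bar>x\<bar> > 1" shows "deriv \<psi>p x = 0" "deriv \<psi>m x = 0"
proof -
  have "\<exists>c. (\<forall>\<^sub>F z in nhds x. \<psi>p z = c) \<and> (\<forall>\<^sub>F z in nhds x. \<psi>m z = 1 - c)"
  proof (cases "x > 1")
    case True
    have e: "\<forall>\<^sub>F z in nhds x. z \<in> {1<..}" using True by (intro eventually_nhds_in_open) auto
    have "\<psi>m z = 0" "\<psi>p z = 1" if "z \<in> {1<..}" for z using psi_right[of z] psi_sum[of z] that by auto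
    then show ?thesis by (intro exI[of _ 1] conjI) (rule eventually_mono[OF e], simp)+
  next
    case False
    then have e: "\<forall>\<^sub>F z in nhds x. z \<in> {..<-1}" using assms by (intro eventually_nhds_in_open) auto
    have "\<psi>p z = 0" "\<psi>m z = 1" if "z \<in> {..<-1}" for z using psi_left[of z] psi_sum[of z] that by auto
    then show ?thesis by (intro exI[of _ 0] conjI) (rule eventually_mono[OF e], simp)+
  qed
  then show "deriv \<psi>p x = 0" "deriv \<psi>m x = 0" using deriv_locally_constant by blast+
qed

lemma L2_deriv_psi: "L2 (deriv \<psi>p)" "L2 (deriv \<psi>m)"
proof -
  have "L2 f" if "continuous_on UNIV f" "\<And>x. \<bar>x\<bar> > 1 \<Longrightarrow> f x = 0" for f :: "real \<Rightarrow> real"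
  proof -
    have "bounded (f ` {-1..1})"
      by (meson compact_Icc compact_continuous_image compact_imp_bounded continuous_on_subset that(1) subset_UNIV)
    then obtain B where B: "\<And>x. x \<in> {-1..1} \<Longrightarrow> \<bar>f x\<bar> \<le> B" unfolding bounded_iff by force
    show ?thesis
    proof (rule L2_bounded_support[of _ 1 B])
      show "\<bar>f x\<bar> \<le> B" if "\<bar>x\<bar> \<le> 1" for x using B[of x] that by (simp add: abs_le_iff)
    qed (use that borel_measurable_continuous_onI in auto)
  qed
  then show "L2 (deriv \<psi>p)" "L2 (deriv \<psi>m)"
    using psi_smooth smooth1_continuous smooth1_deriv deriv_psi_support by blast+
qed

text \<open>2 M2 T serves the regions |x| \<ge> 1, where the defect is twice an energy tail; 4 C
  serves |x| < 1, where the defect is at most 2 C and 1 + x^2 at most 2.\<close>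

definition A where "A T = 2 * M2 T + 4 * C"

text \<open>\<psi>p - \<psi>m is a smooth sign function, so C (\<psi>p - \<psi>m) has the limits of
  2 H - C at both ends, and the difference is controlled by the tails.\<close>

lemma defect_bound:
  assumes T: "\<bar>s\<bar> \<le> T" and x: "X s \<xi> = x"
  shows "\<bar>2 * H \<xi> - C - C * (\<psi>p x - \<psi>m x)\<bar> \<le> A T / (1 + x\<^sup>2)"
proof -
  have pos: "0 < 1 + x\<^sup>2" by (simp add: add_pos_nonneg)
  have M0: "0 \<le> M2 T" by (rule tails(3)[OF T])
  have le: "2 * (M2 T / (1 + x\<^sup>2)) \<le> A T / (1 + x\<^sup>2)"
    using pos C0 by (simp add: A_def divide_right_mono)
  consider "x \<le> -1" | "x \<ge> 1" | "\<bar>x\<bar> < 1" by linarith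
  then show ?thesis
  proof cases
    case 1
    then have "\<psi>p x = 0" "\<psi>m x = 1" using psi_left psi_sum[of x] by auto
    then show ?thesis using tails(1)[OF T, of \<xi>] x 1 le H_range(1)[of \<xi>] by simp
  next
    case 2
    then have "\<psi>m x = 0" "\<psi>p x = 1" using psi_right psi_sum[of x] by auto
    then show ?thesis using tails(2)[OF T, of \<xi>] x 2 le H_range(2)[of \<xi>] by simp
  next
    case 3
    have "\<bar>\<psi>p x - \<psi>m x\<bar> \<le> 1" using psi_sum[of x] psi_range[of x] by (simp add: abs_le_iff)
    then have "\<bar>C * (\<psi>p x - \<psi>m x)\<bar> \<le> C" using C0 mult_left_mono[of "\<bar>\<psi>p x - \<psi>m x\<bar>" 1 C] by (simp add: abs_mult)
    then have "\<bar>2 * H \<xi> - C - C * (\<psi>p x - \<psi>m x)\<bar> \<le> 2 * C" using H_range(3)[of \<xi>] by linarith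
    also have "2 * C \<le> A T / (1 + x\<^sup>2)"
    proof -
      have "x\<^sup>2 \<le> 1" using 3 by (simp add: abs_square_le_1)
      then have "2 * C * (1 + x\<^sup>2) \<le> 2 * C * 2" using C0 by (intro mult_left_mono) auto
      also have "\<dots> \<le> A T" using M0 by (simp add: A_def)
      finally show ?thesis using pos by (simp add: pos_le_divide_eq)
    qed
    finally show ?thesis .
  qed
qed

text \<open>Open and closed half lines have different mass only at atoms, of which there are
  countably many.\<close>

lemma AE_mu_Iio: "AE x in lborel. measure (mu t) {..<x} = H (S.R t x)"
proof -
  have "countable {x. measure (mu t) {x} \<noteq> 0}" using S.mu.countable_support by simp
  then have "AE x in lborel. x \<notin> {x. measure (mu t) {x} \<noteq> 0}"
    by (intro AE_not_in countable_imp_null_set_lborel)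
  then show ?thesis
  proof eventually_elim
    fix x assume "x \<notin> {x. measure (mu t) {x} \<noteq> 0}"
    moreover have "{..x} = {..<x} \<union> {x}" by auto
    then have "measure (mu t) {..x} = measure (mu t) {..<x} + measure (mu t) {x}"
      using S.mu.finite_measure_Union[of "{..<x}" t "{x}"] by simp
    ultimately show "measure (mu t) {..<x} = H (S.R t x)" using S.mu_Iic[of t x] by simp
  qed
qed

text \<open>In the square of the majorant one factor 1 / (1 + x^2) is bounded by 1, and the other is
  integrable.\<close>

lemma L2_inverse_sq_bound:
  assumes m: "f \<in> borel_measurable borel" and b: "AE x in lborel. \<bar>f x\<bar> \<le> B / (1 + x\<^sup>2)"
  shows "L2 f"
  unfolding L2_def
proof
  show "integrable lborel (\<lambda>x. (f x)\<^sup>2)"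
  proof (rule Bochner_Integration.integrable_bound)
    show "integrable lborel (\<lambda>x. B\<^sup>2 * (1 / (1 + x\<^sup>2)))" by (intro integrable_mult_right integrable_inverse_1_plus_sq)
    show "AE x in lborel. norm ((f x)\<^sup>2) \<le> norm (B\<^sup>2 * (1 / (1 + x\<^sup>2)))"
      using b
    proof eventually_elim
      fix x assume b: "\<bar>f x\<bar> \<le> B / (1 + x\<^sup>2)"
      have pos: "1 \<le> 1 + x\<^sup>2" by simp
      have "\<bar>f x\<bar>\<^sup>2 \<le> (B / (1 + x\<^sup>2))\<^sup>2" using b by (intro power_mono) auto
      also have "\<dots> = B\<^sup>2 / (1 + x\<^sup>2) / (1 + x\<^sup>2)" by (simp add: power2_eq_square)
      also have "\<dots> \<le> B\<^sup>2 / (1 + x\<^sup>2) / 1" by (intro divide_left_mono) (auto simp: add_pos_nonneg)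
      finally show "norm ((f x)\<^sup>2) \<le> norm (B\<^sup>2 * (1 / (1 + x\<^sup>2)))" by (simp add: add_nonneg_nonneg)
    qed
  qed (use m in auto)
qed (use m in simp)

text \<open>Since \<psi>m = 1 - \<psi>p, subtracting C \<psi>p from the distribution function leaves
  half of the defect estimated in \<open>defect_bound\<close>.\<close>

lemma E1_0_mu: "E1_0 \<psi>p (\<lambda>x. measure (mu t) {..<x})"
  unfolding E1_0_def
proof (intro exI[of _ "\<lambda>x. measure (mu t) {..<x} - C * \<psi>p x"] exI[of _ C] conjI allI)
  have "mono (\<lambda>x. measure (mu t) {..<x})" by (intro monoI S.mu.finite_measure_mono) auto
  then have [measurable]: "(\<lambda>x. measure (mu t) {..<x}) \<in> borel_measurable borel" by (rule borel_measurable_mono)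
  show "L2 (\<lambda>x. measure (mu t) {..<x} - C * \<psi>p x)"
  proof (rule L2_inverse_sq_bound)
    show "AE x in lborel. \<bar>measure (mu t) {..<x} - C * \<psi>p x\<bar> \<le> A \<bar>t\<bar> / (1 + x\<^sup>2)"
      using AE_mu_Iio[of t]
    proof eventually_elim
      fix x assume e: "measure (mu t) {..<x} = H (S.R t x)"
      have "2 * H (S.R t x) - C - C * (\<psi>p x - \<psi>m x) = 2 * (H (S.R t x) - C * \<psi>p x)"
        using psi_sum[of x] by (simp add: algebra_simps) (metis distrib_left mult.right_neutral)
      then have "\<bar>H (S.R t x) - C * \<psi>p x\<bar> \<le> \<bar>2 * H (S.R t x) - C - C * (\<psi>p x - \<psi>m x)\<bar>" by simp
      also have "\<dots> \<le> A \<bar>t\<bar> / (1 + x\<^sup>2)" by (rule defect_bound) (auto simp: S.X_R)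
      finally show "\<bar>measure (mu t) {..<x} - C * \<psi>p x\<bar> \<le> A \<bar>t\<bar> / (1 + x\<^sup>2)" by (simp add: e)
    qed
  qed simp
qed simp

text \<open>The increment of u without the change of its limits: u accelerates by C / 4 at the right
  end and by -C / 4 at the left, which C / 4 (\<psi>p - \<psi>m) reproduces. The remainder is square
  integrable.\<close>

definition w where "w t s x = u t x - u s x - (t - s) * C / 4 * (\<psi>p x - \<psi>m x)"

lemma w_meas[measurable]: "w t s \<in> borel_measurable borel"
  unfolding w_def[abs_def] by measurable

text \<open>Fubini: a unit of energy at z is seen by exactly those centres x within distance d of z,
  a set of length 2 d.\<close>

lemma nn_integral_window:
  assumes d: "0 \<le> d"
  shows "(\<integral>\<^sup>+x. emeasure (mu t) {x - d..x + d} \<partial>lborel) = ennreal (2 * d * C)"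
proof -
  interpret pair_sigma_finite lborel "mu t" ..
  have "{z \<in> space (borel \<Otimes>\<^sub>M borel). fst z - d \<le> snd z \<and> snd z \<le> fst z + d} \<in> sets (borel \<Otimes>\<^sub>M borel)"
    by measurable
  then have [measurable]: "{z. fst z - d \<le> snd z \<and> snd z \<le> fst z + d} \<in> sets (borel \<Otimes>\<^sub>M borel)"
    by (simp add: space_pair_measure)
  have m: "(\<lambda>(x, z). indicator {x - d..x + d} z :: ennreal) \<in> borel_measurable (lborel \<Otimes>\<^sub>M mu t)"
  proof -
    have "(\<lambda>(x, z). indicator {x - d..x + d} z :: ennreal) = indicator {z. fst z - d \<le> snd z \<and> snd z \<le> fst z + d}"
      by (auto simp: indicator_def fun_eq_iff)
    moreover have "sets (lborel \<Otimes>\<^sub>M mu t) = sets (borel \<Otimes>\<^sub>M borel)" by (intro sets_pair_measure_cong) auto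
    ultimately show ?thesis by (simp add: borel_measurable_indicator)
  qed
  have "(\<integral>\<^sup>+x. emeasure (mu t) {x - d..x + d} \<partial>lborel) = (\<integral>\<^sup>+x. (\<integral>\<^sup>+z. indicator {x - d..x + d} z \<partial>mu t) \<partial>lborel)" by simp
  also have "\<dots> = (\<integral>\<^sup>+z. (\<integral>\<^sup>+x. indicator {x - d..x + d} z \<partial>lborel) \<partial>mu t)" using Fubini'[OF m] by simp
  also have "\<dots> = (\<integral>\<^sup>+z. ennreal (2 * d) \<partial>mu t)"
  proof (intro nn_integral_cong)
    fix z
    have "(\<integral>\<^sup>+x. indicator {x - d..x + d} z \<partial>lborel) = (\<integral>\<^sup>+x. indicator {z - d..z + d} x \<partial>lborel)"
      by (intro nn_integral_cong) (auto simp: indicator_def)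
    then show "(\<integral>\<^sup>+x. indicator {x - d..x + d} z \<partial>lborel) = ennreal (2 * d)" using d by simp
  qed
  also have "\<dots> = ennreal (2 * d * C)"
    using d C0 S.mu_UNIV[of t] by (simp add: S.mu.emeasure_eq_measure ennreal_mult)
  finally show ?thesis .
qed

text \<open>The part a compares u t at x and at the arrival point of the characteristic through (s,
  x); the part b is the defect of the acceleration. The energy near x bounds a^2 by d times the mass
  of a window, which integrates in x to order d^2. So the L2 norm of a is of order |t - s|, though a
  itself is only of order |t - s|^(1/2).\<close>

lemma w_pointwise:
  assumes ts: "\<bar>t\<bar> \<le> T" "\<bar>s\<bar> \<le> T"
  shows "(w t s x)\<^sup>2 \<le> 2 * (V T * \<bar>t - s\<bar>) * measure (mu t) {x - V T * \<bar>t - s\<bar>..x + V T * \<bar>t - s\<bar>}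
     + (t - s)\<^sup>2 / 8 * (A T)\<^sup>2 * (1 / (1 + x\<^sup>2))"
proof -
  define d where "d = V T * \<bar>t - s\<bar>"
  have T0: "0 \<le> T" using ts by linarith
  define \<xi> where "\<xi> = S.R s x"
  have x: "X s \<xi> = x" unfolding \<xi>_def by (rule S.X_R)
  define a where "a = u t x - u t (X t \<xi>)"
  define b where "b = (t - s) / 4 * (2 * H \<xi> - C - C * (\<psi>p x - \<psi>m x))"
  have "w t s x = a + b"
  proof -
    have "u t (X t \<xi>) = u s x + (t - s) / 4 * (2 * H \<xi> - C)" using u_X_diff[of t \<xi> s] unfolding x by linarith
    then show ?thesis unfolding w_def a_def b_def by (simp add: field_simps)
  qed
  then have 1: "(w t s x)\<^sup>2 \<le> 2 * a\<^sup>2 + 2 * b\<^sup>2"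
    using zero_le_power2[of "a - b"] by (simp add: power2_eq_square algebra_simps)
  have 2: "a\<^sup>2 \<le> d * measure (mu t) {x - d..x + d}"
  proof -
    have dx: "\<bar>x - X t \<xi>\<bar> \<le> d" using X_lipschitz[OF ts, of \<xi>] by (simp add: x d_def abs_minus_commute)
    have "a\<^sup>2 \<le> \<bar>x - X t \<xi>\<bar> * measure (mu t) {min x (X t \<xi>)..max x (X t \<xi>)}" unfolding a_def by (rule u_energy)
    also have "\<dots> \<le> d * measure (mu t) {x - d..x + d}"
      using dx by (intro mult_mono S.mu.finite_measure_mono) (auto simp: abs_le_iff)
    finally show ?thesis .
  qed
  have 3: "b\<^sup>2 \<le> (t - s)\<^sup>2 / 16 * ((A T)\<^sup>2 * (1 / (1 + x\<^sup>2)))"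
  proof -
    have pos: "1 \<le> 1 + x\<^sup>2" by simp
    have "b\<^sup>2 = (t - s)\<^sup>2 / 16 * (2 * H \<xi> - C - C * (\<psi>p x - \<psi>m x))\<^sup>2"
      unfolding b_def by (simp add: power_mult_distrib power_divide)
    also have "(2 * H \<xi> - C - C * (\<psi>p x - \<psi>m x))\<^sup>2 \<le> (A T / (1 + x\<^sup>2))\<^sup>2"
      using power_mono[OF defect_bound[OF ts(2) x], of 2] by simp
    also have "\<dots> = (A T)\<^sup>2 / (1 + x\<^sup>2) / (1 + x\<^sup>2)" by (simp add: power2_eq_square)
    also have "\<dots> \<le> (A T)\<^sup>2 / (1 + x\<^sup>2) / 1" by (intro divide_left_mono) (auto simp: add_pos_nonneg)
    finally show ?thesis by (simp add: mult_left_mono)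
  qed
  have "2 * (k / 16 * (l * m)) = k / 8 * l * m" for k l m :: real by simp
  from this[of "(t - s)\<^sup>2" "(A T)\<^sup>2" "1 / (1 + x\<^sup>2)"]
  have 4: "2 * ((t - s)\<^sup>2 / 16 * ((A T)\<^sup>2 * (1 / (1 + x\<^sup>2)))) = (t - s)\<^sup>2 / 8 * (A T)\<^sup>2 * (1 / (1 + x\<^sup>2))" .
  have 5: "2 * d * measure (mu t) {x - d..x + d} = 2 * (d * measure (mu t) {x - d..x + d})" by simp
  show ?thesis unfolding d_def[symmetric] using 1 2 3 4 5 by linarith
qed

text \<open>The first summand is 2 d * (2 d C) for d = V T * |t - s|, divided by (t - s)^2; the
  second is the integrated defect.\<close>

definition Lip where "Lip T = 4 * (V T)\<^sup>2 * C + (A T)\<^sup>2 / 8 * (\<integral>x. 1 / (1 + x\<^sup>2) \<partial>(lborel :: real measure))"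

lemma w_L2:
  assumes ts: "\<bar>t\<bar> \<le> T" "\<bar>s\<bar> \<le> T"
  shows "L2 (w t s)" "(\<integral>x. (w t s x)\<^sup>2 \<partial>lborel) \<le> Lip T * (t - s)\<^sup>2" "0 \<le> Lip T"
proof -
  have T0: "0 \<le> T" using ts by linarith
  define d where "d = V T * \<bar>t - s\<bar>"
  have d0: "0 \<le> d" using V0[OF T0] by (simp add: d_def)
  let ?I = "\<integral>x. 1 / (1 + x\<^sup>2) \<partial>(lborel :: real measure)"
  have I0: "0 \<le> ?I" by (intro Bochner_Integration.integral_nonneg) (simp add: add_nonneg_nonneg)
  show L0: "0 \<le> Lip T" unfolding Lip_def using I0 C0 by simp
  have c0: "0 \<le> (t - s)\<^sup>2 / 8 * (A T)\<^sup>2" by simp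
  have [measurable]: "(\<lambda>x. emeasure (mu t) {x - d..x + d}) \<in> borel_measurable borel"
  proof -
    have "(\<lambda>x. emeasure (mu t) (Pair x -` {z. fst z - d \<le> snd z \<and> snd z \<le> fst z + d})) \<in> borel_measurable borel"
    proof (rule S.mu.measurable_emeasure_Pair)
      have "{z \<in> space (borel \<Otimes>\<^sub>M borel). fst z - d \<le> snd z \<and> snd z \<le> fst z + d} \<in> sets (borel \<Otimes>\<^sub>M borel)"
        by measurable
      then have "{z. fst z - d \<le> snd z \<and> snd z \<le> fst z + d} \<in> sets (borel \<Otimes>\<^sub>M borel)"
        by (simp add: space_pair_measure)
      moreover have "sets (borel \<Otimes>\<^sub>M mu t) = sets (borel \<Otimes>\<^sub>M borel)" by (intro sets_pair_measure_cong) auto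
      ultimately show "{z. fst z - d \<le> snd z \<and> snd z \<le> fst z + d} \<in> sets (borel \<Otimes>\<^sub>M mu t)" by simp
    qed
    moreover have "Pair x -` {z. fst z - d \<le> snd z \<and> snd z \<le> fst z + d} = {x - d..x + d}" for x by auto
    ultimately show ?thesis by simp
  qed
  have combine: "ennreal (a * b + c * e) = ennreal a * ennreal b + ennreal c * ennreal e"
    if "0 \<le> a" "0 \<le> b" "0 \<le> c" "0 \<le> e" for a b c e
    using that by (simp add: ennreal_mult)
  have "(\<integral>\<^sup>+x. ennreal ((w t s x)\<^sup>2) \<partial>lborel) \<le>
     (\<integral>\<^sup>+x. ennreal (2 * d) * emeasure (mu t) {x - d..x + d} + ennreal ((t - s)\<^sup>2 / 8 * (A T)\<^sup>2) * ennreal (1 / (1 + x\<^sup>2)) \<partial>lborel)"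
  proof (rule nn_integral_mono)
    fix x :: real
    have i0: "0 \<le> 1 / (1 + x\<^sup>2)" by (simp add: add_nonneg_nonneg)
    have "ennreal ((w t s x)\<^sup>2) \<le> ennreal (2 * d * measure (mu t) {x - d..x + d} + (t - s)\<^sup>2 / 8 * (A T)\<^sup>2 * (1 / (1 + x\<^sup>2)))"
      using w_pointwise[OF ts, of x] unfolding d_def by (rule ennreal_leI)
    also have "\<dots> = ennreal (2 * d) * emeasure (mu t) {x - d..x + d} + ennreal ((t - s)\<^sup>2 / 8 * (A T)\<^sup>2) * ennreal (1 / (1 + x\<^sup>2))"
      unfolding S.mu.emeasure_eq_measure using d0 c0 i0
      by (intro combine) (auto simp: measure_nonneg)
    finally show "ennreal ((w t s x)\<^sup>2) \<le> ennreal (2 * d) * emeasure (mu t) {x - d..x + d} + ennreal ((t - s)\<^sup>2 / 8 * (A T)\<^sup>2) * ennreal (1 / (1 + x\<^sup>2))" .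
  qed
  also have "\<dots> = ennreal (2 * d) * ennreal (2 * d * C) + ennreal ((t - s)\<^sup>2 / 8 * (A T)\<^sup>2) * ennreal ?I"
  proof -
    have "(\<integral>\<^sup>+x. ennreal (2 * d) * emeasure (mu t) {x - d..x + d} + ennreal ((t - s)\<^sup>2 / 8 * (A T)\<^sup>2) * ennreal (1 / (1 + x\<^sup>2)) \<partial>lborel)
      = (\<integral>\<^sup>+x. ennreal (2 * d) * emeasure (mu t) {x - d..x + d} \<partial>lborel) + (\<integral>\<^sup>+(x::real). ennreal ((t - s)\<^sup>2 / 8 * (A T)\<^sup>2) * ennreal (1 / (1 + x\<^sup>2)) \<partial>lborel)"
      by (rule nn_integral_add) auto
    also have "\<dots> = ennreal (2 * d) * (\<integral>\<^sup>+x. emeasure (mu t) {x - d..x + d} \<partial>lborel) + ennreal ((t - s)\<^sup>2 / 8 * (A T)\<^sup>2) * (\<integral>\<^sup>+(x::real). ennreal (1 / (1 + x\<^sup>2)) \<partial>lborel)"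
      by (intro arg_cong2[where f = "(+)"] nn_integral_cmult) auto
    also have "(\<integral>\<^sup>+(x::real). ennreal (1 / (1 + x\<^sup>2)) \<partial>lborel) = ennreal ?I"
      by (rule nn_integral_eq_integral[OF integrable_inverse_1_plus_sq]) (simp add: add_nonneg_nonneg)
    finally show ?thesis unfolding nn_integral_window[OF d0, of t] .
  qed
  also have "\<dots> = ennreal (Lip T * (t - s)\<^sup>2)"
  proof -
    have "ennreal (2 * d) * ennreal (2 * d * C) + ennreal ((t - s)\<^sup>2 / 8 * (A T)\<^sup>2) * ennreal ?I
       = ennreal (2 * d * (2 * d * C) + (t - s)\<^sup>2 / 8 * (A T)\<^sup>2 * ?I)"
      using d0 c0 I0 C0 by (intro combine[symmetric]) auto
    also have "2 * d * (2 * d * C) + (t - s)\<^sup>2 / 8 * (A T)\<^sup>2 * ?I = Lip T * (t - s)\<^sup>2"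
    proof -
      have "2 * d * (2 * d * C) = 4 * d\<^sup>2 * C" by (simp add: power2_eq_square)
      also have "d\<^sup>2 = (V T)\<^sup>2 * (t - s)\<^sup>2" by (simp add: d_def power_mult_distrib)
      finally show ?thesis unfolding Lip_def by (simp add: algebra_simps)
    qed
    finally show ?thesis .
  qed
  finally have fin: "(\<integral>\<^sup>+x. ennreal ((w t s x)\<^sup>2) \<partial>lborel) \<le> ennreal (Lip T * (t - s)\<^sup>2)" .
  have i: "integrable lborel (\<lambda>x. (w t s x)\<^sup>2)"
    by (rule integrableI_nonneg) (use fin in \<open>auto simp: order_le_less_trans[OF _ ennreal_less_top]\<close>)
  then show "L2 (w t s)" by (simp add: L2_def)
  have "ennreal (\<integral>x. (w t s x)\<^sup>2 \<partial>lborel) \<le> ennreal (Lip T * (t - s)\<^sup>2)"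
    using fin i by (simp add: nn_integral_eq_integral)
  then show "(\<integral>x. (w t s x)\<^sup>2 \<partial>lborel) \<le> Lip T * (t - s)\<^sup>2" using L0 by (simp add: ennreal_le_iff)
qed

text \<open>C^2 / 8 is twice the square of C / 4, from the coefficients of \<psi>p and \<psi>m in
  the increment.\<close>

lemma u_lipschitz_E2_0:
  assumes ts: "\<bar>t\<bar> \<le> T" "\<bar>s\<bar> \<le> T"
  shows "E2_0_norm_le \<psi>p \<psi>m (\<lambda>x. u t x - u s x) (sqrt (Lip T + C\<^sup>2 / 8) * \<bar>t - s\<bar>)"
  unfolding E2_0_norm_le_def
proof (rule exI[of _ "w t s"], rule exI[of _ "(t - s) * C / 4"], rule exI[of _ "- (t - s) * C / 4"], intro conjI allI)
  show "L2 (w t s)" by (rule w_L2[OF ts])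
  show "u t x - u s x = w t s x + (t - s) * C / 4 * \<psi>p x + - (t - s) * C / 4 * \<psi>m x" for x
    by (simp add: w_def field_simps)
  have "(\<integral>x. (w t s x)\<^sup>2 \<partial>lborel) + ((t - s) * C / 4)\<^sup>2 + (- (t - s) * C / 4)\<^sup>2 \<le> (Lip T + C\<^sup>2 / 8) * (t - s)\<^sup>2"
  proof -
    have "((t - s) * C / 4)\<^sup>2 + (- (t - s) * C / 4)\<^sup>2 = C\<^sup>2 / 8 * (t - s)\<^sup>2"
      by (simp add: power2_eq_square field_simps)
    moreover have "(Lip T + C\<^sup>2 / 8) * (t - s)\<^sup>2 = Lip T * (t - s)\<^sup>2 + C\<^sup>2 / 8 * (t - s)\<^sup>2"
      by (rule distrib_right)
    ultimately show ?thesis using w_L2(2)[OF ts] by linarith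
  qed
  then have "sqrt ((\<integral>x. (w t s x)\<^sup>2 \<partial>lborel) + ((t - s) * C / 4)\<^sup>2 + (- (t - s) * C / 4)\<^sup>2) \<le> sqrt ((Lip T + C\<^sup>2 / 8) * (t - s)\<^sup>2)"
    by (rule real_sqrt_le_mono)
  also have "\<dots> = sqrt (Lip T + C\<^sup>2 / 8) * \<bar>t - s\<bar>" by (simp add: real_sqrt_mult)
  finally show "sqrt ((\<integral>x. (w t s x)\<^sup>2 \<partial>lborel) + ((t - s) * C / 4)\<^sup>2 + (- (t - s) * C / 4)\<^sup>2) \<le> sqrt (Lip T + C\<^sup>2 / 8) * \<bar>t - s\<bar>" .
qed

lemma L2_g: "L2 (S.eul_g t)"
  unfolding L2_def
proof
  have "(\<integral>\<^sup>+x. ennreal ((S.eul_g t x)\<^sup>2) \<partial>lborel) \<le> emeasure (mu t) UNIV"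
    using ac_part_nn_integral_le[OF S.ac_part_mu, of UNIV t] by simp
  also have "\<dots> < \<infinity>" by (simp add: S.mu.emeasure_eq_measure)
  finally show "integrable lborel (\<lambda>x. (S.eul_g t x)\<^sup>2)" by (intro integrableI_nonneg) auto
qed simp

text \<open>Membership is carried over from time 0: the increment since then is in L2 up to new
  coefficients of \<psi>p and \<psi>m, and the derivative is in L2 because the energy is
  finite.\<close>

lemma E2_u: "E2 \<psi>p \<psi>m (u t)"
proof -
  from init_E2 obtain fb a b where f: "H1 fb" "\<And>x. u 0 x = fb x + a * \<psi>p x + b * \<psi>m x" by (auto simp: E2_def)
  define a' where "a' = a + t * C / 4"
  define b' where "b' = b - t * C / 4"
  define f' where "f' x = fb x + w t 0 x" for x
  have u: "u t x = f' x + a' * \<psi>p x + b' * \<psi>m x" for x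
  proof -
    have "u t x = w t 0 x + u 0 x + t * C / 4 * (\<psi>p x - \<psi>m x)" by (simp add: w_def)
    then show ?thesis unfolding f'_def a'_def b'_def f(2) by (simp add: field_simps)
  qed
  have wL: "L2 (w t 0)" by (rule w_L2(1)[of t "\<bar>t\<bar>" 0]) auto
  have 1: "L2 f'" using L2_lincomb[of fb "w t 0" 1 1] f(1) wL unfolding f'_def[abs_def] by (simp add: H1_def)
  have "f' = (\<lambda>x. u t x - (a' * \<psi>p x + b' * \<psi>m x))" by (simp add: fun_eq_iff u)
  then have 2: "wderiv f' (\<lambda>x. S.eul_g t x - (a' * deriv \<psi>p x + b' * deriv \<psi>m x))"
    using wderiv_diff[OF S.wderiv_u[of t] wderiv_lincomb[OF psi_C1]] by simp
  have 3: "L2 (\<lambda>x. S.eul_g t x - (a' * deriv \<psi>p x + b' * deriv \<psi>m x))"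
    using L2_lincomb[OF L2_g L2_lincomb[OF L2_deriv_psi], of 1 t "-1" a' b']
    by (simp only: mult_1 mult_minus1 add_uminus_conv_diff)
  show ?thesis unfolding E2_def H1_def using 1 2 3 u by blast
qed

lemma inD_flow: "inD \<psi>p \<psi>m (u t) (mu t)"
  unfolding inD_def using E2_u E1_0_mu S.fin_borel_mu S.wderiv_u S.ac_part_mu by blast

end

section \<open>The flow solves the equation\<close>

lemma integrable_prod_bound:
  fixes f :: "real \<times> real \<Rightarrow> real"
  assumes m: "f \<in> borel_measurable (borel \<Otimes>\<^sub>M borel)" and a: "integrable lborel a" and b: "integrable lborel b"
    and le: "\<And>t x. \<bar>f (t, x)\<bar> \<le> a t * b x"
  shows "integrable (lborel \<Otimes>\<^sub>M lborel) f"
proof -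
  have m': "f \<in> borel_measurable (lborel \<Otimes>\<^sub>M lborel)" using m by simp
  have base: "integrable (lborel \<Otimes>\<^sub>M lborel) (\<lambda>p. a (fst p) * b (snd p))"
  proof (rule lborel_pair.Fubini_integrable)
    have [measurable]: "a \<in> borel_measurable borel" "b \<in> borel_measurable borel" using a b by auto
    show "(\<lambda>p. a (fst p) * b (snd p)) \<in> borel_measurable (lborel \<Otimes>\<^sub>M lborel)" by simp
    have "integrable lborel (\<lambda>t. \<bar>a t\<bar> * (\<integral>x. \<bar>b x\<bar> \<partial>lborel))" using a by simp
    then show "integrable lborel (\<lambda>t. LINT x|lborel. norm (a (fst (t, x)) * b (snd (t, x))))"
      by (simp add: abs_mult)
  qed (use b in auto)
  show ?thesis
    by (rule Bochner_Integration.integrable_bound[OF base m'])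
       (use le in \<open>auto intro!: AE_I2 order_trans[OF _ abs_ge_self]\<close>)
qed

text \<open>In Lagrangian variables both weak formulations integrate an exact time derivative of a
  quantity that vanishes for large t. Fubini and the fundamental theorem leave the initial
  value.\<close>

lemma integral_time_derivative:
  fixes \<Phi> \<Phi>' :: "real \<Rightarrow> real \<Rightarrow> real"
  assumes d: "\<And>t x. ((\<lambda>t. \<Phi> t x) has_real_derivative \<Phi>' t x) (at t)"
    and c: "\<And>x. continuous_on UNIV (\<lambda>t. \<Phi>' t x)"
    and m: "(\<lambda>p. \<Phi>' (fst p) (snd p)) \<in> borel_measurable (borel \<Otimes>\<^sub>M borel)"
    and D: "integrable lborel D" "\<And>t x. t \<in> {0..B} \<Longrightarrow> \<bar>\<Phi>' t x\<bar> \<le> D x"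
    and z: "\<And>t x. t \<ge> B \<Longrightarrow> \<Phi> t x = 0" "\<And>t x. t > B \<Longrightarrow> \<Phi>' t x = 0"
    and B: "0 \<le> B"
  shows "(LINT t:{0..}|lborel. \<integral>x. \<Phi>' t x \<partial>lborel) = - (\<integral>x. \<Phi> 0 x \<partial>lborel)"
proof -
  have [measurable]: "(\<lambda>p. \<Phi>' (fst p) (snd p)) \<in> borel_measurable (borel \<Otimes>\<^sub>M borel)" by (rule m)
  have "(\<lambda>p. \<Phi>' (fst p) (snd p) * indicator {0..B} (fst p)) \<in> borel_measurable (borel \<Otimes>\<^sub>M borel)" by measurable
  then have i: "integrable (lborel \<Otimes>\<^sub>M lborel) (\<lambda>p. \<Phi>' (fst p) (snd p) * indicator {0..B} (fst p))"
  proof (rule integrable_prod_bound[OF _ _ D(1)])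
    show "integrable lborel (indicator {0..B} :: real \<Rightarrow> real)"
      by (rule integrable_real_indicator) (auto simp: emeasure_lborel_Icc_eq)
  qed (auto simp: indicator_def D(2))
  have "(LINT t:{0..}|lborel. \<integral>x. \<Phi>' t x \<partial>lborel) = (\<integral>t. (\<integral>x. \<Phi>' t x * indicator {0..B} t \<partial>lborel) \<partial>lborel)"
    unfolding set_lebesgue_integral_def
  proof (intro Bochner_Integration.integral_cong refl)
    fix t show "indicator {0..} t *\<^sub>R (\<integral>x. \<Phi>' t x \<partial>lborel) = (\<integral>x. \<Phi>' t x * indicator {0..B} t \<partial>lborel)"
      using z(2)[of t] by (cases "t > B") (auto simp: indicator_def)
  qed
  also have "\<dots> = (\<integral>x. (\<integral>t. \<Phi>' t x * indicator {0..B} t \<partial>lborel) \<partial>lborel)"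
    using lborel_pair.Fubini_integral[of "\<lambda>t x. \<Phi>' t x * indicator {0..B} t"] i by (simp add: case_prod_unfold)
  also have "\<dots> = (\<integral>x. \<Phi> B x - \<Phi> 0 x \<partial>lborel)"
    by (intro Bochner_Integration.integral_cong refl integral_FTC_Icc_real B d)
       (use c in \<open>auto simp: continuous_on_eq_continuous_at\<close>)
  finally show ?thesis by (simp add: z(1))
qed

text \<open>Allows a total x-derivative to be added to the momentum balance without changing
  it.\<close>

lemma wderiv_integral_eq_0:
  assumes w: "wderiv f g" and z: "\<And>x. \<bar>x\<bar> > B \<Longrightarrow> f x = 0" "\<And>x. \<bar>x\<bar> > B \<Longrightarrow> g x = 0" and B: "B \<ge> 0"
  shows "integrable lborel g" "(\<integral>x. g x \<partial>lborel) = 0"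
proof -
  let ?a = "-B-1" and ?b = "B+1"
  have e: "indicator {?a..?b} x *\<^sub>R g x = g x" for x using z(2)[of x] by (cases "\<bar>x\<bar> > B") (auto simp: indicator_def)
  show "integrable lborel g" using wderiv_integrable[OF w, of ?a ?b] unfolding set_integrable_def e .
  have "?a \<le> ?b" using B by simp
  then have "f ?b - f ?a = (LBINT x:{?a..?b}. g x)" using w by (simp add: wderiv_def)
  also have "\<dots> = (\<integral>x. g x \<partial>lborel)" unfolding set_lebesgue_integral_def e ..
  finally show "(\<integral>x. g x \<partial>lborel) = 0" using z(1)[of ?a] z(1)[of ?b] B by simp
qed

context hs_flow_psi
begin

lemma continuous_X: "continuous_on UNIV (\<lambda>t. X t \<xi>)" and continuous_U: "continuous_on UNIV (\<lambda>t. U t \<xi>)"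
  unfolding X_def U_def by (auto intro!: continuous_intros)

lemma test_fun_along:
  assumes \<phi>: "test_fun \<phi>"
  shows "((\<lambda>t. \<phi> (t, X t \<xi>)) has_real_derivative pdt \<phi> (t, X t \<xi>) + pdx \<phi> (t, X t \<xi>) * U t \<xi>) (at t)"
proof (rule DERIV_along_curve[where S = UNIV and K = "\<lambda>s z. \<phi> (s, z)" and ?k2.0 = "\<lambda>s z. pdx \<phi> (s, z)" and x = "\<lambda>t. X t \<xi>"])
  have s: "smooth2 \<phi>" using \<phi> by (simp add: test_fun_def)
  show "((\<lambda>s. \<phi> (s, X t \<xi>)) has_real_derivative pdt \<phi> (t, X t \<xi>)) (at t)" by (rule smooth2_DERIV[OF s])
  show "((\<lambda>z. \<phi> (s, z)) has_real_derivative pdx \<phi> (s, z)) (at z)" for s z by (rule smooth2_DERIV[OF s])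
  show "continuous_on (UNIV \<times> UNIV) (\<lambda>(s, z). pdx \<phi> (s, z))" using smooth2_continuous(3)[OF s] by (simp add: case_prod_eta)
  show "((\<lambda>t. X t \<xi>) has_real_derivative U t \<xi>) (at t)" by (rule X_deriv)
qed simp

lemma comp_test_meas:
  fixes f :: "real \<times> real \<Rightarrow> real"
  assumes f: "continuous_on UNIV f"
  shows "(\<lambda>z. f (fst z, X (fst z) (snd z))) \<in> borel_measurable (borel \<Otimes>\<^sub>M borel)"
    "continuous_on UNIV (\<lambda>t. f (t, X t \<xi>))" "(\<lambda>x. f (t, x)) \<in> borel_measurable borel"
proof -
  have [measurable]: "f \<in> borel_measurable (borel \<Otimes>\<^sub>M borel)"
    using borel_measurable_continuous_onI[OF f] by (simp add: borel_prod)
  show "(\<lambda>z. f (fst z, X (fst z) (snd z))) \<in> borel_measurable (borel \<Otimes>\<^sub>M borel)" by measurable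
  show "(\<lambda>x. f (t, x)) \<in> borel_measurable borel" by measurable
  show "continuous_on UNIV (\<lambda>t. f (t, X t \<xi>))"
    by (intro continuous_on_compose2[OF f] continuous_intros continuous_X) auto
qed

text \<open>Because h does not depend on time, the tested energy balance is the time derivative of h
  \<xi> * \<phi> (t, X t \<xi>).\<close>

lemma weak_energy:
  assumes \<phi>: "test_fun \<phi>"
  shows "(LINT t:{0..}|lborel. \<integral>x. pdt \<phi> (t, x) + u t x * pdx \<phi> (t, x) \<partial>(mu t)) = - (\<integral>x. \<phi> (0, x) \<partial>(mu 0))"
proof -
  have s: "smooth2 \<phi>" using \<phi> by (simp add: test_fun_def)
  note cont = smooth2_continuous[OF s]
  obtain B where B: "B > 0" "\<And>t x. \<bar>t\<bar> > B \<or> \<bar>x\<bar> > B \<Longrightarrow> \<phi> (t,x) = 0 \<and> pdt \<phi> (t,x) = 0 \<and> pdx \<phi> (t,x) = 0"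
    "\<And>p. \<bar>\<phi> p\<bar> \<le> B" "\<And>p. \<bar>pdt \<phi> p\<bar> \<le> B" "\<And>p. \<bar>pdx \<phi> p\<bar> \<le> B" using test_fun_bounds[OF \<phi>] by metis
  note [measurable] = cont[THEN comp_test_meas(1)] cont[THEN comp_test_meas(3)]
  have [measurable]: "h \<in> borel_measurable borel" using S.meas by blast
  let ?F' = "\<lambda>t \<xi>. h \<xi> * (pdt \<phi> (t, X t \<xi>) + pdx \<phi> (t, X t \<xi>) * U t \<xi>)"
  have "(\<integral>x. pdt \<phi> (t, x) + u t x * pdx \<phi> (t, x) \<partial>(mu t)) = (\<integral>\<xi>. ?F' t \<xi> \<partial>lborel)" for t
    by (subst S.integral_mu) (auto simp: S.u_X mult.commute)
  then have "(LINT t:{0..}|lborel. \<integral>x. pdt \<phi> (t, x) + u t x * pdx \<phi> (t, x) \<partial>(mu t)) = (LINT t:{0..}|lborel. \<integral>\<xi>. ?F' t \<xi> \<partial>lborel)"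
    by simp
  also have "\<dots> = - (\<integral>\<xi>. h \<xi> * \<phi> (0, X 0 \<xi>) \<partial>lborel)"
  \<comment> \<open>B + 1 instead of B, as \<phi> is known to vanish only strictly beyond B.\<close>
  proof (rule integral_time_derivative[where \<Phi> = "\<lambda>t \<xi>. h \<xi> * \<phi> (t, X t \<xi>)" and B = "B + 1" and D = "\<lambda>\<xi>. h \<xi> * (B + B * V (B + 1))"])
    show "((\<lambda>t. h \<xi> * \<phi> (t, X t \<xi>)) has_real_derivative ?F' t \<xi>) (at t)" for t \<xi>
      by (rule DERIV_cmult[OF test_fun_along[OF \<phi>]])
    show "continuous_on UNIV (\<lambda>t. ?F' t \<xi>)" for \<xi>
      by (intro continuous_intros comp_test_meas(2) cont continuous_U)
    show "integrable lborel (\<lambda>\<xi>. h \<xi> * (B + B * V (B + 1)))" using S.integrable_h by simp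
    show "\<bar>?F' t \<xi>\<bar> \<le> h \<xi> * (B + B * V (B + 1))" if "t \<in> {0..B + 1}" for t \<xi>
    proof -
      have "\<bar>pdx \<phi> (t, X t \<xi>) * U t \<xi>\<bar> \<le> B * V (B + 1)"
        unfolding abs_mult using B U_bd[of t "B + 1" \<xi>] that by (intro mult_mono) auto
      then have "\<bar>pdt \<phi> (t, X t \<xi>) + pdx \<phi> (t, X t \<xi>) * U t \<xi>\<bar> \<le> B + B * V (B + 1)"
        using B(4)[of "(t, X t \<xi>)"] by linarith
      then show ?thesis unfolding abs_mult using S.h0[of \<xi>] by (simp add: mult_left_mono)
    qed
    show "t \<ge> B + 1 \<Longrightarrow> h \<xi> * \<phi> (t, X t \<xi>) = 0" for t \<xi> using B(1) B(2)[of t "X t \<xi>"] by simp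
    show "t > B + 1 \<Longrightarrow> ?F' t \<xi> = 0" for t \<xi> using B(1) B(2)[of t "X t \<xi>"] by simp
  qed (use B in \<open>simp_all, measurable\<close>)
  also have "(\<integral>\<xi>. h \<xi> * \<phi> (0, X 0 \<xi>) \<partial>lborel) = (\<integral>x. \<phi> (0, x) \<partial>(mu 0))"
    by (subst S.integral_mu) auto
  finally show ?thesis .
qed

lemma pq_bounds: "p \<xi> \<le> 1" "h \<xi> \<le> 1" "\<bar>q \<xi>\<bar> \<le> 1"
proof -
  show 1: "p \<xi> \<le> 1" "h \<xi> \<le> 1" using ph[of \<xi>] I.P0[of \<xi>] I.h0[of \<xi>] by auto
  have "(q \<xi>)\<^sup>2 \<le> 1 * 1" unfolding I.Q2 using 1 I.P0[of \<xi>] I.h0[of \<xi>] by (intro mult_mono) auto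
  then show "\<bar>q \<xi>\<bar> \<le> 1" by (simp add: abs_square_le_1)
qed

lemma P_bound: assumes "0 \<le> t" "t \<le> T" shows "\<bar>P t \<xi>\<bar> \<le> 1 + T + T\<^sup>2 / 4" "\<bar>Q t \<xi>\<bar> \<le> 1 + T"
proof -
  have 1: "\<bar>t * q \<xi>\<bar> \<le> T * 1" unfolding abs_mult using pq_bounds[of \<xi>] assms by (intro mult_mono) auto
  have 2: "t\<^sup>2 / 4 * h \<xi> \<le> T\<^sup>2 / 4 * 1"
    using pq_bounds[of \<xi>] assms I.h0[of \<xi>] by (intro mult_mono divide_right_mono power_mono) auto
  have 3: "t / 2 * h \<xi> \<le> T / 2 * 1" using pq_bounds[of \<xi>] assms I.h0[of \<xi>] by (intro mult_mono) auto
  have 4: "0 \<le> t / 2 * h \<xi>" using I.h0[of \<xi>] assms by simp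
  show "\<bar>P t \<xi>\<bar> \<le> 1 + T + T\<^sup>2 / 4" using 1 2 pq_bounds(1)[of \<xi>] P_nonneg[of t \<xi>] unfolding P_def by linarith
  show "\<bar>Q t \<xi>\<bar> \<le> 1 + T" using 3 4 pq_bounds(3)[of \<xi>] assms unfolding Q_def by linarith
qed

lemma mu_difference: "AE x in lborel. measure (mu t) {..<x} - measure (mu t) {x<..} = 2 * H (S.R t x) - C"
  using AE_mu_Iio[of t]
proof eventually_elim
  fix x assume e: "measure (mu t) {..<x} = H (S.R t x)"
  have "UNIV = {..x} \<union> {x<..}" "{..x} \<inter> {x<..} = {}" by auto
  then have "measure (mu t) UNIV = measure (mu t) {..x} + measure (mu t) {x<..}"
    using S.mu.finite_measure_Union[of "{..x}" t "{x<..}"] by (metis S.sets_mu(1) atMost_borel greaterThan_borel)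
  then show "measure (mu t) {..<x} - measure (mu t) {x<..} = 2 * H (S.R t x) - C"
    using e S.mu_Iic[of t x] S.mu_UNIV[of t] by simp
qed

text \<open>The equation contains u^2 / 2 times \<phi>_x, while transport along X needs u^2
  \<phi>_x. Adding half the x-derivative of u^2 \<phi>, whose integral is 0, supplies the other half
  together with u u_x \<phi>. With P u_x = Q the integrand becomes the time derivative of U \<phi>
  P.\<close>

lemma momentum_change_of_variables:
  assumes \<phi>: "test_fun \<phi>"
  shows "(\<integral>x. u t x * pdt \<phi> (t, x) + (u t x)\<^sup>2 / 2 * pdx \<phi> (t, x)
          + 1/4 * (measure (mu t) {..<x} - measure (mu t) {x<..}) * \<phi> (t, x) \<partial>lborel)
    = (\<integral>\<xi>. 1 / 4 * (2 * H \<xi> - C) * \<phi> (t, X t \<xi>) * P t \<xi>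
        + U t \<xi> * (pdt \<phi> (t, X t \<xi>) + pdx \<phi> (t, X t \<xi>) * U t \<xi>) * P t \<xi> + U t \<xi> * \<phi> (t, X t \<xi>) * Q t \<xi> \<partial>lborel)"
    (is "?L = (\<integral>\<xi>. ?R \<xi> \<partial>lborel)")
proof -
  have s: "smooth2 \<phi>" using \<phi> by (simp add: test_fun_def)
  note cont = smooth2_continuous[OF s]
  obtain B where B: "B > 0" "\<And>t x. \<bar>t\<bar> > B \<or> \<bar>x\<bar> > B \<Longrightarrow> \<phi> (t,x) = 0 \<and> pdt \<phi> (t,x) = 0 \<and> pdx \<phi> (t,x) = 0"
    "\<And>p. \<bar>\<phi> p\<bar> \<le> B" "\<And>p. \<bar>pdt \<phi> p\<bar> \<le> B" "\<And>p. \<bar>pdx \<phi> p\<bar> \<le> B" using test_fun_bounds[OF \<phi>] by metis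
  note [measurable] = cont[THEN comp_test_meas(3)]
  have [measurable]: "H \<in> borel_measurable borel" "P t \<in> borel_measurable borel" "U t \<in> borel_measurable borel"
     "Q t \<in> borel_measurable borel" "X t \<in> borel_measurable borel" using S.meas by blast+
  have mono: "mono (\<lambda>x. measure (mu t) {..<x})" by (intro monoI S.mu.finite_measure_mono) auto
  then have [measurable]: "(\<lambda>x. measure (mu t) {..<x}) \<in> borel_measurable borel" by (rule borel_measurable_mono)
  have "mono (\<lambda>x. - measure (mu t) {x<..})" by (intro monoI le_imp_neg_le S.mu.finite_measure_mono) auto
  then have "(\<lambda>x. - measure (mu t) {x<..}) \<in> borel_measurable borel" by (rule borel_measurable_mono)
  then have [measurable]: "(\<lambda>x. measure (mu t) {x<..}) \<in> borel_measurable borel" by simp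
  let ?g = "S.eul_g t"
  let ?f1 = "\<lambda>x. u t x * pdt \<phi> (t, x) + (u t x)\<^sup>2 / 2 * pdx \<phi> (t, x) + 1/4 * (2 * H (S.R t x) - C) * \<phi> (t, x)"
  let ?f2 = "\<lambda>x. u t x * ?g x * \<phi> (t, x) + (u t x)\<^sup>2 / 2 * pdx \<phi> (t, x)"
  have ub: "\<bar>u t x\<bar> \<le> V \<bar>t\<bar>" for x using U_bd[of t "\<bar>t\<bar>" "S.R t x"] by (simp add: S.eul_u_def)
  have V1: "0 \<le> V \<bar>t\<bar>" using ub[of 0] by linarith
  have L: "?L = (\<integral>x. ?f1 x \<partial>lborel)"
    by (rule integral_cong_AE) (use mu_difference[of t] in \<open>simp, simp, eventually_elim, simp\<close>)
  have i1: "integrable lborel ?f1"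
  proof (rule integrableI_bounded_set[where A = "{-B..B}" and B = "V \<bar>t\<bar> * B + (V \<bar>t\<bar>)\<^sup>2 / 2 * B + 1 / 4 * C * B"])
    show "AE x in lborel. x \<in> {-B..B} \<longrightarrow> norm (?f1 x) \<le> V \<bar>t\<bar> * B + (V \<bar>t\<bar>)\<^sup>2 / 2 * B + 1 / 4 * C * B"
    proof (intro AE_I2 impI)
      fix x
      have "\<bar>u t x * pdt \<phi> (t, x)\<bar> \<le> V \<bar>t\<bar> * B" unfolding abs_mult using ub B V1 by (intro mult_mono) auto
      moreover have "(u t x)\<^sup>2 \<le> (V \<bar>t\<bar>)\<^sup>2" using power_mono[OF ub[of x], of 2] by simp
      then have "\<bar>(u t x)\<^sup>2 / 2 * pdx \<phi> (t, x)\<bar> \<le> (V \<bar>t\<bar>)\<^sup>2 / 2 * B" unfolding abs_mult using B by (intro mult_mono) auto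
      moreover have "\<bar>1/4 * (2 * H (S.R t x) - C) * \<phi> (t, x)\<bar> \<le> 1 / 4 * C * B"
        unfolding abs_mult using H_range(3) B C0 by (intro mult_mono) auto
      ultimately show "norm (?f1 x) \<le> V \<bar>t\<bar> * B + (V \<bar>t\<bar>)\<^sup>2 / 2 * B + 1 / 4 * C * B" unfolding real_norm_def by linarith
    qed
    show "AE x in lborel. x \<notin> {-B..B} \<longrightarrow> ?f1 x = 0"
    proof (intro AE_I2 impI)
      fix x assume "x \<notin> {-B..B}" then have "\<bar>x\<bar> > B" by auto
      then show "?f1 x = 0" using B(2)[of t x] by simp
    qed
  qed (auto simp: emeasure_lborel_Icc_eq)
  have w: "wderiv (\<lambda>x. u t x * u t x * \<phi> (t, x)) (\<lambda>x. u t x * u t x * pdx \<phi> (t, x) + (u t x * ?g x + ?g x * u t x) * \<phi> (t, x))"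
  proof (rule wderiv_mult[OF wderiv_mult[OF S.wderiv_u S.wderiv_u]])
    show "wderiv (\<lambda>x. \<phi> (t, x)) (\<lambda>x. pdx \<phi> (t, x))"
    proof (rule C1_wderiv[OF smooth2_DERIV(2)[OF s]])
      show "continuous_on UNIV (\<lambda>x. pdx \<phi> (t, x))"
        by (intro continuous_on_compose2[OF cont(3)] continuous_intros) auto
    qed
  qed
  have e2: "u t x * u t x * pdx \<phi> (t, x) + (u t x * ?g x + ?g x * u t x) * \<phi> (t, x) = 2 * ?f2 x" for x
    by (simp add: power2_eq_square algebra_simps)
  have z: "\<phi> (t,x) = 0" "pdx \<phi> (t,x) = 0" if "\<bar>x\<bar> > B" for x using B(2)[of t x] that by auto
  have i2: "integrable lborel (\<lambda>x. 2 * ?f2 x)" "(\<integral>x. 2 * ?f2 x \<partial>lborel) = 0"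
    using wderiv_integral_eq_0[OF w, of B, unfolded e2] B(1) z by auto
  have double_0: "2 * a = 0 \<Longrightarrow> a = 0" for a :: real by simp
  have half: "1 / 2 * (2 * a) = a" for a :: real by simp
  have "integrable lborel (\<lambda>x. 1 / 2 * (2 * ?f2 x))" by (rule integrable_mult_right, rule i2(1))
  then have i2': "integrable lborel ?f2" by (simp only: half)
  have "2 * (\<integral>x. ?f2 x \<partial>lborel) = 0" using i2(2) by (simp only: integral_mult_right_zero)
  then have i2'': "(\<integral>x. ?f2 x \<partial>lborel) = 0" by (rule double_0)
  have "(\<integral>x. ?f1 x \<partial>lborel) = (\<integral>x. ?f1 x + ?f2 x \<partial>lborel)"
    by (simp only: Bochner_Integration.integral_add[OF i1 i2'] i2'' add_0_right)
  also have "\<dots> = (\<integral>\<xi>. P t \<xi> * (?f1 (X t \<xi>) + ?f2 (X t \<xi>)) \<partial>lborel)"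
    by (rule S.integral_X) measurable
  also have "\<dots> = (\<integral>\<xi>. ?R \<xi> \<partial>lborel)"
  proof (rule integral_cong_AE)
    \<comment> \<open>The factor P is kept attached to u_x and to H: only the products P u_x = Q and
      P H(R X) = P H are identities almost everywhere, including where P = 0.\<close>
    have alg: "P' * ((a * \<phi>t + a\<^sup>2 / 2 * \<phi>x + 1/4 * (2 * H' - C) * \<phi>') + (a * g' * \<phi>' + a\<^sup>2 / 2 * \<phi>x))
      = 1 / 4 * (2 * (P' * H') - C * P') * \<phi>' + a * (\<phi>t + \<phi>x * a) * P' + a * \<phi>' * (P' * g')" for P' a \<phi>t \<phi>x H' \<phi>' g' :: real
      by (simp add: power2_eq_square field_simps)
    show "AE \<xi> in lborel. P t \<xi> * (?f1 (X t \<xi>) + ?f2 (X t \<xi>)) = ?R \<xi>"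
      using S.g_X[of t] S.AE_R_X[of t]
    proof eventually_elim
      fix \<xi> assume g: "P t \<xi> * ?g (X t \<xi>) = Q t \<xi>"
        and R: "P t \<xi> > 0 \<longrightarrow> X t \<xi> \<notin> X t ` \<rat> \<and> S.R t (X t \<xi>) = \<xi>"
      have R': "P t \<xi> * H (S.R t (X t \<xi>)) = P t \<xi> * H \<xi>" using R P_nonneg[of t \<xi>] by (cases "P t \<xi> = 0") auto
      have "P t \<xi> * (?f1 (X t \<xi>) + ?f2 (X t \<xi>)) = 1 / 4 * (2 * (P t \<xi> * H (S.R t (X t \<xi>))) - C * P t \<xi>) * \<phi> (t, X t \<xi>)
        + U t \<xi> * (pdt \<phi> (t, X t \<xi>) + pdx \<phi> (t, X t \<xi>) * U t \<xi>) * P t \<xi> + U t \<xi> * \<phi> (t, X t \<xi>) * (P t \<xi> * ?g (X t \<xi>))"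
        unfolding S.u_X by (rule alg)
      also have "\<dots> = ?R \<xi>" unfolding g R' by (simp add: algebra_simps)
      finally show "P t \<xi> * (?f1 (X t \<xi>) + ?f2 (X t \<xi>)) = ?R \<xi>" .
    qed
  qed measurable
  finally show ?thesis unfolding L .
qed

lemma weak_momentum:
  assumes \<phi>: "test_fun \<phi>"
  shows "(LINT t:{0..}|lborel. LINT x|lborel. u t x * pdt \<phi> (t, x) + (u t x)\<^sup>2 / 2 * pdx \<phi> (t, x)
          + 1/4 * (measure (mu t) {..<x} - measure (mu t) {x<..}) * \<phi> (t, x)) = - (LINT x|lborel. u 0 x * \<phi> (0, x))"
proof -
  have s: "smooth2 \<phi>" using \<phi> by (simp add: test_fun_def)
  note cont = smooth2_continuous[OF s]
  obtain B where B: "B > 0" "\<And>t x. \<bar>t\<bar> > B \<or> \<bar>x\<bar> > B \<Longrightarrow> \<phi> (t,x) = 0 \<and> pdt \<phi> (t,x) = 0 \<and> pdx \<phi> (t,x) = 0"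
    "\<And>p. \<bar>\<phi> p\<bar> \<le> B" "\<And>p. \<bar>pdt \<phi> p\<bar> \<le> B" "\<And>p. \<bar>pdx \<phi> p\<bar> \<le> B" using test_fun_bounds[OF \<phi>] by metis
  note [measurable] = cont[THEN comp_test_meas(1)] cont[THEN comp_test_meas(3)]
  have [measurable]: "H \<in> borel_measurable borel" using S.meas by blast
  let ?F = "\<lambda>t \<xi>. U t \<xi> * \<phi> (t, X t \<xi>) * P t \<xi>"
  let ?F' = "\<lambda>t \<xi>. 1 / 4 * (2 * H \<xi> - C) * \<phi> (t, X t \<xi>) * P t \<xi>
        + U t \<xi> * (pdt \<phi> (t, X t \<xi>) + pdx \<phi> (t, X t \<xi>) * U t \<xi>) * P t \<xi> + U t \<xi> * \<phi> (t, X t \<xi>) * Q t \<xi>"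
  define T where "T = B + 1"
  have T: "0 \<le> T" using B by (simp add: T_def)
  \<comment> \<open>For t \<le> T a label with |X t \<xi>| \<le> B lies in [-r, r], the bracket
    being the largest distance between X t \<xi> and \<xi>.\<close>
  define r where "r = B + (C + T * Bd + T\<^sup>2 / 8 * C)"
  define PB where "PB = 1 + T + T\<^sup>2 / 4"
  \<comment> \<open>One summand for each of the three terms of \<open>?F'\<close>.\<close>
  define K where "K = 1 / 4 * C * B * PB + V T * (B + B * V T) * PB + V T * B * (1 + T)"
  have VT: "0 \<le> V T" by (rule V0[OF T])
  have K0: "0 \<le> K" unfolding K_def PB_def using B T VT C0 by (intro add_nonneg_nonneg mult_nonneg_nonneg) auto
  have "(LINT t:{0..}|lborel. \<integral>\<xi>. ?F' t \<xi> \<partial>lborel) = - (\<integral>\<xi>. ?F 0 \<xi> \<partial>lborel)"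
  proof (rule integral_time_derivative[where B = T and D = "\<lambda>\<xi>. K * indicator {-r..r} \<xi>"])
    show "((\<lambda>t. ?F t \<xi>) has_real_derivative ?F' t \<xi>) (at t)" for t \<xi>
    proof -
      have dU: "((\<lambda>t. U t \<xi>) has_real_derivative 1 / 4 * (2 * H \<xi> - C)) (at t)"
        unfolding U_def by (auto intro!: derivative_eq_intros)
      have dP: "((\<lambda>t. P t \<xi>) has_real_derivative Q t \<xi>) (at t)"
        unfolding P_def Q_def by (auto intro!: derivative_eq_intros)
      from DERIV_mult[OF DERIV_mult[OF dU test_fun_along[OF \<phi>]] dP]
      show ?thesis by (simp add: algebra_simps)
    qed
    have "continuous_on UNIV (\<lambda>t. P t \<xi>)" "continuous_on UNIV (\<lambda>t. Q t \<xi>)" for \<xi>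
      unfolding P_def Q_def by (auto intro!: continuous_intros)
    then show "continuous_on UNIV (\<lambda>t. ?F' t \<xi>)" for \<xi>
      by (intro continuous_intros comp_test_meas(2) cont continuous_U)
    show "integrable lborel (\<lambda>\<xi>. K * indicator {-r..r} \<xi>)"
      by (intro integrable_mult_right integrable_real_indicator) (auto simp: emeasure_lborel_Icc_eq)
    show "\<bar>?F' t \<xi>\<bar> \<le> K * indicator {-r..r} \<xi>" if t: "t \<in> {0..T}" for t \<xi>
    proof (cases "\<bar>X t \<xi>\<bar> > B")
      case True
      then show ?thesis using B(2)[of t "X t \<xi>"] K0 by simp
    next
      case False
      have "\<bar>X t \<xi> - \<xi>\<bar> \<le> C + \<bar>t\<bar> * Bd + t\<^sup>2 / 8 * C" by (rule S.X_near)
      also have "\<dots> \<le> C + T * Bd + T\<^sup>2 / 8 * C"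
        using t Bd0 C0 by (intro add_mono mult_right_mono divide_right_mono power_mono) auto
      finally have "\<xi> \<in> {-r..r}" using False unfolding r_def by auto
      have U1: "\<bar>U t \<xi>\<bar> \<le> V T" using U_bd[of t T \<xi>] t by simp
      have P1: "\<bar>P t \<xi>\<bar> \<le> PB" "\<bar>Q t \<xi>\<bar> \<le> 1 + T" using P_bound[of t T \<xi>] t by (auto simp: PB_def)
      have "\<bar>1 / 4 * (2 * H \<xi> - C) * \<phi> (t, X t \<xi>) * P t \<xi>\<bar> \<le> 1 / 4 * C * B * PB"
        unfolding abs_mult using H_range(3)[of \<xi>] B P1 C0 by (intro mult_mono) auto
      moreover have "\<bar>pdx \<phi> (t, X t \<xi>) * U t \<xi>\<bar> \<le> B * V T"
        unfolding abs_mult using B U1 by (intro mult_mono) auto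
      then have "\<bar>pdt \<phi> (t, X t \<xi>) + pdx \<phi> (t, X t \<xi>) * U t \<xi>\<bar> \<le> B + B * V T"
        using B(4)[of "(t, X t \<xi>)"] by linarith
      then have "\<bar>U t \<xi> * (pdt \<phi> (t, X t \<xi>) + pdx \<phi> (t, X t \<xi>) * U t \<xi>) * P t \<xi>\<bar> \<le> V T * (B + B * V T) * PB"
        unfolding abs_mult[of "_ * _" "P t \<xi>"] abs_mult[of "U t \<xi>" "_ + _"] using U1 P1 VT B
        by (intro mult_mono) auto
      moreover have "\<bar>U t \<xi> * \<phi> (t, X t \<xi>) * Q t \<xi>\<bar> \<le> V T * B * (1 + T)"
        unfolding abs_mult using U1 P1 B VT by (intro mult_mono) auto
      ultimately have "\<bar>?F' t \<xi>\<bar> \<le> K" unfolding K_def by linarith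
      then show ?thesis using \<open>\<xi> \<in> {-r..r}\<close> by simp
    qed
    show "t \<ge> T \<Longrightarrow> ?F t \<xi> = 0" for t \<xi> using B(1) B(2)[of t "X t \<xi>"] by (simp add: T_def)
    show "t > T \<Longrightarrow> ?F' t \<xi> = 0" for t \<xi> using B(1) B(2)[of t "X t \<xi>"] by (simp add: T_def)
    show "(\<lambda>p. ?F' (fst p) (snd p)) \<in> borel_measurable (borel \<Otimes>\<^sub>M borel)" by measurable
  qed (rule T)
  moreover have "(\<integral>\<xi>. ?F 0 \<xi> \<partial>lborel) = (\<integral>x. u 0 x * \<phi> (0, x) \<partial>lborel)"
    by (subst (2) S.integral_X[of _ 0]) (auto simp: S.u_X mult_ac)
  ultimately show ?thesis unfolding momentum_change_of_variables[OF \<phi>] by simp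
qed

theorem flow_is_weak_solution: "weak_cons_sol \<psi>p \<psi>m u mu"
  unfolding weak_cons_sol_def
proof (intro conjI)
  show "\<forall>T>0. (\<exists>\<alpha> C. 0 < \<alpha> \<and> \<alpha> \<le> 1 \<and> (\<forall>t s x y. t \<in> {0..T} \<longrightarrow> s \<in> {0..T} \<longrightarrow>
                 \<bar>u t x - u s y\<bar> \<le> C * dist (t, x) (s, y) powr \<alpha>))
          \<and> (\<exists>L. \<forall>t s. t \<in> {0..T} \<longrightarrow> s \<in> {0..T} \<longrightarrow>
                 E2_0_norm_le \<psi>p \<psi>m (\<lambda>x. u t x - u s x) (L * \<bar>t - s\<bar>))"
  proof (intro allI impI conjI)
    fix T :: real assume "T > 0"
    then show "\<exists>\<alpha> C. 0 < \<alpha> \<and> \<alpha> \<le> 1 \<and> (\<forall>t s x y. t \<in> {0..T} \<longrightarrow> s \<in> {0..T} \<longrightarrow>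
                 \<bar>u t x - u s y\<bar> \<le> C * dist (t, x) (s, y) powr \<alpha>)" by (rule u_holder)
    show "\<exists>L. \<forall>t s. t \<in> {0..T} \<longrightarrow> s \<in> {0..T} \<longrightarrow> E2_0_norm_le \<psi>p \<psi>m (\<lambda>x. u t x - u s x) (L * \<bar>t - s\<bar>)"
      by (intro exI[of _ "sqrt (Lip T + C\<^sup>2 / 8)"] allI impI u_lipschitz_E2_0) auto
  qed
  show "\<forall>t\<ge>0. fin_borel (mu t) \<and> E1_0 \<psi>p (\<lambda>x. measure (mu t) {..<x}) \<and> (\<exists>g. wderiv (u t) g \<and> ac_part (mu t) (\<lambda>x. (g x)\<^sup>2))"
    using inD_flow by (auto simp: inD_def)
qed (use E2_u weak_momentum weak_energy AE_density mu_weakly_continuous in auto)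

end

section \<open>Mollified test functions\<close>

lemma wderiv_FTC: "wderiv f g \<Longrightarrow> a \<le> b \<Longrightarrow> f b - f a = (LBINT x:{a..b}. g x)"
  by (simp add: wderiv_def)

text \<open>The values of S at both ends encode that \<beta> has integral 1.\<close>

locale bump =
  fixes \<beta> S :: "real \<Rightarrow> real"
  assumes smooth_\<beta>: "smooth1 \<beta>" and \<beta>_nonneg: "\<And>x. 0 \<le> \<beta> x" and \<beta>_support: "\<And>x. \<bar>x\<bar> \<ge> 1 \<Longrightarrow> \<beta> x = 0"
    and S_deriv: "\<And>x. (S has_real_derivative \<beta> x) (at x)"
    and S_left: "\<And>x. x \<le> -1 \<Longrightarrow> S x = 0" and S_right: "\<And>x. x \<ge> 1 \<Longrightarrow> S x = 1"

text \<open>The product \<psi>p * \<psi>m is smooth, nonnegative and zero outside (-1, 1), so it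
  only has to be normalized. It is not identically zero because \<psi>p takes the value 1/2
  somewhere.\<close>

lemma ex_bump:
  assumes sm: "smooth1 \<psi>p" "smooth1 \<psi>m" and sum: "\<And>x. \<psi>p x + \<psi>m x = 1"
    and range: "\<And>x. 0 \<le> \<psi>p x \<and> \<psi>p x \<le> 1"
    and left: "\<And>x. x \<le> -1 \<Longrightarrow> \<psi>p x = 0" and right: "\<And>x. x \<ge> 1 \<Longrightarrow> \<psi>m x = 0"
  shows "\<exists>\<beta> S. bump \<beta> S"
proof -
  define b where "b x = \<psi>p x * \<psi>m x" for x
  have smb: "smooth1 b" unfolding b_def[abs_def] by (rule smooth1_mult[OF sm])
  have cb: "continuous_on A b" for A by (rule smooth1_continuous[OF smb])
  have mr: "0 \<le> \<psi>m x" "\<psi>m x \<le> 1" for x using sum[of x] range[of x] by auto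
  have b0: "0 \<le> b x" for x using range mr by (simp add: b_def)
  have bz: "b x = 0" if "\<bar>x\<bar> \<ge> 1" for x
    using left[of x] right[of x] that by (cases "x \<ge> 1") (auto simp: b_def abs_if split: if_splits)
  define B where "B x = integral {-1..x} b" for x
  have dB: "(B has_real_derivative b x) (at x)" for x
  proof -
    \<comment> \<open>A base point left of both x and -1 makes x an interior point of the interval
      of integration; since b vanishes up to -1, moving the base does not change the
      integral.\<close>
    define a where "a = min x (-1) - 1"
    have ieq: "integral {a..z} b = B z" if "z > a" for z
    proof (cases "z \<ge> -1")
      case True
      have "integral {a..-1} b + integral {-1..z} b = integral {a..z} b"
        using True by (intro Henstock_Kurzweil_Integration.integral_combine integrable_continuous_real cb) (auto simp: a_def)
      moreover have "integral {a..-1} b = 0"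
        using Henstock_Kurzweil_Integration.integral_cong[of "{a..-1}" b "\<lambda>_. 0"] bz by simp
      ultimately show ?thesis by (simp add: B_def)
    next
      case False
      then show ?thesis
        using Henstock_Kurzweil_Integration.integral_cong[of "{a..z}" b "\<lambda>_. 0"] bz by (simp add: B_def)
    qed
    have "((\<lambda>z. integral {a..z} b) has_real_derivative b x) (at x within {a..x + 1})"
      by (rule integral_has_real_derivative[OF cb]) (auto simp: a_def)
    then have "((\<lambda>z. integral {a..z} b) has_real_derivative b x) (at x)"
      by (subst (asm) at_within_interior) (auto simp: a_def)
    moreover have "x \<in> {a<..}" by (simp add: a_def)
    ultimately show ?thesis
      by (rule has_field_derivative_transform_within_open[OF _ open_greaterThan]) (use ieq in auto)
  qed
  have monoB: "B x \<le> B z" if "x \<le> z" for x z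
    by (rule DERIV_nonneg_imp_nondecreasing[OF that]) (use dB b0 in blast)
  have Bl: "B x = 0" if "x \<le> -1" for x
  proof (cases "x = -1")
    case False then show ?thesis using that by (simp add: B_def)
  qed (simp add: B_def)
  have Br: "B x = B 1" if "x \<ge> 1" for x
  proof -
    have "integral {-1..1} b + integral {1..x} b = integral {-1..x} b"
      using that by (intro Henstock_Kurzweil_Integration.integral_combine integrable_continuous_real cb) auto
    moreover have "integral {1..x} b = 0"
      using Henstock_Kurzweil_Integration.integral_cong[of "{1..x}" b "\<lambda>_. 0"] bz by simp
    ultimately show ?thesis by (simp add: B_def)
  qed
  have B1: "0 < B 1"
  proof -
    have "\<exists>x\<ge>-1. x \<le> 1 \<and> \<psi>p x = 1 / 2"
      using left[of "-1"] right[of 1] sum[of 1] smooth1_continuous[OF sm(1)] by (intro IVT') auto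
    then obtain x where x: "-1 \<le> x" "x \<le> 1" "\<psi>p x = 1 / 2" by blast
    then have bx: "b x > 0" using sum[of x] by (simp add: b_def)
    then have "x \<noteq> 1" using bz[of 1] by auto
    with x have x1: "x < 1" by simp
    obtain d where d: "d > 0" "\<And>k. 0 < k \<Longrightarrow> k < d \<Longrightarrow> B x < B (x + k)"
      using DERIV_pos_inc_right[OF dB bx] by auto
    define k where "k = min (d / 2) (1 - x)"
    have "0 < k" "k < d" "x + k \<le> 1" using d(1) x1 by (auto simp: k_def min_def)
    then have "B x < B (x + k)" "B (x + k) \<le> B 1" using d(2) monoB by auto
    moreover have "0 \<le> B x" using monoB[of "-1" x] Bl[of "-1"] x by simp
    ultimately show ?thesis by linarith
  qed
  have "bump (\<lambda>x. 1 / B 1 * b x) (\<lambda>x. 1 / B 1 * B x)"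
  proof
    show "smooth1 (\<lambda>x. 1 / B 1 * b x)" by (rule smooth1_cmult[OF smb])
    show "((\<lambda>x. 1 / B 1 * B x) has_real_derivative 1 / B 1 * b x) (at x)" for x by (rule DERIV_cmult[OF dB])
    show "1 \<le> x \<Longrightarrow> 1 / B 1 * B x = 1" for x using Br[of x] B1 by simp
    show "0 \<le> 1 / B 1 * b x" for x using b0[of x] B1 by simp
    show "\<bar>x\<bar> \<ge> 1 \<Longrightarrow> 1 / B 1 * b x = 0" for x using bz[of x] by simp
    show "x \<le> -1 \<Longrightarrow> 1 / B 1 * B x = 0" for x using Bl[of x] by simp
  qed
  then show ?thesis by blast
qed

lemma smooth1_compact_support_bounded:
  assumes f: "smooth1 f" and z: "\<And>x. \<bar>x\<bar> > 1 \<Longrightarrow> f x = 0"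
  shows "\<exists>B\<ge>0. \<forall>x. \<bar>f x\<bar> \<le> B" "\<And>x. \<bar>x\<bar> > 1 \<Longrightarrow> deriv f x = 0"
proof -
  have "bounded (f ` {-1..1})"
    using smooth1_continuous[OF f] compact_continuous_image compact_imp_bounded compact_Icc by blast
  then obtain B where B: "\<And>x. x \<in> {-1..1} \<Longrightarrow> \<bar>f x\<bar> \<le> B" unfolding bounded_iff by force
  have "\<bar>f x\<bar> \<le> \<bar>B\<bar>" for x
  proof (cases "\<bar>x\<bar> > 1")
    case False
    then have "x \<in> {-1..1}" by auto
    then have "\<bar>f x\<bar> \<le> B" by (rule B)
    then show ?thesis by linarith
  qed (simp add: z)
  then show "\<exists>B\<ge>0. \<forall>x. \<bar>f x\<bar> \<le> B" by (meson abs_ge_zero)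
  fix x :: real assume x: "\<bar>x\<bar> > 1"
  have "open {x::real. \<bar>x\<bar> > 1}" by (intro open_Collect_less continuous_intros)
  then have "\<forall>\<^sub>F y in nhds x. f y = 0"
    using x z by (auto elim!: eventually_mono dest!: eventually_nhds_in_open)
  then show "deriv f x = 0" by (rule deriv_locally_constant)
qed

context bump
begin

lemma smooth_S: "smooth1 S" by (rule smooth1_antideriv[OF smooth_\<beta> S_deriv])

lemma S_mono: "x \<le> y \<Longrightarrow> S x \<le> S y"
  by (rule DERIV_nonneg_imp_nondecreasing) (use S_deriv \<beta>_nonneg in blast)+

lemma S_range: "0 \<le> S x" "S x \<le> 1"
  using S_mono[of "min x (-1)" x] S_left[of "min x (-1)"] S_mono[of x "max x 1"] S_right[of "max x 1"] by auto

lemma \<beta>_pos: "\<exists>x. \<bar>x\<bar> < 1 \<and> 0 < \<beta> x"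
proof (rule ccontr)
  assume "\<not> ?thesis"
  then have z: "\<beta> x = 0" for x using \<beta>_nonneg[of x] \<beta>_support[of x] by (metis antisym not_less)
  have "S 1 = S (-1)" using DERIV_const_ratio_const[of "-1" 1 S 0] S_deriv[unfolded z] by simp
  then show False using S_left[of "-1"] S_right[of 1] by simp
qed

text \<open>A step smoothed over the width \<delta>, followed by its first three derivatives; each
  differentiation costs a factor 1 / \<delta>.\<close>

definition Sd where "Sd \<delta> y = S (y / \<delta>)"
definition bd where "bd \<delta> y = \<beta> (y / \<delta>) / \<delta>"
definition bd' where "bd' \<delta> y = deriv \<beta> (y / \<delta>) / \<delta>\<^sup>2"
definition bd'' where "bd'' \<delta> y = deriv (deriv \<beta>) (y / \<delta>) / \<delta> ^ 3"

definition M where "M = (SOME M. M \<ge> 0 \<and> (\<forall>x. \<bar>\<beta> x\<bar> \<le> M) \<and> (\<forall>x. \<bar>deriv \<beta> x\<bar> \<le> M) \<and> (\<forall>x. \<bar>deriv (deriv \<beta>) x\<bar> \<le> M))"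

lemma M: "0 \<le> M" "\<bar>\<beta> x\<bar> \<le> M" "\<bar>deriv \<beta> x\<bar> \<le> M" "\<bar>deriv (deriv \<beta>) x\<bar> \<le> M"
  and deriv_\<beta>_support: "\<bar>x\<bar> > 1 \<Longrightarrow> deriv \<beta> x = 0"
proof -
  have z: "\<bar>x\<bar> > 1 \<Longrightarrow> \<beta> x = 0" for x using \<beta>_support by simp
  note 1 = smooth1_compact_support_bounded[OF smooth_\<beta> z]
  note 2 = smooth1_compact_support_bounded[OF smooth1_deriv[OF smooth_\<beta>] 1(2)]
  note 3 = smooth1_compact_support_bounded[OF smooth1_deriv[OF smooth1_deriv[OF smooth_\<beta>]] 2(2)]
  obtain B1 where B1: "0 \<le> B1" "\<And>x. \<bar>\<beta> x\<bar> \<le> B1" using 1(1) by auto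
  obtain B2 where B2: "0 \<le> B2" "\<And>x. \<bar>deriv \<beta> x\<bar> \<le> B2" using 2(1) by auto
  obtain B3 where B3: "0 \<le> B3" "\<And>x. \<bar>deriv (deriv \<beta>) x\<bar> \<le> B3" using 3(1) by auto
  have "\<exists>M. M \<ge> 0 \<and> (\<forall>x. \<bar>\<beta> x\<bar> \<le> M) \<and> (\<forall>x. \<bar>deriv \<beta> x\<bar> \<le> M) \<and> (\<forall>x. \<bar>deriv (deriv \<beta>) x\<bar> \<le> M)"
  proof (intro exI[of _ "B1 + B2 + B3"] conjI allI)
    show "\<bar>\<beta> x\<bar> \<le> B1 + B2 + B3" "\<bar>deriv \<beta> x\<bar> \<le> B1 + B2 + B3" "\<bar>deriv (deriv \<beta>) x\<bar> \<le> B1 + B2 + B3" for x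
      using B1(1) B2(1) B3(1) B1(2)[of x] B2(2)[of x] B3(2)[of x] by linarith+
  qed (use B1 B2 B3 in auto)
  from someI_ex[OF this] show "0 \<le> M" "\<bar>\<beta> x\<bar> \<le> M" "\<bar>deriv \<beta> x\<bar> \<le> M" "\<bar>deriv (deriv \<beta>) x\<bar> \<le> M"
    unfolding M_def by blast+
  show "\<bar>x\<bar> > 1 \<Longrightarrow> deriv \<beta> x = 0" by (rule 1(2))
qed

lemma smooth_scaled: "smooth1 (\<lambda>x. Sd \<delta> (x - z))" "smooth1 (\<lambda>x. bd \<delta> (x - z))" 
proof -
  have e: "(x - z) / \<delta> = (1 / \<delta>) * x + (- z / \<delta>)" for x by (simp add: diff_divide_distrib)
  show "smooth1 (\<lambda>x. Sd \<delta> (x - z))" unfolding Sd_def e by (rule smooth1_affine[OF smooth_S])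
  have "smooth1 (\<lambda>x. (1 / \<delta>) * \<beta> ((1 / \<delta>) * x + (- z / \<delta>)))" by (intro smooth1_cmult smooth1_affine smooth_\<beta>)
  then show "smooth1 (\<lambda>x. bd \<delta> (x - z))" unfolding bd_def e by simp
qed

context
  fixes \<delta> :: real assumes \<delta>: "\<delta> > 0"
begin

lemma DERIV_scaled:
  "(Sd \<delta> has_real_derivative bd \<delta> y) (at y)"
  "(bd \<delta> has_real_derivative bd' \<delta> y) (at y)"
  "(bd' \<delta> has_real_derivative bd'' \<delta> y) (at y)"
proof -
  have d: "((\<lambda>y. y / \<delta>) has_real_derivative 1 / \<delta>) (at y)" using \<delta> by (auto intro!: derivative_eq_intros)
  show "(Sd \<delta> has_real_derivative bd \<delta> y) (at y)"
    using DERIV_chain2[OF S_deriv d] by (simp add: Sd_def[abs_def] bd_def)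
  show "(bd \<delta> has_real_derivative bd' \<delta> y) (at y)"
    using DERIV_cmult[OF DERIV_chain2[OF smooth1_DERIV[OF smooth_\<beta>] d], of "1 / \<delta>"]
    by (simp add: bd_def[abs_def] bd'_def power2_eq_square)
  show "(bd' \<delta> has_real_derivative bd'' \<delta> y) (at y)"
    using DERIV_cmult[OF DERIV_chain2[OF smooth1_DERIV[OF smooth1_deriv[OF smooth_\<beta>]] d], of "1 / \<delta>\<^sup>2"]
    by (simp add: bd'_def[abs_def] bd''_def power2_eq_square power3_eq_cube)
qed

lemma DERIV_translate:
  "((\<lambda>x. Sd \<delta> (x - z)) has_real_derivative bd \<delta> (x - z)) (at x)"
  "((\<lambda>x. bd \<delta> (x - z)) has_real_derivative bd' \<delta> (x - z)) (at x)"
  using DERIV_scaled[of "x - z"] DERIV_shift[of _ _ x "-z"] by simp_all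

lemma deriv_translate: "deriv (\<lambda>x. Sd \<delta> (x - z)) = (\<lambda>x. bd \<delta> (x - z))" "deriv (\<lambda>x. bd \<delta> (x - z)) = (\<lambda>x. bd' \<delta> (x - z))"
  using DERIV_translate by (auto intro!: ext DERIV_imp_deriv)

lemma scaled_bounds:
  "0 \<le> Sd \<delta> y" "Sd \<delta> y \<le> 1" "0 \<le> bd \<delta> y" "\<bar>bd \<delta> y\<bar> \<le> M / \<delta>" "\<bar>bd' \<delta> y\<bar> \<le> M / \<delta>\<^sup>2" "\<bar>bd'' \<delta> y\<bar> \<le> M / \<delta> ^ 3"
  using \<delta> S_range M \<beta>_nonneg by (auto simp: Sd_def bd_def bd'_def bd''_def abs_divide divide_right_mono)

lemma scaled_support:
  "y \<le> -\<delta> \<Longrightarrow> Sd \<delta> y = 0" "y \<ge> \<delta> \<Longrightarrow> Sd \<delta> y = 1"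
  "\<bar>y\<bar> \<ge> \<delta> \<Longrightarrow> bd \<delta> y = 0" "\<bar>y\<bar> > \<delta> \<Longrightarrow> bd' \<delta> y = 0"
proof -
  show "y \<le> -\<delta> \<Longrightarrow> Sd \<delta> y = 0" using \<delta> by (auto simp: Sd_def pos_divide_le_eq intro!: S_left)
  show "y \<ge> \<delta> \<Longrightarrow> Sd \<delta> y = 1" using \<delta> by (auto simp: Sd_def pos_le_divide_eq intro!: S_right)
  show "\<bar>y\<bar> \<ge> \<delta> \<Longrightarrow> bd \<delta> y = 0" using \<delta> \<beta>_support[of "y / \<delta>"] by (simp add: bd_def abs_divide pos_le_divide_eq)
  show "\<bar>y\<bar> > \<delta> \<Longrightarrow> bd' \<delta> y = 0" using \<delta> deriv_\<beta>_support[of "y / \<delta>"] by (simp add: bd'_def abs_divide pos_less_divide_eq)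
qed

lemma scaled_continuous: "continuous_on A (Sd \<delta>)" "continuous_on A (bd \<delta>)" "continuous_on A (bd' \<delta>)"
  using DERIV_scaled by (meson DERIV_isCont continuous_at_imp_continuous_on)+

lemma scaled_measurable: "Sd \<delta> \<in> borel_measurable borel" "bd \<delta> \<in> borel_measurable borel" "bd' \<delta> \<in> borel_measurable borel"
  using scaled_continuous[of UNIV] borel_measurable_continuous_onI by blast+

lemma lipschitz_scaled:
  "\<bar>Sd \<delta> a - Sd \<delta> b\<bar> \<le> M / \<delta> * \<bar>a - b\<bar>"
  "\<bar>bd \<delta> a - bd \<delta> b\<bar> \<le> M / \<delta>\<^sup>2 * \<bar>a - b\<bar>"
  "\<bar>bd' \<delta> a - bd' \<delta> b\<bar> \<le> M / \<delta> ^ 3 * \<bar>a - b\<bar>"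
proof -
  have "norm (f a - f b) \<le> K * norm (a - b)"
    if "\<And>y. (f has_real_derivative f' y) (at y)" "\<And>y. \<bar>f' y\<bar> \<le> K" for f f' :: "real \<Rightarrow> real" and K
    by (rule field_differentiable_bound[of UNIV f f']) (use that in auto)
  from this[OF DERIV_scaled(1) scaled_bounds(4)] this[OF DERIV_scaled(2) scaled_bounds(5)] this[OF DERIV_scaled(3) scaled_bounds(6)]
  show "\<bar>Sd \<delta> a - Sd \<delta> b\<bar> \<le> M / \<delta> * \<bar>a - b\<bar>"
  "\<bar>bd \<delta> a - bd \<delta> b\<bar> \<le> M / \<delta>\<^sup>2 * \<bar>a - b\<bar>"
  "\<bar>bd' \<delta> a - bd' \<delta> b\<bar> \<le> M / \<delta> ^ 3 * \<bar>a - b\<bar>" by simp_all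
qed

lemma integral_scaled_full:
  "integrable lborel (\<lambda>x. bd \<delta> (x - z))" "(\<integral>x. bd \<delta> (x - z) \<partial>lborel) = 1"
  "integrable lborel (\<lambda>x. bd' \<delta> (x - z))" "(\<integral>x. bd' \<delta> (x - z) \<partial>lborel) = 0"
proof -
  let ?a = "z - \<delta> - 1" and ?b = "z + \<delta> + 1"
  have ab: "?a \<le> ?b" using \<delta> by simp
  have w1: "wderiv (\<lambda>x. Sd \<delta> (x - z)) (\<lambda>x. bd \<delta> (x - z))"
    by (rule C1_wderiv[OF DERIV_translate(1)]) (intro continuous_on_compose2[OF scaled_continuous(2)[of UNIV]] continuous_intros, auto)
  have w2: "wderiv (\<lambda>x. bd \<delta> (x - z)) (\<lambda>x. bd' \<delta> (x - z))"
    by (rule C1_wderiv[OF DERIV_translate(2)]) (intro continuous_on_compose2[OF scaled_continuous(3)[of UNIV]] continuous_intros, auto)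
  have e1: "indicator {?a..?b} x *\<^sub>R bd \<delta> (x - z) = bd \<delta> (x - z)" for x
    using scaled_support(3)[of "x - z"] by (cases "\<bar>x - z\<bar> \<ge> \<delta>") (auto simp: indicator_def)
  have e2: "indicator {?a..?b} x *\<^sub>R bd' \<delta> (x - z) = bd' \<delta> (x - z)" for x
    using scaled_support(4)[of "x - z"] by (cases "\<bar>x - z\<bar> > \<delta>") (auto simp: indicator_def)
  show "integrable lborel (\<lambda>x. bd \<delta> (x - z))" "integrable lborel (\<lambda>x. bd' \<delta> (x - z))"
    using wderiv_integrable[OF w1, of ?a ?b] wderiv_integrable[OF w2, of ?a ?b] unfolding set_integrable_def e1 e2 by auto
  have "Sd \<delta> (?b - z) - Sd \<delta> (?a - z) = (LBINT x:{?a..?b}. bd \<delta> (x - z))"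
    "bd \<delta> (?b - z) - bd \<delta> (?a - z) = (LBINT x:{?a..?b}. bd' \<delta> (x - z))"
    by (rule wderiv_FTC[OF w1 ab], rule wderiv_FTC[OF w2 ab])
  then show "(\<integral>x. bd \<delta> (x - z) \<partial>lborel) = 1" "(\<integral>x. bd' \<delta> (x - z) \<partial>lborel) = 0"
    unfolding set_lebesgue_integral_def e1 e2 using \<delta> scaled_support by simp_all
qed

end

text \<open>These are the inner integrals that arise when the kernel is integrated against the mass
  on one side of x and the order of integration is exchanged.\<close>

lemma integral_scaled_half:
  assumes \<delta>: "\<delta> > 0"
  shows "(\<integral>x. bd \<delta> (x - z) * indicator {..<y} x \<partial>lborel) = Sd \<delta> (y - z)"
    "(\<integral>x. bd \<delta> (x - z) * indicator {y<..} x \<partial>lborel) = 1 - Sd \<delta> (y - z)"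
proof -
  let ?a = "min (z - \<delta> - 1) (y - 1)"
  have w1: "wderiv (\<lambda>x. Sd \<delta> (x - z)) (\<lambda>x. bd \<delta> (x - z))"
    by (rule C1_wderiv[OF DERIV_translate(1)[OF \<delta>]]) (intro continuous_on_compose2[OF scaled_continuous(2)[OF \<delta>, of UNIV]] continuous_intros, auto)
  have [measurable]: "bd \<delta> \<in> borel_measurable borel" by (rule scaled_measurable[OF \<delta>])
  have e: "AE x in lborel. bd \<delta> (x - z) * indicator {..<y} x = indicator {?a..y} x *\<^sub>R bd \<delta> (x - z)"
    using AE_lborel_singleton[of y]
  proof eventually_elim
    fix x assume "x \<noteq> y"
    then show "bd \<delta> (x - z) * indicator {..<y} x = indicator {?a..y} x *\<^sub>R bd \<delta> (x - z)"
      using scaled_support(3)[OF \<delta>, of "x - z"] by (cases "\<bar>x - z\<bar> \<ge> \<delta>") (auto simp: indicator_def)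
  qed
  have "(\<integral>x. bd \<delta> (x - z) * indicator {..<y} x \<partial>lborel) = (LBINT x:{?a..y}. bd \<delta> (x - z))"
    unfolding set_lebesgue_integral_def by (rule integral_cong_AE[OF _ _ e]) measurable
  also have "\<dots> = Sd \<delta> (y - z) - Sd \<delta> (?a - z)" by (rule wderiv_FTC[OF w1, symmetric]) simp
  also have "Sd \<delta> (?a - z) = 0" using \<delta> by (intro scaled_support) auto
  finally show 1: "(\<integral>x. bd \<delta> (x - z) * indicator {..<y} x \<partial>lborel) = Sd \<delta> (y - z)" by simp
  have i: "integrable lborel (\<lambda>x. bd \<delta> (x - z) * indicator {..<y} x)" "integrable lborel (\<lambda>x. bd \<delta> (x - z) * indicator {y<..} x)"
    by (intro integrable_real_mult_indicator integral_scaled_full[OF \<delta>], simp)+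
  have "1 = (\<integral>x. bd \<delta> (x - z) * indicator {..<y} x + bd \<delta> (x - z) * indicator {y<..} x \<partial>lborel)"
    unfolding integral_scaled_full(2)[OF \<delta>, of z, symmetric]
    by (rule integral_cong_AE) (use AE_lborel_singleton[of y] in \<open>measurable, eventually_elim, auto simp: indicator_def\<close>)
  also have "\<dots> = Sd \<delta> (y - z) + (\<integral>x. bd \<delta> (x - z) * indicator {y<..} x \<partial>lborel)"
    by (subst Bochner_Integration.integral_add[OF i]) (simp add: 1)
  finally show "(\<integral>x. bd \<delta> (x - z) * indicator {y<..} x \<partial>lborel) = 1 - Sd \<delta> (y - z)" by simp
qed

text \<open>A test function in time: it equals 1 on [0,\<tau> - \<epsilon>] and 0 beyond \<tau> + \<epsilon>; the cut-off on the
  negative half line is invisible to the weak formulation.\<close>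
definition \<theta> where "\<theta> \<epsilon> \<tau> t = Sd 1 (t - (-10)) - Sd \<epsilon> (t - \<tau>)"

lemma smooth_\<theta>: "smooth1 (\<theta> \<epsilon> \<tau>)"
  unfolding \<theta>_def[abs_def] by (intro smooth1_diff smooth_scaled)

text \<open>The number 11 comes from the ascending ramp of \<theta>, which is centred at -10 and has
  half-width 1.\<close>

lemma \<theta>_facts:
  assumes "0 < \<epsilon>" "\<epsilon> < \<tau>"
  shows "\<theta> \<epsilon> \<tau> 0 = 1" "\<And>t. t \<ge> \<tau> + \<epsilon> \<Longrightarrow> \<theta> \<epsilon> \<tau> t = 0" "\<And>t. \<bar>t\<bar> > 11 + \<tau> + \<epsilon> \<Longrightarrow> \<theta> \<epsilon> \<tau> t = 0"
    "\<And>t. (\<theta> \<epsilon> \<tau> has_real_derivative deriv (\<theta> \<epsilon> \<tau>) t) (at t)"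
    "\<And>t. t \<ge> 0 \<Longrightarrow> deriv (\<theta> \<epsilon> \<tau>) t = - bd \<epsilon> (t - \<tau>)"
proof -
  show "\<theta> \<epsilon> \<tau> 0 = 1" "\<And>t. t \<ge> \<tau> + \<epsilon> \<Longrightarrow> \<theta> \<epsilon> \<tau> t = 0"
    using assms scaled_support(1,2)[of 1] scaled_support(1,2)[of \<epsilon>] by (simp_all add: \<theta>_def)
  show "\<theta> \<epsilon> \<tau> t = 0" if "\<bar>t\<bar> > 11 + \<tau> + \<epsilon>" for t
  proof (cases "t \<ge> 0")
    case True
    then show ?thesis using that assms scaled_support(2)[of 1 "t + 10"] scaled_support(2)[of \<epsilon> "t - \<tau>"] by (simp add: \<theta>_def)
  next
    case False
    then show ?thesis using that assms scaled_support(1)[of 1 "t + 10"] scaled_support(1)[of \<epsilon> "t - \<tau>"] by (simp add: \<theta>_def)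
  qed
  show "\<And>t. (\<theta> \<epsilon> \<tau> has_real_derivative deriv (\<theta> \<epsilon> \<tau>) t) (at t)" by (rule smooth1_DERIV[OF smooth_\<theta>])
  show "deriv (\<theta> \<epsilon> \<tau>) t = - bd \<epsilon> (t - \<tau>)" if "t \<ge> 0" for t
  proof (rule DERIV_imp_deriv)
    have "(\<theta> \<epsilon> \<tau> has_real_derivative bd 1 (t - (-10)) - bd \<epsilon> (t - \<tau>)) (at t)"
      unfolding \<theta>_def[abs_def] using assms by (intro DERIV_diff DERIV_translate) auto
    then show "(\<theta> \<epsilon> \<tau> has_real_derivative - bd \<epsilon> (t - \<tau>)) (at t)"
      using scaled_support(3)[of 1 "t + 10"] that by simp
  qed
qed

text \<open>The hypothesis says that the continuous defect D of the integrated balance has integral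
  zero against every narrow bump at t. If D t were nonzero, a bump inside a region of constant sign
  would contradict this.\<close>

lemma time_integrated:
  assumes a: "continuous_on {0..} a" and b: "continuous_on {0..} b"
    and weak: "\<And>\<epsilon> \<tau>. 0 < \<epsilon> \<Longrightarrow> \<epsilon> < \<tau> \<Longrightarrow> (LINT t:{0..}|lborel. deriv (\<theta> \<epsilon> \<tau>) t * a t + \<theta> \<epsilon> \<tau> t * b t) = - a 0"
    and t: "0 \<le> t"
  shows "a t - a 0 = integral {0..t} b"
proof (cases "t = 0")
  case False
  with t have \<tau>: "0 < t" by simp
  define A where "A s = a 0 + integral {0..s} b" for s
  define D where "D s = a s - A s" for s
  have cD: "continuous_on {0..T} D" for T
    unfolding D_def A_def
    by (intro continuous_intros indefinite_integral_continuous_1 integrable_continuous_real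
        continuous_on_subset[OF a] continuous_on_subset[OF b]) auto
  have key: "integral {0..t + \<epsilon>} (\<lambda>s. bd \<epsilon> (s - t) * D s) = 0" if \<epsilon>: "0 < \<epsilon>" "\<epsilon> < t" for \<epsilon>
  proof -
    note th = \<theta>_facts[OF \<epsilon>]
    let ?T = "t + \<epsilon>"
    have T: "0 \<le> ?T" using \<epsilon> by simp
    have cdt: "continuous_on X (deriv (\<theta> \<epsilon> t))" "continuous_on X (\<theta> \<epsilon> t)" for X
      using smooth1_continuous smooth_\<theta> smooth1_deriv by blast+
    let ?g = "\<lambda>s. deriv (\<theta> \<epsilon> t) s * a s + \<theta> \<epsilon> t s * b s"
    have z: "deriv (\<theta> \<epsilon> t) s = 0" "\<theta> \<epsilon> t s = 0" if "s > ?T" for s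
      using th(2)[of s] th(5)[of s] that \<epsilon> scaled_support(3)[of \<epsilon> "s - t"] by auto
    have cg: "continuous_on {0..?T} ?g"
      by (intro continuous_intros cdt continuous_on_subset[OF a] continuous_on_subset[OF b]) auto
    have "- a 0 = (LINT s:{0..?T}|lborel. ?g s)"
      unfolding weak[OF \<epsilon>, symmetric] set_lebesgue_integral_def
      by (intro Bochner_Integration.integral_cong refl) (auto simp: indicator_def z)
    also have "\<dots> = integral {0..?T} ?g"
      by (rule set_borel_integral_eq_integral(2)[OF borel_integrable_atLeastAtMost'[OF cg]])
    finally have 1: "integral {0..?T} ?g = - a 0" by simp
    \<comment> \<open>The candidate A satisfies the same identity by the fundamental theorem;
      subtracting the two leaves only the bump against D.\<close>
    have "((\<lambda>s. deriv (\<theta> \<epsilon> t) s * A s + \<theta> \<epsilon> t s * b s) has_integral (\<theta> \<epsilon> t ?T * A ?T - \<theta> \<epsilon> t 0 * A 0)) {0..?T}"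
    proof (rule fundamental_theorem_of_calculus[OF T])
      fix s assume s: "s \<in> {0..?T}"
      have "(A has_real_derivative b s) (at s within {0..?T})"
        unfolding A_def using integral_has_real_derivative[of 0 ?T b s] s continuous_on_subset[OF b, of "{0..?T}"]
        by (auto intro!: derivative_eq_intros)
      from DERIV_mult[OF has_field_derivative_at_within[OF th(4)] this]
      have "((\<lambda>s. \<theta> \<epsilon> t s * A s) has_real_derivative deriv (\<theta> \<epsilon> t) s * A s + \<theta> \<epsilon> t s * b s) (at s within {0..?T})"
        by (simp add: algebra_simps)
      then show "((\<lambda>s. \<theta> \<epsilon> t s * A s) has_vector_derivative deriv (\<theta> \<epsilon> t) s * A s + \<theta> \<epsilon> t s * b s) (at s within {0..?T})"
        by (simp add: has_real_derivative_iff_has_vector_derivative)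
    qed
    moreover have "\<theta> \<epsilon> t ?T * A ?T - \<theta> \<epsilon> t 0 * A 0 = - a 0" using th(1) th(2)[of ?T] by (simp add: A_def)
    ultimately have 2: "((\<lambda>s. deriv (\<theta> \<epsilon> t) s * A s + \<theta> \<epsilon> t s * b s) has_integral - a 0) {0..?T}" by simp
    have 3: "(?g has_integral - a 0) {0..?T}"
      using integrable_integral[OF integrable_continuous_real[OF cg]] 1 by simp
    from has_integral_diff[OF 2 3]
    have "((\<lambda>s. deriv (\<theta> \<epsilon> t) s * (A s - a s)) has_integral 0) {0..?T}" by (simp add: algebra_simps)
    moreover have "deriv (\<theta> \<epsilon> t) s * (A s - a s) = bd \<epsilon> (s - t) * D s" if "s \<in> {0..?T}" for s
      using th(5)[of s] that by (simp add: D_def algebra_simps)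
    ultimately have "((\<lambda>s. bd \<epsilon> (s - t) * D s) has_integral 0) {0..?T}"
      by (rule has_integral_cong[THEN iffD1, rotated]) 
    then show ?thesis by (rule integral_unique)
  qed
  \<comment> \<open>The factor c treats both signs at once, through c = 1 and c = -1.\<close>
  have no: "\<not> (0 < c * D t)" for c :: real
  proof
    assume pos: "0 < c * D t"
    have "continuous_on {0..2 * t} (\<lambda>s. c * D s)" by (intro continuous_intros cD)
    then have "((\<lambda>s. c * D s) \<longlongrightarrow> c * D t) (at t within {0..2 * t})" using \<tau> by (simp add: continuous_on_def)
    from order_tendstoD(1)[OF this pos] obtain d where d: "d > 0" "\<And>s. s \<in> {0..2 * t} \<Longrightarrow> s \<noteq> t \<Longrightarrow> dist s t < d \<Longrightarrow> 0 < c * D s"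
      unfolding eventually_at by blast
    define \<epsilon> where "\<epsilon> = min d t / 2"
    have \<epsilon>: "0 < \<epsilon>" "\<epsilon> < t" "\<epsilon> < d" using d(1) \<tau> by (auto simp: \<epsilon>_def min_def)
    have pos': "0 < c * D s" if "\<bar>s - t\<bar> \<le> \<epsilon>" for s
    proof (cases "s = t")
      case False
      have "s \<in> {0..2 * t}" "dist s t < d" using that \<epsilon> by (auto simp: dist_real_def)
      then show ?thesis using d(2) False by blast
    qed (use pos in simp)
    let ?f = "\<lambda>s. bd \<epsilon> (s - t) * (c * D s)"
    have cf: "continuous_on {0..t + \<epsilon>} ?f"
      by (intro continuous_intros cD continuous_on_compose2[OF scaled_continuous(2)[OF \<epsilon>(1), of UNIV]]) auto
    have nn: "0 \<le> ?f s" for s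
    proof (cases "\<bar>s - t\<bar> \<le> \<epsilon>")
      case True then show ?thesis using pos'[of s] scaled_bounds(3)[OF \<epsilon>(1)] by simp
    qed (use scaled_support(3)[OF \<epsilon>(1), of "s - t"] in simp)
    have "integral {0..t + \<epsilon>} ?f = c * integral {0..t + \<epsilon>} (\<lambda>s. bd \<epsilon> (s - t) * D s)"
      by (subst Henstock_Kurzweil_Integration.integral_mult_right[symmetric]) (simp add: mult_ac)
    then have "integral {0..t + \<epsilon>} ?f = 0" using key[OF \<epsilon>(1,2)] by simp
    then have zero: "\<forall>s\<in>{0..t + \<epsilon>}. ?f s = 0"
      using integral_eq_0_iff[OF cf] nn \<epsilon> by auto
    \<comment> \<open>A point where \<beta> is positive, rescaled to width \<epsilon> around t, lies
      where c D is positive, so the integrand cannot vanish identically.\<close>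
    obtain x0 where x0: "\<bar>x0\<bar> < 1" "0 < \<beta> x0" using \<beta>_pos by blast
    define s where "s = t + \<epsilon> * x0"
    have "\<bar>\<epsilon> * x0\<bar> \<le> \<epsilon> * 1" unfolding abs_mult using x0 \<epsilon> by (intro mult_mono) auto
    then have s: "\<bar>s - t\<bar> \<le> \<epsilon>" by (simp add: s_def)
    have "bd \<epsilon> (s - t) > 0" using x0 \<epsilon> by (simp add: s_def bd_def)
    then have "0 < ?f s" using pos'[OF s] by simp
    moreover have "s \<in> {0..t + \<epsilon>}" using s \<epsilon> by auto
    ultimately show False using zero by force
  qed
  have "D t = 0" using no[of 1] no[of "-1"] by simp
  then show ?thesis by (simp add: D_def A_def)
qed simp

end

text \<open>A remainder that is quadratic in the increment and uniform in x integrates to O(k^2)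
  over a finite measure, which takes the place of dominated convergence.\<close>

lemma integral_param_DERIV:
  fixes f f' :: "real \<Rightarrow> real \<Rightarrow> real"
  assumes M: "finite_measure M" and i: "\<And>z. integrable M (f z)" and i': "integrable M (f' z)"
    and rem: "\<And>k x. x \<in> space M \<Longrightarrow> \<bar>f (z + k) x - f z x - k * f' z x\<bar> \<le> K * k\<^sup>2"
  shows "((\<lambda>z. \<integral>x. f z x \<partial>M) has_real_derivative (\<integral>x. f' z x \<partial>M)) (at z)"
proof -
  interpret finite_measure M by (rule M)
  define L where "L = \<bar>K\<bar> * measure M (space M)"
  have est: "\<bar>((\<integral>x. f (z + k) x \<partial>M) - (\<integral>x. f z x \<partial>M)) / k - (\<integral>x. f' z x \<partial>M)\<bar> \<le> L * \<bar>k\<bar>" if "k \<noteq> 0" for k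
  proof -
    have "(\<integral>x. f (z + k) x \<partial>M) - (\<integral>x. f z x \<partial>M) - k * (\<integral>x. f' z x \<partial>M) = (\<integral>x. f (z + k) x - f z x - k * f' z x \<partial>M)"
      using i i' by simp
    also have "\<bar>\<dots>\<bar> \<le> (\<integral>x. \<bar>f (z + k) x - f z x - k * f' z x\<bar> \<partial>M)" by (rule integral_abs_bound)
    also have "\<dots> \<le> (\<integral>x. \<bar>K\<bar> * k\<^sup>2 \<partial>M)"
    proof (rule integral_mono)
      fix x assume "x \<in> space M"
      from rem[OF this, of k] show "\<bar>f (z + k) x - f z x - k * f' z x\<bar> \<le> \<bar>K\<bar> * k\<^sup>2"
        by (rule order_trans) (intro mult_right_mono, auto)
    qed (use i i' in auto)
    also have "\<dots> = L * k\<^sup>2" by (simp add: L_def mult_ac)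
    finally have "\<bar>(\<integral>x. f (z + k) x \<partial>M) - (\<integral>x. f z x \<partial>M) - k * (\<integral>x. f' z x \<partial>M)\<bar> / \<bar>k\<bar> \<le> L * k\<^sup>2 / \<bar>k\<bar>"
      by (rule divide_right_mono) simp
    moreover have "\<bar>(\<integral>x. f (z + k) x \<partial>M) - (\<integral>x. f z x \<partial>M) - k * (\<integral>x. f' z x \<partial>M)\<bar> / \<bar>k\<bar>
       = \<bar>((\<integral>x. f (z + k) x \<partial>M) - (\<integral>x. f z x \<partial>M)) / k - (\<integral>x. f' z x \<partial>M)\<bar>"
      using that by (simp add: abs_divide[symmetric] diff_divide_distrib)
    moreover have "L * k\<^sup>2 / \<bar>k\<bar> = L * \<bar>k\<bar>" using that by (metis abs_mult_self_eq abs_zero mult.assoc nonzero_mult_div_cancel_right power2_eq_square abs_eq_0)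
    ultimately show ?thesis by simp
  qed
  have "((\<lambda>k. ((\<integral>x. f (z + k) x \<partial>M) - (\<integral>x. f z x \<partial>M)) / k - (\<integral>x. f' z x \<partial>M)) \<longlongrightarrow> 0) (at 0)"
  proof (rule Lim_null_comparison[where g = "\<lambda>k. L * \<bar>k\<bar>"])
    show "\<forall>\<^sub>F k in at 0. norm (((\<integral>x. f (z + k) x \<partial>M) - (\<integral>x. f z x \<partial>M)) / k - (\<integral>x. f' z x \<partial>M)) \<le> L * \<bar>k\<bar>"
      using est by (auto simp: eventually_at intro!: exI[of _ 1])
    have "((\<lambda>k. L * \<bar>k\<bar>) \<longlongrightarrow> L * \<bar>0\<bar>) (at 0)" by (intro tendsto_intros)
    then show "((\<lambda>k. L * \<bar>k\<bar>) \<longlongrightarrow> 0) (at 0)" by simp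
  qed
  then show ?thesis unfolding DERIV_def by (rule LIM_zero_cancel)
qed

section \<open>Evolution of the energy of a weak solution\<close>

locale weak_solution = bump \<beta> S for \<beta> S +
  fixes \<psi>p \<psi>m :: "real \<Rightarrow> real" and v :: "real \<Rightarrow> real \<Rightarrow> real" and \<nu> :: "real \<Rightarrow> real measure"
  assumes sol: "weak_cons_sol \<psi>p \<psi>m v \<nu>"
    and psi_range: "\<And>x. 0 \<le> \<psi>p x \<and> \<psi>p x \<le> 1" "\<And>x. 0 \<le> \<psi>m x \<and> \<psi>m x \<le> 1"
begin

lemmas sol_E2 = sol[unfolded weak_cons_sol_def, THEN conjunct1, rule_format]
lemmas sol_rest = sol[unfolded weak_cons_sol_def, THEN conjunct2]
lemmas sol_measure = sol_rest[THEN conjunct1, rule_format]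
lemmas sol_momentum = sol_rest[THEN conjunct2, THEN conjunct1, rule_format]
lemmas sol_energy = sol_rest[THEN conjunct2, THEN conjunct2, THEN conjunct1, rule_format]
lemmas sol_regularity = sol_rest[THEN conjunct2, THEN conjunct2, THEN conjunct2, THEN conjunct1, rule_format]
lemmas sol_density = sol_rest[THEN conjunct2, THEN conjunct2, THEN conjunct2, THEN conjunct2, THEN conjunct1]
lemmas sol_continuity = sol_rest[THEN conjunct2, THEN conjunct2, THEN conjunct2, THEN conjunct2, THEN conjunct2, rule_format]

lemma fin: "t \<ge> 0 \<Longrightarrow> fin_borel (\<nu> t)"
  using sol_measure by blast

lemma finite_\<nu>: "t \<ge> 0 \<Longrightarrow> finite_measure (\<nu> t)"
  by (rule fin_borel_finite_measure[OF fin])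

lemma sets_\<nu>: "t \<ge> 0 \<Longrightarrow> sets (\<nu> t) = sets borel"
  using fin by (auto simp: fin_borel_def)

lemma space_\<nu>: "t \<ge> 0 \<Longrightarrow> space (\<nu> t) = UNIV"
  using sets_eq_imp_space_eq[OF sets_\<nu>] by simp

lemma meas_\<nu>: "t \<ge> 0 \<Longrightarrow> borel_measurable (\<nu> t) = (borel_measurable borel :: (real \<Rightarrow> real) set)"
  by (rule measurable_cong_sets[OF sets_\<nu> refl])

lemma ex_density: assumes "t \<ge> 0" obtains g where "wderiv (v t) g" "ac_part (\<nu> t) (\<lambda>x. (g x)\<^sup>2)"
proof -
  show ?thesis using sol_measure[OF assms] that by blast
qed

lemma energy: assumes "t \<ge> 0" "x \<le> y" shows "(v t y - v t x)\<^sup>2 \<le> (y - x) * measure (\<nu> t) {x<..<y}"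
proof -
  obtain g where "wderiv (v t) g" "ac_part (\<nu> t) (\<lambda>x. (g x)\<^sup>2)" using ex_density[OF assms(1)] .
  then show ?thesis by (rule ac_part_energy_le[OF _ fin[OF assms(1)] _ assms(2)])
qed

lemma v_cont: assumes "t \<ge> 0" shows "continuous_on UNIV (v t)"
proof -
  obtain g where "wderiv (v t) g" using ex_density[OF assms] .
  then show ?thesis by (rule wderiv_continuous)
qed

lemma v_meas: "t \<ge> 0 \<Longrightarrow> v t \<in> borel_measurable borel"
  by (rule borel_measurable_continuous_onI[OF v_cont])

lemma weak_cont_\<nu>:
  fixes f :: "real \<Rightarrow> real"
  assumes "continuous_on UNIV f" "bounded (range f)" shows "continuous_on {0..} (\<lambda>t. \<integral>x. f x \<partial>(\<nu> t))"
  by (rule sol_continuity) (use assms in auto)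

text \<open>The constant is enlarged to be positive because the modulus of continuity divides by
  it.\<close>

lemma holder: assumes "T > 0" obtains \<alpha> K where "0 < \<alpha>" "\<alpha> \<le> 1" "K > 0"
  "\<And>t s x y. t \<in> {0..T} \<Longrightarrow> s \<in> {0..T} \<Longrightarrow> \<bar>v t x - v s y\<bar> \<le> K * dist (t, x) (s, y) powr \<alpha>"
proof -
  obtain \<alpha> K where H: "0 < \<alpha>" "\<alpha> \<le> 1"
    "\<And>t s x y. t \<in> {0..T} \<Longrightarrow> s \<in> {0..T} \<Longrightarrow> \<bar>v t x - v s y\<bar> \<le> K * dist (t, x) (s, y) powr \<alpha>"
    using sol_regularity[OF assms, THEN conjunct1] by (elim exE conjE) blast
  have "\<bar>v t x - v s y\<bar> \<le> (\<bar>K\<bar> + 1) * dist (t, x) (s, y) powr \<alpha>" if "t \<in> {0..T}" "s \<in> {0..T}" for t s x y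
    by (rule order_trans[OF H(3)[OF that]]) (intro mult_right_mono, auto)
  then show ?thesis using that[of \<alpha> "\<bar>K\<bar> + 1"] H by auto
qed

lemma unif_cont: assumes "T > 0" "e > 0"
  obtains \<rho> where "\<rho> > 0" "\<And>t s x y. t \<in> {0..T} \<Longrightarrow> s \<in> {0..T} \<Longrightarrow> \<bar>t - s\<bar> < \<rho> \<Longrightarrow> \<bar>x - y\<bar> < \<rho> \<Longrightarrow> \<bar>v t x - v s y\<bar> \<le> e"
proof -
  obtain \<alpha> K where H: "0 < \<alpha>" "\<alpha> \<le> 1" "K > 0"
    "\<And>t s x y. t \<in> {0..T} \<Longrightarrow> s \<in> {0..T} \<Longrightarrow> \<bar>v t x - v s y\<bar> \<le> K * dist (t, x) (s, y) powr \<alpha>" using holder[OF assms(1)] by blast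
  \<comment> \<open>Solves K r^\<alpha> = e; half of r for each coordinate keeps the distance within
    r.\<close>
  define r where "r = (e / K) powr (1 / \<alpha>)"
  have r: "r > 0" "K * r powr \<alpha> = e" using H(1,3) assms by (auto simp: r_def powr_powr)
  show ?thesis
  proof (rule that[of "r / 2"])
    fix t s x y assume *: "t \<in> {0..T}" "s \<in> {0..T}" "\<bar>t - s\<bar> < r / 2" "\<bar>x - y\<bar> < r / 2"
    have "dist (t, x) (s, y) \<le> \<bar>t - s\<bar> + \<bar>x - y\<bar>"
      using sqrt_sum_squares_le_sum_abs[of "t - s" "x - y"] by (simp add: dist_Pair_Pair dist_real_def)
    also have "\<dots> \<le> r" using * by simp
    finally have "K * dist (t, x) (s, y) powr \<alpha> \<le> K * r powr \<alpha>" using H by (intro mult_left_mono powr_mono2) auto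
    then show "\<bar>v t x - v s y\<bar> \<le> e" using H(4)[OF *(1,2), of x y] r by linarith
  qed (use r in simp)
qed

text \<open>Boundedness at time 0 comes from membership in E2, at later times from the Hoelder
  estimate in t at fixed x.\<close>

lemma v_bounded: assumes "T > 0" obtains B where "B > 0" "\<And>t x. t \<in> {0..T} \<Longrightarrow> \<bar>v t x\<bar> \<le> B"
proof -
  obtain \<alpha> K where H: "0 < \<alpha>" "\<alpha> \<le> 1" "K > 0"
    "\<And>t s x y. t \<in> {0..T} \<Longrightarrow> s \<in> {0..T} \<Longrightarrow> \<bar>v t x - v s y\<bar> \<le> K * dist (t, x) (s, y) powr \<alpha>" using holder[OF assms(1)] by blast
  have "E2 \<psi>p \<psi>m (v 0)" by (rule sol_E2) simp
  from E2_bounded[OF this psi_range] obtain B where B: "B > 0" "\<And>x. \<bar>v 0 x\<bar> \<le> B" by blast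
  show ?thesis
  proof (rule that[of "B + K * T powr \<alpha>"])
    fix t x :: real assume t: "t \<in> {0..T}"
    have "dist (t, x) (0, x) powr \<alpha> \<le> T powr \<alpha>" using t H(1) by (intro powr_mono2) (auto simp: dist_Pair_Pair)
    then have "K * dist (t, x) (0, x) powr \<alpha> \<le> K * T powr \<alpha>" using H by (intro mult_left_mono) auto
    then show "\<bar>v t x\<bar> \<le> B + K * T powr \<alpha>" using H(4)[of t 0 x x] t B(2)[of x] assms by simp
  qed (use B H in \<open>auto intro: add_pos_nonneg\<close>)
qed

text \<open>Families of integrands f t z whose integrals against \<nu> t are continuous in (t, z): the
  parameter dependence is uniform in x, because \<nu> t varies only weakly.\<close>
definition nice :: "(real \<Rightarrow> real \<Rightarrow> real \<Rightarrow> real) \<Rightarrow> bool" where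
  "nice f \<longleftrightarrow> (\<forall>t\<ge>0. \<forall>z. continuous_on UNIV (f t z)) \<and> (\<forall>T>0. \<exists>B. \<forall>t\<in>{0..T}. \<forall>z x. \<bar>f t z x\<bar> \<le> B)
    \<and> (\<forall>t0\<ge>0. \<forall>z0. \<forall>e>0. \<exists>d>0. \<forall>t\<ge>0. \<forall>z x. \<bar>t - t0\<bar> < d \<longrightarrow> \<bar>z - z0\<bar> < d \<longrightarrow> \<bar>f t z x - f t0 z0 x\<bar> \<le> e)"

lemma niceD:
  assumes "nice f"
  shows "t \<ge> 0 \<Longrightarrow> continuous_on UNIV (f t z)" "T > 0 \<Longrightarrow> \<exists>B. \<forall>t\<in>{0..T}. \<forall>z x. \<bar>f t z x\<bar> \<le> B"
    "t0 \<ge> 0 \<Longrightarrow> e > 0 \<Longrightarrow> \<exists>d>0. \<forall>t\<ge>0. \<forall>z x. \<bar>t - t0\<bar> < d \<longrightarrow> \<bar>z - z0\<bar> < d \<longrightarrow> \<bar>f t z x - f t0 z0 x\<bar> \<le> e"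
  using assms unfolding nice_def by blast+

lemma nice_meas: "nice f \<Longrightarrow> t \<ge> 0 \<Longrightarrow> f t z \<in> borel_measurable borel"
  using niceD(1) borel_measurable_continuous_onI by blast

lemma nice_bound: assumes "nice f" "t \<ge> 0" obtains B where "B \<ge> 0" "\<And>z x. \<bar>f t z x\<bar> \<le> B"
proof -
  obtain B where "\<forall>s\<in>{0..t + 1}. \<forall>z x. \<bar>f s z x\<bar> \<le> B" using niceD(2)[OF assms(1), of "t + 1"] assms(2) by auto
  then have "\<bar>f t z x\<bar> \<le> B" for z x using assms(2) by auto
  then show ?thesis using that[of B] abs_ge_zero order_trans by metis
qed

lemma nice_v: "nice (\<lambda>t z x. v t x)"
  unfolding nice_def
proof (intro conjI allI impI)
  fix T :: real assume "T > 0"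
  from v_bounded[OF this] show "\<exists>B. \<forall>t\<in>{0..T}. \<forall>z x. \<bar>v t x\<bar> \<le> B" by metis
next
  fix t0 z0 e :: real assume "0 \<le> t0" "e > 0"
  then obtain \<rho> where r: "\<rho> > 0" "\<And>t s x y. t \<in> {0..t0 + 1} \<Longrightarrow> s \<in> {0..t0 + 1} \<Longrightarrow> \<bar>t - s\<bar> < \<rho> \<Longrightarrow> \<bar>x - y\<bar> < \<rho> \<Longrightarrow> \<bar>v t x - v s y\<bar> \<le> e"
    using unif_cont[of "t0 + 1" e] by auto
  show "\<exists>d>0. \<forall>t\<ge>0. \<forall>z x. \<bar>t - t0\<bar> < d \<longrightarrow> \<bar>z - z0\<bar> < d \<longrightarrow> \<bar>v t x - v t0 x\<bar> \<le> e"
    by (rule exI[of _ "min \<rho> 1"]) (use r \<open>0 \<le> t0\<close> in auto)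
qed (rule v_cont)

lemma nice_translate:
  assumes c: "continuous_on UNIV g" and b: "\<And>y. \<bar>g y\<bar> \<le> B" and l: "\<And>a b. \<bar>g a - g b\<bar> \<le> L * \<bar>a - b\<bar>"
  shows "nice (\<lambda>t z x. g (x - z))"
  unfolding nice_def
proof (intro conjI allI impI)
  show "continuous_on UNIV (\<lambda>x. g (x - z))" for z
    by (intro continuous_on_compose2[OF c] continuous_intros) auto
  show "\<exists>B. \<forall>t\<in>{0..T}. \<forall>z x. \<bar>g (x - z)\<bar> \<le> B" for T :: real using b by blast
  fix t0 z0 e :: real assume e: "e > 0"
  show "\<exists>d>0. \<forall>t\<ge>0. \<forall>z x. \<bar>t - t0\<bar> < d \<longrightarrow> \<bar>z - z0\<bar> < d \<longrightarrow> \<bar>g (x - z) - g (x - z0)\<bar> \<le> e"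
  proof (intro exI[of _ "e / (\<bar>L\<bar> + 1)"] conjI allI impI)
    fix t z x :: real assume z: "\<bar>z - z0\<bar> < e / (\<bar>L\<bar> + 1)"
    have "\<bar>g (x - z) - g (x - z0)\<bar> \<le> L * \<bar>z - z0\<bar>" using l[of "x - z" "x - z0"] by (simp add: abs_minus_commute)
    also have "\<dots> \<le> (\<bar>L\<bar> + 1) * \<bar>z - z0\<bar>" by (intro mult_right_mono) auto
    also have "\<dots> \<le> (\<bar>L\<bar> + 1) * (e / (\<bar>L\<bar> + 1))" using z by (intro mult_left_mono) auto
    also have "\<dots> = e" by (simp add: add_pos_nonneg[THEN less_imp_neq, symmetric] nonzero_eq_divide_eq)
    finally show "\<bar>g (x - z) - g (x - z0)\<bar> \<le> e" .
  qed (use e in auto)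
qed

lemma nice_mult: assumes f: "nice f" and g: "nice g" shows "nice (\<lambda>t z x. f t z x * g t z x)"
  unfolding nice_def
proof (intro conjI allI impI)
  show "continuous_on UNIV (\<lambda>x. f t z x * g t z x)" if "t \<ge> 0" for t z
    by (intro continuous_intros niceD(1)[OF f that] niceD(1)[OF g that])
  fix T :: real assume T: "T > 0"
  obtain Bf Bg where B: "\<forall>t\<in>{0..T}. \<forall>z x. \<bar>f t z x\<bar> \<le> Bf" "\<forall>t\<in>{0..T}. \<forall>z x. \<bar>g t z x\<bar> \<le> Bg"
    using niceD(2)[OF f T] niceD(2)[OF g T] by blast
  have "\<forall>t\<in>{0..T}. \<forall>z x. \<bar>f t z x * g t z x\<bar> \<le> \<bar>Bf\<bar> * \<bar>Bg\<bar>"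
  proof (intro ballI allI)
    fix t z x assume "t \<in> {0..T}"
    then have "\<bar>f t z x\<bar> \<le> Bf" "\<bar>g t z x\<bar> \<le> Bg" using B by auto
    then show "\<bar>f t z x * g t z x\<bar> \<le> \<bar>Bf\<bar> * \<bar>Bg\<bar>" unfolding abs_mult by (intro mult_mono) linarith+
  qed
  then show "\<exists>B. \<forall>t\<in>{0..T}. \<forall>z x. \<bar>f t z x * g t z x\<bar> \<le> B" by blast
next
  fix t0 z0 e :: real assume t0: "t0 \<ge> 0" and e: "e > 0"
  obtain Bf where Bf: "Bf \<ge> 0" "\<And>z x. \<bar>f t0 z x\<bar> \<le> Bf" by (rule nice_bound[OF f t0]) (rule that)
  obtain Bg where Bg: "Bg \<ge> 0" "\<And>z x. \<bar>g t0 z x\<bar> \<le> Bg" by (rule nice_bound[OF g t0]) (rule that)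
  \<comment> \<open>The cap 1 absorbs the product of the two errors, which is then at most
    e'.\<close>
  define e' where "e' = min 1 (e / (Bf + Bg + 1))"
  have pos: "Bf + Bg + 1 > 0" using Bf Bg by simp
  have "e' \<le> e / (Bf + Bg + 1)" by (simp add: e'_def)
  then have e': "e' > 0" "e' \<le> 1" "e' * (Bf + Bg + 1) \<le> e"
    using e pos unfolding pos_le_divide_eq[OF pos] by (auto simp: e'_def)
  obtain d1 where d1: "d1 > 0" "\<forall>t\<ge>0. \<forall>z x. \<bar>t - t0\<bar> < d1 \<longrightarrow> \<bar>z - z0\<bar> < d1 \<longrightarrow> \<bar>f t z x - f t0 z0 x\<bar> \<le> e'"
    using niceD(3)[OF f t0 e'(1)] by blast
  obtain d2 where d2: "d2 > 0" "\<forall>t\<ge>0. \<forall>z x. \<bar>t - t0\<bar> < d2 \<longrightarrow> \<bar>z - z0\<bar> < d2 \<longrightarrow> \<bar>g t z x - g t0 z0 x\<bar> \<le> e'"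
    using niceD(3)[OF g t0 e'(1)] by blast
  show "\<exists>d>0. \<forall>t\<ge>0. \<forall>z x. \<bar>t - t0\<bar> < d \<longrightarrow> \<bar>z - z0\<bar> < d \<longrightarrow> \<bar>f t z x * g t z x - f t0 z0 x * g t0 z0 x\<bar> \<le> e"
  proof (intro exI[of _ "min d1 d2"] conjI allI impI)
    fix t z x assume *: "t \<ge> 0" "\<bar>t - t0\<bar> < min d1 d2" "\<bar>z - z0\<bar> < min d1 d2"
    define a where "a = f t z x - f t0 z0 x"
    define b where "b = g t z x - g t0 z0 x"
    have ab: "\<bar>a\<bar> \<le> e'" "\<bar>b\<bar> \<le> e'" using d1 d2 * by (auto simp: a_def b_def)
    have "f t z x * g t z x - f t0 z0 x * g t0 z0 x = f t0 z0 x * b + a * g t0 z0 x + a * b"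
      by (simp add: a_def b_def algebra_simps)
    also have "\<bar>\<dots>\<bar> \<le> \<bar>f t0 z0 x * b\<bar> + \<bar>a * g t0 z0 x\<bar> + \<bar>a * b\<bar>" by linarith
    also have "\<dots> \<le> Bf * e' + e' * Bg + e' * 1"
      unfolding abs_mult using ab Bf Bg e' by (intro add_mono mult_mono) auto
    also have "\<dots> \<le> e" using e'(3) by (simp add: algebra_simps)
    finally show "\<bar>f t z x * g t z x - f t0 z0 x * g t0 z0 x\<bar> \<le> e" .
  qed (use d1 d2 in auto)
qed

lemma nice_scaled: assumes "\<delta> > 0"
  shows "nice (\<lambda>t z x. Sd \<delta> (x - z))" "nice (\<lambda>t z x. bd \<delta> (x - z))" "nice (\<lambda>t z x. bd' \<delta> (x - z))"
proof -
  have "\<bar>Sd \<delta> y\<bar> \<le> 1" for y using scaled_bounds(1,2)[OF assms] by auto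
  then show "nice (\<lambda>t z x. Sd \<delta> (x - z))"
    by (intro nice_translate[of "Sd \<delta>" 1 "M / \<delta>"] scaled_continuous lipschitz_scaled assms)
  show "nice (\<lambda>t z x. bd \<delta> (x - z))" "nice (\<lambda>t z x. bd' \<delta> (x - z))"
    by (rule nice_translate[OF scaled_continuous(2) scaled_bounds(4) lipschitz_scaled(2)], (rule assms)+)
       (rule nice_translate[OF scaled_continuous(3) scaled_bounds(5) lipschitz_scaled(3)], (rule assms)+)
qed

definition m where "m t = measure (\<nu> t) UNIV"

lemma nice_integrable: assumes "nice f" "t \<ge> 0" shows "integrable (\<nu> t) (f t z)"
proof -
  interpret finite_measure "\<nu> t" by (rule finite_\<nu>[OF assms(2)])
  obtain B where "B \<ge> 0" and B: "\<And>z x. \<bar>f t z x\<bar> \<le> B" by (rule nice_bound[OF assms]) (rule that)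
  show ?thesis using B nice_meas[OF assms, of z] meas_\<nu>[OF assms(2)]
    by (intro integrable_const_bound[of _ B]) auto
qed

lemma integral_abs_le:
  assumes t: "t \<ge> 0" and f: "f \<in> borel_measurable borel" and b: "\<And>x. \<bar>f x\<bar> \<le> B"
  shows "\<bar>\<integral>x. f x \<partial>(\<nu> t)\<bar> \<le> B * m t"
proof -
  interpret finite_measure "\<nu> t" by (rule finite_\<nu>[OF t])
  have i: "integrable (\<nu> t) f" using b f meas_\<nu>[OF t] by (intro integrable_const_bound[of _ B]) auto
  have "\<bar>\<integral>x. f x \<partial>(\<nu> t)\<bar> \<le> (\<integral>x. \<bar>f x\<bar> \<partial>(\<nu> t))" by (rule integral_abs_bound)
  also have "\<dots> \<le> (\<integral>x. B \<partial>(\<nu> t))" using i b by (intro integral_mono) auto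
  finally show ?thesis using space_\<nu>[OF t] by (simp add: m_def mult.commute)
qed

lemma m_cont: "continuous_on {0..} m"
proof -
  have "continuous_on {0..} (\<lambda>t. \<integral>x. (1::real) \<partial>(\<nu> t))" by (rule weak_cont_\<nu>) auto
  then show ?thesis by (rule continuous_on_eq) (simp add: m_def space_\<nu>)
qed

lemma m_nonneg: "0 \<le> m t" by (simp add: m_def)

text \<open>Replacing f t z by the fixed integrand f t0 z0 costs a uniform error times the mass,
  which stays below m t0 + 1 near t0; for the fixed integrand weak continuity of the measures
  applies.\<close>

lemma nice_joint:
  assumes f: "nice f"
  shows "continuous_on ({0..} \<times> UNIV) (\<lambda>(t, z). \<integral>x. f t z x \<partial>(\<nu> t))"
  unfolding continuous_on_iff
proof (intro ballI allI impI)
  fix p :: "real \<times> real" and e :: real assume p: "p \<in> {0..} \<times> UNIV" and e: "0 < e"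
  obtain t0 z0 where p0: "p = (t0, z0)" "t0 \<ge> 0" using p by (cases p) auto
  obtain d1 where d1: "d1 > 0" "\<And>t. t \<in> {0..} \<Longrightarrow> dist t t0 < d1 \<Longrightarrow> dist (m t) (m t0) < 1"
    using m_cont[unfolded continuous_on_iff, rule_format, of t0 1] p0 by auto
  define e1 where "e1 = (e / 2) / (m t0 + 1)"
  have mp: "m t0 + 1 > 0" using m_nonneg[of t0] by simp
  then have ne: "m t0 + 1 \<noteq> 0" by simp
  have e1: "e1 > 0" using e mp by (simp add: e1_def)
  have e1m: "e1 * (m t0 + 1) = e / 2"
    unfolding e1_def by (rule nonzero_eq_divide_eq[THEN iffD1, OF ne refl])
  obtain d2 where d2: "d2 > 0" "\<forall>t\<ge>0. \<forall>z x. \<bar>t - t0\<bar> < d2 \<longrightarrow> \<bar>z - z0\<bar> < d2 \<longrightarrow> \<bar>f t z x - f t0 z0 x\<bar> \<le> e1"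
    using niceD(3)[OF f p0(2) e1] by blast
  obtain B where "B \<ge> 0" and B: "\<And>z x. \<bar>f t0 z x\<bar> \<le> B" by (rule nice_bound[OF f p0(2)]) (rule that)
  have "bounded (range (f t0 z0))" unfolding bounded_iff using B by (intro exI[of _ B]) auto
  note wc = weak_cont_\<nu>[OF niceD(1)[OF f p0(2)] this]
  obtain d3 where d3: "d3 > 0" "\<And>t. t \<in> {0..} \<Longrightarrow> dist t t0 < d3 \<Longrightarrow> dist (\<integral>x. f t0 z0 x \<partial>(\<nu> t)) (\<integral>x. f t0 z0 x \<partial>(\<nu> t0)) < e / 2"
    using wc[unfolded continuous_on_iff, rule_format, of t0 "e / 2"] e p0(2) by auto
  show "\<exists>d>0. \<forall>p'\<in>{0..} \<times> UNIV. dist p' p < d \<longrightarrow>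
     dist (case p' of (t, z) \<Rightarrow> \<integral>x. f t z x \<partial>(\<nu> t)) (case p of (t, z) \<Rightarrow> \<integral>x. f t z x \<partial>(\<nu> t)) < e"
  proof (intro exI[of _ "Min {d1, d2, d3}"] conjI ballI impI)
    fix p' :: "real \<times> real" assume p': "p' \<in> {0..} \<times> UNIV" and d: "dist p' p < Min {d1, d2, d3}"
    obtain t z where pt: "p' = (t, z)" "t \<ge> 0" using p' by (cases p') auto
    have dt: "dist t t0 < d1" "dist t t0 < d2" "dist t t0 < d3" "dist z z0 < d2"
      using d dist_fst_le[of p' p] dist_snd_le[of p' p] by (auto simp: pt p0)
    have i0: "integrable (\<nu> t) (f t0 z0)"
    proof -
      interpret finite_measure "\<nu> t" by (rule finite_\<nu>[OF pt(2)])
      show ?thesis using B nice_meas[OF f p0(2), of z0] meas_\<nu>[OF pt(2)]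
        by (intro integrable_const_bound[of _ B]) auto
    qed
    have "\<bar>(\<integral>x. f t z x \<partial>(\<nu> t)) - (\<integral>x. f t0 z0 x \<partial>(\<nu> t))\<bar> = \<bar>\<integral>x. f t z x - f t0 z0 x \<partial>(\<nu> t)\<bar>"
      using nice_integrable[OF f pt(2)] i0 by simp
    also have "\<dots> \<le> e1 * m t"
      using d2 dt pt by (intro integral_abs_le borel_measurable_diff nice_meas[OF f] p0(2)) (auto simp: dist_real_def)
    also have "\<dots> \<le> e1 * (m t0 + 1)" using d1(2)[of t] dt pt e1 by (intro mult_left_mono) (auto simp: dist_real_def)
    finally have "\<bar>(\<integral>x. f t z x \<partial>(\<nu> t)) - (\<integral>x. f t0 z0 x \<partial>(\<nu> t))\<bar> \<le> e / 2" unfolding e1m .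
    moreover have "\<bar>(\<integral>x. f t0 z0 x \<partial>(\<nu> t)) - (\<integral>x. f t0 z0 x \<partial>(\<nu> t0))\<bar> < e / 2"
      using d3(2)[of t] dt pt by (simp add: dist_real_def)
    ultimately show "dist (case p' of (t, z) \<Rightarrow> \<integral>x. f t z x \<partial>(\<nu> t)) (case p of (t, z) \<Rightarrow> \<integral>x. f t z x \<partial>(\<nu> t)) < e"
      unfolding pt p0 dist_real_def prod.case by linarith
  qed (use d1 d2 d3 in auto)
qed

lemma nice_time:
  assumes f: "nice f" shows "continuous_on {0..} (\<lambda>t. \<integral>x. f t z x \<partial>(\<nu> t))"
proof -
  have "continuous_on {0..} (\<lambda>t. (\<lambda>(t, z). \<integral>x. f t z x \<partial>(\<nu> t)) (t, z))"
    by (rule continuous_on_compose2[OF nice_joint[OF f]]) (auto intro!: continuous_intros)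
  then show ?thesis by simp
qed

text \<open>Tests with products of a time cut-off and \<psi>. As both sides are continuous in time,
  collapsing the cut-off gives the balance at every t and not only almost every one.\<close>

lemma weak_energy_eq:
  assumes \<psi>: "smooth1 \<psi>" and z: "\<And>x. \<bar>x\<bar> > r \<Longrightarrow> \<psi> x = 0"
    and n1: "nice (\<lambda>t z x. \<psi> x)" and n2: "nice (\<lambda>t z x. v t x * deriv \<psi> x)" and t: "0 \<le> t"
  shows "(\<integral>x. \<psi> x \<partial>(\<nu> t)) - (\<integral>x. \<psi> x \<partial>(\<nu> 0)) = integral {0..t} (\<lambda>s. \<integral>x. v s x * deriv \<psi> x \<partial>(\<nu> s))"
proof (rule time_integrated[OF _ _ _ t])
  show "continuous_on {0..} (\<lambda>t. \<integral>x. \<psi> x \<partial>(\<nu> t))" "continuous_on {0..} (\<lambda>s. \<integral>x. v s x * deriv \<psi> x \<partial>(\<nu> s))"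
    by (rule nice_time[OF n1], rule nice_time[OF n2])
  fix \<epsilon> \<tau> :: real assume e: "0 < \<epsilon>" "\<epsilon> < \<tau>"
  define \<phi> where "\<phi> p = \<theta> \<epsilon> \<tau> (fst p) * \<psi> (snd p)" for p :: "real \<times> real"
  have tf: "test_fun \<phi>" unfolding \<phi>_def[abs_def]
    by (rule test_fun_tensor[OF smooth_\<theta> \<psi>, of "max r (11 + \<tau> + \<epsilon>)"]) (use z \<theta>_facts(3)[OF e] in auto)
  have pd: "pdt \<phi> = (\<lambda>p. deriv (\<theta> \<epsilon> \<tau>) (fst p) * \<psi> (snd p))" "pdx \<phi> = (\<lambda>p. \<theta> \<epsilon> \<tau> (fst p) * deriv \<psi> (snd p))"
    unfolding \<phi>_def[abs_def] by (rule pd_tensor[OF smooth_\<theta> \<psi>])+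
  have "(LINT t:{0..}|lborel. \<integral>x. pdt \<phi> (t, x) + v t x * pdx \<phi> (t, x) \<partial>(\<nu> t)) = - (\<integral>x. \<phi> (0, x) \<partial>(\<nu> 0))"
    by (rule sol_energy[OF tf])
  moreover have "(\<integral>x. \<phi> (0, x) \<partial>(\<nu> 0)) = (\<integral>x. \<psi> x \<partial>(\<nu> 0))" using \<theta>_facts(1)[OF e] by (simp add: \<phi>_def)
  moreover have "(LINT t:{0..}|lborel. \<integral>x. pdt \<phi> (t, x) + v t x * pdx \<phi> (t, x) \<partial>(\<nu> t))
     = (LINT t:{0..}|lborel. deriv (\<theta> \<epsilon> \<tau>) t * (\<integral>x. \<psi> x \<partial>(\<nu> t)) + \<theta> \<epsilon> \<tau> t * (\<integral>x. v t x * deriv \<psi> x \<partial>(\<nu> t)))"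
  proof (rule set_lebesgue_integral_cong)
    show "\<forall>t. t \<in> {0..} \<longrightarrow> (\<integral>x. pdt \<phi> (t, x) + v t x * pdx \<phi> (t, x) \<partial>(\<nu> t))
      = deriv (\<theta> \<epsilon> \<tau>) t * (\<integral>x. \<psi> x \<partial>(\<nu> t)) + \<theta> \<epsilon> \<tau> t * (\<integral>x. v t x * deriv \<psi> x \<partial>(\<nu> t))"
    proof (intro allI impI)
      fix t :: real assume "t \<in> {0..}"
      then have t: "t \<ge> 0" by simp
      have "(\<integral>x. pdt \<phi> (t, x) + v t x * pdx \<phi> (t, x) \<partial>(\<nu> t)) = (\<integral>x. deriv (\<theta> \<epsilon> \<tau>) t * \<psi> x + \<theta> \<epsilon> \<tau> t * (v t x * deriv \<psi> x) \<partial>(\<nu> t))"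
        unfolding pd by (intro Bochner_Integration.integral_cong refl) (simp add: mult_ac)
      also have "\<dots> = deriv (\<theta> \<epsilon> \<tau>) t * (\<integral>x. \<psi> x \<partial>(\<nu> t)) + \<theta> \<epsilon> \<tau> t * (\<integral>x. v t x * deriv \<psi> x \<partial>(\<nu> t))"
        using nice_integrable[OF n1 t] nice_integrable[OF n2 t] by simp
      finally show "(\<integral>x. pdt \<phi> (t, x) + v t x * pdx \<phi> (t, x) \<partial>(\<nu> t))
      = deriv (\<theta> \<epsilon> \<tau>) t * (\<integral>x. \<psi> x \<partial>(\<nu> t)) + \<theta> \<epsilon> \<tau> t * (\<integral>x. v t x * deriv \<psi> x \<partial>(\<nu> t))" .
    qed
  qed simp
  ultimately show "(LINT t:{0..}|lborel. deriv (\<theta> \<epsilon> \<tau>) t * (\<integral>x. \<psi> x \<partial>(\<nu> t)) + \<theta> \<epsilon> \<tau> t * (\<integral>x. v t x * deriv \<psi> x \<partial>(\<nu> t)))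
    = - (\<integral>x. \<psi> x \<partial>(\<nu> 0))" by simp
qed

section \<open>Balance of the smoothed energy to the right of a point\<close>

definition J where "J \<delta> t z = (\<integral>x. Sd \<delta> (x - z) \<partial>(\<nu> t))"
text \<open>The energy flux through the smoothing layer around z, which will be the time derivative
  of J at fixed z.\<close>

definition k where "k \<delta> t z = (\<integral>x. v t x * bd \<delta> (x - z) \<partial>(\<nu> t))"

lemma nice_k: "\<delta> > 0 \<Longrightarrow> nice (\<lambda>t z x. v t x * bd \<delta> (x - z))"
  by (intro nice_mult nice_v nice_scaled)

lemma k_time_cont: "\<delta> > 0 \<Longrightarrow> continuous_on {0..} (\<lambda>t. k \<delta> t z)"
  unfolding k_def by (rule nice_time[OF nice_k])

text \<open>Freezing the parameter makes a translate with fixed centre admissible where the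
  integrand is to depend on x alone.\<close>

lemma nice_fix: assumes f: "nice f" shows "nice (\<lambda>t z' x. f t z x)"
  unfolding nice_def
proof (intro conjI allI impI)
  show "continuous_on UNIV (f t z)" if "t \<ge> 0" for t by (rule niceD(1)[OF f that])
  fix T :: real assume T: "T > 0"
  obtain B where "\<forall>t\<in>{0..T}. \<forall>z x. \<bar>f t z x\<bar> \<le> B" using niceD(2)[OF f T] by (elim exE)
  then have "\<forall>t\<in>{0..T}. \<forall>z' x. \<bar>f t z x\<bar> \<le> B" by simp
  then show "\<exists>B. \<forall>t\<in>{0..T}. \<forall>z' x. \<bar>f t z x\<bar> \<le> B" by (rule exI)
next
  fix t0 z0 e :: real assume t0: "t0 \<ge> 0" and e: "e > 0"
  obtain d where d: "d > 0" "\<forall>t\<ge>0. \<forall>z' x. \<bar>t - t0\<bar> < d \<longrightarrow> \<bar>z' - z\<bar> < d \<longrightarrow> \<bar>f t z' x - f t0 z x\<bar> \<le> e"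
    using niceD(3)[OF f t0 e, of z] by (elim exE conjE)
  show "\<exists>d>0. \<forall>t\<ge>0. \<forall>z' x. \<bar>t - t0\<bar> < d \<longrightarrow> \<bar>z' - z0\<bar> < d \<longrightarrow> \<bar>f t z x - f t0 z x\<bar> \<le> e"
  proof (rule exI[of _ d], intro conjI allI impI d(1))
    fix t z' x assume "t \<ge> 0" "\<bar>t - t0\<bar> < d"
    then show "\<bar>f t z x - f t0 z x\<bar> \<le> e" using d(2)[rule_format, of t z x] d(1) by simp
  qed
qed

lemma nice_lincomb: assumes f: "nice f" and g: "nice g" shows "nice (\<lambda>t z x. f t z x - g t z x)"
  unfolding nice_def
proof (intro conjI allI impI)
  show "continuous_on UNIV (\<lambda>x. f t z x - g t z x)" if "t \<ge> 0" for t z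
    by (intro continuous_intros niceD(1)[OF f that] niceD(1)[OF g that])
  fix T :: real assume T: "T > 0"
  obtain Bf Bg where B: "\<forall>t\<in>{0..T}. \<forall>z x. \<bar>f t z x\<bar> \<le> Bf" "\<forall>t\<in>{0..T}. \<forall>z x. \<bar>g t z x\<bar> \<le> Bg"
    using niceD(2)[OF f T] niceD(2)[OF g T] by blast
  have "\<forall>t\<in>{0..T}. \<forall>z x. \<bar>f t z x - g t z x\<bar> \<le> Bf + Bg"
  proof (intro ballI allI)
    fix t z x assume "t \<in> {0..T}"
    then have "\<bar>f t z x\<bar> \<le> Bf" "\<bar>g t z x\<bar> \<le> Bg" using B by auto
    then show "\<bar>f t z x - g t z x\<bar> \<le> Bf + Bg" by linarith
  qed
  then show "\<exists>B. \<forall>t\<in>{0..T}. \<forall>z x. \<bar>f t z x - g t z x\<bar> \<le> B" by blast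
next
  fix t0 z0 e :: real assume t0: "t0 \<ge> 0" and e: "e > 0"
  obtain d1 where d1: "d1 > 0" "\<forall>t\<ge>0. \<forall>z x. \<bar>t - t0\<bar> < d1 \<longrightarrow> \<bar>z - z0\<bar> < d1 \<longrightarrow> \<bar>f t z x - f t0 z0 x\<bar> \<le> e / 2"
    using niceD(3)[OF f t0 half_gt_zero[OF e]] by blast
  obtain d2 where d2: "d2 > 0" "\<forall>t\<ge>0. \<forall>z x. \<bar>t - t0\<bar> < d2 \<longrightarrow> \<bar>z - z0\<bar> < d2 \<longrightarrow> \<bar>g t z x - g t0 z0 x\<bar> \<le> e / 2"
    using niceD(3)[OF g t0 half_gt_zero[OF e]] by blast
  show "\<exists>d>0. \<forall>t\<ge>0. \<forall>z x. \<bar>t - t0\<bar> < d \<longrightarrow> \<bar>z - z0\<bar> < d \<longrightarrow> \<bar>f t z x - g t z x - (f t0 z0 x - g t0 z0 x)\<bar> \<le> e"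
  proof (intro exI[of _ "min d1 d2"] conjI allI impI)
    fix t z x assume *: "t \<ge> 0" "\<bar>t - t0\<bar> < min d1 d2" "\<bar>z - z0\<bar> < min d1 d2"
    then have "\<bar>f t z x - f t0 z0 x\<bar> \<le> e / 2" "\<bar>g t z x - g t0 z0 x\<bar> \<le> e / 2" using d1 d2 by auto
    then show "\<bar>f t z x - g t z x - (f t0 z0 x - g t0 z0 x)\<bar> \<le> e" by linarith
  qed (use d1 d2 in auto)
qed

text \<open>A single step is not compactly supported. Subtracting a step at R makes it so, at the
  price of a flux at R that disappears as R tends to infinity.\<close>

lemma J_evolution_cutoff:
  assumes \<delta>: "\<delta> > 0" and t: "0 \<le> t"
  shows "(J \<delta> t z - J 1 t R) - (J \<delta> 0 z - J 1 0 R) = integral {0..t} (\<lambda>s. k \<delta> s z - k 1 s R)"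
proof -
  let ?\<psi> = "\<lambda>x. Sd \<delta> (x - z) - Sd 1 (x - R)"
  have one: "(1::real) > 0" by simp
  have d: "deriv ?\<psi> = (\<lambda>x. bd \<delta> (x - z) - bd 1 (x - R))"
    by (intro ext DERIV_imp_deriv DERIV_diff DERIV_translate \<delta> one)
  have n1: "nice (\<lambda>t z' x. ?\<psi> x)"
    using nice_lincomb[OF nice_fix[OF nice_scaled(1)[OF \<delta>]] nice_fix[OF nice_scaled(1)[OF one]]] .
  have nb: "nice (\<lambda>t z' x. v t x * bd \<delta> (x - z))" "nice (\<lambda>t z' x. v t x * bd 1 (x - R))"
    using nice_fix[OF nice_k[OF \<delta>], of z] nice_fix[OF nice_k[OF one], of R] .
  have n2: "nice (\<lambda>t z' x. v t x * deriv ?\<psi> x)"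
    unfolding d right_diff_distrib by (rule nice_lincomb[OF nb])
  have "(\<integral>x. ?\<psi> x \<partial>(\<nu> t)) - (\<integral>x. ?\<psi> x \<partial>(\<nu> 0)) = integral {0..t} (\<lambda>s. \<integral>x. v s x * deriv ?\<psi> x \<partial>(\<nu> s))"
  proof (rule weak_energy_eq[OF _ _ n1 n2 t, of "\<bar>z\<bar> + \<bar>R\<bar> + \<delta> + 1"])
    show "smooth1 ?\<psi>" by (intro smooth1_diff smooth_scaled)
    fix x assume x: "\<bar>x\<bar> > \<bar>z\<bar> + \<bar>R\<bar> + \<delta> + 1"
    show "?\<psi> x = 0"
    proof (cases "x \<ge> 0")
      case True
      then have "x - z \<ge> \<delta>" "x - R \<ge> 1" using x \<delta> by auto
      then show ?thesis using scaled_support(2) \<delta> by simp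
    next
      case False
      then have "x - z \<le> -\<delta>" "x - R \<le> -1" using x \<delta> by auto
      then show ?thesis using scaled_support(1) \<delta> by simp
    qed
  qed
  moreover have "(\<integral>x. ?\<psi> x \<partial>(\<nu> s)) = J \<delta> s z - J 1 s R" if "s \<ge> 0" for s
    unfolding J_def using nice_integrable[OF nice_scaled(1)[OF \<delta>] that] nice_integrable[OF nice_scaled(1)[OF one] that] by simp
  moreover have "integral {0..t} (\<lambda>s. \<integral>x. v s x * deriv ?\<psi> x \<partial>(\<nu> s)) = integral {0..t} (\<lambda>s. k \<delta> s z - k 1 s R)"
  proof (rule Henstock_Kurzweil_Integration.integral_cong)
    fix s assume "s \<in> {0..t}"
    then have s: "s \<ge> 0" by simp
    show "(\<integral>x. v s x * deriv ?\<psi> x \<partial>(\<nu> s)) = k \<delta> s z - k 1 s R"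
      unfolding k_def d right_diff_distrib using nice_integrable[OF nb(1) s] nice_integrable[OF nb(2) s] by simp
  qed
  ultimately show ?thesis using t by simp
qed

text \<open>At each time the unit bump around z n leaves every fixed point, so dominated convergence
  applies first in x and then in time. The absolute value covers both ends of the line.\<close>

lemma flux_vanishes:
  assumes z: "filterlim (\<lambda>n. \<bar>z n\<bar>) at_top sequentially" and t: "0 \<le> t"
  shows "(\<lambda>n. integral {0..t} (\<lambda>s. k 1 s (z n))) \<longlonglongrightarrow> 0"
proof -
  have one: "(1::real) > 0" by simp
  obtain B where B: "B > 0" "\<And>s x. s \<in> {0..t + 1} \<Longrightarrow> \<bar>v s x\<bar> \<le> B" using v_bounded[of "t + 1"] t by auto
  have "bounded (m ` {0..t})"
    by (intro compact_imp_bounded compact_continuous_image compact_Icc continuous_on_subset[OF m_cont]) auto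
  then obtain Mm where "\<forall>x\<in>m ` {0..t}. norm x \<le> Mm" unfolding bounded_iff by blast
  then have Mm: "\<And>s. s \<in> {0..t} \<Longrightarrow> m s \<le> Mm" by (auto dest: abs_le_D1)
  have "(\<lambda>n. integral {0..t} (\<lambda>s. k 1 s (z n))) \<longlonglongrightarrow> integral {0..t} (\<lambda>s. 0)"
  proof (rule dominated_convergence(2)[where h = "\<lambda>s. B * M * Mm"])
    show "(\<lambda>s. k 1 s (z n)) integrable_on {0..t}" for n
      by (intro integrable_continuous_real continuous_on_subset[OF k_time_cont[OF one]]) auto
    show "norm (k 1 s (z n)) \<le> B * M * Mm" if "s \<in> {0..t}" for n s
    proof -
      have "\<bar>k 1 s (z n)\<bar> \<le> B * M * m s" unfolding k_def
      proof (rule integral_abs_le)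
        fix x
        have "\<bar>v s x\<bar> \<le> B" "\<bar>bd 1 (x - z n)\<bar> \<le> M" using B(2)[of s x] that scaled_bounds(4)[OF one, of "x - z n"] by auto
        then show "\<bar>v s x * bd 1 (x - z n)\<bar> \<le> B * M" unfolding abs_mult using B by (intro mult_mono) auto
      qed (use that nice_meas[OF nice_k[OF one], of s "z n"] in auto)
      also have "\<dots> \<le> B * M * Mm" using Mm that B bump_axioms M(1) by (intro mult_left_mono) auto
      finally show ?thesis by simp
    qed
    show "(\<lambda>n. k 1 s (z n)) \<longlonglongrightarrow> 0" if "s \<in> {0..t}" for s
    proof -
      have s: "s \<ge> 0" using that by simp
      interpret finite_measure "\<nu> s" by (rule finite_\<nu>[OF s])
      have "(\<lambda>n. \<integral>x. v s x * bd 1 (x - z n) \<partial>(\<nu> s)) \<longlonglongrightarrow> (\<integral>x. 0 \<partial>(\<nu> s))"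
      proof (rule integral_dominated_convergence[where w = "\<lambda>x. B * M"])
        show "AE x in \<nu> s. (\<lambda>n. v s x * bd 1 (x - z n)) \<longlonglongrightarrow> 0"
        proof (intro AE_I2 tendsto_eventually)
          fix x
          have "\<forall>\<^sub>F n in sequentially. \<bar>x\<bar> + 1 \<le> \<bar>z n\<bar>" using z by (simp add: filterlim_at_top)
          then show "\<forall>\<^sub>F n in sequentially. v s x * bd 1 (x - z n) = 0"
          proof eventually_elim
            fix n assume "\<bar>x\<bar> + 1 \<le> \<bar>z n\<bar>"
            then have "\<bar>x - z n\<bar> \<ge> 1" by linarith
            then show "v s x * bd 1 (x - z n) = 0" using scaled_support(3)[OF one] by simp
          qed
        qed
        show "AE x in \<nu> s. norm (v s x * bd 1 (x - z n)) \<le> B * M" for n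
        proof (intro AE_I2)
          fix x
          have "\<bar>v s x\<bar> \<le> B" "\<bar>bd 1 (x - z n)\<bar> \<le> M" using B(2)[of s x] that scaled_bounds(4)[OF one, of "x - z n"] by auto
          then show "norm (v s x * bd 1 (x - z n)) \<le> B * M" unfolding real_norm_def abs_mult using B by (intro mult_mono) auto
        qed
      qed (use nice_meas[OF nice_k[OF one] s] meas_\<nu>[OF s] in auto)
      then show ?thesis by (simp add: k_def)
    qed
  qed (rule integrable_const_ivl)
  then show ?thesis by simp
qed

lemma J_limits:
  assumes \<delta>: "\<delta> > 0" and t: "0 \<le> t"
  shows "(\<lambda>n. J \<delta> t (real n)) \<longlonglongrightarrow> 0" "(\<lambda>n. J \<delta> t (- real n)) \<longlonglongrightarrow> m t"
proof -
  interpret finite_measure "\<nu> t" by (rule finite_\<nu>[OF t])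
  note n = nice_meas[OF nice_scaled(1)[OF \<delta>] t]
  have b: "norm (Sd \<delta> y) \<le> 1" for y using scaled_bounds(1,2)[OF \<delta>, of y] by simp
  have "(\<lambda>n. \<integral>x. Sd \<delta> (x - real n) \<partial>(\<nu> t)) \<longlonglongrightarrow> (\<integral>x. 0 \<partial>(\<nu> t))"
  proof (rule integral_dominated_convergence[where w = "\<lambda>x. 1"])
    show "AE x in \<nu> t. (\<lambda>n. Sd \<delta> (x - real n)) \<longlonglongrightarrow> 0"
    proof (intro AE_I2 tendsto_eventually)
      fix x
      have "\<forall>\<^sub>F n in sequentially. x + \<delta> \<le> real n" by (rule eventually_sequentiallyI[of "nat \<lceil>x + \<delta>\<rceil>"]) linarith
      then show "\<forall>\<^sub>F n in sequentially. Sd \<delta> (x - real n) = 0"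
        by eventually_elim (rule scaled_support(1)[OF \<delta>], simp)
    qed
  qed (use n b meas_\<nu>[OF t] in auto)
  then show "(\<lambda>n. J \<delta> t (real n)) \<longlonglongrightarrow> 0" by (simp add: J_def)
  have "(\<lambda>n. \<integral>x. Sd \<delta> (x - (- real n)) \<partial>(\<nu> t)) \<longlonglongrightarrow> (\<integral>x. 1 \<partial>(\<nu> t))"
  proof (rule integral_dominated_convergence[where w = "\<lambda>x. 1"])
    show "AE x in \<nu> t. (\<lambda>n. Sd \<delta> (x - (- real n))) \<longlonglongrightarrow> 1"
    proof (intro AE_I2 tendsto_eventually)
      fix x
      have "\<forall>\<^sub>F n in sequentially. \<delta> - x \<le> real n" by (rule eventually_sequentiallyI[of "nat \<lceil>\<delta> - x\<rceil>"]) linarith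
      then show "\<forall>\<^sub>F n in sequentially. Sd \<delta> (x - (- real n)) = 1"
        by eventually_elim (rule scaled_support(2)[OF \<delta>], simp)
    qed
    show "(\<lambda>x. Sd \<delta> (x - (- real n))) \<in> borel_measurable (\<nu> t)" for n
      using n[of "- real n"] meas_\<nu>[OF t] by simp
  qed (use b in auto)
  then show "(\<lambda>n. J \<delta> t (- real n)) \<longlonglongrightarrow> m t" using space_\<nu>[OF t] by (simp add: J_def m_def)
qed

lemma J_evolution:
  assumes \<delta>: "\<delta> > 0" and t: "0 \<le> t"
  shows "J \<delta> t z - J \<delta> 0 z = integral {0..t} (\<lambda>s. k \<delta> s z)"
proof -
  have one: "(1::real) > 0" by simp
  have i: "(\<lambda>s. k \<delta> s z) integrable_on {0..t}" "(\<lambda>s. k 1 s r) integrable_on {0..t}" for r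
    by (intro integrable_continuous_real continuous_on_subset[OF k_time_cont] \<delta> one, simp)+
  have "(\<lambda>n. (J \<delta> t z - J 1 t (real n)) - (J \<delta> 0 z - J 1 0 (real n))) \<longlonglongrightarrow> (J \<delta> t z - 0) - (J \<delta> 0 z - 0)"
    by (intro tendsto_intros J_limits one t) simp
  moreover have "(\<lambda>n. (J \<delta> t z - J 1 t (real n)) - (J \<delta> 0 z - J 1 0 (real n)))
     = (\<lambda>n. integral {0..t} (\<lambda>s. k \<delta> s z) - integral {0..t} (\<lambda>s. k 1 s (real n)))"
    by (intro ext) (simp add: J_evolution_cutoff[OF \<delta> t] Henstock_Kurzweil_Integration.integral_diff i)
  moreover have "(\<lambda>n. integral {0..t} (\<lambda>s. k \<delta> s z) - integral {0..t} (\<lambda>s. k 1 s (real n))) \<longlonglongrightarrow> integral {0..t} (\<lambda>s. k \<delta> s z) - 0"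
    by (intro tendsto_intros flux_vanishes t) (simp add: filterlim_real_sequentially)
  ultimately show ?thesis using LIMSEQ_unique by fastforce
qed

text \<open>Moving the step to minus infinity turns J into the total mass, while the flux tends to
  0.\<close>

lemma mass_conserved: assumes t: "0 \<le> t" shows "m t = m 0"
proof -
  have one: "(1::real) > 0" by simp
  have "(\<lambda>n. J 1 t (- real n) - J 1 0 (- real n)) \<longlonglongrightarrow> m t - m 0"
    by (intro tendsto_intros J_limits one t) simp
  moreover have "(\<lambda>n. J 1 t (- real n) - J 1 0 (- real n)) \<longlonglongrightarrow> 0"
    unfolding J_evolution[OF one t] by (rule flux_vanishes[OF _ t]) (simp add: filterlim_real_sequentially)
  ultimately show ?thesis using LIMSEQ_unique by fastforce
qed

end

section \<open>Quantile curves are characteristics\<close>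

text \<open>A Taylor estimate from the Lipschitz constant of g' alone, in the form needed for
  differentiating a kernel with respect to its centre.\<close>

lemma translate_remainder:
  fixes g g' :: "real \<Rightarrow> real"
  assumes d: "\<And>y. (g has_real_derivative g' y) (at y)" and l: "\<And>a b. \<bar>g' a - g' b\<bar> \<le> L * \<bar>a - b\<bar>"
  shows "\<bar>g (a - k) - g a + k * g' a\<bar> \<le> L * k\<^sup>2"
proof -
  have "norm ((g (a - k) - (a - k) * g' a) - (g a - a * g' a)) \<le> (L * \<bar>k\<bar>) * norm ((a - k) - a)"
  proof (rule field_differentiable_bound[of "{a - \<bar>k\<bar>..a + \<bar>k\<bar>}" _ "\<lambda>y. g' y - g' a"])
    show "((\<lambda>y. g y - y * g' a) has_field_derivative g' y - g' a) (at y within {a - \<bar>k\<bar>..a + \<bar>k\<bar>})" for y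
      by (rule has_field_derivative_at_within) (auto intro!: derivative_eq_intros d)
    fix y assume "y \<in> {a - \<bar>k\<bar>..a + \<bar>k\<bar>}"
    then have y: "\<bar>y - a\<bar> \<le> \<bar>k\<bar>" by (auto simp: abs_le_iff)
    have "0 \<le> L" using l[of 1 0] abs_ge_zero[of "g' 1 - g' 0"] by simp
    then have "L * \<bar>y - a\<bar> \<le> L * \<bar>k\<bar>" using y by (rule mult_left_mono[rotated])
    then show "norm (g' y - g' a) \<le> L * \<bar>k\<bar>" using l[of y a] by simp
  qed auto
  then show ?thesis by (simp add: algebra_simps power2_eq_square)
qed

text \<open>The factor 3 is the loss incurred in \<open>X_step\<close>, where the smoothing width is
  finally sent to 0.\<close>

lemma le_from_eps:
  fixes a b :: real
  assumes "\<delta>0 > 0" "\<And>\<delta>. 0 < \<delta> \<Longrightarrow> \<delta> < \<delta>0 \<Longrightarrow> a \<le> b + 3 * \<delta>" shows "a \<le> b"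
proof (rule ccontr)
  assume "\<not> a \<le> b"
  then have ab: "a > b" by simp
  define \<delta> where "\<delta> = min (\<delta>0 / 2) ((a - b) / 4)"
  have "0 < \<delta>" "\<delta> < \<delta>0" "\<delta> \<le> (a - b) / 4" using assms(1) ab by (auto simp: \<delta>_def min_def)
  then show False using assms(2)[of \<delta>] ab by simp
qed

context weak_solution
begin

definition F where "F t x = measure (\<nu> t) {..x}"

lemma F_mono: "t \<ge> 0 \<Longrightarrow> x \<le> y \<Longrightarrow> F t x \<le> F t y"
  unfolding F_def by (intro finite_measure.finite_measure_mono[OF finite_\<nu>]) (auto simp: sets_\<nu>)

lemma measure_Ioi: assumes t: "t \<ge> 0" shows "measure (\<nu> t) {x<..} = m 0 - F t x"
proof -
  interpret finite_measure "\<nu> t" by (rule finite_\<nu>[OF t])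
  have "measure (\<nu> t) (UNIV - {..x}) = measure (\<nu> t) UNIV - measure (\<nu> t) {..x}"
    by (rule finite_measure_Diff) (auto simp: sets_\<nu>[OF t])
  moreover have "UNIV - {..x} = {x<..}" by auto
  ultimately show ?thesis using mass_conserved[OF t] by (simp add: F_def m_def)
qed

lemma F_le: "t \<ge> 0 \<Longrightarrow> F t x \<le> m 0"
  using measure_Ioi[of t x] measure_nonneg[of "\<nu> t" "{x<..}"] by simp

text \<open>A step smoothed over \<delta> lies between the sharp steps at distance \<delta>, so
  balances for J can be read as inequalities for F.\<close>

lemma J_bounds:
  assumes t: "t \<ge> 0" and \<delta>: "\<delta> > 0"
  shows "J \<delta> t z \<le> m 0 - F t (z - \<delta>)" "m 0 - F t (z + \<delta>) \<le> J \<delta> t z"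
proof -
  interpret finite_measure "\<nu> t" by (rule finite_\<nu>[OF t])
  have i: "integrable (\<nu> t) (\<lambda>x. Sd \<delta> (x - z))" using nice_integrable[OF nice_scaled(1)[OF \<delta>] t] .
  have ind: "integrable (\<nu> t) (indicator {a<..} :: real \<Rightarrow> real)" "(\<integral>x. indicator {a<..} x \<partial>(\<nu> t)) = m 0 - F t a" for a
    using measure_Ioi[OF t] by (auto simp: sets_\<nu>[OF t] space_\<nu>[OF t] emeasure_eq_measure)
  show "J \<delta> t z \<le> m 0 - F t (z - \<delta>)" unfolding J_def ind(2)[symmetric]
    by (rule integral_mono[OF i ind(1)])
       (use scaled_bounds(2)[OF \<delta>] scaled_support(1)[OF \<delta>] in \<open>auto simp: indicator_def\<close>)
  show "m 0 - F t (z + \<delta>) \<le> J \<delta> t z" unfolding J_def ind(2)[symmetric]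
    by (rule integral_mono[OF ind(1) i])
       (use scaled_bounds(1)[OF \<delta>] scaled_support(2)[OF \<delta>] in \<open>auto simp: indicator_def\<close>)
qed

lemma J_time_DERIV:
  assumes \<delta>: "\<delta> > 0" and t: "t \<in> {0..T}"
  shows "((\<lambda>s. J \<delta> s z) has_real_derivative k \<delta> t z) (at t within {0..T})"
proof -
  have "((\<lambda>s. J \<delta> 0 z + integral {0..s} (\<lambda>s. k \<delta> s z)) has_real_derivative 0 + k \<delta> t z) (at t within {0..T})"
    by (intro DERIV_add DERIV_const integral_has_real_derivative t continuous_on_subset[OF k_time_cont[OF \<delta>]]) auto
  then show ?thesis
  proof (rule has_field_derivative_transform_within[where d = 1, OF _ _ t, THEN back_subst[of "\<lambda>y. (_ has_real_derivative y) _"]])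
    fix s assume "s \<in> {0..T}"
    then show "J \<delta> 0 z + integral {0..s} (\<lambda>s. k \<delta> s z) = J \<delta> s z" using J_evolution[OF \<delta>, of s z] by simp
  qed simp_all
qed

lemma J_space_DERIV:
  assumes \<delta>: "\<delta> > 0" and t: "t \<ge> 0"
  shows "(J \<delta> t has_real_derivative (- (\<integral>x. bd \<delta> (x - z) \<partial>(\<nu> t)))) (at z)"
proof -
  have i: "integrable (\<nu> t) (\<lambda>x. Sd \<delta> (x - z))" "integrable (\<nu> t) (\<lambda>x. bd \<delta> (x - z))" for z
    by (rule nice_integrable[OF nice_scaled(1)[OF \<delta>] t], rule nice_integrable[OF nice_scaled(2)[OF \<delta>] t])
  have "((\<lambda>z. \<integral>x. Sd \<delta> (x - z) \<partial>(\<nu> t)) has_real_derivative (\<integral>x. - bd \<delta> (x - z) \<partial>(\<nu> t))) (at z)"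
  proof (rule integral_param_DERIV[OF finite_\<nu>[OF t], where K = "M / \<delta>\<^sup>2"])
    show "\<bar>Sd \<delta> (x - (z + h)) - Sd \<delta> (x - z) - h * - bd \<delta> (x - z)\<bar> \<le> M / \<delta>\<^sup>2 * h\<^sup>2" for h x
      using translate_remainder[OF DERIV_scaled(1)[OF \<delta>] lipschitz_scaled(2)[OF \<delta>], of "x - z" h]
      by (simp add: algebra_simps)
  qed (use i in auto)
  then show ?thesis unfolding J_def[abs_def] by simp
qed

text \<open>For a moving step, energy passes through the layer only with the relative velocity v -
  x'.\<close>

lemma J_along:
  assumes \<delta>: "\<delta> > 0" and t: "t \<in> {0..T}" and x: "(x has_real_derivative x') (at t within {0..T})"
  shows "((\<lambda>s. J \<delta> s (x s)) has_real_derivative (\<integral>y. (v t y - x') * bd \<delta> (y - x t) \<partial>(\<nu> t))) (at t within {0..T})"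
proof -
  have t0: "t \<ge> 0" using t by simp
  have "((\<lambda>s. J \<delta> s (x s)) has_real_derivative k \<delta> t (x t) + (- (\<integral>y. bd \<delta> (y - x t) \<partial>(\<nu> t))) * x') (at t within {0..T})"
  proof (rule DERIV_along_curve[OF t J_time_DERIV[OF \<delta> t] _ _ x])
    show "(J \<delta> s has_real_derivative (- (\<integral>x. bd \<delta> (x - z) \<partial>(\<nu> s)))) (at z)" if "s \<in> {0..T}" for s z
      by (rule J_space_DERIV[OF \<delta>]) (use that in simp)
    have "continuous_on ({0..} \<times> UNIV) (\<lambda>p. - (case p of (s, z) \<Rightarrow> \<integral>x. bd \<delta> (x - z) \<partial>(\<nu> s)))"
      by (intro continuous_on_minus nice_joint nice_scaled \<delta>)
    then have "continuous_on ({0..T} \<times> UNIV) (\<lambda>p. - (case p of (s, z) \<Rightarrow> \<integral>x. bd \<delta> (x - z) \<partial>(\<nu> s)))"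
      by (rule continuous_on_subset) auto
    then show "continuous_on ({0..T} \<times> UNIV) (\<lambda>(s, z). - (\<integral>x. bd \<delta> (x - z) \<partial>(\<nu> s)))"
      by (simp add: case_prod_unfold)
  qed
  moreover have "k \<delta> t (x t) + (- (\<integral>y. bd \<delta> (y - x t) \<partial>(\<nu> t))) * x' = (\<integral>y. (v t y - x') * bd \<delta> (y - x t) \<partial>(\<nu> t))"
    unfolding k_def left_diff_distrib
    using nice_integrable[OF nice_k[OF \<delta>] t0, of "x t"] nice_integrable[OF nice_scaled(2)[OF \<delta>] t0, of "x t"] by simp
  ultimately show ?thesis by simp
qed

text \<open>If v \<le> c near a line of slope c, no energy crosses it from left to right. The sign
  \<sigma> also covers the reversed inequality, so such lines act as barriers on either
  side.\<close>

lemma J_line: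
  assumes \<delta>: "\<delta> > 0" and st: "0 \<le> s" "s \<le> t" and sg: "\<sigma> = 1 \<or> \<sigma> = -1"
    and le: "\<And>\<tau> x. \<tau> \<in> {s..t} \<Longrightarrow> \<bar>x - (z + c * (\<tau> - s))\<bar> < \<delta> \<Longrightarrow> 0 \<le> \<sigma> * (c - v \<tau> x)"
  shows "0 \<le> \<sigma> * (J \<delta> s z - J \<delta> t (z + c * (t - s)))"
proof -
  let ?x = "\<lambda>\<tau>. z + c * (\<tau> - s)"
  let ?d = "\<lambda>\<tau>. \<integral>y. (v \<tau> y - c) * bd \<delta> (y - ?x \<tau>) \<partial>(\<nu> \<tau>)"
  have "(?d has_integral (J \<delta> t (?x t) - J \<delta> s (?x s))) {s..t}"
  proof (rule fundamental_theorem_of_calculus[OF st(2)])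
    fix \<tau> assume \<tau>: "\<tau> \<in> {s..t}"
    have "((\<lambda>\<tau>. J \<delta> \<tau> (?x \<tau>)) has_real_derivative ?d \<tau>) (at \<tau> within {0..t})"
      using \<tau> st by (intro J_along[OF \<delta>]) (auto intro!: derivative_eq_intros)
    then have "((\<lambda>\<tau>. J \<delta> \<tau> (?x \<tau>)) has_real_derivative ?d \<tau>) (at \<tau> within {s..t})"
      by (rule DERIV_subset) (use st in auto)
    then show "((\<lambda>\<tau>. J \<delta> \<tau> (?x \<tau>)) has_vector_derivative ?d \<tau>) (at \<tau> within {s..t})"
      by (simp add: has_real_derivative_iff_has_vector_derivative)
  qed
  from has_integral_mult_right[OF this, of "- \<sigma>"]
  have "((\<lambda>\<tau>. - \<sigma> * ?d \<tau>) has_integral (\<sigma> * (J \<delta> s z - J \<delta> t (?x t)))) {s..t}" by (simp add: algebra_simps)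
  then show ?thesis
  proof (rule has_integral_nonneg)
    fix \<tau> assume \<tau>: "\<tau> \<in> {s..t}"
    have "- \<sigma> * ?d \<tau> = (\<integral>y. \<sigma> * (c - v \<tau> y) * bd \<delta> (y - ?x \<tau>) \<partial>(\<nu> \<tau>))"
      by (subst integral_mult_right_zero[symmetric]) (simp add: algebra_simps)
    also have "\<dots> \<ge> 0"
    proof (rule Bochner_Integration.integral_nonneg)
      fix y
      show "0 \<le> \<sigma> * (c - v \<tau> y) * bd \<delta> (y - ?x \<tau>)"
        using le[OF \<tau>, of y] scaled_bounds(3)[OF \<delta>, of "y - ?x \<tau>"] scaled_support(3)[OF \<delta>, of "y - ?x \<tau>"]
        by (cases "\<bar>y - ?x \<tau>\<bar> < \<delta>") (auto simp: not_less)
    qed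
    finally show "0 \<le> - \<sigma> * ?d \<tau>" .
  qed
qed

text \<open>The left-continuous quantile function of \<nu> t. At an atom a whole range of levels
  shares one point, so F t (X t \<eta>) may exceed \<eta>.\<close>

definition X where "X t \<eta> = Inf {x. \<eta> \<le> F t x}"

text \<open>Levels strictly between 0 and the total mass make the set nonempty and bounded below;
  right continuity of F makes the infimum a minimum.\<close>

lemma galois_X:
  assumes t: "t \<ge> 0" and \<eta>: "0 < \<eta>" "\<eta> < m 0"
  shows "X t \<eta> \<le> x \<longleftrightarrow> \<eta> \<le> F t x"
proof -
  let ?S = "{x. \<eta> \<le> F t x}"
  note lim = cdf_limits[OF fin[OF t]]
  have mt: "measure (\<nu> t) UNIV = m 0" using mass_conserved[OF t] by (simp add: m_def)
  have "\<forall>\<^sub>F x in at_top. \<eta> < F t x" unfolding F_def by (rule order_tendstoD(1)[OF lim(2)]) (use \<eta> mt in simp)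
  then obtain x1 where "\<eta> < F t x1" by (auto simp: eventually_at_top_linorder)
  then have ne: "?S \<noteq> {}" by (auto intro!: exI[of _ x1])
  have "\<forall>\<^sub>F x in at_bot. F t x < \<eta>" unfolding F_def by (rule order_tendstoD(2)[OF lim(1)]) (use \<eta> in simp)
  then obtain x2 where x2: "F t x2 < \<eta>" by (auto simp: eventually_at_bot_linorder)
  have bd: "bdd_below ?S"
  proof (rule bdd_belowI[of _ x2])
    fix x assume "x \<in> ?S"
    then show "x2 \<le> x" using x2 F_mono[OF t, of x x2] by (cases "x2 \<le> x") auto
  qed
  have "X t \<eta> \<in> ?S"
  proof -
    define s where "s n = X t \<eta> + 1 / real (Suc n)" for n
    have s: "X t \<eta> < s n" for n by (simp add: s_def)
    have lim: "s \<longlonglongrightarrow> X t \<eta>"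
      using tendsto_add[OF tendsto_const[of "X t \<eta>"] LIMSEQ_inverse_real_of_nat] by (simp add: s_def[abs_def] inverse_eq_divide)
    have "(\<lambda>n. F t (s n)) \<longlonglongrightarrow> F t (X t \<eta>)" unfolding F_def by (rule cdf_right_limit[OF fin[OF t] s lim])
    moreover have "\<eta> \<le> F t (s n)" for n
    proof -
      obtain x where "x \<in> ?S" "x < s n" using cInf_lessD[OF ne] s[of n] unfolding X_def by blast
      then show ?thesis using F_mono[OF t, of x "s n"] by auto
    qed
    ultimately show ?thesis using LIMSEQ_le_const by blast
  qed
  then show ?thesis using cInf_lower[OF _ bd, of x] F_mono[OF t, of "X t \<eta>" x] by (auto simp: X_def)
qed

text \<open>Barriers of speed c, started beside X s \<eta>, keep at least \<eta> of the energy on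
  their left in the first case and less than \<eta> in the second. The shifts by multiples of
  \<delta> compensate the smoothing of the steps.\<close>

lemma X_step:
  assumes st: "0 \<le> s" "s \<le> t" and \<eta>: "0 < \<eta>" "\<eta> < m 0" and \<delta>: "\<delta> > 0"
  shows "(\<And>\<tau> x. \<tau> \<in> {s..t} \<Longrightarrow> \<bar>x - X s \<eta>\<bar> \<le> \<bar>c\<bar> * (t - s) + 4 * \<delta> \<Longrightarrow> v \<tau> x \<le> c) \<Longrightarrow> X t \<eta> \<le> X s \<eta> + c * (t - s) + 3 * \<delta>"
    "(\<And>\<tau> x. \<tau> \<in> {s..t} \<Longrightarrow> \<bar>x - X s \<eta>\<bar> \<le> \<bar>c\<bar> * (t - s) + 4 * \<delta> \<Longrightarrow> v \<tau> x \<ge> c) \<Longrightarrow> X s \<eta> + c * (t - s) \<le> X t \<eta> + 3 * \<delta>"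
proof -
  have t0: "t \<ge> 0" using st by simp
  have ct: "\<bar>c * (\<tau> - s)\<bar> \<le> \<bar>c\<bar> * (t - s)" if "\<tau> \<in> {s..t}" for \<tau>
    unfolding abs_mult using that by (intro mult_left_mono) auto
  {
    assume le: "\<And>\<tau> x. \<tau> \<in> {s..t} \<Longrightarrow> \<bar>x - X s \<eta>\<bar> \<le> \<bar>c\<bar> * (t - s) + 4 * \<delta> \<Longrightarrow> v \<tau> x \<le> c"
    \<comment> \<open>The shift puts X s \<eta> at the left edge of the layer, so at most m 0 -
      \<eta> counts as lying to the right.\<close>
    define z where "z = X s \<eta> + \<delta>"
    have line: "0 \<le> 1 * (J \<delta> s z - J \<delta> t (z + c * (t - s)))"
    proof (rule J_line[OF \<delta> st])
      fix \<tau> x assume "\<tau> \<in> {s..t}" "\<bar>x - (z + c * (\<tau> - s))\<bar> < \<delta>"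
      moreover from this have "\<bar>x - X s \<eta>\<bar> \<le> \<bar>c\<bar> * (t - s) + 4 * \<delta>" using ct[of \<tau>] \<delta> unfolding z_def by linarith
      ultimately show "0 \<le> 1 * (c - v \<tau> x)" using le by simp
    qed simp
    have "J \<delta> t (z + c * (t - s)) \<le> J \<delta> s z" using line by simp
    moreover have "J \<delta> s z \<le> m 0 - F s (X s \<eta>)" using J_bounds(1)[OF st(1) \<delta>, of z] by (simp add: z_def)
    moreover have "\<eta> \<le> F s (X s \<eta>)" using galois_X[OF st(1) \<eta>, of "X s \<eta>"] by simp
    moreover have "m 0 - F t (z + c * (t - s) + \<delta>) \<le> J \<delta> t (z + c * (t - s))" by (rule J_bounds(2)[OF t0 \<delta>])
    ultimately have "\<eta> \<le> F t (z + c * (t - s) + \<delta>)" by linarith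
    then have "X t \<eta> \<le> z + c * (t - s) + \<delta>" by (simp add: galois_X[OF t0 \<eta>])
    then show "X t \<eta> \<le> X s \<eta> + c * (t - s) + 3 * \<delta>" using \<delta> by (simp add: z_def)
  next
    assume le: "\<And>\<tau> x. \<tau> \<in> {s..t} \<Longrightarrow> \<bar>x - X s \<eta>\<bar> \<le> \<bar>c\<bar> * (t - s) + 4 * \<delta> \<Longrightarrow> v \<tau> x \<ge> c"
    \<comment> \<open>2 \<delta> instead of \<delta>, because z + \<delta> must lie strictly left of
      X s \<eta> for F to be below \<eta> there.\<close>
    define z where "z = X s \<eta> - 2 * \<delta>"
    have line: "0 \<le> -1 * (J \<delta> s z - J \<delta> t (z + c * (t - s)))"
    proof (rule J_line[OF \<delta> st])
      fix \<tau> x assume "\<tau> \<in> {s..t}" "\<bar>x - (z + c * (\<tau> - s))\<bar> < \<delta>"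
      moreover from this have "\<bar>x - X s \<eta>\<bar> \<le> \<bar>c\<bar> * (t - s) + 4 * \<delta>" using ct[of \<tau>] \<delta> unfolding z_def by linarith
      ultimately show "0 \<le> -1 * (c - v \<tau> x)" using le by simp
    qed simp
    have "J \<delta> s z \<le> J \<delta> t (z + c * (t - s))" using line by simp
    moreover have "m 0 - F s (z + \<delta>) \<le> J \<delta> s z" by (rule J_bounds(2)[OF st(1) \<delta>])
    moreover have "F s (z + \<delta>) < \<eta>" using galois_X[OF st(1) \<eta>, of "z + \<delta>"] \<delta> by (simp add: z_def)
    moreover have "J \<delta> t (z + c * (t - s)) \<le> m 0 - F t (z + c * (t - s) - \<delta>)" by (rule J_bounds(1)[OF t0 \<delta>])
    ultimately have "F t (z + c * (t - s) - \<delta>) < \<eta>" by linarith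
    then have "\<not> X t \<eta> \<le> z + c * (t - s) - \<delta>" by (simp add: galois_X[OF t0 \<eta>])
    then show "X s \<eta> + c * (t - s) \<le> X t \<eta> + 3 * \<delta>" by (simp add: z_def)
  }
qed

text \<open>On the region that the barriers can reach, v is constant up to e, so lines of speed v0 +
  e and v0 - e enclose the curve. That h does not depend on s is what later gives the derivative
  from the left.\<close>

lemma X_increment:
  assumes T: "T > 0" and e: "0 < e" "e \<le> 1" and \<eta>: "0 < \<eta>" "\<eta> < m 0"
  obtains h where "h > 0" "\<And>s t. 0 \<le> s \<Longrightarrow> s \<le> t \<Longrightarrow> t \<le> T \<Longrightarrow> t - s < h \<Longrightarrow> \<bar>X t \<eta> - X s \<eta> - (t - s) * v s (X s \<eta>)\<bar> \<le> e * (t - s)"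
proof -
  obtain B where B: "B > 0" "\<And>t x. t \<in> {0..T} \<Longrightarrow> \<bar>v t x\<bar> \<le> B" by (rule v_bounded[OF T]) (rule that)
  obtain \<rho> where r: "\<rho> > 0" "\<And>t s x y. t \<in> {0..T} \<Longrightarrow> s \<in> {0..T} \<Longrightarrow> \<bar>t - s\<bar> < \<rho> \<Longrightarrow> \<bar>x - y\<bar> < \<rho> \<Longrightarrow> \<bar>v t x - v s y\<bar> \<le> e"
    by (rule unif_cont[OF T e(1)]) (rule that)
  show ?thesis
  \<comment> \<open>B + 2 leaves room for the travel (B + 1) (t - s) of a barrier, whose speed is at
    most B + 1, and for t - s itself.\<close>
  proof (rule that[of "\<rho> / (B + 2)"])
    show "\<rho> / (B + 2) > 0" using r(1) B(1) by simp
    fix s t assume st: "0 \<le> s" "s \<le> t" "t \<le> T" "t - s < \<rho> / (B + 2)"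
    have sB: "(t - s) * (B + 2) < \<rho>" using st(4) B(1) by (simp add: pos_less_divide_eq)
    have ts0: "0 \<le> t - s" using st by simp
    have sB1: "(B + 1) * (t - s) < \<rho>" "t - s < \<rho>"
    proof -
      have "(t - s) * (B + 2) = (B + 1) * (t - s) + (t - s)" by (simp add: algebra_simps)
      moreover have "0 \<le> (B + 1) * (t - s)" using B(1) ts0 by simp
      ultimately show "(B + 1) * (t - s) < \<rho>" "t - s < \<rho>" using sB ts0 by linarith+
    qed
    define v0 where "v0 = v s (X s \<eta>)"
    have v0: "\<bar>v0\<bar> \<le> B" using B(2)[of s] st by (simp add: v0_def)
    \<comment> \<open>Guarantees |c| (t - s) + 4 \<delta> < \<rho> for every \<delta> below
      \<delta>0 and every admissible speed c.\<close>
    define \<delta>0 where "\<delta>0 = (\<rho> - (B + 1) * (t - s)) / 4"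
    have d0: "\<delta>0 > 0" using sB1 by (simp add: \<delta>0_def)
    have near: "\<bar>v \<tau> x - v0\<bar> \<le> e" if "\<tau> \<in> {s..t}" "\<bar>x - X s \<eta>\<bar> \<le> \<bar>c\<bar> * (t - s) + 4 * \<delta>" "\<delta> < \<delta>0" "\<bar>c\<bar> \<le> B + 1" for \<tau> x c \<delta>
    proof -
      have "\<bar>c\<bar> * (t - s) \<le> (B + 1) * (t - s)" using that(4) ts0 by (rule mult_right_mono)
      moreover have "a < \<rho>" if "w \<le> W" "a \<le> w + 4 * \<delta>" "\<delta> < (\<rho> - W) / 4" for a w W using that by simp
      ultimately have "\<bar>x - X s \<eta>\<bar> < \<rho>" using that(2,3) unfolding \<delta>0_def by blast
      then show ?thesis unfolding v0_def using that(1) st sB1(2) by (intro r(2)) auto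
    qed
    have "X t \<eta> \<le> X s \<eta> + (v0 + e) * (t - s)"
    proof (rule le_from_eps[OF d0])
      fix \<delta> assume \<delta>: "0 < \<delta>" "\<delta> < \<delta>0"
      have c: "\<bar>v0 + e\<bar> \<le> B + 1" using v0 e by linarith
      show "X t \<eta> \<le> X s \<eta> + (v0 + e) * (t - s) + 3 * \<delta>"
      proof (rule X_step(1)[OF st(1,2) \<eta> \<delta>(1)])
        fix \<tau> x assume "\<tau> \<in> {s..t}" "\<bar>x - X s \<eta>\<bar> \<le> \<bar>v0 + e\<bar> * (t - s) + 4 * \<delta>"
        from near[OF this \<delta>(2) c] show "v \<tau> x \<le> v0 + e" by linarith
      qed
    qed
    moreover have "X s \<eta> + (v0 - e) * (t - s) \<le> X t \<eta>"
    proof (rule le_from_eps[OF d0])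
      fix \<delta> assume \<delta>: "0 < \<delta>" "\<delta> < \<delta>0"
      have c: "\<bar>v0 - e\<bar> \<le> B + 1" using v0 e by linarith
      show "X s \<eta> + (v0 - e) * (t - s) \<le> X t \<eta> + 3 * \<delta>"
      proof (rule X_step(2)[OF st(1,2) \<eta> \<delta>(1)])
        fix \<tau> x assume "\<tau> \<in> {s..t}" "\<bar>x - X s \<eta>\<bar> \<le> \<bar>v0 - e\<bar> * (t - s) + 4 * \<delta>"
        from near[OF this \<delta>(2) c] show "v \<tau> x \<ge> v0 - e" by linarith
      qed
    qed
    ultimately show "\<bar>X t \<eta> - X s \<eta> - (t - s) * v s (X s \<eta>)\<bar> \<le> e * (t - s)"
      unfolding v0_def[symmetric] by (simp add: abs_le_iff algebra_simps)
  qed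
qed

lemma X_DERIV:
  assumes T: "T > 0" and \<eta>: "0 < \<eta>" "\<eta> < m 0" and t: "t \<in> {0..T}"
  shows "((\<lambda>s. X s \<eta>) has_real_derivative v t (X t \<eta>)) (at t within {0..T})"
  unfolding has_field_derivative_iff Lim_within
proof (intro allI impI)
  fix r :: real assume r: "r > 0"
  define e where "e = min 1 (r / 4)"
  have e: "0 < e" "e \<le> 1" "2 * e < r" using r by (auto simp: e_def min_def)
  obtain h where h: "h > 0" "\<And>s t. 0 \<le> s \<Longrightarrow> s \<le> t \<Longrightarrow> t \<le> T \<Longrightarrow> t - s < h \<Longrightarrow> \<bar>X t \<eta> - X s \<eta> - (t - s) * v s (X s \<eta>)\<bar> \<le> e * (t - s)"
    by (rule X_increment[OF T e(1,2) \<eta>]) (rule that)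
  obtain B where B: "B > 0" "\<And>t x. t \<in> {0..T} \<Longrightarrow> \<bar>v t x\<bar> \<le> B" by (rule v_bounded[OF T]) (rule that)
  obtain \<rho> where rho: "\<rho> > 0" "\<And>t s x y. t \<in> {0..T} \<Longrightarrow> s \<in> {0..T} \<Longrightarrow> \<bar>t - s\<bar> < \<rho> \<Longrightarrow> \<bar>x - y\<bar> < \<rho> \<Longrightarrow> \<bar>v t x - v s y\<bar> \<le> e"
    by (rule unif_cont[OF T e(1)]) (rule that)
  \<comment> \<open>For s < t the increment estimate is anchored at the earlier time s; transferring
    the velocity to time t costs a second e, whence the factor 2.\<close>
  have key: "\<bar>X s \<eta> - X t \<eta> - (s - t) * v t (X t \<eta>)\<bar> \<le> 2 * e * \<bar>s - t\<bar>"
    if s: "s \<in> {0..T}" and d: "\<bar>s - t\<bar> < min h (\<rho> / (B + 2))" for s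
  proof (cases "t \<le> s")
    case True
    have "\<bar>X s \<eta> - X t \<eta> - (s - t) * v t (X t \<eta>)\<bar> \<le> e * (s - t)" using h(2)[of t s] True s t d by auto
    also have "\<dots> \<le> 2 * e * \<bar>s - t\<bar>" using True e by simp
    finally show ?thesis .
  next
    case False
    then have st: "s < t" by simp
    have 1: "\<bar>X t \<eta> - X s \<eta> - (t - s) * v s (X s \<eta>)\<bar> \<le> e * (t - s)" using h(2)[of s t] st s t d by auto
    have sB: "(t - s) * (B + 2) < \<rho>" using d B(1) st by (simp add: pos_less_divide_eq)
    have "\<bar>(t - s) * v s (X s \<eta>)\<bar> \<le> (t - s) * B" unfolding abs_mult using st B(2)[OF s] by simp
    moreover have "e * (t - s) \<le> 1 * (t - s)" using e st by (intro mult_right_mono) auto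
    moreover have "(t - s) * (B + 2) = (t - s) * B + 2 * (t - s)" by (simp add: algebra_simps)
    moreover have tsB: "0 \<le> (t - s) * B" using st B by simp
    ultimately have "\<bar>X t \<eta> - X s \<eta>\<bar> < \<rho>" using 1 sB st by linarith
    moreover have "2 * (t - s) < \<rho>" using sB tsB by (simp add: algebra_simps)
    then have "\<bar>t - s\<bar> < \<rho>" using st by simp
    ultimately have 2: "\<bar>v t (X t \<eta>) - v s (X s \<eta>)\<bar> \<le> e" using rho(2)[OF t s] by blast
    have "X s \<eta> - X t \<eta> - (s - t) * v t (X t \<eta>) = (t - s) * (v t (X t \<eta>) - v s (X s \<eta>)) - (X t \<eta> - X s \<eta> - (t - s) * v s (X s \<eta>))"
      by (simp add: algebra_simps)
    also have "\<bar>\<dots>\<bar> \<le> (t - s) * e + e * (t - s)"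
    proof -
      have "\<bar>(t - s) * (v t (X t \<eta>) - v s (X s \<eta>))\<bar> \<le> (t - s) * e" unfolding abs_mult using 2 st by simp
      then show ?thesis using 1 by linarith
    qed
    finally show ?thesis using st by simp
  qed
  show "\<exists>d>0. \<forall>s\<in>{0..T}. 0 < dist s t \<and> dist s t < d \<longrightarrow> dist ((X s \<eta> - X t \<eta>) / (s - t)) (v t (X t \<eta>)) < r"
  proof (intro exI[of _ "min h (\<rho> / (B + 2))"] conjI ballI impI)
    fix s assume "s \<in> {0..T}" "0 < dist s t \<and> dist s t < min h (\<rho> / (B + 2))"
    then have s: "s \<in> {0..T}" "s \<noteq> t \<and> norm (s - t) < min h (\<rho> / (B + 2))" by (auto simp: dist_real_def)
    have "(X s \<eta> - X t \<eta>) / (s - t) - v t (X t \<eta>) = (X s \<eta> - X t \<eta> - (s - t) * v t (X t \<eta>)) / (s - t)"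
      using s by (simp add: diff_divide_distrib)
    also have "norm \<dots> = \<bar>X s \<eta> - X t \<eta> - (s - t) * v t (X t \<eta>)\<bar> / \<bar>s - t\<bar>" by (simp add: abs_divide)
    also have "\<dots> \<le> 2 * e" using key[OF s(1)] s(2) by (simp add: pos_divide_le_eq)
    also have "\<dots> < r" by (rule e(3))
    finally show "dist ((X s \<eta> - X t \<eta>) / (s - t)) (v t (X t \<eta>)) < r" by (simp add: dist_real_def)
  qed (use h rho B in auto)
qed

section \<open>The velocity along characteristics\<close>

lemma leb_integrable:
  assumes f: "nice f" and t: "t \<ge> 0" and z: "\<And>x. \<bar>x - z\<bar> > \<delta> \<Longrightarrow> f t z x = 0"
  shows "integrable lborel (f t z)"
proof -
  obtain B where "B \<ge> 0" and B: "\<And>z x. \<bar>f t z x\<bar> \<le> B" by (rule nice_bound[OF f t]) (rule that)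
  show ?thesis
  proof (rule integrableI_bounded_set[where A = "{z - \<delta>..z + \<delta>}" and B = B])
    show "AE x in lborel. x \<notin> {z - \<delta>..z + \<delta>} \<longrightarrow> f t z x = 0"
    proof (intro AE_I2 impI)
      fix x assume "x \<notin> {z - \<delta>..z + \<delta>}"
      then have "\<bar>x - z\<bar> > \<delta>" by auto
      then show "f t z x = 0" by (rule z)
    qed
  qed (use B nice_meas[OF f t] in \<open>auto simp: emeasure_lborel_Icc_eq\<close>)
qed

text \<open>The counterpart of \<open>nice_joint\<close> for Lebesgue measure. Its infinite mass is
  compensated by the supports, which stay in one window of length 2 \<delta> + 2 while z moves by
  less than 1.\<close>

lemma leb_joint:
  assumes f: "nice f" and \<delta>: "\<delta> > 0" and z: "\<And>t z x. t \<ge> 0 \<Longrightarrow> \<bar>x - z\<bar> > \<delta> \<Longrightarrow> f t z x = 0"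
  shows "continuous_on ({0..} \<times> UNIV) (\<lambda>(t, z). \<integral>x. f t z x \<partial>lborel)"
  unfolding continuous_on_iff
proof (intro ballI allI impI)
  fix p :: "real \<times> real" and e :: real assume p: "p \<in> {0..} \<times> UNIV" and e: "0 < e"
  obtain t0 z0 where p0: "p = (t0, z0)" "t0 \<ge> 0" using p by (cases p) auto
  define L where "L = 2 * \<delta> + 2"
  have L: "L > 0" using \<delta> by (simp add: L_def)
  define e1 where "e1 = e / 2 / L"
  have e1: "e1 > 0" "e1 * L = e / 2" using e L by (auto simp: e1_def)
  obtain d where d: "d > 0" "\<forall>t\<ge>0. \<forall>z x. \<bar>t - t0\<bar> < d \<longrightarrow> \<bar>z - z0\<bar> < d \<longrightarrow> \<bar>f t z x - f t0 z0 x\<bar> \<le> e1"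
    using niceD(3)[OF f p0(2) e1(1), of z0] by (elim exE conjE)
  show "\<exists>d>0. \<forall>p'\<in>{0..} \<times> UNIV. dist p' p < d \<longrightarrow>
     dist (case p' of (t, z) \<Rightarrow> \<integral>x. f t z x \<partial>lborel) (case p of (t, z) \<Rightarrow> \<integral>x. f t z x \<partial>lborel) < e"
  proof (intro exI[of _ "min d 1"] conjI ballI impI)
    fix p' :: "real \<times> real" assume p': "p' \<in> {0..} \<times> UNIV" and dp: "dist p' p < min d 1"
    obtain t zz where pt: "p' = (t, zz)" "t \<ge> 0" using p' by (cases p') auto
    have dt: "\<bar>t - t0\<bar> < d" "\<bar>zz - z0\<bar> < d" "\<bar>zz - z0\<bar> < 1"
      using dp dist_fst_le[of p' p] dist_snd_le[of p' p] by (auto simp: pt p0 dist_real_def)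
    have i: "integrable lborel (f t zz)" "integrable lborel (f t0 z0)"
      using leb_integrable[OF f pt(2), of \<delta> zz] leb_integrable[OF f p0(2), of \<delta> z0] z pt(2) p0(2) by auto
    have "\<bar>(\<integral>x. f t zz x \<partial>lborel) - (\<integral>x. f t0 z0 x \<partial>lborel)\<bar> = \<bar>\<integral>x. f t zz x - f t0 z0 x \<partial>lborel\<bar>" using i by simp
    also have "\<dots> \<le> (\<integral>x. \<bar>f t zz x - f t0 z0 x\<bar> \<partial>lborel)" by (rule integral_abs_bound)
    also have "\<dots> \<le> (\<integral>x. e1 * indicator {z0 - \<delta> - 1..z0 + \<delta> + 1} x \<partial>lborel)"
    proof (rule integral_mono)
      show "integrable lborel (\<lambda>x. e1 * indicator {z0 - \<delta> - 1..z0 + \<delta> + 1} x)"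
        by (intro integrable_mult_right integrable_real_indicator) (auto simp: emeasure_lborel_Icc_eq)
      fix x
      show "\<bar>f t zz x - f t0 z0 x\<bar> \<le> e1 * indicator {z0 - \<delta> - 1..z0 + \<delta> + 1} x"
      proof (cases "x \<in> {z0 - \<delta> - 1..z0 + \<delta> + 1}")
        case True
        then show ?thesis using d(2) pt(2) dt by simp
      next
        case False
        then have "\<bar>x - zz\<bar> > \<delta>" "\<bar>x - z0\<bar> > \<delta>" using dt(3) by auto
        then show ?thesis using z pt(2) p0(2) e1(1) by simp
      qed
    qed (use i in auto)
    also have "\<dots> = e1 * L" using \<delta> by (simp add: L_def)
    finally show "dist (case p' of (t, z) \<Rightarrow> \<integral>x. f t z x \<partial>lborel) (case p of (t, z) \<Rightarrow> \<integral>x. f t z x \<partial>lborel) < e"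
      unfolding pt p0 dist_real_def prod.case e1(2) using e by linarith
  qed (use d in auto)
qed

lemma leb_time:
  assumes "nice f" "\<delta> > 0" "\<And>t z x. t \<ge> 0 \<Longrightarrow> \<bar>x - z\<bar> > \<delta> \<Longrightarrow> f t z x = 0"
  shows "continuous_on {0..} (\<lambda>t. \<integral>x. f t z x \<partial>lborel)"
proof -
  have "continuous_on {0..} (\<lambda>t. (\<lambda>(t, z). \<integral>x. f t z x \<partial>lborel) (t, z))"
    by (rule continuous_on_compose2[OF leb_joint[OF assms]]) (auto intro!: continuous_intros)
  then show ?thesis by simp
qed

text \<open>One statement for both half planes y < x and x < y, whose sections are the two half
  lines in the source term of the momentum equation.\<close>

lemma kernel_Fubini:
  assumes t: "t \<ge> 0" and \<delta>: "\<delta> > 0" and A: "A \<in> sets (borel \<Otimes>\<^sub>M borel)"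
  shows "integrable lborel (\<lambda>x. bd \<delta> (x - z) * measure (\<nu> t) {y. (x, y) \<in> A})"
    "(\<integral>x. bd \<delta> (x - z) * measure (\<nu> t) {y. (x, y) \<in> A} \<partial>lborel) = (\<integral>y. (\<integral>x. bd \<delta> (x - z) * indicator A (x, y) \<partial>lborel) \<partial>(\<nu> t))"
proof -
  interpret N: finite_measure "\<nu> t" by (rule finite_\<nu>[OF t])
  interpret pair_sigma_finite lborel "\<nu> t" ..
  have sp: "sets (lborel \<Otimes>\<^sub>M \<nu> t) = sets (borel \<Otimes>\<^sub>M borel)" by (intro sets_pair_measure_cong) (auto simp: sets_\<nu>[OF t])
  have mA: "(indicator A :: real \<times> real \<Rightarrow> real) \<in> borel_measurable (lborel \<Otimes>\<^sub>M \<nu> t)"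
    by (intro borel_measurable_indicator) (simp only: sp A)
  have mb: "(\<lambda>p. bd \<delta> (fst p - z)) \<in> borel_measurable (lborel \<Otimes>\<^sub>M \<nu> t)"
    using scaled_measurable(2)[OF \<delta>] by measurable
  have base: "integrable (lborel \<Otimes>\<^sub>M \<nu> t) (\<lambda>p. bd \<delta> (fst p - z))"
  proof (rule Fubini_integrable[OF mb])
    show "integrable lborel (\<lambda>x. \<integral>y. norm (bd \<delta> (fst (x, y) - z)) \<partial>(\<nu> t))"
      using integral_scaled_full(1)[OF \<delta>, of z] by simp
  qed simp
  have i: "integrable (lborel \<Otimes>\<^sub>M \<nu> t) (\<lambda>p. bd \<delta> (fst p - z) * indicator A p)"
    by (rule Bochner_Integration.integrable_bound[OF base borel_measurable_times[OF mb mA]]) (auto simp: indicator_def)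
  have inner: "(\<integral>y. bd \<delta> (x - z) * indicator A (x, y) \<partial>(\<nu> t)) = bd \<delta> (x - z) * measure (\<nu> t) {y. (x, y) \<in> A}" for x
  proof -
    have "(\<integral>y. indicator A (x, y) \<partial>(\<nu> t)) = (\<integral>y. (indicator {y. (x, y) \<in> A} y :: real) \<partial>(\<nu> t))"
      by (intro Bochner_Integration.integral_cong) (auto simp: indicator_def)
    then show ?thesis by (simp add: space_\<nu>[OF t])
  qed
  show "integrable lborel (\<lambda>x. bd \<delta> (x - z) * measure (\<nu> t) {y. (x, y) \<in> A})"
    using integrable_fst'[OF i] by (simp only: fst_conv inner)
  show "(\<integral>x. bd \<delta> (x - z) * measure (\<nu> t) {y. (x, y) \<in> A} \<partial>lborel) = (\<integral>y. (\<integral>x. bd \<delta> (x - z) * indicator A (x, y) \<partial>lborel) \<partial>(\<nu> t))"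
  proof -
    have "integrable (lborel \<Otimes>\<^sub>M \<nu> t) (case_prod (\<lambda>x y. bd \<delta> (x - z) * indicator A (x, y)))"
      using i by (simp add: case_prod_unfold)
    from Fubini_integral[OF this] show ?thesis by (simp only: inner)
  qed
qed

text \<open>Exchanging the order of integration turns the difference of the two masses into the
  \<nu> t-integral of 1 - 2 Sd (y - z).\<close>

lemma kernel_mass_difference:
  assumes t: "t \<ge> 0" and \<delta>: "\<delta> > 0"
  shows "integrable lborel (\<lambda>x. (measure (\<nu> t) {..<x} - measure (\<nu> t) {x<..}) * bd \<delta> (x - z))"
    "(\<integral>x. (measure (\<nu> t) {..<x} - measure (\<nu> t) {x<..}) * bd \<delta> (x - z) \<partial>lborel) = m 0 - 2 * J \<delta> t z"
proof -
  interpret N: finite_measure "\<nu> t" by (rule finite_\<nu>[OF t])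
  define A1 where "A1 = {p :: real \<times> real. snd p < fst p}"
  define A2 where "A2 = {p :: real \<times> real. fst p < snd p}"
  have "{p \<in> space (borel \<Otimes>\<^sub>M borel). snd p < (fst p :: real)} \<in> sets (borel \<Otimes>\<^sub>M borel)"
    "{p \<in> space (borel \<Otimes>\<^sub>M borel). fst p < (snd p :: real)} \<in> sets (borel \<Otimes>\<^sub>M borel)" by measurable
  then have A: "A1 \<in> sets (borel \<Otimes>\<^sub>M borel)" "A2 \<in> sets (borel \<Otimes>\<^sub>M borel)"
    by (simp_all add: A1_def A2_def space_pair_measure)
  have s1: "{y. (x, y) \<in> A1} = {..<x}" "{y. (x, y) \<in> A2} = {x<..}" for x by (auto simp: A1_def A2_def)
  have s2: "indicator A1 (x, y) = (indicator {y<..} x :: real)" "indicator A2 (x, y) = (indicator {..<y} x :: real)" for x y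
    by (auto simp: A1_def A2_def indicator_def)
  note k1 = kernel_Fubini[OF t \<delta> A(1), of z, unfolded s1 s2 integral_scaled_half[OF \<delta>]]
  note k2 = kernel_Fubini[OF t \<delta> A(2), of z, unfolded s1 s2 integral_scaled_half[OF \<delta>]]
  have e: "(measure (\<nu> t) {..<x} - measure (\<nu> t) {x<..}) * bd \<delta> (x - z)
     = bd \<delta> (x - z) * measure (\<nu> t) {..<x} - bd \<delta> (x - z) * measure (\<nu> t) {x<..}" for x by (simp add: algebra_simps)
  show "integrable lborel (\<lambda>x. (measure (\<nu> t) {..<x} - measure (\<nu> t) {x<..}) * bd \<delta> (x - z))"
    unfolding e by (intro Bochner_Integration.integrable_diff k1(1) k2(1))
  have i: "integrable (\<nu> t) (\<lambda>y. Sd \<delta> (y - z))" by (rule nice_integrable[OF nice_scaled(1)[OF \<delta>] t])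
  have "(\<integral>y. 1 - Sd \<delta> (y - z) \<partial>(\<nu> t)) = m 0 - J \<delta> t z"
    using i mass_conserved[OF t] by (simp add: J_def m_def space_\<nu>[OF t])
  then show "(\<integral>x. (measure (\<nu> t) {..<x} - measure (\<nu> t) {x<..}) * bd \<delta> (x - z) \<partial>lborel) = m 0 - 2 * J \<delta> t z"
    unfolding e using Bochner_Integration.integral_diff[OF k1(1) k2(1)] k1(2) k2(2) by (simp add: J_def)
qed

section \<open>The mollified velocity\<close>

definition V where "V \<delta> t z = (\<integral>x. v t x * bd \<delta> (x - z) \<partial>lborel)"
definition b where "b \<delta> t z = 1/2 * (\<integral>x. v t x * v t x * bd' \<delta> (x - z) \<partial>lborel) + 1/4 * (m 0 - 2 * J \<delta> t z)"

lemma nice_b: "\<delta> > 0 \<Longrightarrow> nice (\<lambda>t z x. v t x * bd' \<delta> (x - z))" "\<delta> > 0 \<Longrightarrow> nice (\<lambda>t z x. v t x * v t x * bd' \<delta> (x - z))"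
  by (intro nice_mult nice_v nice_scaled, assumption)+

lemma velocity_integrable:
  assumes t: "t \<ge> 0" and \<delta>: "\<delta> > 0"
  shows "integrable lborel (\<lambda>x. v t x * bd \<delta> (x - z))" "integrable lborel (\<lambda>x. v t x * bd' \<delta> (x - z))"
    "integrable lborel (\<lambda>x. v t x * v t x * bd' \<delta> (x - z))"
proof -
  show "integrable lborel (\<lambda>x. v t x * bd \<delta> (x - z))"
    using leb_integrable[OF nice_k[OF \<delta>] t, of \<delta> z] scaled_support(3)[OF \<delta>] by simp
  show "integrable lborel (\<lambda>x. v t x * bd' \<delta> (x - z))" "integrable lborel (\<lambda>x. v t x * v t x * bd' \<delta> (x - z))"
    using leb_integrable[OF nice_b(1)[OF \<delta>] t, of \<delta> z] leb_integrable[OF nice_b(2)[OF \<delta>] t, of \<delta> z] scaled_support(4)[OF \<delta>] by simp_all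
qed

lemma b_time_cont: assumes \<delta>: "\<delta> > 0" shows "continuous_on {0..} (\<lambda>t. b \<delta> t z)"
proof -
  have "continuous_on {0..} (\<lambda>t. \<integral>x. v t x * v t x * bd' \<delta> (x - z) \<partial>lborel)"
    by (rule leb_time[OF nice_b(2)[OF \<delta>] \<delta>]) (simp add: scaled_support(4)[OF \<delta>])
  moreover have "continuous_on {0..} (\<lambda>t. J \<delta> t z)" unfolding J_def by (rule nice_time[OF nice_scaled(1)[OF \<delta>]])
  ultimately show ?thesis unfolding b_def by (intro continuous_intros)
qed

text \<open>The momentum equation tested with a time cut-off times the bump around z.\<close>

lemma V_evolution:
  assumes \<delta>: "\<delta> > 0" and t: "t \<ge> 0"
  shows "V \<delta> t z - V \<delta> 0 z = integral {0..t} (\<lambda>s. b \<delta> s z)"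
proof (rule time_integrated[OF _ b_time_cont[OF \<delta>] _ t])
  show "continuous_on {0..} (\<lambda>t. V \<delta> t z)" unfolding V_def
    by (rule leb_time[OF nice_k[OF \<delta>] \<delta>]) (simp add: scaled_support(3)[OF \<delta>])
  fix \<epsilon> \<tau> :: real assume e: "0 < \<epsilon>" "\<epsilon> < \<tau>"
  let ?\<psi> = "\<lambda>x. bd \<delta> (x - z)"
  define \<phi> where "\<phi> p = \<theta> \<epsilon> \<tau> (fst p) * ?\<psi> (snd p)" for p :: "real \<times> real"
  have sm: "smooth1 ?\<psi>" by (rule smooth_scaled)
  have tf: "test_fun \<phi>" unfolding \<phi>_def[abs_def]
  proof (rule test_fun_tensor[OF smooth_\<theta> sm, of "max (\<bar>z\<bar> + \<delta>) (11 + \<tau> + \<epsilon>)"])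
    show "\<bar>x\<bar> > max (\<bar>z\<bar> + \<delta>) (11 + \<tau> + \<epsilon>) \<Longrightarrow> \<theta> \<epsilon> \<tau> x = 0" for x using \<theta>_facts(3)[OF e, of x] by simp
    show "\<bar>x\<bar> > max (\<bar>z\<bar> + \<delta>) (11 + \<tau> + \<epsilon>) \<Longrightarrow> ?\<psi> x = 0" for x by (rule scaled_support(3)[OF \<delta>]) auto
  qed
  have pd: "pdt \<phi> = (\<lambda>p. deriv (\<theta> \<epsilon> \<tau>) (fst p) * ?\<psi> (snd p))" "pdx \<phi> = (\<lambda>p. \<theta> \<epsilon> \<tau> (fst p) * bd' \<delta> (snd p - z))"
    unfolding \<phi>_def[abs_def] using pd_tensor[OF smooth_\<theta> sm] by (simp_all add: deriv_translate[OF \<delta>])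
  have inner: "(LINT x|lborel. v t x * pdt \<phi> (t, x) + (v t x)\<^sup>2 / 2 * pdx \<phi> (t, x)
          + 1/4 * (measure (\<nu> t) {..<x} - measure (\<nu> t) {x<..}) * \<phi> (t, x))
     = deriv (\<theta> \<epsilon> \<tau>) t * V \<delta> t z + \<theta> \<epsilon> \<tau> t * b \<delta> t z" if t: "t \<ge> 0" for t
  proof -
    note i = velocity_integrable(1,3)[OF t \<delta>, of z] kernel_mass_difference(1)[OF t \<delta>, of z]
    have "(LINT x|lborel. v t x * pdt \<phi> (t, x) + (v t x)\<^sup>2 / 2 * pdx \<phi> (t, x)
          + 1/4 * (measure (\<nu> t) {..<x} - measure (\<nu> t) {x<..}) * \<phi> (t, x))
      = (LINT x|lborel. deriv (\<theta> \<epsilon> \<tau>) t * (v t x * ?\<psi> x) + (\<theta> \<epsilon> \<tau> t / 2) * (v t x * v t x * bd' \<delta> (x - z))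
          + (\<theta> \<epsilon> \<tau> t / 4) * ((measure (\<nu> t) {..<x} - measure (\<nu> t) {x<..}) * ?\<psi> x))"
      unfolding pd unfolding \<phi>_def by (intro Bochner_Integration.integral_cong refl) (simp add: power2_eq_square algebra_simps)
    also have "\<dots> = deriv (\<theta> \<epsilon> \<tau>) t * V \<delta> t z + (\<theta> \<epsilon> \<tau> t / 2) * (\<integral>x. v t x * v t x * bd' \<delta> (x - z) \<partial>lborel)
        + (\<theta> \<epsilon> \<tau> t / 4) * (m 0 - 2 * J \<delta> t z)"
      unfolding V_def kernel_mass_difference(2)[OF t \<delta>, of z, symmetric]
      using i by (simp only: Bochner_Integration.integral_add integrable_mult_right Bochner_Integration.integrable_add integral_mult_right_zero)
    also have "\<dots> = deriv (\<theta> \<epsilon> \<tau>) t * V \<delta> t z + \<theta> \<epsilon> \<tau> t * b \<delta> t z" by (simp add: b_def field_simps)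
    finally show ?thesis .
  qed
  have "(LINT t:{0..}|lborel. deriv (\<theta> \<epsilon> \<tau>) t * V \<delta> t z + \<theta> \<epsilon> \<tau> t * b \<delta> t z)
    = (LINT t:{0..}|lborel. LINT x|lborel. v t x * pdt \<phi> (t, x) + (v t x)\<^sup>2 / 2 * pdx \<phi> (t, x)
          + 1/4 * (measure (\<nu> t) {..<x} - measure (\<nu> t) {x<..}) * \<phi> (t, x))"
    by (rule set_lebesgue_integral_cong) (use inner in auto)
  also have "\<dots> = - (LINT x|lborel. v 0 x * \<phi> (0, x))" by (rule sol_momentum[OF tf])
  also have "\<dots> = - V \<delta> 0 z" using \<theta>_facts(1)[OF e] by (simp add: \<phi>_def V_def)
  finally show "(LINT t:{0..}|lborel. deriv (\<theta> \<epsilon> \<tau>) t * V \<delta> t z + \<theta> \<epsilon> \<tau> t * b \<delta> t z) = - V \<delta> 0 z" .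
qed

lemma V_time_DERIV:
  assumes \<delta>: "\<delta> > 0" and t: "t \<in> {0..T}"
  shows "((\<lambda>s. V \<delta> s z) has_real_derivative b \<delta> t z) (at t within {0..T})"
proof -
  have "((\<lambda>s. V \<delta> 0 z + integral {0..s} (\<lambda>s. b \<delta> s z)) has_real_derivative 0 + b \<delta> t z) (at t within {0..T})"
    by (intro DERIV_add DERIV_const integral_has_real_derivative t continuous_on_subset[OF b_time_cont[OF \<delta>]]) auto
  then show ?thesis
  proof (rule has_field_derivative_transform_within[where d = 1, OF _ _ t, THEN back_subst[of "\<lambda>y. (_ has_real_derivative y) _"]])
    fix s assume "s \<in> {0..T}"
    then show "V \<delta> 0 z + integral {0..s} (\<lambda>s. b \<delta> s z) = V \<delta> s z" using V_evolution[OF \<delta>, of s z] by simp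
  qed simp_all
qed

text \<open>Lebesgue measure is restricted to a bounded interval in order to differentiate under the
  integral of a finite measure; one interval serves all z within 1 of z0.\<close>

lemma V_space_DERIV:
  assumes \<delta>: "\<delta> > 0" and t: "t \<ge> 0"
  shows "(V \<delta> t has_real_derivative (- (\<integral>x. v t x * bd' \<delta> (x - z0) \<partial>lborel))) (at z0)"
proof -
  define I where "I = {z0 - \<delta> - 1..z0 + \<delta> + 1}"
  define N where "N = density lborel (\<lambda>x. ennreal (indicator I x))"
  have [measurable]: "I \<in> sets borel" by (simp add: I_def)
  have mN: "borel_measurable N = (borel_measurable borel :: (real \<Rightarrow> real) set)" by (rule measurable_cong_sets) (auto simp: N_def)
  have fN: "finite_measure N"
  proof (rule finite_measureI)
    have "emeasure N (space N) = emeasure lborel I" by (simp add: N_def emeasure_density ennreal_indicator)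
    then show "emeasure N (space N) \<noteq> \<infinity>" by (simp add: I_def emeasure_lborel_Icc_eq)
  qed
  interpret N: finite_measure N by (rule fN)
  have [measurable]: "v t \<in> borel_measurable borel" by (rule v_meas[OF t])
  obtain B where "B \<ge> 0" and B: "\<And>z x. \<bar>v t x\<bar> \<le> B" by (rule nice_bound[OF nice_v t]) (rule that)
  note sm[measurable] = scaled_measurable[OF \<delta>]
  have iN: "(\<integral>x. f x \<partial>N) = (\<integral>x. f x \<partial>lborel)" if "f \<in> borel_measurable borel" "\<And>x. x \<notin> I \<Longrightarrow> f x = 0" for f :: "real \<Rightarrow> real"
  proof -
    have "(\<integral>x. f x \<partial>N) = (\<integral>x. indicator I x *\<^sub>R f x \<partial>lborel)" unfolding N_def using that(1) by (subst integral_density) auto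
    also have "\<dots> = (\<integral>x. f x \<partial>lborel)" using that(2) by (intro Bochner_Integration.integral_cong) (auto simp: indicator_def)
    finally show ?thesis .
  qed
  have "((\<lambda>z. \<integral>x. v t x * bd \<delta> (x - z) \<partial>N) has_real_derivative (\<integral>x. v t x * - bd' \<delta> (x - z0) \<partial>N)) (at z0)"
  proof (rule integral_param_DERIV[OF fN, where K = "B * (M / \<delta> ^ 3)"])
    show "integrable N (\<lambda>x. v t x * bd \<delta> (x - z))" for z
    proof (rule N.integrable_const_bound[of _ "B * (M / \<delta>)"])
      show "AE x in N. norm (v t x * bd \<delta> (x - z)) \<le> B * (M / \<delta>)"
        unfolding real_norm_def abs_mult using B scaled_bounds(4)[OF \<delta>] \<open>B \<ge> 0\<close> by (intro AE_I2 mult_mono) auto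
    qed (simp add: mN)
    show "integrable N (\<lambda>x. v t x * - bd' \<delta> (x - z0))"
    proof (rule N.integrable_const_bound[of _ "B * (M / \<delta>\<^sup>2)"])
      show "AE x in N. norm (v t x * - bd' \<delta> (x - z0)) \<le> B * (M / \<delta>\<^sup>2)"
        unfolding real_norm_def abs_mult abs_minus_cancel using B scaled_bounds(5)[OF \<delta>] \<open>B \<ge> 0\<close> by (intro AE_I2 mult_mono) auto
    qed (simp add: mN)
    fix h x
    have "v t x * bd \<delta> (x - (z0 + h)) - v t x * bd \<delta> (x - z0) - h * (v t x * - bd' \<delta> (x - z0))
      = v t x * (bd \<delta> ((x - z0) - h) - bd \<delta> (x - z0) + h * bd' \<delta> (x - z0))" by (simp add: algebra_simps)
    also have "\<bar>\<dots>\<bar> \<le> B * (M / \<delta> ^ 3 * h\<^sup>2)"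
      unfolding abs_mult[of "v t x"] using B \<open>B \<ge> 0\<close> translate_remainder[OF DERIV_scaled(2)[OF \<delta>] lipschitz_scaled(3)[OF \<delta>], of "x - z0" h]
      by (intro mult_mono) auto
    finally show "\<bar>v t x * bd \<delta> (x - (z0 + h)) - v t x * bd \<delta> (x - z0) - h * (v t x * - bd' \<delta> (x - z0))\<bar> \<le> B * (M / \<delta> ^ 3) * h\<^sup>2"
      by simp
  qed
  moreover have "(\<integral>x. v t x * - bd' \<delta> (x - z0) \<partial>N) = - (\<integral>x. v t x * bd' \<delta> (x - z0) \<partial>lborel)"
  proof -
    have "(\<integral>x. v t x * - bd' \<delta> (x - z0) \<partial>N) = (\<integral>x. v t x * - bd' \<delta> (x - z0) \<partial>lborel)"
    proof (rule iN)
      fix x assume "x \<notin> I"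
      then have "\<bar>x - z0\<bar> > \<delta>" by (auto simp: I_def)
      then show "v t x * - bd' \<delta> (x - z0) = 0" by (simp add: scaled_support(4)[OF \<delta>])
    qed measurable
    then show ?thesis by simp
  qed
  ultimately have "((\<lambda>z. \<integral>x. v t x * bd \<delta> (x - z) \<partial>N) has_real_derivative (- (\<integral>x. v t x * bd' \<delta> (x - z0) \<partial>lborel))) (at z0)" by simp
  then show ?thesis
  proof (rule has_field_derivative_transform_within_open[where S = "{z0 - 1<..<z0 + 1}"])
    fix z assume z: "z \<in> {z0 - 1<..<z0 + 1}"
    show "(\<integral>x. v t x * bd \<delta> (x - z) \<partial>N) = V \<delta> t z" unfolding V_def
    proof (rule iN)
      fix x assume "x \<notin> I"
      then have "\<bar>x - z\<bar> \<ge> \<delta>" using z by (auto simp: I_def)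
      then show "v t x * bd \<delta> (x - z) = 0" by (simp add: scaled_support(3)[OF \<delta>])
    qed measurable
  qed auto
qed

text \<open>The terms v^2 / 2 and -x' v combine to (v - x')^2 / 2, since bd' has integral 0 and so
  x'^2 may be added. On a characteristic this square vanishes at the curve, which makes the term
  small.\<close>

lemma V_along:
  assumes \<delta>: "\<delta> > 0" and t: "t \<in> {0..T}" and x: "(x has_real_derivative x') (at t within {0..T})"
  shows "((\<lambda>s. V \<delta> s (x s)) has_real_derivative
     1/2 * (\<integral>y. (v t y - x')\<^sup>2 * bd' \<delta> (y - x t) \<partial>lborel) + 1/4 * (m 0 - 2 * J \<delta> t (x t))) (at t within {0..T})"
proof -
  have t0: "t \<ge> 0" using t by simp
  have d: "((\<lambda>s. V \<delta> s (x s)) has_real_derivative b \<delta> t (x t) + (- (\<integral>y. v t y * bd' \<delta> (y - x t) \<partial>lborel)) * x') (at t within {0..T})"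
  proof (rule DERIV_along_curve[OF t V_time_DERIV[OF \<delta> t] _ _ x])
    show "(V \<delta> s has_real_derivative (- (\<integral>x. v s x * bd' \<delta> (x - z) \<partial>lborel))) (at z)" if "s \<in> {0..T}" for s z
      by (rule V_space_DERIV[OF \<delta>]) (use that in simp)
    have "continuous_on ({0..} \<times> UNIV) (\<lambda>p. - (case p of (s, z) \<Rightarrow> \<integral>x. v s x * bd' \<delta> (x - z) \<partial>lborel))"
      by (intro continuous_on_minus leb_joint[OF nice_b(1)[OF \<delta>] \<delta>]) (simp add: scaled_support(4)[OF \<delta>])
    then have "continuous_on ({0..T} \<times> UNIV) (\<lambda>p. - (case p of (s, z) \<Rightarrow> \<integral>x. v s x * bd' \<delta> (x - z) \<partial>lborel))"
      by (rule continuous_on_subset) auto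
    then show "continuous_on ({0..T} \<times> UNIV) (\<lambda>(s, z). - (\<integral>x. v s x * bd' \<delta> (x - z) \<partial>lborel))"
      by (simp add: case_prod_unfold)
  qed
  have eq: "(\<integral>y. (v t y - x')\<^sup>2 * bd' \<delta> (y - x t) \<partial>lborel)
     = (\<integral>y. v t y * v t y * bd' \<delta> (y - x t) \<partial>lborel) - 2 * x' * (\<integral>y. v t y * bd' \<delta> (y - x t) \<partial>lborel)"
  proof -
    note i = velocity_integrable(2,3)[OF t0 \<delta>, of "x t"] integral_scaled_full(3)[OF \<delta>, of "x t"]
    have "(\<integral>y. (v t y - x')\<^sup>2 * bd' \<delta> (y - x t) \<partial>lborel)
      = (\<integral>y. v t y * v t y * bd' \<delta> (y - x t) + (- 2 * x') * (v t y * bd' \<delta> (y - x t)) + x'\<^sup>2 * bd' \<delta> (y - x t) \<partial>lborel)"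
      by (intro Bochner_Integration.integral_cong refl) (simp add: power2_eq_square algebra_simps)
    also have "\<dots> = (\<integral>y. v t y * v t y * bd' \<delta> (y - x t) \<partial>lborel) + (- 2 * x') * (\<integral>y. v t y * bd' \<delta> (y - x t) \<partial>lborel) + x'\<^sup>2 * 0"
      unfolding integral_scaled_full(4)[OF \<delta>, of "x t", symmetric]
      using i by (simp only: Bochner_Integration.integral_add integrable_mult_right Bochner_Integration.integrable_add integral_mult_right_zero)
    finally show ?thesis by simp
  qed
  have e: "b \<delta> t (x t) + (- (\<integral>y. v t y * bd' \<delta> (y - x t) \<partial>lborel)) * x'
    = 1/2 * (\<integral>y. (v t y - x')\<^sup>2 * bd' \<delta> (y - x t) \<partial>lborel) + 1/4 * (m 0 - 2 * J \<delta> t (x t))"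
    unfolding b_def eq by (simp add: algebra_simps)
  show ?thesis using d unfolding e .
qed

text \<open>The powers of \<delta> balance: the square is at most 2 \<delta> E, bd' at most M /
  \<delta>^2, and the support has length 2 \<delta>, which leaves 4 M E. The centre x + \<delta>
  places the support in [x, x + 2 \<delta>], so only energy strictly to the right of x
  enters.\<close>

lemma transport_defect:
  assumes t: "t \<ge> 0" and \<delta>: "\<delta> > 0"
  shows "\<bar>1/2 * (\<integral>y. (v t y - v t x)\<^sup>2 * bd' \<delta> (y - (x + \<delta>)) \<partial>lborel)\<bar> \<le> 2 * M * measure (\<nu> t) {x<..<x + 2 * \<delta>}"
proof -
  interpret finite_measure "\<nu> t" by (rule finite_\<nu>[OF t])
  define E where "E = measure (\<nu> t) {x<..<x + 2 * \<delta>}"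
  define c where "c = 2 * \<delta> * E * (M / \<delta>\<^sup>2)"
  have E0: "0 \<le> E" by (simp add: E_def)
  have c0: "0 \<le> c" unfolding c_def using E0 \<delta> M(1) by (intro mult_nonneg_nonneg divide_nonneg_nonneg) auto
  have pw: "\<bar>(v t y - v t x)\<^sup>2 * bd' \<delta> (y - (x + \<delta>))\<bar> \<le> c * indicator {x..x + 2 * \<delta>} y" for y
  proof (cases "y \<in> {x..x + 2 * \<delta>}")
    case True
    have "(v t y - v t x)\<^sup>2 \<le> (y - x) * measure (\<nu> t) {x<..<y}" using energy[OF t, of x y] True by simp
    also have "\<dots> \<le> 2 * \<delta> * E" unfolding E_def using True \<delta>
      by (intro mult_mono finite_measure_mono) (auto simp: sets_\<nu>[OF t])
    finally have "\<bar>(v t y - v t x)\<^sup>2\<bar> * \<bar>bd' \<delta> (y - (x + \<delta>))\<bar> \<le> 2 * \<delta> * E * (M / \<delta>\<^sup>2)"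
      using scaled_bounds(5)[OF \<delta>] E0 \<delta> by (intro mult_mono) auto
    then show ?thesis using True by (simp add: abs_mult c_def)
  next
    case False
    then have "\<bar>y - (x + \<delta>)\<bar> > \<delta>" by auto
    then show ?thesis using scaled_support(4)[OF \<delta>] c0 by simp
  qed
  have ic: "integrable lborel (\<lambda>y. c * indicator {x..x + 2 * \<delta>} y)"
    by (intro integrable_mult_right integrable_real_indicator) (auto simp: emeasure_lborel_Icc_eq)
  have [measurable]: "v t \<in> borel_measurable borel" "bd' \<delta> \<in> borel_measurable borel" by (rule v_meas[OF t], rule scaled_measurable(3)[OF \<delta>])
  have im: "integrable lborel (\<lambda>y. (v t y - v t x)\<^sup>2 * bd' \<delta> (y - (x + \<delta>)))"
    by (rule Bochner_Integration.integrable_bound[OF ic]) (use pw c0 in \<open>auto intro!: AE_I2 simp: order_trans[OF _ abs_ge_self]\<close>)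
  have "\<bar>\<integral>y. (v t y - v t x)\<^sup>2 * bd' \<delta> (y - (x + \<delta>)) \<partial>lborel\<bar> \<le> (\<integral>y. \<bar>(v t y - v t x)\<^sup>2 * bd' \<delta> (y - (x + \<delta>))\<bar> \<partial>lborel)"
    by (rule integral_abs_bound)
  also have "\<dots> \<le> (\<integral>y. c * indicator {x..x + 2 * \<delta>} y \<partial>lborel)" by (rule integral_mono[OF integrable_abs[OF im] ic pw])
  also have "\<dots> = 2 * \<delta> * c" using \<delta> by simp
  also have "\<dots> = 4 * M * E" using \<delta> by (simp add: c_def power2_eq_square)
  finally show ?thesis by (simp add: E_def)
qed

section \<open>The limit of vanishing width\<close>

definition \<delta>n where "\<delta>n n = 1 / real (Suc n)"

lemma \<delta>n: "\<delta>n n > 0" "\<delta>n \<longlonglongrightarrow> 0"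
  using LIMSEQ_inverse_real_of_nat by (simp_all add: \<delta>n_def[abs_def] inverse_eq_divide)

lemma \<delta>n_Suc: "\<delta>n (Suc n) \<le> \<delta>n n"
  by (simp add: \<delta>n_def frac_le)

lemma F_right_limit: assumes t: "t \<ge> 0" shows "(\<lambda>n. F t (x + 2 * \<delta>n n)) \<longlonglongrightarrow> F t x"
proof -
  have "(\<lambda>n. x + 2 * \<delta>n n) \<longlonglongrightarrow> x + 2 * 0" by (intro tendsto_intros \<delta>n(2))
  then show ?thesis unfolding F_def by (intro cdf_right_limit[OF fin[OF t]]) (use \<delta>n(1) in auto)
qed

text \<open>The intervals are open at x and shrink to the empty set, so an atom at x itself does not
  obstruct the limit.\<close>

lemma energy_vanishes: assumes t: "t \<ge> 0" shows "(\<lambda>n. measure (\<nu> t) {x<..<x + 2 * \<delta>n n}) \<longlonglongrightarrow> 0"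
proof (rule tendsto_sandwich[OF _ _ tendsto_const])
  interpret finite_measure "\<nu> t" by (rule finite_\<nu>[OF t])
  have "(\<lambda>n. F t (x + 2 * \<delta>n n) - F t x) \<longlonglongrightarrow> F t x - F t x" by (intro tendsto_intros F_right_limit[OF t])
  then show "(\<lambda>n. F t (x + 2 * \<delta>n n) - F t x) \<longlonglongrightarrow> 0" by simp
  show "\<forall>\<^sub>F n in sequentially. measure (\<nu> t) {x<..<x + 2 * \<delta>n n} \<le> F t (x + 2 * \<delta>n n) - F t x"
  proof (intro always_eventually allI)
    fix n
    have "{..x + 2 * \<delta>n n} - {..x} = {x<..x + 2 * \<delta>n n}" by auto
    then have "F t (x + 2 * \<delta>n n) - F t x = measure (\<nu> t) {x<..x + 2 * \<delta>n n}"
      using finite_measure_Diff[of "{..x + 2 * \<delta>n n}" "{..x}"] \<delta>n(1)[of n] by (simp add: F_def sets_\<nu>[OF t])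
    moreover have "measure (\<nu> t) {x<..<x + 2 * \<delta>n n} \<le> measure (\<nu> t) {x<..x + 2 * \<delta>n n}"
      by (rule finite_measure_mono) (auto simp: sets_\<nu>[OF t])
    ultimately show "measure (\<nu> t) {x<..<x + 2 * \<delta>n n} \<le> F t (x + 2 * \<delta>n n) - F t x" by simp
  qed
qed simp

text \<open>With the layer to the right of x, right continuity of F identifies the limit at x
  itself, a jump included.\<close>

lemma J_right_limit: assumes t: "t \<ge> 0" shows "(\<lambda>n. J (\<delta>n n) t (x + \<delta>n n)) \<longlonglongrightarrow> m 0 - F t x"
proof (rule tendsto_sandwich[of "\<lambda>n. m 0 - F t (x + 2 * \<delta>n n)" _ _ "\<lambda>n. m 0 - F t x"])
  show "\<forall>\<^sub>F n in sequentially. J (\<delta>n n) t (x + \<delta>n n) \<le> m 0 - F t x"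
  proof (intro always_eventually allI)
    fix n show "J (\<delta>n n) t (x + \<delta>n n) \<le> m 0 - F t x"
      using J_bounds(1)[OF t \<delta>n(1), of n "x + \<delta>n n"] by simp
  qed
  show "\<forall>\<^sub>F n in sequentially. m 0 - F t (x + 2 * \<delta>n n) \<le> J (\<delta>n n) t (x + \<delta>n n)"
  proof (intro always_eventually allI)
    fix n show "m 0 - F t (x + 2 * \<delta>n n) \<le> J (\<delta>n n) t (x + \<delta>n n)"
      using J_bounds(2)[OF t \<delta>n(1), of "x + \<delta>n n" n] by (simp add: algebra_simps)
  qed
  show "(\<lambda>n. m 0 - F t (x + 2 * \<delta>n n)) \<longlonglongrightarrow> m 0 - F t x" by (intro tendsto_intros F_right_limit[OF t])
qed simp

lemma measure_le_m: assumes t: "t \<ge> 0" shows "measure (\<nu> t) A \<le> m 0"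
proof -
  interpret finite_measure "\<nu> t" by (rule finite_\<nu>[OF t])
  have "measure (\<nu> t) A \<le> measure (\<nu> t) (space (\<nu> t))" by (rule bounded_measure)
  then show ?thesis using mass_conserved[OF t] by (simp add: m_def space_\<nu>[OF t])
qed

text \<open>Over the support of the bump the velocity varies by at most sqrt (2 \<delta> m 0), by
  the energy estimate.\<close>

lemma V_right_limit: assumes t: "t \<ge> 0" shows "(\<lambda>n. V (\<delta>n n) t (x + \<delta>n n)) \<longlonglongrightarrow> v t x"
proof -
  have est: "\<bar>V \<delta> t (x + \<delta>) - v t x\<bar> \<le> sqrt (2 * \<delta> * m 0)" if \<delta>: "\<delta> > 0" for \<delta>
  proof -
    note i = velocity_integrable(1)[OF t \<delta>, of "x + \<delta>"] integral_scaled_full(1)[OF \<delta>, of "x + \<delta>"]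
    have eq: "V \<delta> t (x + \<delta>) - v t x = (\<integral>y. v t y * bd \<delta> (y - (x + \<delta>)) - v t x * bd \<delta> (y - (x + \<delta>)) \<partial>lborel)"
      using i integral_scaled_full(2)[OF \<delta>, of "x + \<delta>"] by (simp add: V_def)
    have "\<bar>V \<delta> t (x + \<delta>) - v t x\<bar> \<le> (\<integral>y. \<bar>v t y * bd \<delta> (y - (x + \<delta>)) - v t x * bd \<delta> (y - (x + \<delta>))\<bar> \<partial>lborel)"
      unfolding eq by (rule integral_abs_bound)
    also have "\<dots> \<le> (\<integral>y. sqrt (2 * \<delta> * m 0) * bd \<delta> (y - (x + \<delta>)) \<partial>lborel)"
    proof (rule integral_mono)
      fix y
      show "\<bar>v t y * bd \<delta> (y - (x + \<delta>)) - v t x * bd \<delta> (y - (x + \<delta>))\<bar> \<le> sqrt (2 * \<delta> * m 0) * bd \<delta> (y - (x + \<delta>))"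
      proof (cases "y \<in> {x..x + 2 * \<delta>}")
        case True
        have "(v t y - v t x)\<^sup>2 \<le> (y - x) * measure (\<nu> t) {x<..<y}" using energy[OF t, of x y] True by simp
        also have "\<dots> \<le> 2 * \<delta> * m 0" using True \<delta> measure_le_m[OF t] by (intro mult_mono) auto
        finally have "\<bar>v t y - v t x\<bar> \<le> sqrt (2 * \<delta> * m 0)" by (simp add: real_le_rsqrt)
        then have "\<bar>v t y - v t x\<bar> * bd \<delta> (y - (x + \<delta>)) \<le> sqrt (2 * \<delta> * m 0) * bd \<delta> (y - (x + \<delta>))"
          by (rule mult_right_mono) (rule scaled_bounds(3)[OF \<delta>])
        then show ?thesis using scaled_bounds(3)[OF \<delta>, of "y - (x + \<delta>)"] by (simp add: left_diff_distrib[symmetric] abs_mult)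
      next
        case False
        then have "\<bar>y - (x + \<delta>)\<bar> \<ge> \<delta>" by auto
        then show ?thesis using scaled_support(3)[OF \<delta>] by simp
      qed
    qed (use i in auto)
    also have "\<dots> = sqrt (2 * \<delta> * m 0)" by (simp add: integral_scaled_full(2)[OF \<delta>])
    finally show ?thesis .
  qed
  have "(\<lambda>n. sqrt (2 * \<delta>n n * m 0)) \<longlonglongrightarrow> sqrt (2 * 0 * m 0)" by (intro tendsto_intros \<delta>n(2))
  then have lim0: "(\<lambda>n. sqrt (2 * \<delta>n n * m 0)) \<longlonglongrightarrow> 0" by simp
  have "(\<lambda>n. V (\<delta>n n) t (x + \<delta>n n) - v t x) \<longlonglongrightarrow> 0"
  proof (rule Lim_null_comparison[OF _ lim0])
    show "\<forall>\<^sub>F n in sequentially. norm (V (\<delta>n n) t (x + \<delta>n n) - v t x) \<le> sqrt (2 * \<delta>n n * m 0)"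
      unfolding real_norm_def by (intro always_eventually allI est \<delta>n(1))
  qed
  then show ?thesis by (rule LIM_zero_cancel)
qed

text \<open>The shifted curve x + \<delta>n n has the same speed, so the balance of the mollified
  velocity along it consists of the transport defect and a mass term. Both converge at every s and
  are bounded by multiples of m 0, which permits dominated convergence in time.\<close>

theorem velocity_along_characteristic:
  assumes t: "t \<in> {0..T}"
    and x: "\<And>s. s \<in> {0..T} \<Longrightarrow> (x has_real_derivative v s (x s)) (at s within {0..T})"
  shows "v t (x t) - v 0 (x 0) = integral {0..t} (\<lambda>s. 1/4 * (2 * F s (x s) - m 0))"
proof -
  define d where "d n s = 1/2 * (\<integral>y. (v s y - v s (x s))\<^sup>2 * bd' (\<delta>n n) (y - (x s + \<delta>n n)) \<partial>lborel)
      + 1/4 * (m 0 - 2 * J (\<delta>n n) s (x s + \<delta>n n))" for n s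
  have hi: "(d n has_integral (V (\<delta>n n) t (x t + \<delta>n n) - V (\<delta>n n) 0 (x 0 + \<delta>n n))) {0..t}" for n
  proof (rule fundamental_theorem_of_calculus)
    show "0 \<le> t" using t by simp
    fix s assume s: "s \<in> {0..t}"
    then have sT: "s \<in> {0..T}" using t by auto
    have "((\<lambda>s. x s + \<delta>n n) has_real_derivative v s (x s)) (at s within {0..T})"
      using DERIV_add[OF x[OF sT] DERIV_const[of "\<delta>n n"]] by simp
    from V_along[OF \<delta>n(1)[of n] sT this]
    have "((\<lambda>s. V (\<delta>n n) s (x s + \<delta>n n)) has_real_derivative d n s) (at s within {0..T})" by (simp add: d_def)
    then have "((\<lambda>s. V (\<delta>n n) s (x s + \<delta>n n)) has_real_derivative d n s) (at s within {0..t})"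
      by (rule DERIV_subset) (use t in auto)
    then show "((\<lambda>s. V (\<delta>n n) s (x s + \<delta>n n)) has_vector_derivative d n s) (at s within {0..t})"
      by (simp add: has_real_derivative_iff_has_vector_derivative)
  qed
  have lim: "(\<lambda>n. integral {0..t} (d n)) \<longlonglongrightarrow> integral {0..t} (\<lambda>s. 1/4 * (2 * F s (x s) - m 0))"
  proof (rule dominated_convergence(2)[where h = "\<lambda>s. 2 * M * m 0 + 1/4 * m 0"])
    show "d n integrable_on {0..t}" for n using hi by blast
    show "norm (d n s) \<le> 2 * M * m 0 + 1/4 * m 0" if "s \<in> {0..t}" for n s
    proof -
      have s: "s \<ge> 0" using that by simp
      have "\<bar>1/2 * (\<integral>y. (v s y - v s (x s))\<^sup>2 * bd' (\<delta>n n) (y - (x s + \<delta>n n)) \<partial>lborel)\<bar> \<le> 2 * M * measure (\<nu> s) {x s<..<x s + 2 * \<delta>n n}"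
        by (rule transport_defect[OF s \<delta>n(1)])
      also have "\<dots> \<le> 2 * M * m 0" using M(1) measure_le_m[OF s] by (intro mult_left_mono) auto
      finally have 1: "\<bar>1/2 * (\<integral>y. (v s y - v s (x s))\<^sup>2 * bd' (\<delta>n n) (y - (x s + \<delta>n n)) \<partial>lborel)\<bar> \<le> 2 * M * m 0" .
      have "0 \<le> F s y" for y by (simp add: F_def)
      then have "J (\<delta>n n) s (x s + \<delta>n n) \<le> m 0" using J_bounds(1)[OF s \<delta>n(1), of n "x s + \<delta>n n"] by (smt (verit))
      moreover have "0 \<le> J (\<delta>n n) s (x s + \<delta>n n)"
        unfolding J_def by (intro Bochner_Integration.integral_nonneg scaled_bounds(1) \<delta>n(1))
      ultimately have "\<bar>1/4 * (m 0 - 2 * J (\<delta>n n) s (x s + \<delta>n n))\<bar> \<le> 1/4 * m 0" by simp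
      with 1 show ?thesis unfolding d_def real_norm_def by linarith
    qed
    show "(\<lambda>n. d n s) \<longlonglongrightarrow> 1/4 * (2 * F s (x s) - m 0)" if "s \<in> {0..t}" for s
    proof -
      have s: "s \<ge> 0" using that by simp
      have "(\<lambda>n. 1/2 * (\<integral>y. (v s y - v s (x s))\<^sup>2 * bd' (\<delta>n n) (y - (x s + \<delta>n n)) \<partial>lborel)) \<longlonglongrightarrow> 0"
      proof (rule Lim_null_comparison[where g = "\<lambda>n. 2 * M * measure (\<nu> s) {x s<..<x s + 2 * \<delta>n n}"])
        show "\<forall>\<^sub>F n in sequentially. norm (1/2 * (\<integral>y. (v s y - v s (x s))\<^sup>2 * bd' (\<delta>n n) (y - (x s + \<delta>n n)) \<partial>lborel))
           \<le> 2 * M * measure (\<nu> s) {x s<..<x s + 2 * \<delta>n n}"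
          unfolding real_norm_def by (intro always_eventually allI transport_defect[OF s \<delta>n(1)])
        have "(\<lambda>n. 2 * M * measure (\<nu> s) {x s<..<x s + 2 * \<delta>n n}) \<longlonglongrightarrow> 2 * M * 0"
          by (intro tendsto_intros energy_vanishes[OF s])
        then show "(\<lambda>n. 2 * M * measure (\<nu> s) {x s<..<x s + 2 * \<delta>n n}) \<longlonglongrightarrow> 0" by simp
      qed
      then have "(\<lambda>n. d n s) \<longlonglongrightarrow> 0 + 1/4 * (m 0 - 2 * (m 0 - F s (x s)))"
        unfolding d_def by (intro tendsto_intros J_right_limit[OF s])
      then show ?thesis by (simp add: algebra_simps)
    qed
  qed (rule integrable_const_ivl)
  have "(\<lambda>n. V (\<delta>n n) t (x t + \<delta>n n) - V (\<delta>n n) 0 (x 0 + \<delta>n n)) \<longlonglongrightarrow> v t (x t) - v 0 (x 0)"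
    by (intro tendsto_intros V_right_limit) (use t in auto)
  moreover have "integral {0..t} (d n) = V (\<delta>n n) t (x t + \<delta>n n) - V (\<delta>n n) 0 (x 0 + \<delta>n n)" for n
    by (rule integral_unique[OF hi])
  ultimately show ?thesis using lim LIMSEQ_unique by fastforce
qed

text \<open>F is below \<eta> to the left of X t \<eta> and at least \<eta> at this point, so the
  excess is at most the atom there, and a measure with a density has none. One exceptional set of
  times serves all levels.\<close>

lemma F_X:
  "\<exists>N. negligible N \<and> (\<forall>t\<ge>0. t \<notin> N \<longrightarrow> (\<forall>\<eta>. 0 < \<eta> \<longrightarrow> \<eta> < m 0 \<longrightarrow> F t (X t \<eta>) = \<eta>))"
proof -
  obtain N where N: "N \<in> null_sets lborel" "\<And>t. t \<ge> 0 \<Longrightarrow> t \<notin> N \<Longrightarrow> (\<exists>g. wderiv (v t) g \<and> has_density (\<nu> t) (\<lambda>x. (g x)\<^sup>2))"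
    using sol_density by blast
  have "N \<in> null_sets lebesgue" using N(1) by (simp add: null_sets_completionI)
  then have "negligible N" by (simp add: negligible_iff_null_sets)
  moreover have "F t (X t \<eta>) = \<eta>" if t: "t \<ge> 0" "t \<notin> N" and \<eta>: "0 < \<eta>" "\<eta> < m 0" for t \<eta>
  proof -
    interpret finite_measure "\<nu> t" by (rule finite_\<nu>[OF t(1)])
    obtain g where g: "has_density (\<nu> t) (\<lambda>x. (g x)\<^sup>2)" using N(2)[OF t] by blast
    let ?x = "X t \<eta>"
    have "emeasure (\<nu> t) {?x} = (\<integral>\<^sup>+x\<in>{?x}. ennreal ((g x)\<^sup>2) \<partial>lborel)" using g by (simp add: has_density_def)
    also have "\<dots> = (\<integral>\<^sup>+(x::real). 0 \<partial>lborel)"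
      by (rule nn_integral_cong_AE) (use AE_lborel_singleton[of ?x] in \<open>eventually_elim, simp\<close>)
    finally have atom: "measure (\<nu> t) {?x} = 0" by (simp add: measure_def)
    define a where "a n = ?x - \<delta>n n" for n
    have "(\<lambda>n. measure (\<nu> t) {a n<..?x}) \<longlonglongrightarrow> measure (\<nu> t) (\<Inter>n. {a n<..?x})"
    proof (rule finite_Lim_measure_decseq)
      show "range (\<lambda>n. {a n<..?x}) \<subseteq> sets (\<nu> t)" by (auto simp: sets_\<nu>[OF t(1)])
      show "decseq (\<lambda>n. {a n<..?x})"
      proof (rule decseq_SucI)
        fix n show "{a (Suc n)<..?x} \<subseteq> {a n<..?x}" using \<delta>n_Suc[of n] by (auto simp: a_def)
      qed
    qed
    also have "(\<Inter>n. {a n<..?x}) = {?x}"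
    proof (intro set_eqI iffI)
      fix y assume y: "y \<in> (\<Inter>n. {a n<..?x})"
      have "a \<longlonglongrightarrow> ?x - 0" unfolding a_def[abs_def] by (intro tendsto_intros \<delta>n(2))
      then have "?x \<le> y" using y by (intro LIMSEQ_le_const2[of a "?x" y]) (auto simp: less_imp_le)
      then show "y \<in> {?x}" using y by auto
    qed (use \<delta>n(1) in \<open>auto simp: a_def\<close>)
    finally have lim: "(\<lambda>n. measure (\<nu> t) {a n<..?x}) \<longlonglongrightarrow> 0" by (simp add: atom)
    have "F t ?x - \<eta> \<le> measure (\<nu> t) {a n<..?x}" for n
    proof -
      have "a n < ?x" using \<delta>n(1)[of n] by (simp add: a_def)
      then have "\<not> ?x \<le> a n" by simp
      then have "F t (a n) < \<eta>" using galois_X[OF t(1) \<eta>, of "a n"] by simp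
      moreover have "{..?x} - {..a n} = {a n<..?x}" by auto
      then have "F t ?x - F t (a n) = measure (\<nu> t) {a n<..?x}"
        using finite_measure_Diff[of "{..?x}" "{..a n}"] \<open>a n < ?x\<close> by (simp add: F_def sets_\<nu>[OF t(1)])
      ultimately show ?thesis by linarith
    qed
    then have "F t ?x - \<eta> \<le> 0" using lim LIMSEQ_le_const by blast
    moreover have "\<eta> \<le> F t ?x" using galois_X[OF t(1) \<eta>, of ?x] by simp
    ultimately show ?thesis by simp
  qed
  ultimately show ?thesis by blast
qed

text \<open>The time integral does not see the null set on which F differs from \<eta>, so each
  quantile curve moves with constant acceleration.\<close>

lemma velocity_X:
  assumes t: "t \<ge> 0" and \<eta>: "0 < \<eta>" "\<eta> < m 0"
  shows "v t (X t \<eta>) = v 0 (X 0 \<eta>) + t / 4 * (2 * \<eta> - m 0)"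
proof -
  obtain N where N: "negligible N" "\<And>t. t \<ge> 0 \<Longrightarrow> t \<notin> N \<Longrightarrow> F t (X t \<eta>) = \<eta>" using F_X \<eta> by blast
  have T: "t + 1 > 0" using t by simp
  have "v t (X t \<eta>) - v 0 (X 0 \<eta>) = integral {0..t} (\<lambda>s. 1/4 * (2 * F s (X s \<eta>) - m 0))"
    by (rule velocity_along_characteristic[of t "t + 1"]) (use t X_DERIV[OF T \<eta>] in auto)
  also have "\<dots> = integral {0..t} (\<lambda>s. 1/4 * (2 * \<eta> - m 0))"
    by (rule integral_spike[OF N(1)]) (use N(2) in auto)
  also have "\<dots> = t / 4 * (2 * \<eta> - m 0)" using t by simp
  finally show ?thesis by simp
qed

lemma X_explicit:
  assumes t: "t \<ge> 0" and \<eta>: "0 < \<eta>" "\<eta> < m 0"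
  shows "X t \<eta> = X 0 \<eta> + t * v 0 (X 0 \<eta>) + t\<^sup>2 / 8 * (2 * \<eta> - m 0)"
proof -
  have T: "t + 1 > 0" using t by simp
  have 1: "((\<lambda>s. v s (X s \<eta>)) has_integral (X t \<eta> - X 0 \<eta>)) {0..t}"
  proof (rule fundamental_theorem_of_calculus[OF t])
    fix s assume s: "s \<in> {0..t}"
    have "((\<lambda>s. X s \<eta>) has_real_derivative v s (X s \<eta>)) (at s within {0..t + 1})" by (rule X_DERIV[OF T \<eta>]) (use s in auto)
    then have "((\<lambda>s. X s \<eta>) has_real_derivative v s (X s \<eta>)) (at s within {0..t})" by (rule DERIV_subset) auto
    then show "((\<lambda>s. X s \<eta>) has_vector_derivative v s (X s \<eta>)) (at s within {0..t})"
      by (simp add: has_real_derivative_iff_has_vector_derivative)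
  qed
  let ?G = "\<lambda>s. s * v 0 (X 0 \<eta>) + s\<^sup>2 / 8 * (2 * \<eta> - m 0)"
  have 2: "((\<lambda>s. v s (X s \<eta>)) has_integral (?G t - ?G 0)) {0..t}"
  proof (rule fundamental_theorem_of_calculus[OF t])
    fix s assume s: "s \<in> {0..t}"
    have "(?G has_real_derivative v 0 (X 0 \<eta>) + s / 4 * (2 * \<eta> - m 0)) (at s within {0..t})"
      by (auto intro!: derivative_eq_intros)
    then show "(?G has_vector_derivative v s (X s \<eta>)) (at s within {0..t})"
      using velocity_X[OF _ \<eta>, of s] s by (simp add: has_real_derivative_iff_has_vector_derivative)
  qed
  from has_integral_unique[OF 1 2] show ?thesis by simp
qed

text \<open>Without energy there are no quantile levels. But then v is constant in space, so the
  momentum flux and the mass term vanish and v is constant in time as well.\<close>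

lemma velocity_no_mass:
  assumes "m 0 = 0" and t: "t \<ge> 0"
  shows "v t x = v 0 x"
proof -
  have const: "v s y = v s x" if "s \<ge> 0" for s y
  proof -
    have "(v s b - v s a)\<^sup>2 \<le> 0" if "a \<le> b" for a b
    proof -
      have "(v s b - v s a)\<^sup>2 \<le> (b - a) * measure (\<nu> s) {a<..<b}" by (rule energy[OF \<open>s \<ge> 0\<close> that])
      moreover have "measure (\<nu> s) {a<..<b} = 0"
        using measure_le_m[OF \<open>s \<ge> 0\<close>, of "{a<..<b}"] measure_nonneg[of "\<nu> s" "{a<..<b}"] assms(1) by simp
      ultimately show ?thesis by simp
    qed
    from this[of x y] this[of y x] show ?thesis by (cases "x \<le> y") auto
  qed
  have one: "(1::real) > 0" by simp
  have V: "V 1 s x = v s x" if "s \<ge> 0" for s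
  proof -
    have "V 1 s x = (\<integral>y. v s x * bd 1 (y - x) \<partial>lborel)" unfolding V_def
      by (intro Bochner_Integration.integral_cong refl) (use const[OF that] in metis)
    then show ?thesis by (simp add: integral_scaled_full(2)[OF one])
  qed
  have b: "b 1 s x = 0" if s: "s \<ge> 0" for s
  proof -
    have "(\<integral>y. v s y * v s y * bd' 1 (y - x) \<partial>lborel) = (\<integral>y. (v s x * v s x) * bd' 1 (y - x) \<partial>lborel)"
      by (intro Bochner_Integration.integral_cong refl) (use const[OF that] in metis)
    also have "\<dots> = 0" by (simp add: integral_scaled_full(4)[OF one])
    finally have 1: "(\<integral>y. v s y * v s y * bd' 1 (y - x) \<partial>lborel) = 0" .
    have "J 1 s x \<le> m 0" using J_bounds(1)[OF s one, of x] measure_nonneg[of "\<nu> s" "{..x - 1}"] unfolding F_def by linarith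
    moreover have "0 \<le> J 1 s x" unfolding J_def by (intro Bochner_Integration.integral_nonneg scaled_bounds(1) one)
    ultimately show ?thesis using assms(1) 1 by (simp add: b_def)
  qed
  have "V 1 t x - V 1 0 x = integral {0..t} (\<lambda>s. b 1 s x)" by (rule V_evolution[OF one t])
  also have "\<dots> = integral {0..t} (\<lambda>s. 0)" by (rule Henstock_Kurzweil_Integration.integral_cong) (use b in auto)
  finally show ?thesis using V t by simp
qed

text \<open>The velocity at an arbitrary point is approximated by its values on the quantile curves,
  since the velocity does not vary across a region without energy.\<close>

lemma velocity_near_X:
  assumes t: "t \<ge> 0" and \<eta>: "0 < \<eta>" "\<eta> < m 0"
  shows "F t x / 2 \<le> \<eta> \<Longrightarrow> \<eta> < F t x \<Longrightarrow> (v t x - v t (X t \<eta>))\<^sup>2 \<le> (x - X t (F t x / 2)) * (F t x - \<eta>)"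
    "F t x = 0 \<Longrightarrow> \<eta> \<le> m 0 / 2 \<Longrightarrow> (v t x - v t (X t \<eta>))\<^sup>2 \<le> (X t (m 0 / 2) - x) * \<eta>"
proof -
  interpret finite_measure "\<nu> t" by (rule finite_\<nu>[OF t])
  have diff: "measure (\<nu> t) {a<..<b} \<le> F t b - F t a" if "a \<le> b" for a b
  proof -
    have "{..b} - {..a} = {a<..b}" by auto
    then have "F t b - F t a = measure (\<nu> t) {a<..b}"
      using finite_measure_Diff[of "{..b}" "{..a}"] that by (simp add: F_def sets_\<nu>[OF t])
    moreover have "measure (\<nu> t) {a<..<b} \<le> measure (\<nu> t) {a<..b}" by (rule finite_measure_mono) (auto simp: sets_\<nu>[OF t])
    ultimately show ?thesis by simp
  qed
  show "(v t x - v t (X t \<eta>))\<^sup>2 \<le> (x - X t (F t x / 2)) * (F t x - \<eta>)" if h: "F t x / 2 \<le> \<eta>" "\<eta> < F t x"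
  proof -
    have Xx: "X t \<eta> \<le> x" using galois_X[OF t \<eta>] h by simp
    have \<eta>F: "\<eta> \<le> F t (X t \<eta>)" using galois_X[OF t \<eta>, of "X t \<eta>"] by simp
    have h2: "0 < F t x / 2" "F t x / 2 < m 0" using h \<eta> by auto
    \<comment> \<open>The half level bounds the distance from x to X t \<eta> independently of
      \<eta>, so the estimate tends to 0 as \<eta> approaches F t x.\<close>
    have X2: "X t (F t x / 2) \<le> X t \<eta>" using galois_X[OF t h2, of "X t \<eta>"] \<eta>F h by simp
    have "(v t x - v t (X t \<eta>))\<^sup>2 \<le> (x - X t \<eta>) * measure (\<nu> t) {X t \<eta><..<x}" by (rule energy[OF t Xx])
    also have "\<dots> \<le> (x - X t (F t x / 2)) * (F t x - \<eta>)"
      using diff[OF Xx] \<eta>F X2 Xx by (intro mult_mono) auto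
    finally show ?thesis .
  qed
  show "(v t x - v t (X t \<eta>))\<^sup>2 \<le> (X t (m 0 / 2) - x) * \<eta>" if h: "F t x = 0" "\<eta> \<le> m 0 / 2"
  proof -
    have xX: "x \<le> X t \<eta>" using galois_X[OF t \<eta>, of x] h \<eta> by simp
    have m2: "0 < m 0 / 2" "m 0 / 2 < m 0" using \<eta> by auto
    have "m 0 / 2 \<le> F t (X t (m 0 / 2))" using galois_X[OF t m2, of "X t (m 0 / 2)"] by simp
    then have X2: "X t \<eta> \<le> X t (m 0 / 2)" using galois_X[OF t \<eta>] h by simp
    \<comment> \<open>The point X t \<eta> may carry an atom, so F there is no bound. The open
      interval is exhausted by intervals ending at points where F is still below \<eta>.\<close>
    have E: "measure (\<nu> t) {x<..<X t \<eta>} \<le> \<eta>"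
    proof -
      define a where "a n = X t \<eta> - \<delta>n n" for n
      have "(\<lambda>n. measure (\<nu> t) {x<..a n}) \<longlonglongrightarrow> measure (\<nu> t) (\<Union>n. {x<..a n})"
      proof (rule finite_Lim_measure_incseq)
        show "range (\<lambda>n. {x<..a n}) \<subseteq> sets (\<nu> t)" by (auto simp: sets_\<nu>[OF t])
        show "incseq (\<lambda>n. {x<..a n})"
        proof (rule incseq_SucI)
          fix n show "{x<..a n} \<subseteq> {x<..a (Suc n)}" using \<delta>n_Suc[of n] by (auto simp: a_def)
        qed
      qed
      moreover have "(\<Union>n. {x<..a n}) = {x<..<X t \<eta>}"
      proof (intro set_eqI iffI)
        fix y assume y: "y \<in> {x<..<X t \<eta>}"
        then have "\<forall>\<^sub>F n in sequentially. \<delta>n n < X t \<eta> - y" by (intro order_tendstoD(2)[OF \<delta>n(2)]) simp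
        then obtain n where "\<delta>n n < X t \<eta> - y" by (auto simp: eventually_sequentially)
        then show "y \<in> (\<Union>n. {x<..a n})" using y by (intro UN_I[of n]) (auto simp: a_def)
      next
        fix y assume "y \<in> (\<Union>n. {x<..a n})"
        then obtain n where "x < y" "y \<le> a n" by auto
        then show "y \<in> {x<..<X t \<eta>}" using \<delta>n(1)[of n] by (simp add: a_def)
      qed
      moreover have "measure (\<nu> t) {x<..a n} \<le> \<eta>" for n
      proof -
        have "\<not> X t \<eta> \<le> a n" using \<delta>n(1)[of n] by (simp add: a_def)
        then have "F t (a n) < \<eta>" using galois_X[OF t \<eta>, of "a n"] by simp
        moreover have "measure (\<nu> t) {x<..a n} \<le> measure (\<nu> t) {..a n}" by (rule finite_measure_mono) (auto simp: sets_\<nu>[OF t])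
        ultimately show ?thesis unfolding F_def by linarith
      qed
      ultimately show ?thesis using LIMSEQ_le_const2 by metis
    qed
    have "(v t x - v t (X t \<eta>))\<^sup>2 = (v t (X t \<eta>) - v t x)\<^sup>2" by (simp add: power2_commute)
    also have "\<dots> \<le> (X t \<eta> - x) * measure (\<nu> t) {x<..<X t \<eta>}" by (rule energy[OF t xX])
    also have "\<dots> \<le> (X t (m 0 / 2) - x) * \<eta>" using E X2 xX by (intro mult_mono) auto
    finally show ?thesis .
  qed
qed

end

section \<open>Uniqueness and the main theorem\<close>

locale two_solutions = A: weak_solution \<beta> S \<psi>p \<psi>m v \<nu> + B: weak_solution \<beta> S \<psi>p \<psi>m v' \<nu>'
  for \<beta> S \<psi>p \<psi>m v \<nu> v' \<nu>' +
  assumes init_v: "v 0 = v' 0" and init_\<nu>: "\<nu> 0 = \<nu>' 0"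
begin

lemma mass_eq: "A.m 0 = B.m 0" by (simp add: A.m_def B.m_def init_\<nu>)

lemma X_eq: assumes "t \<ge> 0" "0 < \<eta>" "\<eta> < A.m 0" shows "A.X t \<eta> = B.X t \<eta>"
proof -
  have "A.X 0 \<eta> = B.X 0 \<eta>" by (simp add: A.X_def B.X_def A.F_def B.F_def init_\<nu>)
  then show ?thesis using A.X_explicit[OF assms] B.X_explicit[OF assms(1,2)] assms(3) by (simp add: mass_eq init_v)
qed

lemma velocity_X_eq: assumes "t \<ge> 0" "0 < \<eta>" "\<eta> < A.m 0" shows "v t (A.X t \<eta>) = v' t (A.X t \<eta>)"
proof -
  have "A.X 0 \<eta> = B.X 0 \<eta>" by (simp add: A.X_def B.X_def A.F_def B.F_def init_\<nu>)
  then show ?thesis using A.velocity_X[OF assms] B.velocity_X[OF assms(1,2)] assms(3) X_eq[OF assms]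
    by (simp add: mass_eq init_v)
qed

text \<open>If the values differed, one of the two distribution functions would reach their mean at
  x and the other would not, so the common quantile at this level would lie on both sides of
  x.\<close>

lemma F_eq: assumes t: "t \<ge> 0" shows "A.F t x = B.F t x"
proof (rule ccontr)
  assume ne: "A.F t x \<noteq> B.F t x"
  have r: "0 \<le> A.F t x" "0 \<le> B.F t x" "A.F t x \<le> A.m 0" "B.F t x \<le> A.m 0"
    using A.F_le[OF t] B.F_le[OF t] mass_eq by (auto simp: A.F_def B.F_def)
  define \<eta> where "\<eta> = (A.F t x + B.F t x) / 2"
  have \<eta>: "0 < \<eta>" "\<eta> < A.m 0" using ne r by (auto simp: \<eta>_def)
  have "\<eta> \<le> A.F t x \<longleftrightarrow> \<eta> \<le> B.F t x"
    using A.galois_X[OF t \<eta>, of x] B.galois_X[OF t \<eta>(1), of x] \<eta>(2) X_eq[OF t \<eta>] mass_eq by simp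
  then show False using ne by (cases "A.F t x < B.F t x") (auto simp: \<eta>_def)
qed

lemma \<nu>_eq: assumes t: "t \<ge> 0" shows "\<nu> t = \<nu>' t"
  by (rule fin_borel_eqI_cdf[OF A.fin[OF t] B.fin[OF t]]) (use F_eq[OF t] in \<open>simp add: A.F_def B.F_def\<close>)

text \<open>The velocities agree on the common quantile curves. Each of them differs at x from its
  value on such a curve by an amount that vanishes as the level tends to F t x.\<close>

lemma v_eq: assumes t: "t \<ge> 0" shows "v t x = v' t x"
proof (cases "A.m 0 = 0")
  case True
  then show ?thesis using A.velocity_no_mass[OF _ t, of x] B.velocity_no_mass[OF _ t, of x] mass_eq init_v by simp
next
  case False
  then have m0: "A.m 0 > 0" using A.m_nonneg[of 0] by simp
  \<comment> \<open>From (a - b)^2 \<le> 2 a^2 + 2 b^2 with a and b the two errors.\<close>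
  have key: "(v t x - v' t x)\<^sup>2 \<le> 4 * K"
    if "(v t x - v t (A.X t \<eta>))\<^sup>2 \<le> K" "(v' t x - v' t (A.X t \<eta>))\<^sup>2 \<le> K" "0 < \<eta>" "\<eta> < A.m 0" for \<eta> K
  proof -
    have "v t x - v' t x = (v t x - v t (A.X t \<eta>)) - (v' t x - v' t (A.X t \<eta>))" using velocity_X_eq[OF t that(3,4)] by simp
    then have "(v t x - v' t x)\<^sup>2 \<le> 2 * (v t x - v t (A.X t \<eta>))\<^sup>2 + 2 * (v' t x - v' t (A.X t \<eta>))\<^sup>2"
      using zero_le_power2[of "(v t x - v t (A.X t \<eta>)) + (v' t x - v' t (A.X t \<eta>))"]
      by (simp only: power2_eq_square) (simp add: algebra_simps)
    then show ?thesis using that(1,2) by linarith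
  qed
  have zero: "v t x = v' t x"
    if "e0 > 0" and est: "\<And>e. 0 < e \<Longrightarrow> e < e0 \<Longrightarrow> (v t x - v' t x)\<^sup>2 \<le> 4 * (c * e)" for c e0
  proof -
    have "(v t x - v' t x)\<^sup>2 \<le> 0"
    \<comment> \<open>The choice e = 3 d / (4 |c| + 1) turns the error 4 c e into at most the 3 d
      that \<open>le_from_eps\<close> tolerates.\<close>
    proof (rule le_from_eps[of "e0 * (4 * \<bar>c\<bar> + 1) / 3"])
      show "0 < e0 * (4 * \<bar>c\<bar> + 1) / 3" using that(1) by (simp add: add_nonneg_pos)
      fix d assume d: "0 < d" "d < e0 * (4 * \<bar>c\<bar> + 1) / 3"
      define e where "e = 3 * d / (4 * \<bar>c\<bar> + 1)"
      have pos: "4 * \<bar>c\<bar> + 1 > 0" by (simp add: add_nonneg_pos)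
      have e: "0 < e" "e < e0" "e * (4 * \<bar>c\<bar> + 1) = 3 * d" using d pos by (auto simp: e_def pos_divide_less_eq mult.commute)
      have "c * e \<le> \<bar>c\<bar> * e" using e(1) by (intro mult_right_mono) auto
      moreover have "e * (4 * \<bar>c\<bar> + 1) = 4 * (\<bar>c\<bar> * e) + e" by (simp add: algebra_simps)
      ultimately show "(v t x - v' t x)\<^sup>2 \<le> 0 + 3 * d" using est[OF e(1,2)] e(1,3) by linarith
    qed
    then show ?thesis by simp
  qed
  show ?thesis
  proof (cases "A.F t x = 0")
    \<comment> \<open>No energy lies at or left of x, so all quantile curves lie to its right, and x
      is approached through levels tending to 0.\<close>
    case True
    show ?thesis
    proof (rule zero[of "A.m 0 / 2" "A.X t (A.m 0 / 2) - x"])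
      fix e assume e: "0 < e" "e < A.m 0 / 2"
      then have e': "0 < e" "e < A.m 0" "e \<le> A.m 0 / 2" by auto
      have m2: "0 < A.m 0 / 2" "A.m 0 / 2 < A.m 0" using m0 by auto
      show "(v t x - v' t x)\<^sup>2 \<le> 4 * ((A.X t (A.m 0 / 2) - x) * e)"
      proof (rule key[OF _ _ e'(1,2)])
        show "(v t x - v t (A.X t e))\<^sup>2 \<le> (A.X t (A.m 0 / 2) - x) * e"
          by (rule A.velocity_near_X(2)[OF t e'(1,2) True e'(3)])
        show "(v' t x - v' t (A.X t e))\<^sup>2 \<le> (A.X t (A.m 0 / 2) - x) * e"
          using B.velocity_near_X(2)[OF t e'(1), of x] e' True F_eq[OF t, of x] X_eq[OF t e'(1,2)] X_eq[OF t m2] mass_eq by simp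
      qed
    qed (use m0 in simp)
  next
    case False
    then have F0: "A.F t x > 0" using measure_nonneg[of "\<nu> t" "{..x}"] by (simp add: A.F_def less_le)
    have Fm: "A.F t x \<le> A.m 0" by (rule A.F_le[OF t])
    show ?thesis
    proof (rule zero[of "A.F t x / 2" "x - A.X t (A.F t x / 2)"])
      fix e assume e: "0 < e" "e < A.F t x / 2"
      define \<eta> where "\<eta> = A.F t x - e"
      have \<eta>: "0 < \<eta>" "\<eta> < A.m 0" "A.F t x / 2 \<le> \<eta>" "\<eta> < A.F t x" using e Fm by (auto simp: \<eta>_def)
      have F2: "0 < A.F t x / 2" "A.F t x / 2 < A.m 0" using F0 Fm by auto
      have ee: "A.F t x - \<eta> = e" by (simp add: \<eta>_def)
      show "(v t x - v' t x)\<^sup>2 \<le> 4 * ((x - A.X t (A.F t x / 2)) * e)"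
      proof (rule key[OF _ _ \<eta>(1,2)])
        show "(v t x - v t (A.X t \<eta>))\<^sup>2 \<le> (x - A.X t (A.F t x / 2)) * e"
          using A.velocity_near_X(1)[OF t \<eta>] unfolding ee .
        have "(v' t x - v' t (B.X t \<eta>))\<^sup>2 \<le> (x - B.X t (B.F t x / 2)) * (B.F t x - \<eta>)"
          using B.velocity_near_X(1)[OF t \<eta>(1), of x] \<eta> F_eq[OF t, of x] mass_eq by simp
        then show "(v' t x - v' t (A.X t \<eta>))\<^sup>2 \<le> (x - A.X t (A.F t x / 2)) * e"
          unfolding F_eq[OF t, of x, symmetric] X_eq[OF t \<eta>(1,2), symmetric] X_eq[OF t F2, symmetric] ee .
      qed
    qed (use F0 in simp)
  qed
qed

end

theorem theorem5p10:
  fixes \<psi>p \<psi>m :: "real \<Rightarrow> real" and \<gamma> :: real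
    and u0 :: "real \<Rightarrow> real" and \<mu>0 :: "real measure"
  assumes psi_smooth: "smooth1 \<psi>p" "smooth1 \<psi>m"
    and psi_sum: "\<And>x. \<psi>p x + \<psi>m x = 1"
    and psi_range: "\<And>x. 0 \<le> \<psi>p x \<and> \<psi>p x \<le> 1" "\<And>x. 0 \<le> \<psi>m x \<and> \<psi>m x \<le> 1"
    and psi_supp: "closure {x. \<psi>m x \<noteq> 0} \<subseteq> {..<1}" "closure {x. \<psi>p x \<noteq> 0} \<subseteq> {-1<..}"
    and gamma: "\<gamma> > 2"
    and init: "inD \<psi>p \<psi>m u0 \<mu>0"
    and moment: "(\<integral>\<^sup>+x. ennreal (1 + \<bar>x\<bar> powr \<gamma>) \<partial>\<mu>0) < \<infinity>"
  shows "\<exists>u \<mu>. weak_cons_sol \<psi>p \<psi>m u \<mu> \<and> u 0 = u0 \<and> \<mu> 0 = \<mu>0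
           \<and> (\<forall>t\<ge>0. inD \<psi>p \<psi>m (u t) (\<mu> t))
           \<and> (\<forall>t\<ge>0. (\<integral>\<^sup>+x. ennreal (1 + \<bar>x\<bar> powr \<gamma>) \<partial>(\<mu> t)) < \<infinity>)
           \<and> (\<forall>v \<nu>. weak_cons_sol \<psi>p \<psi>m v \<nu> \<and> v 0 = u0 \<and> \<nu> 0 = \<mu>0 \<longrightarrow>
                 (\<forall>t\<ge>0. v t = u t \<and> \<nu> t = \<mu> t))"
proof -
  have left: "\<psi>p x = 0" if "x \<le> -1" for x
    using psi_supp(2) closure_subset[of "{x. \<psi>p x \<noteq> 0}"] that by (metis (mono_tags) greaterThan_iff mem_Collect_eq not_less subsetD)
  have right: "\<psi>m x = 0" if "x \<ge> 1" for x
    using psi_supp(1) closure_subset[of "{x. \<psi>m x \<noteq> 0}"] that by (metis (mono_tags) lessThan_iff mem_Collect_eq not_less subsetD)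
  have E2u0: "E2 \<psi>p \<psi>m u0" and fin: "fin_borel \<mu>0" using init by (auto simp: inD_def)
  obtain g where g: "wderiv u0 g" "ac_part \<mu>0 (\<lambda>x. (g x)\<^sup>2)" using init unfolding inD_def by blast
  interpret E: eulerian_data u0 g \<mu>0 by unfold_locales (rule fin, rule g, rule g)
  obtain Bd where Bd: "Bd > 0" "\<And>x. \<bar>u0 x\<bar> \<le> Bd" by (rule E2_bounded[OF E2u0 psi_range]) (rule that)
  \<comment> \<open>y maps h d\<xi> to the initial measure, so its moments become weighted integrals
    over labels.\<close>
  have transfer: "(\<integral>\<^sup>+\<xi>. ennreal (E.h \<xi>) * f (E.y \<xi>) \<partial>lborel) = (\<integral>\<^sup>+x. f x \<partial>\<mu>0)" if [measurable]: "f \<in> borel_measurable borel" for f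
    by (subst E.distr_h[symmetric]) (simp add: nn_integral_distr nn_integral_density)
  have mom: "(\<integral>\<^sup>+\<xi>. ennreal (E.h \<xi>) * ennreal (\<bar>E.y \<xi>\<bar> powr \<gamma>) \<partial>lborel) < \<infinity>"
  proof -
    have "(\<integral>\<^sup>+\<xi>. ennreal (E.h \<xi>) * ennreal (\<bar>E.y \<xi>\<bar> powr \<gamma>) \<partial>lborel) = (\<integral>\<^sup>+x. ennreal (\<bar>x\<bar> powr \<gamma>) \<partial>\<mu>0)"
      by (rule transfer) simp
    also have "\<dots> \<le> (\<integral>\<^sup>+x. ennreal (1 + \<bar>x\<bar> powr \<gamma>) \<partial>\<mu>0)" by (intro nn_integral_mono ennreal_leI) simp
    finally show ?thesis using moment by simp
  qed
  have mom2: "integrable lborel (\<lambda>\<xi>. E.h \<xi> * (E.y \<xi>)\<^sup>2)"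
  proof (rule integrableI_nonneg)
    \<comment> \<open>The growth condition enters the flow through this second moment; for |x| > 1
      the comparison uses \<gamma> > 2.\<close>
    have sq: "x\<^sup>2 \<le> 1 + \<bar>x\<bar> powr \<gamma>" for x :: real
    proof (cases "\<bar>x\<bar> \<le> 1")
      case True
      then have "x\<^sup>2 \<le> 1" by (simp add: abs_square_le_1)
      then show ?thesis by (simp add: add_increasing2)
    next
      case False
      then have "\<bar>x\<bar> powr 2 \<le> \<bar>x\<bar> powr \<gamma>" using gamma by (intro powr_mono) auto
      moreover have "\<bar>x\<bar> powr 2 = x\<^sup>2" using False by (subst powr_numeral) auto
      ultimately show ?thesis by simp
    qed
    have "(\<integral>\<^sup>+\<xi>. ennreal (E.h \<xi> * (E.y \<xi>)\<^sup>2) \<partial>lborel) = (\<integral>\<^sup>+\<xi>. ennreal (E.h \<xi>) * ennreal ((E.y \<xi>)\<^sup>2) \<partial>lborel)"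
      by (simp add: ennreal_mult' E.h0)
    also have "\<dots> = (\<integral>\<^sup>+x. ennreal (x\<^sup>2) \<partial>\<mu>0)" by (rule transfer) simp
    also have "\<dots> \<le> (\<integral>\<^sup>+x. ennreal (1 + \<bar>x\<bar> powr \<gamma>) \<partial>\<mu>0)" by (intro nn_integral_mono ennreal_leI sq)
    finally show "(\<integral>\<^sup>+\<xi>. ennreal (E.h \<xi> * (E.y \<xi>)\<^sup>2) \<partial>lborel) < \<infinity>" using moment by simp
  qed (auto simp: E.h0)
  interpret F: hs_flow E.y "\<lambda>\<xi>. u0 (E.y \<xi>)" E.p E.q E.h E.C Bd
  proof (intro hs_flow.intro hs_flow_axioms.intro E.snapshot0 mom2)
    show "E.p \<xi> + E.h \<xi> = 1" for \<xi> by (simp add: E.h_def)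
    show "\<bar>u0 (E.y \<xi>)\<bar> \<le> Bd" for \<xi> by (rule Bd(2))
  qed
  have X0: "F.X 0 = E.y" by (simp add: F.X_def fun_eq_iff)
  \<comment> \<open>Every x is the initial position of the label R 0 x, and the Eulerian velocity at
    that position is the initial velocity of the label.\<close>
  have u_init: "F.u 0 = u0"
  proof
    fix x
    have "F.u 0 (F.X 0 (F.S.R 0 x)) = u0 (E.y (F.S.R 0 x))"
      by (rule trans[OF F.S.u_X]) (simp add: F.U_def)
    also have "E.y (F.S.R 0 x) = F.X 0 (F.S.R 0 x)" by (simp add: F.X_def)
    finally show "F.u 0 x = u0 x" unfolding F.S.X_R .
  qed
  have mu_init: "F.mu 0 = \<mu>0" by (subst F.S.eul_mu_def, subst X0, rule E.distr_h)
  interpret G: hs_flow_psi E.y "\<lambda>\<xi>. u0 (E.y \<xi>)" E.p E.q E.h E.C Bd \<psi>p \<psi>m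
    by unfold_locales (use psi_smooth psi_sum psi_range left right E2u0 u_init in auto)
  obtain \<beta> S where bump: "bump \<beta> S"
    using ex_bump[OF psi_smooth psi_sum psi_range(1) left right] by blast
  have solution: "weak_cons_sol \<psi>p \<psi>m v \<nu> \<Longrightarrow> weak_solution \<beta> S \<psi>p \<psi>m v \<nu>" for v \<nu>
    by (intro weak_solution.intro weak_solution_axioms.intro bump psi_range)
  have unique: "\<forall>t\<ge>0. v t = F.u t \<and> \<nu> t = F.mu t"
    if "weak_cons_sol \<psi>p \<psi>m v \<nu> \<and> v 0 = u0 \<and> \<nu> 0 = \<mu>0" for v \<nu>
  proof -
    interpret two_solutions \<beta> S \<psi>p \<psi>m v \<nu> F.u F.mu
      by (intro two_solutions.intro two_solutions_axioms.intro solution G.flow_is_weak_solution)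
         (use that u_init mu_init in auto)
    show ?thesis using v_eq \<nu>_eq by blast
  qed
  show ?thesis
  proof (intro exI[of _ F.u] exI[of _ F.mu] conjI)
    show "weak_cons_sol \<psi>p \<psi>m F.u F.mu" by (rule G.flow_is_weak_solution)
    show "\<forall>t\<ge>0. inD \<psi>p \<psi>m (F.u t) (F.mu t)" using G.inD_flow by blast
    show "\<forall>t\<ge>0. (\<integral>\<^sup>+x. ennreal (1 + \<bar>x\<bar> powr \<gamma>) \<partial>(F.mu t)) < \<infinity>"
      using F.moment[OF _ mom] gamma by simp
    show "\<forall>v \<nu>. weak_cons_sol \<psi>p \<psi>m v \<nu> \<and> v 0 = u0 \<and> \<nu> 0 = \<mu>0 \<longrightarrow> (\<forall>t\<ge>0. v t = F.u t \<and> \<nu> t = F.mu t)"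
      using unique by blast
  qed (rule u_init, rule mu_init)
qed

end
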